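(* Let $f_0$ be a $C^r$-smooth ($r\ge 4$) diffeomorphism of a 2-dimensional manifold $M^2$ that is reversible with respect to an involution $R$ with $\dim \mathrm{Fix}\,R=1$, and assume that $f_0$ satisfies conditions [A], [B], [C] of the context. Let $\{f_\mu\}$ be a one-parameter family of $R$-reversible diffeomorphisms that unfolds at $\mu=0$ the homoclinic tangencies of $f_0$. Then, in any segment $[-\mu_0,\mu_0]$ with $\mu_0>0$ small, there exist infinitely many intervals $\delta_{km}^c$, accumulating at $\mu=0$ as $k,m\to\infty$, such that for $\mu\in\delta_{km}^c$ the first return map $T_{2m1k}=T_2T_0^mT_1T_0^k$ has symmetric elliptic and saddle fixed points.
   Context: Reversibility: a diffeomorphism $f$ is $R$-reversible if $R\circ f=f^{-1}\circ R$, where $R$ is an involution ($R^2=\mathrm{Id}$, $R\neq\mathrm{Id}$, not necessarily linear, of the same smoothness as $f$); $\mathrm{Fix}\,R=\{z: R(z)=z\}$. An object $\Lambda$ is symmetric if $R(\Lambda)=\Lambda$; two different objects form a symmetric couple if they are exchanged by $R$. The manifold $M^2$ need not be orientable. Conditions. [A] $f_0$ has a saddle fixed point $O\in\mathrm{Fix}\,R$ with multipliers $\lambda,\lambda^{-1}$, $0<\lambda<1$. [B] $f_0$ has a symmetric couple of homoclinic orbits $\Gamma_1$ and $\Gamma_2=R(\Gamma_1)$ to $O$, and $W^u(O)$ and $W^s(O)$ have quadratic tangencies at the points of $\Gamma_1$ and $\Gamma_2$. [C] With $T_1$, $M_1^-$ as below, the Jacobian $J_1$ of $T_1$ at $M_1^-$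 (at $\mu=0$, in the local coordinates below) is different from $\pm1$; without loss of generality $|J_1|<1$. Local coordinates. $U_0=R(U_0)$ is a small neighbourhood of $O$ and $T_0=f_\mu|_{U_0}$ is the local map. In $U_0$ one uses $C^{r-1}$ coordinates $(x,y)$ with $O$ at the origin in which $T_0:(x,y)\mapsto(\bar x,\bar y)$ has the form $\bar x=\lambda x+h(x,\bar y)x^2\bar y$, $y=\lambda\bar y+h(\bar y,x)x\bar y^2$, so that $W^s_{loc}(O)=\{y=0\}$, $W^u_{loc}(O)=\{x=0\}$, and $R$ acts locally as $(x,y)\mapsto(y,x)$. Global maps. Choose points $M_1^-=(0,y_1^-)\in W^u_{loc}(O)\cap U_0$ and $M_1^+=f_0^q(M_1^-)=(x_1^+,0)\in W^s_{loc}(O)\cap U_0$ of $\Gamma_1$, for a suitable integer $q>0$, and put $M_2^-=R(M_1^+)$, $M_2^+=R(M_1^-)$, so that $f_0^q(M_2^-)=M_2^+$. Let $\Pi_1^\pm$ be small neighbourhoods of $M_1^\pm$ in $U_0$, and $\Pi_2^-=R(\Pi_1^+)$, $\Pi_2^+=R(\Pi_1^-)$. The global maps are $T_i=f_\mu^q:\Pi_i^-\to\Pi_i^+$, $i=1,2$; they satisfy $T_2=R\,T_1^{-1}R$. Unfolding. The family $f_\mu$ is $C^r$ in coordinates and parameter, and $\mu$ is the splitting parameter of the tangency: $T_1:(x_{11},y_{11})\in\Pi_1^-\mapsto(x_{01},y_{01})\in\Pi_1^+$ has the form $$x_{01}-x_1^+=a x_{11}+b(y_{11}-y_1^-)+\varphi_1,\qquad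 y_{01}=\mu+c x_{11}+d(y_{11}-y_1^-)^2+\varphi_2,$$ with $\varphi_1=O((y_{11}-y_1^-)^2+x_{11}^2)$, $\varphi_2=O(x_{11}^2+|y_{11}-y_1^-|^3+|x_{11}||y_{11}-y_1^-|)$, $d\ne0$, and $J_1=-bc$ at $\mu=0$, so $0<|bc|<1$. (The coefficients and $x_1^+,y_1^-$ may depend on $\mu$.) First return map. For large $k,m$, $T_{2m1k}=T_2T_0^mT_1T_0^k$ is the first return map $$\Pi_2^+\xrightarrow{T_0^k}\Pi_1^-\xrightarrow{T_1}\Pi_1^+\xrightarrow{T_0^m}\Pi_2^-\xrightarrow{T_2}\Pi_2^+,$$ defined on the points of $\Pi_2^+$ for which the composition makes sense. Its fixed points correspond to single-round periodic 12-orbits of $f_\mu$, i.e. periodic orbits near $O\cup\Gamma_1\cup\Gamma_2$ which pass once along $\Gamma_1$ and once along $\Gamma_2$. A fixed point of $T_{2m1k}$ is symmetric if the corresponding periodic orbit of $f_\mu$ is symmetric. A fixed point is elliptic if its multipliers are $e^{\pm i\varphi}$ with $\varphi\in(0,\pi)$. *)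

theory Defs
  imports "HOL-Analysis.Analysis"
begin

subsection \<open>Finite smoothness\<close>

text \<open>Continuous differentiability of order \<open>k\<close>, intended for open \<open>S\<close>.\<close>

primrec Ck_on :: "nat \<Rightarrow> 'a::euclidean_space set \<Rightarrow> ('a \<Rightarrow> 'b::euclidean_space) \<Rightarrow> bool" where
  "Ck_on 0 S f \<longleftrightarrow> continuous_on S f"
| "Ck_on (Suc k) S f \<longleftrightarrow>
     (\<exists>f'. (\<forall>x\<in>S. (f has_derivative f' x) (at x)) \<and> (\<forall>v. Ck_on k S (\<lambda>x. f' x v)))"

text \<open>
  Order \<open>k\<close> smoothness in the phase variable, with a parameter: all partial derivatives with
  respect to the second argument up to order \<open>k\<close> exist and are jointly continuous. No
  differentiability in the parameter (the first argument) is required.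
\<close>

primrec Ck_fibre_on ::
  "nat \<Rightarrow> (real \<times> 'a::euclidean_space) set \<Rightarrow> (real \<Rightarrow> 'a \<Rightarrow> 'b::euclidean_space) \<Rightarrow> bool" where
  "Ck_fibre_on 0 S F \<longleftrightarrow> continuous_on S (\<lambda>(\<mu>, z). F \<mu> z)"
| "Ck_fibre_on (Suc k) S F \<longleftrightarrow>
     continuous_on S (\<lambda>(\<mu>, z). F \<mu> z) \<and>
     (\<exists>F'. (\<forall>(\<mu>, z)\<in>S. (F \<mu> has_derivative F' \<mu> z) (at z)) \<and>
           (\<forall>v. Ck_fibre_on k S (\<lambda>\<mu> z. F' \<mu> z v)))"


subsection \<open>Surfaces\<close>

type_synonym 'm chart = "'m set \<times> ('m \<Rightarrow> real^2)"

definition is_chart :: "'m::topological_space chart \<Rightarrow> bool" where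
  "is_chart = (\<lambda>(U, \<phi>). open U \<and> open (\<phi> ` U) \<and> homeomorphism U (\<phi> ` U) \<phi> (inv_into U \<phi>))"

definition Ck_compatible :: "nat \<Rightarrow> 'm chart \<Rightarrow> 'm chart \<Rightarrow> bool" where
  "Ck_compatible r = (\<lambda>(U, \<phi>) (V, \<eta>).
     Ck_on r (\<phi> ` (U \<inter> V)) (\<eta> \<circ> inv_into U \<phi>) \<and>
     Ck_on r (\<eta> ` (U \<inter> V)) (\<phi> \<circ> inv_into V \<eta>))"

definition Ck_atlas :: "nat \<Rightarrow> 'm::topological_space chart set \<Rightarrow> bool" where
  "Ck_atlas r A \<longleftrightarrow>
     (\<forall>c\<in>A. is_chart c) \<and> (\<forall>c\<in>A. \<forall>d\<in>A. Ck_compatible r c d) \<and> (\<Union>c\<in>A. fst c) = UNIV"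

text \<open>Charts of the maximal atlas generated by \<open>A\<close>.\<close>

definition admissible :: "nat \<Rightarrow> 'm::topological_space chart set \<Rightarrow> 'm chart \<Rightarrow> bool" where
  "admissible r A c \<longleftrightarrow> is_chart c \<and> (\<forall>d\<in>A. Ck_compatible r c d)"

definition Ck_map :: "nat \<Rightarrow> 'm::topological_space chart set \<Rightarrow> ('m \<Rightarrow> 'm) \<Rightarrow> bool" where
  "Ck_map r A g \<longleftrightarrow>
     continuous_on UNIV g \<and>
     (\<forall>(U, \<phi>)\<in>A. \<forall>(V, \<eta>)\<in>A. Ck_on r (\<phi> ` {p \<in> U. g p \<in> V}) (\<eta> \<circ> g \<circ> inv_into U \<phi>))"

definition Ck_diffeo :: "nat \<Rightarrow> 'm::topological_space chart set \<Rightarrow> ('m \<Rightarrow> 'm) \<Rightarrow> bool" where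
  "Ck_diffeo r A g \<longleftrightarrow> bij g \<and> Ck_map r A g \<and> Ck_map r A (inv g)"

text \<open>A family of diffeomorphisms that is smooth jointly in the point and the parameter.\<close>

definition Ck_diffeo_family ::
  "nat \<Rightarrow> 'm::topological_space chart set \<Rightarrow> real set \<Rightarrow> (real \<Rightarrow> 'm \<Rightarrow> 'm) \<Rightarrow> bool" where
  "Ck_diffeo_family r A I f \<longleftrightarrow>
     (\<forall>\<mu>\<in>I. Ck_diffeo r A (f \<mu>)) \<and>
     continuous_on (I \<times> UNIV) (\<lambda>(\<mu>, p). f \<mu> p) \<and>
     (\<forall>(U, \<phi>)\<in>A. \<forall>(V, \<eta>)\<in>A.
        Ck_on r {(\<mu>, z). \<mu> \<in> I \<and> z \<in> \<phi> ` {p \<in> U. f \<mu> p \<in> V}}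
                (\<lambda>(\<mu>, z). \<eta> (f \<mu> (inv_into U \<phi> z))))"

text \<open>
  The fixed point set of an involution is a disjoint union of submanifolds, possibly of different
  dimensions (on the projective plane it may consist of a circle and a point). Its dimension is the
  largest local one.
\<close>

definition locally_dim ::
  "nat \<Rightarrow> 'm::topological_space chart set \<Rightarrow> 'm set \<Rightarrow> 'm \<Rightarrow> nat \<Rightarrow> bool" where
  "locally_dim r A S p n \<longleftrightarrow>
     (\<exists>U \<phi> L. admissible r A (U, \<phi>) \<and> p \<in> U \<and> \<phi> p = 0 \<and>
        subspace L \<and> dim L = n \<and> \<phi> ` (S \<inter> U) = \<phi> ` U \<inter> L)"

definition has_dim :: "nat \<Rightarrow> 'm::topological_space chart set \<Rightarrow> 'm set \<Rightarrow> nat \<Rightarrow> bool" where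
  "has_dim r A S n \<longleftrightarrow>
     (\<forall>p\<in>S. \<exists>j\<le>n. locally_dim r A S p j) \<and> (\<exists>p\<in>S. locally_dim r A S p n)"

definition Fix :: "('m \<Rightarrow> 'm) \<Rightarrow> 'm set" where
  "Fix R = {p. R p = p}"

definition Ck_involution :: "nat \<Rightarrow> 'm::topological_space chart set \<Rightarrow> ('m \<Rightarrow> 'm) \<Rightarrow> bool" where
  "Ck_involution r A R \<longleftrightarrow> Ck_map r A R \<and> R \<circ> R = id \<and> R \<noteq> id"

definition reversible :: "('m \<Rightarrow> 'm) \<Rightarrow> ('m \<Rightarrow> 'm) \<Rightarrow> bool" where
  "reversible R g \<longleftrightarrow> R \<circ> g = inv g \<circ> R"


subsection \<open>Multipliers of fixed points\<close>

text \<open>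
  \<open>z\<close> and \<open>w\<close> are the roots, counted with multiplicity, of the characteristic polynomial of the
  derivative of \<open>g\<close> at the fixed point \<open>p\<close>, computed in some chart (the choice is immaterial).
\<close>

definition multipliers ::
  "'m chart set \<Rightarrow> ('m \<Rightarrow> 'm) \<Rightarrow> 'm \<Rightarrow> complex \<Rightarrow> complex \<Rightarrow> bool" where
  "multipliers A g p z w \<longleftrightarrow> g p = p \<and>
     (\<exists>(U, \<phi>)\<in>A. \<exists>D::real^2^2. p \<in> U \<and>
        ((\<phi> \<circ> g \<circ> inv_into U \<phi>) has_derivative (\<lambda>v. D *v v)) (at (\<phi> p)) \<and>
        (\<forall>t. det (mat t - (\<chi> i j. complex_of_real (D $ i $ j))) = (t - z) * (t - w)))"

definition elliptic :: "'m chart set \<Rightarrow> ('m \<Rightarrow> 'm) \<Rightarrow> 'm \<Rightarrow> bool" where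
  "elliptic A g p \<longleftrightarrow>
     (\<exists>\<theta>. 0 < \<theta> \<and> \<theta> < pi \<and> multipliers A g p (exp (\<i> * of_real \<theta>)) (exp (- \<i> * of_real \<theta>)))"

definition saddle :: "'m chart set \<Rightarrow> ('m \<Rightarrow> 'm) \<Rightarrow> 'm \<Rightarrow> bool" where
  "saddle A g p \<longleftrightarrow>
     (\<exists>\<nu> \<nu>'. 0 < \<bar>\<nu>\<bar> \<and> \<bar>\<nu>\<bar> < 1 \<and> 1 < \<bar>\<nu>'\<bar> \<and> multipliers A g p (of_real \<nu>) (of_real \<nu>'))"


subsection \<open>Invariant manifolds, homoclinic orbits, tangencies\<close>

definition stable_set :: "('m::topological_space \<Rightarrow> 'm) \<Rightarrow> 'm \<Rightarrow> 'm set" where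
  "stable_set g P = {p. (\<lambda>n. (g ^^ n) p) \<longlonglongrightarrow> P}"

definition unstable_set :: "('m::topological_space \<Rightarrow> 'm) \<Rightarrow> 'm \<Rightarrow> 'm set" where
  "unstable_set g P = stable_set (inv g) P"

definition local_stable :: "'m set \<Rightarrow> ('m::topological_space \<Rightarrow> 'm) \<Rightarrow> 'm \<Rightarrow> 'm set" where
  "local_stable U g P = {p \<in> stable_set g P. \<forall>n. (g ^^ n) p \<in> U}"

definition local_unstable :: "'m set \<Rightarrow> ('m::topological_space \<Rightarrow> 'm) \<Rightarrow> 'm \<Rightarrow> 'm set" where
  "local_unstable U g P = local_stable U (inv g) P"

definition full_orbit :: "('m \<Rightarrow> 'm) \<Rightarrow> 'm \<Rightarrow> 'm set" where
  "full_orbit g p = range (\<lambda>n. (g ^^ n) p) \<union> range (\<lambda>n. (inv g ^^ n) p)"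

definition homoclinic_orbit :: "('m::topological_space \<Rightarrow> 'm) \<Rightarrow> 'm \<Rightarrow> 'm set \<Rightarrow> bool" where
  "homoclinic_orbit g P \<Gamma> \<longleftrightarrow>
     (\<exists>p. p \<noteq> P \<and> p \<in> stable_set g P \<inter> unstable_set g P \<and> \<Gamma> = full_orbit g p)"

text \<open>
  In a suitable chart the branches through \<open>p\<close> of the two curves are graphs whose 1-jets agree at
  \<open>p\<close> and whose second derivatives differ there.
\<close>

definition quadratic_tangency ::
  "nat \<Rightarrow> 'm::topological_space chart set \<Rightarrow> 'm set \<Rightarrow> 'm set \<Rightarrow> 'm \<Rightarrow> bool" where
  "quadratic_tangency r A V W p \<longleftrightarrow>
     (\<exists>U \<phi> \<epsilon> (g::real \<Rightarrow> real) (h::real \<Rightarrow> real).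
        admissible r A (U, \<phi>) \<and> p \<in> U \<and> \<phi> p = 0 \<and> \<epsilon> > 0 \<and>
        Ck_on 2 {-\<epsilon><..<\<epsilon>} g \<and> Ck_on 2 {-\<epsilon><..<\<epsilon>} h \<and>
        (\<forall>t\<in>{-\<epsilon><..<\<epsilon>}.
           vector [t, g t] \<in> \<phi> ` U \<and> inv_into U \<phi> (vector [t, g t]) \<in> V \<and>
           vector [t, h t] \<in> \<phi> ` U \<and> inv_into U \<phi> (vector [t, h t]) \<in> W) \<and>
        g 0 = 0 \<and> h 0 = 0 \<and> deriv g 0 = deriv h 0 \<and>
        deriv (deriv g) 0 \<noteq> deriv (deriv h) 0)"

definition symmetric_saddle ::
  "'m chart set \<Rightarrow> ('m \<Rightarrow> 'm) \<Rightarrow> ('m \<Rightarrow> 'm) \<Rightarrow> 'm \<Rightarrow> real \<Rightarrow> bool" where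
  "symmetric_saddle A R g P l \<longleftrightarrow>
     P \<in> Fix R \<and> 0 < l \<and> l < 1 \<and> multipliers A g P (of_real l) (of_real (inverse l))"

definition symmetric_couple_of_tangencies ::
  "nat \<Rightarrow> 'm::topological_space chart set \<Rightarrow> ('m \<Rightarrow> 'm) \<Rightarrow> ('m \<Rightarrow> 'm) \<Rightarrow> 'm
     \<Rightarrow> 'm set \<Rightarrow> 'm set \<Rightarrow> bool" where
  "symmetric_couple_of_tangencies r A R g P \<Gamma>1 \<Gamma>2 \<longleftrightarrow>
     homoclinic_orbit g P \<Gamma>1 \<and> homoclinic_orbit g P \<Gamma>2 \<and> \<Gamma>2 = R ` \<Gamma>1 \<and> \<Gamma>1 \<noteq> \<Gamma>2 \<and>
     (\<forall>p \<in> \<Gamma>1 \<union> \<Gamma>2. quadratic_tangency r A (unstable_set g P) (stable_set g P) p)"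


subsection \<open>Local coordinates and global maps\<close>

text \<open>
  Coordinates \<open>\<psi> \<mu>\<close> on the fixed neighbourhood \<open>U0\<close>, of smoothness \<open>r - 1\<close> with respect to the
  surface, which bring the local map to its cross form and the involution to the reflection
  \<open>(x, y) \<mapsto> (y, x)\<close>. The saddle \<open>P \<mu>\<close>, its multiplier \<open>l \<mu>\<close> and the function \<open>h \<mu>\<close> may depend on
  the parameter. The function \<open>h \<mu>\<close> is only used, and only required to be continuous, on the pairs
  (\<open>x\<close>-coordinate of a point, \<open>y\<close>-coordinate of its image).
\<close>

definition local_coordinates ::
  "nat \<Rightarrow> 'm::topological_space chart set \<Rightarrow> ('m \<Rightarrow> 'm) \<Rightarrow> real set \<Rightarrow> (real \<Rightarrow> 'm \<Rightarrow> 'm)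
     \<Rightarrow> 'm set \<Rightarrow> (real \<Rightarrow> 'm) \<Rightarrow> (real \<Rightarrow> real) \<Rightarrow> (real \<Rightarrow> 'm \<Rightarrow> real^2)
     \<Rightarrow> (real \<Rightarrow> real \<Rightarrow> real \<Rightarrow> real) \<Rightarrow> bool" where
  "local_coordinates r A R I f U0 P l \<psi> h \<longleftrightarrow>
     open U0 \<and> R ` U0 = U0 \<and>
     continuous_on I l \<and>
     (\<forall>\<mu>\<in>I. is_chart (U0, \<psi> \<mu>)) \<and>
     (\<forall>(V, \<eta>)\<in>A.
        Ck_fibre_on (r - 1) {(\<mu>, z). \<mu> \<in> I \<and> z \<in> \<eta> ` (U0 \<inter> V)}
          (\<lambda>\<mu> z. \<psi> \<mu> (inv_into V \<eta> z)) \<and>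
        Ck_fibre_on (r - 1) {(\<mu>, z). \<mu> \<in> I \<and> z \<in> \<psi> \<mu> ` (U0 \<inter> V)}
          (\<lambda>\<mu> z. \<eta> (inv_into U0 (\<psi> \<mu>) z))) \<and>
     (\<forall>\<mu>\<in>I. symmetric_saddle A R (f \<mu>) (P \<mu>) (l \<mu>) \<and> P \<mu> \<in> U0 \<and> \<psi> \<mu> (P \<mu>) = 0 \<and>
        (\<forall>p\<in>U0. \<psi> \<mu> (R p) = vector [\<psi> \<mu> p $ 2, \<psi> \<mu> p $ 1]) \<and>
        local_stable U0 (f \<mu>) (P \<mu>) = {p \<in> U0. \<psi> \<mu> p $ 2 = 0} \<and>
        local_unstable U0 (f \<mu>) (P \<mu>) = {p \<in> U0. \<psi> \<mu> p $ 1 = 0} \<and>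
        (\<forall>p\<in>U0. f \<mu> p \<in> U0 \<longrightarrow>
          (let x = \<psi> \<mu> p $ 1; y = \<psi> \<mu> p $ 2; x' = \<psi> \<mu> (f \<mu> p) $ 1; y' = \<psi> \<mu> (f \<mu> p) $ 2 in
             x' = l \<mu> * x + h \<mu> x y' * x\<^sup>2 * y' \<and>
             y = l \<mu> * y' + h \<mu> y' x * x * y'\<^sup>2))) \<and>
     continuous_on {(\<mu>, \<psi> \<mu> p $ 1, \<psi> \<mu> (f \<mu> p) $ 2) | \<mu> p. \<mu> \<in> I \<and> p \<in> U0 \<and> f \<mu> p \<in> U0}
       (\<lambda>(\<mu>, x, y'). h \<mu> x y')"

text \<open>
  The neighbourhoods \<open>N1m\<close>, \<open>N1p\<close> of the homoclinic points \<open>Mm\<close>, \<open>Mp\<close> (the superscripts minus and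
  plus), which belong to the orbit \<open>\<Gamma>1\<close> of the unperturbed map.
\<close>

definition homoclinic_neighbourhoods ::
  "('m::topological_space \<Rightarrow> 'm) \<Rightarrow> 'm set \<Rightarrow> 'm \<Rightarrow> 'm set \<Rightarrow> nat \<Rightarrow> 'm \<Rightarrow> 'm \<Rightarrow> 'm set \<Rightarrow> 'm set
     \<Rightarrow> bool" where
  "homoclinic_neighbourhoods g U0 P \<Gamma>1 q Mm Mp N1m N1p \<longleftrightarrow>
     q > 0 \<and> Mm \<in> \<Gamma>1 \<inter> local_unstable U0 g P \<and> Mp \<in> \<Gamma>1 \<inter> local_stable U0 g P \<and>
     (g ^^ q) Mm = Mp \<and>
     open N1m \<and> Mm \<in> N1m \<and> N1m \<subseteq> U0 \<and> open N1p \<and> Mp \<in> N1p \<and> N1p \<subseteq> U0"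

text \<open>
  The form of the first global map in the local coordinates, in which the parameter \<open>\<mu>\<close> is the
  splitting parameter. The bounds on the remainders are uniform in the parameter.
\<close>

definition splitting_form ::
  "real set \<Rightarrow> (real \<Rightarrow> 'm \<Rightarrow> 'm) \<Rightarrow> (real \<Rightarrow> 'm \<Rightarrow> real^2) \<Rightarrow> nat \<Rightarrow> 'm set \<Rightarrow> 'm set
     \<Rightarrow> (real \<Rightarrow> real) \<Rightarrow> (real \<Rightarrow> real)
     \<Rightarrow> (real \<Rightarrow> real) \<Rightarrow> (real \<Rightarrow> real) \<Rightarrow> (real \<Rightarrow> real) \<Rightarrow> (real \<Rightarrow> real) \<Rightarrow> bool" where
  "splitting_form I f \<psi> q N1m N1p xp ym a b c d \<longleftrightarrow>
     continuous_on I xp \<and> continuous_on I ym \<and> continuous_on I a \<and> continuous_on I b \<and>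
     continuous_on I c \<and> continuous_on I d \<and>
     (\<forall>\<mu>\<in>I. d \<mu> \<noteq> 0 \<and> vector [0, ym \<mu>] \<in> \<psi> \<mu> ` N1m \<and> vector [xp \<mu>, 0] \<in> \<psi> \<mu> ` N1p) \<and>
     (\<exists>C. \<forall>\<mu>\<in>I. \<forall>p\<in>N1m. (f \<mu> ^^ q) p \<in> N1p \<longrightarrow>
        (let x = \<psi> \<mu> p $ 1; v = \<psi> \<mu> p $ 2 - ym \<mu>;
             x' = \<psi> \<mu> ((f \<mu> ^^ q) p) $ 1; y' = \<psi> \<mu> ((f \<mu> ^^ q) p) $ 2 in
           \<bar>x' - xp \<mu> - (a \<mu> * x + b \<mu> * v)\<bar> \<le> C * (v\<^sup>2 + x\<^sup>2) \<and>
           \<bar>y' - (\<mu> + c \<mu> * x + d \<mu> * v\<^sup>2)\<bar> \<le> C * (x\<^sup>2 + \<bar>v\<bar> ^ 3 + \<bar>x\<bar> * \<bar>v\<bar>)))"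

definition jacobian_in :: "'m set \<Rightarrow> ('m \<Rightarrow> real^2) \<Rightarrow> ('m \<Rightarrow> 'm) \<Rightarrow> 'm \<Rightarrow> real" where
  "jacobian_in U0 \<psi> g p =
     det (matrix (frechet_derivative (\<psi> \<circ> g \<circ> inv_into U0 \<psi>) (at (\<psi> p))))"


subsection \<open>First return map\<close>

definition first_return :: "('m \<Rightarrow> 'm) \<Rightarrow> nat \<Rightarrow> nat \<Rightarrow> nat \<Rightarrow> 'm \<Rightarrow> 'm" where
  "first_return g q m k = (g ^^ q) \<circ> (g ^^ m) \<circ> (g ^^ q) \<circ> (g ^^ k)"

text \<open>
  The points of \<open>R ` N1m\<close> at which the composition of the local and global maps makes sense; the
  iterations of the local map take place inside \<open>U0\<close>.
\<close>

definition first_return_dom ::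
  "('m \<Rightarrow> 'm) \<Rightarrow> ('m \<Rightarrow> 'm) \<Rightarrow> 'm set \<Rightarrow> 'm set \<Rightarrow> 'm set \<Rightarrow> nat \<Rightarrow> nat \<Rightarrow> nat \<Rightarrow> 'm set" where
  "first_return_dom R g U0 N1m N1p q m k =
     {p \<in> R ` N1m.
        (\<forall>j\<le>k. (g ^^ j) p \<in> U0) \<and> (g ^^ k) p \<in> N1m \<and>
        (let p' = (g ^^ q) ((g ^^ k) p) in
           p' \<in> N1p \<and> (\<forall>j\<le>m. (g ^^ j) p' \<in> U0) \<and> (g ^^ m) p' \<in> R ` N1p \<and>
           (g ^^ q) ((g ^^ m) p') \<in> R ` N1m)}"

definition symmetric_fixed_point ::
  "('m \<Rightarrow> 'm) \<Rightarrow> ('m \<Rightarrow> 'm) \<Rightarrow> 'm set \<Rightarrow> 'm set \<Rightarrow> 'm set \<Rightarrow> nat \<Rightarrow> nat \<Rightarrow> nat \<Rightarrow> 'm \<Rightarrow> bool" where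
  "symmetric_fixed_point R g U0 N1m N1p q m k p \<longleftrightarrow>
     p \<in> first_return_dom R g U0 N1m N1p q m k \<and> first_return g q m k p = p \<and>
     R ` full_orbit g p = full_orbit g p"

end

theory Submission
  imports Defs
begin

text \<open>
  Only the symmetric fixed points are searched for, with \<open>k = 2 j\<close>, \<open>m = 2 i\<close> and \<open>i - j\<close> constant. The
  orbits which pass through \<open>Fix R\<close> after half of the time spent near the saddle form two arcs:
  the image of the diagonal \<open>(t, t)\<close> under \<open>T\<^sub>0\<^sup>j\<close> near \<open>M\<^sub>1\<^sup>-\<close>, which is a graph \<open>x = \<gamma>(y)\<close>, and the
  mirror image of such a graph near \<open>M\<^sub>1\<^sup>+\<close>. Symmetric fixed points correspond to the
  intersections of the second arc with the \<open>T\<^sub>1\<close>-image of the first one, that is, to the zeros of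
  a scalar gap function of the arc parameter. As both arcs have slope close to \<open>\<lambda>\<^sup>2\<^sup>j\<close> up to constants,
  the gap has a quadratic fold, and its minimum, rescaled by \<open>\<lambda>\<^sup>4\<^sup>j\<close>, takes all values of a fixed
  interval \<open>(- 2 \<kappa>, - \<kappa>)\<close> for suitable \<open>\<mu>\<close> near \<open>0\<close>. Then there are two zeros,
  where the derivatives of the gap are small and have opposite signs.

  Let \<open>W\<close> be the derivative of the passage between two consecutive points of \<open>Fix R\<close>, with entries
  \<open>\<alpha>, \<beta>, \<gamma>, \<delta>\<close> in the eigenbasis \<open>(1, 1), (1, -1)\<close> of the reflection \<open>S\<close>. The first return map has
  derivative conjugate to \<open>S W\<^sup>-\<^sup>1 S W\<close>, of determinant \<open>1\<close>, and the square of its trace minus \<open>4\<close> is a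
  positive multiple of \<open>\<alpha> \<beta> \<gamma> \<delta>\<close>. The entry \<open>\<gamma>\<close> is proportional to the derivative of the gap, while
  the other three keep their signs, so one of the two points is elliptic and the other is a saddle.
\<close>

subsection \<open>Smoothness in the fibre\<close>

text \<open>Low regularity shapes the proof. The function \<open>h\<close> is only continuous, and
  in the local coordinates everything depends on \<mu> only continuously. So the cross form is used
  for what it yields exactly on the two axes, bounds on derivatives along the fibre do the rest, and
  in place of an implicit function theorem in \<mu> there is the minimum of the gap, which is
  continuous in \<mu>, with the intermediate value theorem.

  The scale is forced. Put \<open>w = l \<mu> ^ (2 * j)\<close>. The slopes of the arcs are known up
  to a relative error \<epsilon>, hence the derivative of the gap up to multiples of
  \<open>\<epsilon> * w\<close>, while the quantities which fix the signs of the other three entries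
  of \<open>W\<close> are of size \<open>w\<close>. If the minimum is
  \<open>- \<kappa> * w\<^sup>2\<close>, the zeros lie at distance about
  \<open>sqrt \<kappa> * w\<close> from it, and the gap has slope of that order there. A small but
  fixed \<kappa> keeps this slope below the other entries, and \<epsilon>, chosen after \<kappa>,
  keeps the errors below the slope.

  The shift \<open>n = i - j\<close> makes \<open>\<Lambda> = l 0 ^ (2 * n)\<close> the ratio of the
  slopes of the arcs. The leading term of \<beta> is a multiple of
  \<open>\<Lambda> * b0 - c0\<close>, with \<open>b0\<close>, \<open>c0\<close> the off-diagonal
  derivatives of the global map; one of \<open>n = 0\<close> and \<open>n = 1\<close> makes it
  nonzero.\<close>

lemma open_slice:
  fixes S :: "('a::topological_space \<times> 'b::topological_space) set"
  assumes "open S"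
  shows "open {z. (\<mu>, z) \<in> S}"
proof -
  have "open (Pair \<mu> -` S)"
    by (rule open_vimage[OF assms]) (intro continuous_intros)
  then show ?thesis by (simp add: vimage_def)
qed

lemma Ck_fibre_on_continuous: "Ck_fibre_on k S F \<Longrightarrow> continuous_on S (\<lambda>(\<mu>, z). F \<mu> z)"
  by (cases k) auto

lemma Ck_fibre_on_subset: "Ck_fibre_on k S F \<Longrightarrow> T \<subseteq> S \<Longrightarrow> Ck_fibre_on k T F"
proof (induction k arbitrary: F)
  case 0
  then show ?case unfolding Ck_fibre_on.simps by (rule continuous_on_subset)
next
  case (Suc k)
  obtain F' where F': "\<forall>(\<mu>, z)\<in>S. (F \<mu> has_derivative F' \<mu> z) (at z)"
      "\<forall>v. Ck_fibre_on k S (\<lambda>\<mu> z. F' \<mu> z v)" using Suc.prems by auto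
  have "continuous_on T (\<lambda>(\<mu>, z). F \<mu> z)"
    using continuous_on_subset[OF Ck_fibre_on_continuous[OF Suc.prems(1)] Suc.prems(2)] .
  moreover have "\<forall>(\<mu>, z)\<in>T. (F \<mu> has_derivative F' \<mu> z) (at z)"
    using F'(1) Suc.prems(2) by blast
  moreover have "\<forall>v. Ck_fibre_on k T (\<lambda>\<mu> z. F' \<mu> z v)"
    using F'(2) Suc.IH Suc.prems(2) by blast
  ultimately show ?case unfolding Ck_fibre_on.simps by blast
qed

lemma Ck_fibre_on_SucD: "Ck_fibre_on (Suc k) S F \<Longrightarrow> Ck_fibre_on k S F"
proof (induction k arbitrary: F)
  case (Suc k)
  obtain F' where F': "\<forall>(\<mu>, z)\<in>S. (F \<mu> has_derivative F' \<mu> z) (at z)"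
      "\<forall>v. Ck_fibre_on (Suc k) S (\<lambda>\<mu> z. F' \<mu> z v)"
    and c: "continuous_on S (\<lambda>(\<mu>, z). F \<mu> z)"
    using Suc.prems unfolding Ck_fibre_on.simps(2)[of "Suc k"] by blast
  have "\<forall>v. Ck_fibre_on k S (\<lambda>\<mu> z. F' \<mu> z v)" using F'(2) Suc.IH by blast
  then show ?case unfolding Ck_fibre_on.simps using c F'(1) by blast
qed simp

lemma Ck_fibre_on_le: "Ck_fibre_on n S F \<Longrightarrow> k \<le> n \<Longrightarrow> Ck_fibre_on k S F"
proof (induction n)
  case (Suc n)
  then show ?case using Ck_fibre_on_SucD[of n S F] by (cases "k = Suc n") auto
qed simp

lemma Ck_fibre_on_cong:
  assumes "Ck_fibre_on k S F" "open S" "\<And>\<mu> z. (\<mu>, z) \<in> S \<Longrightarrow> F \<mu> z = G \<mu> z"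
  shows "Ck_fibre_on k S G"
proof -
  have c: "continuous_on S (\<lambda>(\<mu>, z). G \<mu> z)"
    using Ck_fibre_on_continuous[OF assms(1)]
    by (rule continuous_on_eq) (use assms(3) in auto)
  show ?thesis
  proof (cases k)
    case (Suc n)
    then obtain F' where F': "\<forall>(\<mu>, z)\<in>S. (F \<mu> has_derivative F' \<mu> z) (at z)"
      "\<forall>v. Ck_fibre_on n S (\<lambda>\<mu> z. F' \<mu> z v)" using assms(1) by auto
    have "(G \<mu> has_derivative F' \<mu> z) (at z)" if "(\<mu>, z) \<in> S" for \<mu> z
    proof (rule has_derivative_transform_within_open[OF _ open_slice[OF assms(2)]])
      show "(F \<mu> has_derivative F' \<mu> z) (at z)" using F' that by auto
    qed (use that assms(3) in auto)
    then show ?thesis using c F' Suc by auto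
  qed (use c in simp)
qed

text \<open>On an open set derivatives are unique, so the existential witness may be replaced by
  \<open>frechet_derivative\<close>. A canonical witness is what allows local pieces to be glued in
  \<open>Ck_fibre_on_local\<close>.\<close>

lemma Ck_fibre_on_Suc_iff:
  assumes "open S"
  shows "Ck_fibre_on (Suc k) S F \<longleftrightarrow>
    continuous_on S (\<lambda>(\<mu>, z). F \<mu> z) \<and> (\<forall>(\<mu>, z)\<in>S. F \<mu> differentiable at z) \<and>
    (\<forall>v. Ck_fibre_on k S (\<lambda>\<mu> z. frechet_derivative (F \<mu>) (at z) v))"
    (is "_ \<longleftrightarrow> ?rhs")
proof
  assume "Ck_fibre_on (Suc k) S F"
  then obtain F' where F': "\<forall>(\<mu>, z)\<in>S. (F \<mu> has_derivative F' \<mu> z) (at z)"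
      "\<forall>v. Ck_fibre_on k S (\<lambda>\<mu> z. F' \<mu> z v)" and c: "continuous_on S (\<lambda>(\<mu>, z). F \<mu> z)" by auto
  have "Ck_fibre_on k S (\<lambda>\<mu> z. frechet_derivative (F \<mu>) (at z) v)" for v
  proof (rule Ck_fibre_on_cong[OF F'(2)[rule_format] assms])
    show "F' \<mu> z v = frechet_derivative (F \<mu>) (at z) v" if "(\<mu>, z) \<in> S" for \<mu> z
      using F'(1) that frechet_derivative_at by fastforce
  qed
  then show ?rhs using c F'(1) by (auto simp: differentiable_def)
next
  assume ?rhs
  then show "Ck_fibre_on (Suc k) S F"
    by (auto intro!: exI[of _ "\<lambda>\<mu> z. frechet_derivative (F \<mu>) (at z)"]
        simp: frechet_derivative_works)
qed

lemma Ck_fibre_on_local: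
  assumes "open S" "\<And>x. x \<in> S \<Longrightarrow> \<exists>T. open T \<and> x \<in> T \<and> Ck_fibre_on k T F"
  shows "Ck_fibre_on k S F"
  using assms(2)
proof (induction k arbitrary: F)
  case 0
  show ?case
    unfolding Ck_fibre_on.simps continuous_on_eq_continuous_at[OF assms(1)]
  proof
    fix x assume "x \<in> S"
    then obtain T where "open T" "x \<in> T" "Ck_fibre_on 0 T F" using 0 by blast
    then show "isCont (\<lambda>(\<mu>, z). F \<mu> z) x" by (simp add: continuous_on_eq_continuous_at)
  qed
next
  case (Suc k)
  have loc: "\<exists>T. open T \<and> x \<in> T \<and> Ck_fibre_on k T (\<lambda>\<mu> z. frechet_derivative (F \<mu>) (at z) v)
     \<and> isCont (\<lambda>(\<mu>, z). F \<mu> z) x \<and> (case x of (\<mu>, z) \<Rightarrow> F \<mu> differentiable at z)"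
    if xS: "x \<in> S" for x v
  proof -
    obtain T where T: "open T" "x \<in> T" "Ck_fibre_on (Suc k) T F" using Suc.prems[OF xS] by blast
    have "isCont (\<lambda>(\<mu>, z). F \<mu> z) x"
      using Ck_fibre_on_continuous[OF T(3)] T(2) by (simp add: continuous_on_eq_continuous_at[OF T(1)])
    moreover have "Ck_fibre_on k T (\<lambda>\<mu> z. frechet_derivative (F \<mu>) (at z) v)"
      "case x of (\<mu>, z) \<Rightarrow> F \<mu> differentiable at z"
      using T(2,3) unfolding Ck_fibre_on_Suc_iff[OF T(1)] by simp_all
    ultimately show ?thesis using T(1,2) by (intro exI[of _ T]) simp
  qed
  have "Ck_fibre_on k S (\<lambda>\<mu> z. frechet_derivative (F \<mu>) (at z) v)" for v
  proof (rule Suc.IH)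
    fix x assume "x \<in> S"
    from loc[OF this, of v] show "\<exists>T. open T \<and> x \<in> T \<and>
        Ck_fibre_on k T (\<lambda>\<mu> z. frechet_derivative (F \<mu>) (at z) v)" by (elim exE conjE) (intro exI conjI)
  qed
  moreover have "continuous_on S (\<lambda>(\<mu>, z). F \<mu> z)"
    unfolding continuous_on_eq_continuous_at[OF assms(1)] using loc by metis
  moreover have "\<forall>x\<in>S. case x of (\<mu>, z) \<Rightarrow> F \<mu> differentiable at z" using loc by metis
  ultimately show ?case unfolding Ck_fibre_on_Suc_iff[OF assms(1)] by simp
qed

lemma Ck_fibre_on_add:
  assumes "Ck_fibre_on k S F" "Ck_fibre_on k S G"
  shows "Ck_fibre_on k S (\<lambda>\<mu> z. F \<mu> z + G \<mu> z)"
  using assms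
proof (induction k arbitrary: F G)
  case 0
  then show ?case by (simp add: case_prod_unfold continuous_on_add)
next
  case (Suc k)
  obtain F' G' where *: "\<forall>(\<mu>, z)\<in>S. (F \<mu> has_derivative F' \<mu> z) (at z)"
      "\<forall>v. Ck_fibre_on k S (\<lambda>\<mu> z. F' \<mu> z v)" "\<forall>(\<mu>, z)\<in>S. (G \<mu> has_derivative G' \<mu> z) (at z)"
      "\<forall>v. Ck_fibre_on k S (\<lambda>\<mu> z. G' \<mu> z v)" using Suc.prems by auto
  have "continuous_on S (\<lambda>(\<mu>, z). F \<mu> z + G \<mu> z)"
    using Suc.prems by (simp add: case_prod_unfold continuous_on_add)
  then show ?case unfolding Ck_fibre_on.simps
    using * by (auto intro!: exI[of _ "\<lambda>\<mu> z v. F' \<mu> z v + G' \<mu> z v"] has_derivative_add Suc.IH)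
qed

lemma Ck_fibre_on_const: "Ck_fibre_on k S (\<lambda>\<mu> z. c)"
proof (induction k arbitrary: c)
  case (Suc k)
  then show ?case by (auto intro!: exI[of _ "\<lambda>\<mu> z v. 0"] simp: case_prod_unfold)
qed (simp add: case_prod_unfold)

lemma Ck_fibre_on_sum:
  assumes "finite B" "\<And>b. b \<in> B \<Longrightarrow> Ck_fibre_on k S (F b)"
  shows "Ck_fibre_on k S (\<lambda>\<mu> z. \<Sum>b\<in>B. F b \<mu> z)"
  using assms by (induction B rule: finite_induct) (auto intro: Ck_fibre_on_add Ck_fibre_on_const)

lemma Ck_fibre_on_scaleR:
  fixes F :: "real \<Rightarrow> 'a::euclidean_space \<Rightarrow> real"
  assumes "Ck_fibre_on k S F" "Ck_fibre_on k S G"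
  shows "Ck_fibre_on k S (\<lambda>\<mu> z. F \<mu> z *\<^sub>R G \<mu> z)"
  using assms
proof (induction k arbitrary: F G)
  case 0
  then show ?case by (simp add: case_prod_unfold continuous_on_scaleR)
next
  case (Suc k)
  obtain F' G' where *: "\<forall>(\<mu>, z)\<in>S. (F \<mu> has_derivative F' \<mu> z) (at z)"
      "\<forall>v. Ck_fibre_on k S (\<lambda>\<mu> z. F' \<mu> z v)" "\<forall>(\<mu>, z)\<in>S. (G \<mu> has_derivative G' \<mu> z) (at z)"
      "\<forall>v. Ck_fibre_on k S (\<lambda>\<mu> z. G' \<mu> z v)" using Suc.prems by auto
  have c: "continuous_on S (\<lambda>(\<mu>, z). F \<mu> z *\<^sub>R G \<mu> z)"
    using Suc.prems by (simp add: case_prod_unfold continuous_on_scaleR)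
  have d: "Ck_fibre_on k S F" "Ck_fibre_on k S G" using Suc.prems Ck_fibre_on_SucD by blast+
  show ?case unfolding Ck_fibre_on.simps
  proof (intro conjI exI[of _ "\<lambda>\<mu> z v. F \<mu> z *\<^sub>R G' \<mu> z v + F' \<mu> z v *\<^sub>R G \<mu> z"] allI)
    show "\<forall>(\<mu>, z)\<in>S. ((\<lambda>z. F \<mu> z *\<^sub>R G \<mu> z) has_derivative
        (\<lambda>v. F \<mu> z *\<^sub>R G' \<mu> z v + F' \<mu> z v *\<^sub>R G \<mu> z)) (at z)"
      using * by (auto intro!: has_derivative_scaleR)
    show "Ck_fibre_on k S (\<lambda>\<mu> z. F \<mu> z *\<^sub>R G' \<mu> z v + F' \<mu> z v *\<^sub>R G \<mu> z)" for v
      using * d by (intro Ck_fibre_on_add Suc.IH) auto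
  qed (rule c)
qed

lemma Ck_fibre_on_linear:
  fixes L :: "'b::euclidean_space \<Rightarrow> 'c::euclidean_space"
  assumes "bounded_linear L" "Ck_fibre_on k S F"
  shows "Ck_fibre_on k S (\<lambda>\<mu> z. L (F \<mu> z))"
  using assms(2)
proof (induction k arbitrary: F)
  case 0
  then show ?case
    by (simp add: case_prod_unfold bounded_linear.continuous_on[OF assms(1)])
next
  case (Suc k)
  obtain F' where *: "\<forall>(\<mu>, z)\<in>S. (F \<mu> has_derivative F' \<mu> z) (at z)"
      "\<forall>v. Ck_fibre_on k S (\<lambda>\<mu> z. F' \<mu> z v)" using Suc.prems by auto
  have "continuous_on S (\<lambda>(\<mu>, z). L (F \<mu> z))"
    using Ck_fibre_on_continuous[OF Suc.prems]
    by (simp add: case_prod_unfold bounded_linear.continuous_on[OF assms(1)])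
  then show ?case unfolding Ck_fibre_on.simps
    using * by (auto intro!: exI[of _ "\<lambda>\<mu> z v. L (F' \<mu> z v)"] Suc.IH
        bounded_linear.has_derivative[OF assms(1)])
qed

text \<open>In the chain rule the direction \<open>F' \<mu> z v\<close> moves with \<open>z\<close>,
  whereas the induction hypothesis covers fixed directions only. Expanding it in
  \<open>Basis\<close> leaves a sum of products in which every direction is fixed.\<close>

lemma Ck_fibre_on_compose:
  fixes F :: "real \<Rightarrow> 'a::euclidean_space \<Rightarrow> 'b::euclidean_space"
  assumes "Ck_fibre_on k S F" "Ck_fibre_on k S' G" "\<And>\<mu> z. (\<mu>, z) \<in> S \<Longrightarrow> (\<mu>, F \<mu> z) \<in> S'"
  shows "Ck_fibre_on k S (\<lambda>\<mu> z. G \<mu> (F \<mu> z))"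
  using assms(1,2)
proof (induction k arbitrary: G)
  case 0
  have "continuous_on S (\<lambda>x. (fst x, F (fst x) (snd x)))"
    using 0 by (intro continuous_intros) (simp add: case_prod_unfold)
  moreover have "(\<lambda>x. (fst x, F (fst x) (snd x))) ` S \<subseteq> S'" using assms(3) by auto
  ultimately show ?case
    using continuous_on_compose2[OF Ck_fibre_on_continuous[OF 0(2)]]
    by (fastforce simp: case_prod_unfold)
next
  case (Suc k)
  obtain F' G' where *: "\<forall>(\<mu>, z)\<in>S. (F \<mu> has_derivative F' \<mu> z) (at z)"
      "\<forall>v. Ck_fibre_on k S (\<lambda>\<mu> z. F' \<mu> z v)" "\<forall>(\<mu>, z)\<in>S'. (G \<mu> has_derivative G' \<mu> z) (at z)"
      "\<forall>v. Ck_fibre_on k S' (\<lambda>\<mu> z. G' \<mu> z v)" using Suc.prems by auto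
  have cF: "continuous_on S (\<lambda>(\<mu>, z). F \<mu> z)" and cG: "continuous_on S' (\<lambda>(\<mu>, z). G \<mu> z)"
    using Suc.prems by auto
  have "continuous_on S (\<lambda>x. (fst x, F (fst x) (snd x)))"
    using cF by (intro continuous_intros) (simp add: case_prod_unfold)
  moreover have "(\<lambda>x. (fst x, F (fst x) (snd x))) ` S \<subseteq> S'" using assms(3) by auto
  ultimately have c: "continuous_on S (\<lambda>(\<mu>, z). G \<mu> (F \<mu> z))"
    using continuous_on_compose2[OF cG] by (fastforce simp: case_prod_unfold)
  have d: "Ck_fibre_on k S F" using Suc.prems Ck_fibre_on_SucD by blast
  let ?D = "\<lambda>\<mu> z v. \<Sum>b\<in>Basis. (F' \<mu> z v \<bullet> b) *\<^sub>R G' \<mu> (F \<mu> z) b"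
  show ?case unfolding Ck_fibre_on.simps
  proof (intro conjI exI[of _ ?D] allI)
    show "\<forall>(\<mu>, z)\<in>S. ((\<lambda>z. G \<mu> (F \<mu> z)) has_derivative ?D \<mu> z) (at z)"
    proof clarify
      fix \<mu> z assume S: "(\<mu>, z) \<in> S"
      have hF: "(F \<mu> has_derivative F' \<mu> z) (at z)" using * S by auto
      have hG: "(G \<mu> has_derivative G' \<mu> (F \<mu> z)) (at (F \<mu> z))" using * assms(3)[OF S] by auto
      have "G' \<mu> (F \<mu> z) (F' \<mu> z v) = ?D \<mu> z v" for v
      proof -
        have l: "linear (G' \<mu> (F \<mu> z))" using has_derivative_linear[OF hG] .
        have "G' \<mu> (F \<mu> z) (F' \<mu> z v) = G' \<mu> (F \<mu> z) (\<Sum>b\<in>Basis. (F' \<mu> z v \<bullet> b) *\<^sub>R b)"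
          by (simp add: euclidean_representation)
        then show ?thesis by (simp add: linear_sum[OF l] linear_scale[OF l])
      qed
      then show "((\<lambda>z. G \<mu> (F \<mu> z)) has_derivative ?D \<mu> z) (at z)"
        using has_derivative_compose[OF hF hG] by simp
    qed
    show "Ck_fibre_on k S (\<lambda>\<mu> z. ?D \<mu> z v)" for v
    proof (intro Ck_fibre_on_sum Ck_fibre_on_scaleR)
      show "Ck_fibre_on k S (\<lambda>\<mu> z. F' \<mu> z v \<bullet> b)" for b
        using Ck_fibre_on_linear[OF bounded_linear_inner_left] * by blast
      show "Ck_fibre_on k S (\<lambda>\<mu> z. G' \<mu> (F \<mu> z) b)" for b
        using Suc.IH[OF d, of "\<lambda>\<mu> z. G' \<mu> z b"] * by blast
    qed simp
  qed (rule c)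
qed

text \<open>The derivatives along the fibre are those in the directions \<open>(0, v)\<close>. Joint
  smoothness is given up here because it would not survive the passage to coordinates which are
  merely continuous in \<mu>.\<close>

lemma Ck_on_imp_Ck_fibre_on:
  assumes "Ck_on k S (\<lambda>(\<mu>, z). F \<mu> z)"
  shows "Ck_fibre_on k S F"
  using assms
proof (induction k arbitrary: F)
  case (Suc k)
  then obtain F' where *: "\<forall>x\<in>S. ((\<lambda>(\<mu>, z). F \<mu> z) has_derivative F' x) (at x)"
      "\<forall>v. Ck_on k S (\<lambda>x. F' x v)" by auto
  have c: "continuous_on S (\<lambda>(\<mu>, z). F \<mu> z)"
    using * has_derivative_continuous by (blast intro: continuous_at_imp_continuous_on)
  show ?case unfolding Ck_fibre_on.simps
  proof (intro conjI exI[of _ "\<lambda>\<mu> z v. F' (\<mu>, z) (0, v)"] allI)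
    show "\<forall>(\<mu>, z)\<in>S. (F \<mu> has_derivative (\<lambda>v. F' (\<mu>, z) (0, v))) (at z)"
    proof clarify
      fix \<mu> z assume S: "(\<mu>, z) \<in> S"
      have "(Pair \<mu> has_derivative (\<lambda>v. (0, v))) (at z)" by (auto intro!: derivative_eq_intros)
      from has_derivative_compose[OF this *(1)[rule_format, OF S]]
      show "(F \<mu> has_derivative (\<lambda>v. F' (\<mu>, z) (0, v))) (at z)" by simp
    qed
    show "Ck_fibre_on k S (\<lambda>\<mu> z. F' (\<mu>, z) (0, v))" for v
      by (rule Suc.IH) (use * in \<open>simp add: case_prod_unfold\<close>)
  qed (rule c)
qed simp

subsection \<open>Families in local coordinates\<close>

lemma is_chartD:
  assumes "is_chart (U, \<phi>)"
  shows "open U" "open (\<phi> ` U)" "inj_on \<phi> U" "continuous_on U \<phi>"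
    "continuous_on (\<phi> ` U) (inv_into U \<phi>)" "\<And>p. p \<in> U \<Longrightarrow> inv_into U \<phi> (\<phi> p) = p"
proof -
  have h: "homeomorphism U (\<phi> ` U) \<phi> (inv_into U \<phi>)" and "open U" "open (\<phi> ` U)"
    using assms unfolding is_chart_def by auto
  then show "open U" "open (\<phi> ` U)" "continuous_on U \<phi>" "continuous_on (\<phi> ` U) (inv_into U \<phi>)"
    by (auto simp: homeomorphism_def)
  show *: "inv_into U \<phi> (\<phi> p) = p" if "p \<in> U" for p
    using h that by (auto simp: homeomorphism_def)
  show "inj_on \<phi> U" by (rule inj_on_inverseI[of U "inv_into U \<phi>"]) (rule *)
qed

lemma mem_image_inv_into:
  assumes "inj_on \<phi> U"
  shows "z \<in> \<phi> ` {p \<in> U. Q p} \<longleftrightarrow> z \<in> \<phi> ` U \<and> Q (inv_into U \<phi> z)"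
  using assms by (auto simp: inv_into_f_f)

text \<open>Meant for the transition maps of the atlas, which start the induction in
  \<open>iterate_smooth\<close>.\<close>

lemma Ck_on_imp_Ck_fibre_on_const:
  assumes "Ck_on k S g"
  shows "Ck_fibre_on k (I \<times> S) (\<lambda>\<mu>. g)"
  using assms
proof (induction k arbitrary: g)
  case 0
  have "continuous_on (I \<times> S) (\<lambda>x. g (snd x))"
    by (rule continuous_on_compose2[where g = g and f = snd]) (use 0 in \<open>auto intro!: continuous_intros\<close>)
  then show ?case by (simp add: case_prod_unfold)
next
  case (Suc k)
  then obtain g' where g': "\<forall>x\<in>S. (g has_derivative g' x) (at x)" "\<forall>v. Ck_on k S (\<lambda>x. g' x v)"
    by auto
  have "continuous_on S g"
    using g'(1) has_derivative_continuous by (blast intro: continuous_at_imp_continuous_on)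
  then have "continuous_on (I \<times> S) (\<lambda>x. g (snd x))"
    by (rule continuous_on_compose2[where g = g and f = snd]) (auto intro!: continuous_intros)
  moreover have "\<forall>v. Ck_fibre_on k (I \<times> S) (\<lambda>\<mu> x. g' x v)" using Suc.IH g'(2) by blast
  ultimately show ?case unfolding Ck_fibre_on.simps using g'(1)
    by (intro conjI exI[of _ "\<lambda>\<mu>. g'"]) (auto simp: case_prod_unfold)
qed

text \<open>The data of the saddle alone. The passage near it is studied for an arbitrary height on
  the unstable axis, since it will be used for both arcs; the homoclinic orbit enters with
  \<open>splitting_family\<close>.\<close>

locale reversible_family =
  fixes A :: "'m::{t2_space, second_countable_topology} chart set"
    and R :: "'m \<Rightarrow> 'm" and f :: "real \<Rightarrow> 'm \<Rightarrow> 'm" and P :: "real \<Rightarrow> 'm"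
    and \<psi> :: "real \<Rightarrow> 'm \<Rightarrow> real^2" and h :: "real \<Rightarrow> real \<Rightarrow> real \<Rightarrow> real"
    and l :: "real \<Rightarrow> real" and U0 :: "'m set" and r :: nat and I :: "real set"
  assumes r: "r \<ge> 4" and open_I: "open I"
    and atlas: "Ck_atlas r A" and R_R: "R \<circ> R = id"
    and family: "Ck_diffeo_family r A I f"
    and reversible: "\<And>\<mu>. \<mu> \<in> I \<Longrightarrow> reversible R (f \<mu>)"
    and coordinates: "local_coordinates r A R I f U0 P l \<psi> h"
begin

definition pt :: "real \<Rightarrow> real^2 \<Rightarrow> 'm" where "pt \<mu> = inv_into U0 (\<psi> \<mu>)"

text \<open>Only the two ends of the orbit segment have to lie in \<open>U0\<close>. Thus
  \<open>T n\<close> stands for the powers of the local map and, with \<open>n = q\<close>, for the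
  global map, whose orbits may leave \<open>U0\<close> in between. That an orbit stays in
  \<open>U0\<close> is expressed by membership in \<open>E n\<close> for all
  \<open>n \<le> j\<close>.\<close>

definition E :: "nat \<Rightarrow> (real \<times> (real^2)) set" where
  "E n = {(\<mu>, z). \<mu> \<in> I \<and> z \<in> \<psi> \<mu> ` U0 \<and> (f \<mu> ^^ n) (pt \<mu> z) \<in> U0}"

definition T :: "nat \<Rightarrow> real \<Rightarrow> real^2 \<Rightarrow> real^2" where
  "T n \<mu> z = \<psi> \<mu> ((f \<mu> ^^ n) (pt \<mu> z))"

lemma atlas_chart: "(U, \<phi>) \<in> A \<Longrightarrow> is_chart (U, \<phi>)"
  using atlas unfolding Ck_atlas_def by blast

lemma atlas_cover: obtains U \<phi> where "(U, \<phi>) \<in> A" "p \<in> U"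
proof -
  have "p \<in> (\<Union>c\<in>A. fst c)" using atlas unfolding Ck_atlas_def by simp
  then show ?thesis using that by auto
qed

lemma open_U0: "open U0" and R_U0: "R ` U0 = U0" and l_cont: "continuous_on I l"
  and psi_chart: "\<mu> \<in> I \<Longrightarrow> is_chart (U0, \<psi> \<mu>)"
  using coordinates unfolding local_coordinates_def by auto

lemma psi_smooth:
  assumes "(V, \<eta>) \<in> A"
  shows "Ck_fibre_on (r - 1) {(\<mu>, z). \<mu> \<in> I \<and> z \<in> \<eta> ` (U0 \<inter> V)} (\<lambda>\<mu> z. \<psi> \<mu> (inv_into V \<eta> z))"
    "Ck_fibre_on (r - 1) {(\<mu>, z). \<mu> \<in> I \<and> z \<in> \<psi> \<mu> ` (U0 \<inter> V)} (\<lambda>\<mu> z. \<eta> (pt \<mu> z))"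
proof -
  have "\<forall>(V, \<eta>)\<in>A.
        Ck_fibre_on (r - 1) {(\<mu>, z). \<mu> \<in> I \<and> z \<in> \<eta> ` (U0 \<inter> V)}
          (\<lambda>\<mu> z. \<psi> \<mu> (inv_into V \<eta> z)) \<and>
        Ck_fibre_on (r - 1) {(\<mu>, z). \<mu> \<in> I \<and> z \<in> \<psi> \<mu> ` (U0 \<inter> V)}
          (\<lambda>\<mu> z. \<eta> (inv_into U0 (\<psi> \<mu>) z))"
    using coordinates unfolding local_coordinates_def by (elim conjE)
  from bspec[OF this assms]
  show "Ck_fibre_on (r - 1) {(\<mu>, z). \<mu> \<in> I \<and> z \<in> \<eta> ` (U0 \<inter> V)} (\<lambda>\<mu> z. \<psi> \<mu> (inv_into V \<eta> z))"
    "Ck_fibre_on (r - 1) {(\<mu>, z). \<mu> \<in> I \<and> z \<in> \<psi> \<mu> ` (U0 \<inter> V)} (\<lambda>\<mu> z. \<eta> (pt \<mu> z))"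
    unfolding pt_def by simp_all
qed

lemma pt_psi [simp]: "\<mu> \<in> I \<Longrightarrow> p \<in> U0 \<Longrightarrow> pt \<mu> (\<psi> \<mu> p) = p"
  unfolding pt_def by (rule is_chartD(6)[OF psi_chart])

lemma psi_pt [simp]: "z \<in> \<psi> \<mu> ` U0 \<Longrightarrow> \<psi> \<mu> (pt \<mu> z) = z"
  unfolding pt_def by (rule f_inv_into_f)

lemma pt_U0: "z \<in> \<psi> \<mu> ` U0 \<Longrightarrow> pt \<mu> z \<in> U0"
  unfolding pt_def by (rule inv_into_into)

lemma iterate_continuous: "continuous_on (I \<times> UNIV) (\<lambda>(\<mu>, p). (f \<mu> ^^ n) p)"
proof (induction n)
  case 0
  then show ?case by (simp add: case_prod_unfold continuous_on_snd)
next
  case (Suc n)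
  have c: "continuous_on (I \<times> UNIV) (\<lambda>(\<mu>, p). f \<mu> p)"
    using family unfolding Ck_diffeo_family_def by simp
  have "continuous_on (I \<times> UNIV) (\<lambda>x. (fst x, (f (fst x) ^^ n) (snd x)))"
    using Suc by (intro continuous_intros) (simp add: case_prod_unfold)
  then show ?case using continuous_on_compose2[OF c] by (fastforce simp: case_prod_unfold)
qed

lemma iterate_chart:
  assumes "(U, \<phi>) \<in> A" "open V"
  shows "open {(\<mu>, z). \<mu> \<in> I \<and> z \<in> \<phi> ` {p \<in> U. (f \<mu> ^^ n) p \<in> V}}"
proof -
  note ch = is_chartD[OF atlas_chart[OF assms(1)]]
  have "continuous_on (I \<times> \<phi> ` U) (\<lambda>x. (fst x, inv_into U \<phi> (snd x)))"
    by (intro continuous_intros continuous_on_compose2[OF ch(5)]) auto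
  then have "continuous_on (I \<times> \<phi> ` U) (\<lambda>x. (f (fst x) ^^ n) (inv_into U \<phi> (snd x)))"
    using continuous_on_compose2[OF iterate_continuous[of n]] by (fastforce simp: case_prod_unfold)
  from continuous_open_preimage[OF this open_Times[OF open_I ch(2)] assms(2)]
  show ?thesis unfolding mem_image_inv_into[OF ch(3)]
    by (rule back_subst[of "open"]) auto
qed

text \<open>The intermediate points may lie anywhere on the surface. Near a given orbit one chart
  around its \<open>n\<close>-th point serves for all neighbouring orbits and parameters, and
  \<open>Ck_fibre_on_local\<close> glues the results.\<close>

lemma iterate_smooth:
  assumes "(U, \<phi>) \<in> A" "(V, \<eta>) \<in> A"
  shows "Ck_fibre_on r {(\<mu>, z). \<mu> \<in> I \<and> z \<in> \<phi> ` {p \<in> U. (f \<mu> ^^ n) p \<in> V}}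
    (\<lambda>\<mu> z. \<eta> ((f \<mu> ^^ n) (inv_into U \<phi> z)))"
  using assms(2)
proof (induction n arbitrary: V \<eta>)
  case 0
  have "Ck_compatible r (U, \<phi>) (V, \<eta>)" using atlas assms 0 unfolding Ck_atlas_def by blast
  then have "Ck_on r (\<phi> ` (U \<inter> V)) (\<eta> \<circ> inv_into U \<phi>)" unfolding Ck_compatible_def by simp
  from Ck_on_imp_Ck_fibre_on_const[OF this, of I]
  have "Ck_fibre_on r (I \<times> \<phi> ` (U \<inter> V)) (\<lambda>\<mu> z. \<eta> ((f \<mu> ^^ 0) (inv_into U \<phi> z)))"
    by (simp add: comp_def)
  then show ?case by (rule Ck_fibre_on_subset) auto
next
  case (Suc n)
  let ?S = "{(\<mu>, z). \<mu> \<in> I \<and> z \<in> \<phi> ` {p \<in> U. (f \<mu> ^^ Suc n) p \<in> V}}"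
  note ch = is_chartD[OF atlas_chart[OF assms(1)]]
  have oS: "open ?S" by (rule iterate_chart[OF assms(1) is_chartD(1)[OF atlas_chart[OF Suc.prems]]])
  show ?case
  proof (rule Ck_fibre_on_local[OF oS])
    fix x assume x: "x \<in> ?S"
    obtain \<mu>0 z0 where x_eq: "x = (\<mu>0, z0)" by (cases x)
    obtain W \<omega> where W: "(W, \<omega>) \<in> A" "(f \<mu>0 ^^ n) (inv_into U \<phi> z0) \<in> W" by (rule atlas_cover)
    note cw = is_chartD[OF atlas_chart[OF W(1)]]
    let ?S1 = "{(\<mu>, z). \<mu> \<in> I \<and> z \<in> \<phi> ` {p \<in> U. (f \<mu> ^^ n) p \<in> W}}"
    let ?S2 = "{(\<mu>, z). \<mu> \<in> I \<and> z \<in> \<omega> ` {p \<in> W. f \<mu> p \<in> V}}"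
    have o1: "open ?S1" by (rule iterate_chart[OF assms(1) cw(1)])
    have s1: "Ck_fibre_on r ?S1 (\<lambda>\<mu> z. \<omega> ((f \<mu> ^^ n) (inv_into U \<phi> z)))" by (rule Suc.IH[OF W(1)])
    have "Ck_on r ?S2 (\<lambda>(\<mu>, z). \<eta> (f \<mu> (inv_into W \<omega> z)))"
      using family W(1) Suc.prems unfolding Ck_diffeo_family_def by fastforce
    then have s2: "Ck_fibre_on r ?S2 (\<lambda>\<mu> z. \<eta> (f \<mu> (inv_into W \<omega> z)))"
      by (rule Ck_on_imp_Ck_fibre_on)
    have "Ck_fibre_on r (?S \<inter> ?S1) (\<lambda>\<mu> z. \<eta> (f \<mu> (inv_into W \<omega> (\<omega> ((f \<mu> ^^ n) (inv_into U \<phi> z))))))"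
    proof (rule Ck_fibre_on_compose[OF _ s2])
      show "Ck_fibre_on r (?S \<inter> ?S1) (\<lambda>\<mu> z. \<omega> ((f \<mu> ^^ n) (inv_into U \<phi> z)))"
        by (rule Ck_fibre_on_subset[OF s1]) simp
      fix \<mu> z assume "(\<mu>, z) \<in> ?S \<inter> ?S1"
      then show "(\<mu>, \<omega> ((f \<mu> ^^ n) (inv_into U \<phi> z))) \<in> ?S2"
        unfolding Int_iff mem_Collect_eq prod.case mem_image_inv_into[OF ch(3)] by (auto simp: ch(6))
    qed
    then have "Ck_fibre_on r (?S \<inter> ?S1) (\<lambda>\<mu> z. \<eta> ((f \<mu> ^^ Suc n) (inv_into U \<phi> z)))"
    proof (rule Ck_fibre_on_cong[OF _ open_Int[OF oS o1]])
      fix \<mu> z assume "(\<mu>, z) \<in> ?S \<inter> ?S1"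
      then have "(f \<mu> ^^ n) (inv_into U \<phi> z) \<in> W"
        unfolding Int_iff mem_Collect_eq prod.case mem_image_inv_into[OF ch(3)] by simp
      then show "\<eta> (f \<mu> (inv_into W \<omega> (\<omega> ((f \<mu> ^^ n) (inv_into U \<phi> z))))) =
          \<eta> ((f \<mu> ^^ Suc n) (inv_into U \<phi> z))" by (simp add: cw(6))
    qed
    moreover have "x \<in> ?S1"
      using x W(2) unfolding x_eq mem_Collect_eq prod.case mem_image_inv_into[OF ch(3)] by simp
    ultimately show "\<exists>T. open T \<and> x \<in> T \<and>
        Ck_fibre_on r T (\<lambda>\<mu> z. \<eta> ((f \<mu> ^^ Suc n) (inv_into U \<phi> z)))"
      using x open_Int[OF oS o1] by (intro exI[of _ "?S \<inter> ?S1"] conjI) simp_all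
  qed
qed

text \<open>The ranges of \<open>\<psi> \<mu>\<close> vary with \<mu>, and their openness as a
  family in the variables \<open>(\<mu>, z)\<close> is not part of the definition of the
  coordinates. Chart by chart the map is jointly continuous and injective, so invariance of domain
  in these three real variables gives it. The openness of every \<open>E n\<close> and the joint
  continuity of \<open>pt\<close> rest on this.\<close>

lemma psi_image_open:
  assumes "open \<Omega>" "\<Omega> \<subseteq> I \<times> U0"
  shows "open ((\<lambda>(\<mu>, p). (\<mu>, \<psi> \<mu> p)) ` \<Omega>)"
proof -
  have "open ((\<lambda>(\<mu>, p). (\<mu>, \<psi> \<mu> p)) ` (\<Omega> \<inter> I \<times> V))" if V: "(V, \<eta>) \<in> A" for V \<eta>
  proof -
    note ch = is_chartD[OF atlas_chart[OF V]]
    let ?B = "{(\<mu>, z). \<mu> \<in> I \<and> z \<in> \<eta> ` V \<and> (\<mu>, inv_into V \<eta> z) \<in> \<Omega>}"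
    have "continuous_on (I \<times> \<eta> ` V) (\<lambda>x. (fst x, inv_into V \<eta> (snd x)))"
      by (intro continuous_intros continuous_on_compose2[OF ch(5)]) auto
    from continuous_open_preimage[OF this open_Times[OF open_I ch(2)] assms(1)]
    have oB: "open ?B" by (rule back_subst[of "open"]) auto
    have sub: "?B \<subseteq> {(\<mu>, z). \<mu> \<in> I \<and> z \<in> \<eta> ` (U0 \<inter> V)}"
      using assms(2) by (auto simp: ch(6))
    have "continuous_on ?B (\<lambda>(\<mu>, z). \<psi> \<mu> (inv_into V \<eta> z))"
      by (rule continuous_on_subset[OF Ck_fibre_on_continuous[OF psi_smooth(1)[OF V]] sub])
    then have c: "continuous_on ?B (\<lambda>x. (fst x, \<psi> (fst x) (inv_into V \<eta> (snd x))))"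
      by (intro continuous_intros) (simp add: case_prod_unfold)
    have "inj_on (\<lambda>x. (fst x, \<psi> (fst x) (inv_into V \<eta> (snd x)))) ?B"
    proof (rule inj_onI, clarsimp simp: ch(6))
      fix \<mu> p q assume "\<mu> \<in> I" "(\<mu>, p) \<in> \<Omega>" "(\<mu>, q) \<in> \<Omega>" "\<psi> \<mu> p = \<psi> \<mu> q"
      then have "p = q" using assms(2) inj_onD[OF is_chartD(3)[OF psi_chart[of \<mu>]]] by blast
      then show "\<eta> p = \<eta> q" by simp
    qed
    from invariance_of_domain[OF c oB this]
    have "open ((\<lambda>x. (fst x, \<psi> (fst x) (inv_into V \<eta> (snd x)))) ` ?B)" .
    moreover have "(\<lambda>(\<mu>, p). (\<mu>, \<psi> \<mu> p)) ` (\<Omega> \<inter> I \<times> V) =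
       (\<lambda>x. (fst x, \<psi> (fst x) (inv_into V \<eta> (snd x)))) ` ?B" (is "?L = ?M")
    proof
      show "?M \<subseteq> ?L" by (auto simp: ch(6))
      show "?L \<subseteq> ?M"
      proof clarify
        fix \<mu> p assume "(\<mu>, p) \<in> \<Omega>" "\<mu> \<in> I" "p \<in> V"
        then have "(\<mu>, \<eta> p) \<in> ?B" by (simp add: ch(6))
        from imageI[OF this, of "\<lambda>x. (fst x, \<psi> (fst x) (inv_into V \<eta> (snd x)))"]
        show "(\<mu>, \<psi> \<mu> p) \<in> ?M" using \<open>p \<in> V\<close> by (simp add: ch(6))
      qed
    qed
    ultimately show ?thesis by simp
  qed
  then have "open (\<Union>c\<in>A. (\<lambda>(\<mu>, p). (\<mu>, \<psi> \<mu> p)) ` (\<Omega> \<inter> I \<times> fst c))" by fastforce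
  moreover have "(\<Union>c\<in>A. (\<lambda>(\<mu>, p). (\<mu>, \<psi> \<mu> p)) ` (\<Omega> \<inter> I \<times> fst c)) = (\<lambda>(\<mu>, p). (\<mu>, \<psi> \<mu> p)) ` \<Omega>"
  proof -
    have "(\<Union>c\<in>A. fst c) = UNIV" using atlas unfolding Ck_atlas_def by simp
    moreover have "(\<Union>c\<in>A. \<Omega> \<inter> I \<times> fst c) = \<Omega> \<inter> I \<times> (\<Union>c\<in>A. fst c)" by blast
    moreover have "\<Omega> \<inter> I \<times> UNIV = \<Omega>" using assms(2) by auto
    ultimately show ?thesis by (simp only: image_UN[symmetric])
  qed
  ultimately show ?thesis by simp
qed

lemma E0: "E 0 = {(\<mu>, z). \<mu> \<in> I \<and> z \<in> \<psi> \<mu> ` U0}"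
  unfolding E_def by (auto simp: pt_U0)

lemma E_subset: "E n \<subseteq> E 0" unfolding E0 E_def by auto

lemma pt_preimage_open:
  assumes "open W"
  shows "open {(\<mu>, z). (\<mu>, z) \<in> E 0 \<and> pt \<mu> z \<in> W}"
proof -
  have "{(\<mu>, z). (\<mu>, z) \<in> E 0 \<and> pt \<mu> z \<in> W} = (\<lambda>(\<mu>, p). (\<mu>, \<psi> \<mu> p)) ` (I \<times> (U0 \<inter> W))"
    (is "?L = ?M")
  proof
    show "?M \<subseteq> ?L" unfolding E0 by auto
    show "?L \<subseteq> ?M"
    proof clarify
      fix \<mu> z assume z: "(\<mu>, z) \<in> E 0" "pt \<mu> z \<in> W"
      then have "(\<mu>, pt \<mu> z) \<in> I \<times> (U0 \<inter> W)" by (auto simp: E0 pt_U0)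
      from imageI[OF this, of "\<lambda>(\<mu>, p). (\<mu>, \<psi> \<mu> p)"] show "(\<mu>, z) \<in> ?M" using z by (simp add: E0)
    qed
  qed
  then show ?thesis using psi_image_open[of "I \<times> (U0 \<inter> W)"] assms open_I open_U0
    by (auto simp: open_Times open_Int)
qed

lemma E0_open: "open (E 0)"
  using pt_preimage_open[of UNIV] by simp

lemma pt_continuous: "continuous_on (E 0) (\<lambda>(\<mu>, z). pt \<mu> z)"
  unfolding continuous_on_open_vimage[OF E0_open]
proof clarify
  fix B :: "'m set" assume "open B"
  from pt_preimage_open[OF this]
  show "open ((\<lambda>(\<mu>, z). pt \<mu> z) -` B \<inter> E 0)" by (rule back_subst[of "open"]) auto
qed

lemma iterate_pt_continuous: "continuous_on (E 0) (\<lambda>(\<mu>, z). (f \<mu> ^^ n) (pt \<mu> z))"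
proof -
  have "continuous_on (E 0) (\<lambda>x. (fst x, pt (fst x) (snd x)))"
    using pt_continuous by (intro continuous_intros) (simp add: case_prod_unfold)
  moreover have "(\<lambda>x. (fst x, pt (fst x) (snd x))) ` E 0 \<subseteq> I \<times> UNIV" unfolding E0 by auto
  ultimately show ?thesis
    using continuous_on_compose2[OF iterate_continuous[of n]] by (fastforce simp: case_prod_unfold)
qed

lemma iterate_preimage_open:
  assumes "open W"
  shows "open {(\<mu>, z). (\<mu>, z) \<in> E 0 \<and> (f \<mu> ^^ n) (pt \<mu> z) \<in> W}"
  using continuous_open_preimage[OF iterate_pt_continuous E0_open assms, of n]
  by (rule back_subst[of "open"]) auto

lemma E_open: "open (E n)"
  using iterate_preimage_open[OF open_U0, of n] unfolding E0
  by (rule back_subst[of "open"]) (auto simp: E_def)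

text \<open>The bound \<open>r - 1 \<ge> 3\<close> provides three derivatives, and three are used:
  to show that \<open>pd dy (Tx 1)\<close> is of order \<open>x\<^sup>2\<close>, a third derivative
  is integrated twice from the axis \<open>x = 0\<close>.\<close>

lemma T_smooth: "Ck_fibre_on 3 (E n) (T n)"
proof (rule Ck_fibre_on_local[OF E_open])
  fix x assume x: "x \<in> E n"
  obtain \<mu>0 z0 where x_eq: "x = (\<mu>0, z0)" by (cases x)
  obtain U \<phi> where U: "(U, \<phi>) \<in> A" "pt \<mu>0 z0 \<in> U" by (rule atlas_cover)
  obtain V \<eta> where V: "(V, \<eta>) \<in> A" "(f \<mu>0 ^^ n) (pt \<mu>0 z0) \<in> V" by (rule atlas_cover)
  note cu = is_chartD[OF atlas_chart[OF U(1)]] and cv = is_chartD[OF atlas_chart[OF V(1)]]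
  \<comment> \<open>On this neighbourhood both ends of the orbit stay in fixed charts of the atlas,
    so that \<open>T n\<close> is a composition of three maps of known smoothness: into the atlas,
    the iterate between two charts, and back to the local coordinates.\<close>
  define B where "B = E n \<inter> {(\<mu>, z). (\<mu>, z) \<in> E 0 \<and> pt \<mu> z \<in> U} \<inter>
      {(\<mu>, z). (\<mu>, z) \<in> E 0 \<and> (f \<mu> ^^ n) (pt \<mu> z) \<in> V}"
  have oB: "open B" unfolding B_def
    by (intro open_Int E_open pt_preimage_open iterate_preimage_open cu cv)
  have B: "\<mu> \<in> I \<and> z \<in> \<psi> \<mu> ` U0 \<and> pt \<mu> z \<in> U0 \<and> pt \<mu> z \<in> U \<and> (f \<mu> ^^ n) (pt \<mu> z) \<in> V \<and>
      (f \<mu> ^^ n) (pt \<mu> z) \<in> U0" if "(\<mu>, z) \<in> B" for \<mu> z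
    using that pt_U0 unfolding B_def E_def by auto
  have r3: "3 \<le> r - 1" "3 \<le> r" using r by auto
  have s1: "Ck_fibre_on 3 B (\<lambda>\<mu> z. \<phi> (pt \<mu> z))"
    by (rule Ck_fibre_on_subset[OF Ck_fibre_on_le[OF psi_smooth(2)[OF U(1)] r3(1)]])
      (use B psi_pt in \<open>force\<close>)
  have s2: "Ck_fibre_on 3 B (\<lambda>\<mu> z. \<eta> ((f \<mu> ^^ n) (inv_into U \<phi> (\<phi> (pt \<mu> z)))))"
    by (rule Ck_fibre_on_compose[OF s1 Ck_fibre_on_le[OF iterate_smooth[OF U(1) V(1)] r3(2)]])
      (use B in auto)
  have s3: "Ck_fibre_on 3 B (\<lambda>\<mu> z. \<psi> \<mu> (inv_into V \<eta> (\<eta> ((f \<mu> ^^ n) (inv_into U \<phi> (\<phi> (pt \<mu> z)))))))"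
    by (rule Ck_fibre_on_compose[OF s2 Ck_fibre_on_le[OF psi_smooth(1)[OF V(1)] r3(1)]])
      (use B cu in auto)
  have "Ck_fibre_on 3 B (T n)"
    by (rule Ck_fibre_on_cong[OF s3 oB]) (use B cu cv in \<open>auto simp: T_def\<close>)
  moreover have "x \<in> B" using x U V E_subset unfolding B_def x_eq by auto
  ultimately show "\<exists>B. open B \<and> x \<in> B \<and> Ck_fibre_on 3 B (T n)" using oB by blast
qed

end

section \<open>The reflection of the plane and partial derivatives along the fibre\<close>

definition swap :: "real^2 \<Rightarrow> real^2" where
  "swap z = vector [z $ 2, z $ 1]"

lemma vec2_eq_iff: "z = w \<longleftrightarrow> z $ 1 = w $ 1 \<and> z $ 2 = w $ 2" for z w :: "'a^2"
  by (simp add: vec_eq_iff forall_2)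

lemma swap_nth [simp]: "swap z $ 1 = z $ 2" "swap z $ 2 = z $ 1"
  by (simp_all add: swap_def)

lemma swap_swap [simp]: "swap (swap z) = z"
  by (simp add: vec2_eq_iff)

lemma bounded_linear_swap: "bounded_linear swap"
  by (rule linear_conv_bounded_linear[THEN iffD1]) (auto intro!: linearI simp: vec2_eq_iff)

lemma vector2_decomp: "vector [x, y] = x *\<^sub>R axis 1 1 + y *\<^sub>R (axis 2 1 :: real^2)"
  by (simp add: vec2_eq_iff axis_def)

lemma vector2_nth [simp]: "vector [z $ 1, z $ 2] = z" for z :: "real^2"
  by (simp add: vec2_eq_iff)

lemma continuous_on_vector2 [continuous_intros]:
  assumes "continuous_on S g" "continuous_on S k"
  shows "continuous_on S (\<lambda>x. vector [g x, k x] :: real^2)"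
  unfolding vector2_decomp by (intro continuous_intros assms)

text \<open>A family of the same type as \<open>F\<close>, so that it can be iterated to mixed and
  higher derivatives.\<close>

definition pd :: "'a::euclidean_space \<Rightarrow> (real \<Rightarrow> 'a \<Rightarrow> 'b::euclidean_space) \<Rightarrow> real \<Rightarrow> 'a \<Rightarrow> 'b" where
  "pd v F \<mu> z = frechet_derivative (F \<mu>) (at z) v"

lemma pd_smooth:
  assumes "Ck_fibre_on (Suc k) S F" "open S"
  shows "Ck_fibre_on k S (pd v F)"
  using assms(1) unfolding Ck_fibre_on_Suc_iff[OF assms(2)] pd_def by blast

lemma Ck_fibre_on_has_derivative:
  assumes "Ck_fibre_on (Suc k) S F" "(\<mu>, z) \<in> S"
  shows "(F \<mu> has_derivative (\<lambda>v. pd v F \<mu> z)) (at z)"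
proof -
  have "F \<mu> differentiable (at z)" using assms by (auto simp: differentiable_def)
  then show ?thesis unfolding pd_def frechet_derivative_works by (simp add: eta_contract_eq)
qed

lemma pd_DERIV:
  fixes F :: "real \<Rightarrow> real^2 \<Rightarrow> real"
  assumes "Ck_fibre_on (Suc k) S F" "(\<mu>, vector [x, y]) \<in> S"
  shows "DERIV (\<lambda>x. F \<mu> (vector [x, y])) x :> pd (axis 1 1) F \<mu> (vector [x, y])"
    "DERIV (\<lambda>y. F \<mu> (vector [x, y])) y :> pd (axis 2 1) F \<mu> (vector [x, y])"
proof -
  note d = Ck_fibre_on_has_derivative[OF assms]
  have l: "linear (\<lambda>v. pd v F \<mu> (vector [x, y]))" using has_derivative_linear[OF d] .
  have "((\<lambda>x. vector [x, y] :: real^2) has_derivative (\<lambda>t. t *\<^sub>R axis 1 1)) (at x)"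
    unfolding vector2_decomp by (auto intro!: derivative_eq_intros)
  from has_derivative_compose[OF this d]
  show "DERIV (\<lambda>x. F \<mu> (vector [x, y])) x :> pd (axis 1 1) F \<mu> (vector [x, y])"
    by (simp add: linear_scale[OF l] has_field_derivative_def mult.commute[of _ "pd _ _ _ _"])
  have "((\<lambda>y. vector [x, y] :: real^2) has_derivative (\<lambda>t. t *\<^sub>R axis 2 1)) (at y)"
    unfolding vector2_decomp by (auto intro!: derivative_eq_intros)
  from has_derivative_compose[OF this d]
  show "DERIV (\<lambda>y. F \<mu> (vector [x, y])) y :> pd (axis 2 1) F \<mu> (vector [x, y])"
    by (simp add: linear_scale[OF l] has_field_derivative_def mult.commute[of _ "pd _ _ _ _"])
qed

lemma MVT_bound_zero:
  fixes \<phi> :: "real \<Rightarrow> real"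
  assumes "\<And>t. \<bar>t\<bar> \<le> \<bar>x\<bar> \<Longrightarrow> DERIV \<phi> t :> \<phi>' t" "\<And>t. \<bar>t\<bar> \<le> \<bar>x\<bar> \<Longrightarrow> \<bar>\<phi>' t\<bar> \<le> B"
  shows "\<bar>\<phi> x - \<phi> 0\<bar> \<le> B * \<bar>x\<bar>"
proof -
  have "norm (\<phi> x - \<phi> 0) \<le> B * norm (x - 0)"
    by (rule field_differentiable_bound[of "{- \<bar>x\<bar>..\<bar>x\<bar>}" \<phi> \<phi>'])
      (use assms in \<open>auto intro: has_field_derivative_at_within\<close>)
  then show ?thesis by simp
qed

section \<open>Iterates, time reversal and the two axes in local coordinates\<close>

context reversible_family
begin

lemma R_involutive [simp]: "R (R p) = p"
  using R_R by (metis comp_apply id_apply)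

lemma R_mem [simp]: "R p \<in> U0 \<longleftrightarrow> p \<in> U0"
  using R_U0 by (metis R_involutive imageI)

lemma f_bij: "\<mu> \<in> I \<Longrightarrow> bij (f \<mu>)"
  using family unfolding Ck_diffeo_family_def Ck_diffeo_def by blast

text \<open>This is reversibility without inverses. The innermost pair cancels first, by
  \<open>f \<mu> (R (f \<mu> q)) = R q\<close>, and leaves the same expression with one iterate less
  on either side.\<close>

lemma iterate_reverse:
  assumes "\<mu> \<in> I"
  shows "(f \<mu> ^^ n) (R ((f \<mu> ^^ n) p)) = R p"
proof (induction n arbitrary: p)
  case (Suc n)
  have "f \<mu> (R (f \<mu> q)) = R q" for q
  proof -
    have "R (f \<mu> q) = inv (f \<mu>) (R q)"
      using reversible[OF assms] unfolding Defs.reversible_def by (metis comp_apply)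
    then show ?thesis using f_bij[OF assms] by (simp add: bij_is_surj surj_f_inv_f)
  qed
  moreover have "(f \<mu> ^^ Suc n) (R ((f \<mu> ^^ Suc n) p)) = (f \<mu> ^^ n) (f \<mu> (R (f \<mu> ((f \<mu> ^^ n) p))))"
    by (subst funpow_Suc_right) simp
  ultimately show ?case using Suc by simp
qed simp

lemma coords:
  assumes "\<mu> \<in> I"
  shows l_bounds: "0 < l \<mu>" "l \<mu> < 1"
    and P_mem: "P \<mu> \<in> U0" "\<psi> \<mu> (P \<mu>) = 0"
    and psi_R: "p \<in> U0 \<Longrightarrow> \<psi> \<mu> (R p) = swap (\<psi> \<mu> p)"
    and stable: "local_stable U0 (f \<mu>) (P \<mu>) = {p \<in> U0. \<psi> \<mu> p $ 2 = 0}"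
    and unstable: "local_unstable U0 (f \<mu>) (P \<mu>) = {p \<in> U0. \<psi> \<mu> p $ 1 = 0}"
    and cross_form: "p \<in> U0 \<Longrightarrow> f \<mu> p \<in> U0 \<Longrightarrow>
      \<psi> \<mu> (f \<mu> p) $ 1 = l \<mu> * \<psi> \<mu> p $ 1 +
        h \<mu> (\<psi> \<mu> p $ 1) (\<psi> \<mu> (f \<mu> p) $ 2) * (\<psi> \<mu> p $ 1)\<^sup>2 * \<psi> \<mu> (f \<mu> p) $ 2 \<and>
      \<psi> \<mu> p $ 2 = l \<mu> * \<psi> \<mu> (f \<mu> p) $ 2 +
        h \<mu> (\<psi> \<mu> (f \<mu> p) $ 2) (\<psi> \<mu> p $ 1) * \<psi> \<mu> p $ 1 * (\<psi> \<mu> (f \<mu> p) $ 2)\<^sup>2"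
  using coordinates assms unfolding local_coordinates_def symmetric_saddle_def Let_def swap_def
  by (blast, blast, blast, blast, blast, blast, blast, blast)

lemma h_continuous:
  "continuous_on {(\<mu>, \<psi> \<mu> p $ 1, \<psi> \<mu> (f \<mu> p) $ 2) | \<mu> p. \<mu> \<in> I \<and> p \<in> U0 \<and> f \<mu> p \<in> U0}
    (\<lambda>(\<mu>, x, y'). h \<mu> x y')"
  using coordinates unfolding local_coordinates_def by (elim conjE)

lemma E_I: "(\<mu>, z) \<in> E n \<Longrightarrow> \<mu> \<in> I" unfolding E_def by simp

lemma E_psi: "(\<mu>, z) \<in> E n \<Longrightarrow> \<psi> \<mu> (pt \<mu> z) = z" "(\<mu>, z) \<in> E n \<Longrightarrow> pt \<mu> z \<in> U0"
  unfolding E_def by (auto simp: pt_U0)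

lemma pt_T: "(\<mu>, z) \<in> E n \<Longrightarrow> pt \<mu> (T n \<mu> z) = (f \<mu> ^^ n) (pt \<mu> z)"
  unfolding E_def T_def by simp

lemma T_E0: "(\<mu>, z) \<in> E n \<Longrightarrow> (\<mu>, T n \<mu> z) \<in> E 0"
  unfolding E0 by (auto simp: E_def T_def)

lemma E_add: "(\<mu>, z) \<in> E m \<Longrightarrow> (\<mu>, T m \<mu> z) \<in> E n \<longleftrightarrow> (\<mu>, z) \<in> E (n + m)"
  using T_E0[of \<mu> z m] unfolding E0 by (auto simp: E_def funpow_add pt_T T_def)

lemma T_add: "(\<mu>, z) \<in> E m \<Longrightarrow> T (n + m) \<mu> z = T n \<mu> (T m \<mu> z)"
  using pt_T[of \<mu> z m] unfolding T_def by (simp add: funpow_add)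

lemma T_zero: "(\<mu>, z) \<in> E 0 \<Longrightarrow> T 0 \<mu> z = z"
  by (simp add: T_def E_psi)

lemma swap_E0: "(\<mu>, z) \<in> E 0 \<Longrightarrow> (\<mu>, swap z) \<in> E 0 \<and> pt \<mu> (swap z) = R (pt \<mu> z)"
proof -
  assume z: "(\<mu>, z) \<in> E 0"
  have "\<psi> \<mu> (R (pt \<mu> z)) = swap z" using psi_R[OF E_I[OF z] E_psi(2)[OF z]] E_psi(1)[OF z] by simp
  then show ?thesis using E_psi(2)[OF z] E_I[OF z] unfolding E0
    by (metis (mono_tags, lifting) R_mem case_prodI imageI mem_Collect_eq pt_psi)
qed

lemma T_reverse:
  assumes "(\<mu>, z) \<in> E n"
  shows "(\<mu>, swap (T n \<mu> z)) \<in> E n" "T n \<mu> (swap (T n \<mu> z)) = swap z"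
proof -
  have z: "(\<mu>, z) \<in> E 0" using E_subset assms by blast
  note s = swap_E0[OF T_E0[OF assms]]
  have *: "(f \<mu> ^^ n) (pt \<mu> (swap (T n \<mu> z))) = R (pt \<mu> z)"
    using s pt_T[OF assms] iterate_reverse[OF E_I[OF z]] by simp
  show "(\<mu>, swap (T n \<mu> z)) \<in> E n"
    using s * E_psi(2)[OF z] unfolding E0 by (auto simp: E_def)
  show "T n \<mu> (swap (T n \<mu> z)) = swap z"
    using * psi_R[OF E_I[OF z] E_psi(2)[OF z]] E_psi(1)[OF z] unfolding T_def by simp
qed

lemma E1_iff: "(\<mu>, z) \<in> E 1 \<longleftrightarrow> (\<mu>, z) \<in> E 0 \<and> f \<mu> (pt \<mu> z) \<in> U0"
  using E0 unfolding E_def by auto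

lemma T1_cross:
  assumes "(\<mu>, z) \<in> E 1"
  shows "T 1 \<mu> z $ 1 = l \<mu> * z $ 1 + h \<mu> (z $ 1) (T 1 \<mu> z $ 2) * (z $ 1)\<^sup>2 * T 1 \<mu> z $ 2"
    "z $ 2 = l \<mu> * T 1 \<mu> z $ 2 + h \<mu> (T 1 \<mu> z $ 2) (z $ 1) * z $ 1 * (T 1 \<mu> z $ 2)\<^sup>2"
  using cross_form[OF E_I[OF assms] E_psi(2)[OF assms]] assms E_psi(1)[OF assms]
  unfolding T_def E1_iff by auto

text \<open>The local stable set is forward invariant by its definition, and it is the axis.\<close>

lemma stable_E1:
  assumes "(\<mu>, z) \<in> E 0" "z $ 2 = 0"
  shows "(\<mu>, z) \<in> E 1" "T 1 \<mu> z $ 2 = 0"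
proof -
  have "pt \<mu> z \<in> local_stable U0 (f \<mu>) (P \<mu>)"
    using stable[OF E_I[OF assms(1)]] E_psi[OF assms(1)] assms(2) by simp
  then have c: "(\<lambda>n. (f \<mu> ^^ n) (pt \<mu> z)) \<longlonglongrightarrow> P \<mu>" and u: "\<forall>n. (f \<mu> ^^ n) (pt \<mu> z) \<in> U0"
    unfolding local_stable_def stable_set_def by auto
  have "(\<lambda>n. (f \<mu> ^^ n) (f \<mu> (pt \<mu> z))) \<longlonglongrightarrow> P \<mu>"
    using LIMSEQ_Suc[OF c] by (simp add: funpow_swap1)
  moreover have "\<forall>n. (f \<mu> ^^ n) (f \<mu> (pt \<mu> z)) \<in> U0"
    using u by (metis funpow.simps(2) comp_apply funpow_swap1)
  ultimately have "f \<mu> (pt \<mu> z) \<in> local_stable U0 (f \<mu>) (P \<mu>)"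
    unfolding local_stable_def stable_set_def by simp
  then have "f \<mu> (pt \<mu> z) \<in> U0" "\<psi> \<mu> (f \<mu> (pt \<mu> z)) $ 2 = 0"
    using stable[OF E_I[OF assms(1)]] by auto
  then show "(\<mu>, z) \<in> E 1" "T 1 \<mu> z $ 2 = 0" using assms(1) by (simp only: E1_iff, simp add: T_def)
qed

text \<open>The backward orbit stays on the axis, and for \<open>x = 0\<close> the second equation
  of the cross form is exactly linear. This is how the ordinate \<open>l \<mu> * y\<close> of the
  preimage is found.\<close>

lemma unstable_E1:
  assumes "(\<mu>, vector [0, y]) \<in> E 0"
  shows "(\<mu>, vector [0, l \<mu> * y]) \<in> E 1"
proof -
  let ?z = "vector [0, y] :: real^2"
  have I: "\<mu> \<in> I" by (rule E_I[OF assms])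
  let ?p = "pt \<mu> ?z" and ?g = "inv (f \<mu>)"
  have "?p \<in> local_unstable U0 (f \<mu>) (P \<mu>)" using unstable[OF I] E_psi[OF assms] by simp
  then have c: "(\<lambda>n. (?g ^^ n) ?p) \<longlonglongrightarrow> P \<mu>" and u: "\<forall>n. (?g ^^ n) ?p \<in> U0"
    unfolding local_unstable_def local_stable_def stable_set_def by auto
  have "(\<lambda>n. (?g ^^ n) (?g ?p)) \<longlonglongrightarrow> P \<mu>"
    using LIMSEQ_Suc[OF c] by (simp add: funpow_swap1)
  moreover have "\<forall>n. (?g ^^ n) (?g ?p) \<in> U0"
    using u by (metis funpow.simps(2) comp_apply funpow_swap1)
  ultimately have "?g ?p \<in> local_unstable U0 (f \<mu>) (P \<mu>)"
    unfolding local_unstable_def local_stable_def stable_set_def by simp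
  then have g: "?g ?p \<in> U0" "\<psi> \<mu> (?g ?p) $ 1 = 0" using unstable[OF I] by auto
  have fg: "f \<mu> (?g ?p) = ?p" using f_bij[OF I] by (simp add: bij_is_surj surj_f_inv_f)
  have p: "?p \<in> U0" "\<psi> \<mu> ?p = ?z" using E_psi[OF assms] by auto
  have "\<psi> \<mu> (?g ?p) $ 2 = l \<mu> * y"
    using cross_form[OF I g(1)] fg p g by simp
  then have z: "\<psi> \<mu> (?g ?p) = vector [0, l \<mu> * y]" using g by (simp add: vec2_eq_iff)
  then have "pt \<mu> (vector [0, l \<mu> * y]) = ?g ?p" using pt_psi[OF I g(1)] by simp
  moreover have "(\<mu>, vector [0, l \<mu> * y]) \<in> E 0" unfolding E0 using z g(1) I
    by (auto intro!: image_eqI[where x = "?g ?p"])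
  ultimately show ?thesis unfolding E1_iff using fg p by simp
qed

lemma unstable_power_E1:
  assumes "(\<mu>, vector [0, y]) \<in> E 0"
  shows "(\<mu>, vector [0, l \<mu> ^ Suc i * y]) \<in> E 1"
proof (induction i)
  case 0
  then show ?case using unstable_E1[OF assms] by simp
next
  case (Suc i)
  from unstable_E1[OF subsetD[OF E_subset Suc]] show ?case by (simp add: mult.assoc)
qed

lemma origin_E: "\<mu> \<in> I \<Longrightarrow> (\<mu>, 0) \<in> E 1"
proof (rule stable_E1)
  assume "\<mu> \<in> I"
  then show "(\<mu>, 0) \<in> E 0" unfolding E0 using P_mem[of \<mu>] by (auto intro!: image_eqI[of _ _ "P \<mu>"])
qed simp

definition DT :: "nat \<Rightarrow> real \<Rightarrow> real^2 \<Rightarrow> real^2 \<Rightarrow> real^2" where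
  "DT n \<mu> z v = pd v (T n) \<mu> z"

lemma T_has_derivative: "(\<mu>, z) \<in> E n \<Longrightarrow> (T n \<mu> has_derivative DT n \<mu> z) (at z)"
  using Ck_fibre_on_has_derivative[of 2 "E n" "T n"] T_smooth[of n]
  unfolding DT_def[abs_def] by (simp add: numeral_3_eq_3 numeral_2_eq_2)

lemma DT_linear: "(\<mu>, z) \<in> E n \<Longrightarrow> linear (DT n \<mu> z)"
  by (rule has_derivative_linear[OF T_has_derivative])

lemma open_E_slice: "open {z. (\<mu>, z) \<in> E n}"
  by (rule open_slice[OF E_open])

lemma DT_add:
  assumes "(\<mu>, z) \<in> E m" "(\<mu>, T m \<mu> z) \<in> E n"
  shows "DT (n + m) \<mu> z v = DT n \<mu> (T m \<mu> z) (DT m \<mu> z v)"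
proof -
  have mn: "(\<mu>, z) \<in> E (n + m)" using assms E_add by blast
  have "((\<lambda>z. T n \<mu> (T m \<mu> z)) has_derivative (\<lambda>v. DT n \<mu> (T m \<mu> z) (DT m \<mu> z v))) (at z)"
    by (rule has_derivative_compose[OF T_has_derivative[OF assms(1)] T_has_derivative[OF assms(2)]])
  then have "(T (n + m) \<mu> has_derivative (\<lambda>v. DT n \<mu> (T m \<mu> z) (DT m \<mu> z v))) (at z)"
    by (rule has_derivative_transform_within_open[OF _ open_E_slice[of \<mu> m]])
      (use assms in \<open>auto simp: T_add\<close>)
  from has_derivative_unique[OF this T_has_derivative[OF mn]] show ?thesis by metis
qed

lemma DT_zero:
  assumes "(\<mu>, z) \<in> E 0"
  shows "DT 0 \<mu> z v = v"
proof -
  have "(T 0 \<mu> has_derivative (\<lambda>v. v)) (at z)"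
    by (rule has_derivative_transform_within_open[OF has_derivative_ident open_E_slice[of \<mu> 0]])
      (use assms in \<open>auto simp: T_zero\<close>)
  from has_derivative_unique[OF this T_has_derivative[OF assms]] show ?thesis by metis
qed

text \<open>The derivative of \<open>T_reverse\<close>. It presents the inverse of the derivative of
  an iterate as the derivative of the same iterate at the reflected point, so invertibility needs no
  separate argument.\<close>

lemma DT_reverse:
  assumes "(\<mu>, z) \<in> E n"
  shows "DT n \<mu> (swap (T n \<mu> z)) (swap (DT n \<mu> z v)) = swap v"
proof -
  have "((\<lambda>z. swap (T n \<mu> z)) has_derivative (\<lambda>v. swap (DT n \<mu> z v))) (at z)"
    by (rule bounded_linear.has_derivative[OF bounded_linear_swap T_has_derivative[OF assms]])
  from has_derivative_compose[OF this T_has_derivative[OF T_reverse(1)[OF assms]]]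
  have "((\<lambda>z. T n \<mu> (swap (T n \<mu> z))) has_derivative
      (\<lambda>v. DT n \<mu> (swap (T n \<mu> z)) (swap (DT n \<mu> z v)))) (at z)" .
  then have "(swap has_derivative (\<lambda>v. DT n \<mu> (swap (T n \<mu> z)) (swap (DT n \<mu> z v)))) (at z)"
    by (rule has_derivative_transform_within_open[OF _ open_E_slice[of \<mu> n]])
      (use assms in \<open>auto simp: T_reverse\<close>)
  from has_derivative_unique[OF this bounded_linear_imp_has_derivative[OF bounded_linear_swap]]
  show ?thesis by metis
qed

end

subsection \<open>Bounds near the invariant manifolds of the saddle\<close>

lemma open_box3:
  fixes S :: "(real \<times> real \<times> real) set"
  assumes "open S" "(a, b, c) \<in> S"
  shows "\<exists>e>0. \<forall>x y z. \<bar>x - a\<bar> \<le> e \<longrightarrow> \<bar>y - b\<bar> \<le> e \<longrightarrow> \<bar>z - c\<bar> \<le> e \<longrightarrow> (x, y, z) \<in> S"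
proof -
  obtain U V where U: "open U" "open V" "(a, (b, c)) \<in> U \<times> V" "U \<times> V \<subseteq> S"
    by (rule open_prod_elim[OF assms])
  have abc: "a \<in> U" "(b, c) \<in> V" using U(3) by auto
  obtain V1 V2 where V: "open V1" "open V2" "(b, c) \<in> V1 \<times> V2" "V1 \<times> V2 \<subseteq> V"
    by (rule open_prod_elim[OF U(2) abc(2)])
  have bc: "b \<in> V1" "c \<in> V2" using V(3) by auto
  obtain e1 where e1: "e1 > 0" "cball a e1 \<subseteq> U"
    using open_contains_cball_eq[OF U(1)] abc(1) by auto
  obtain e2 where e2: "e2 > 0" "cball b e2 \<subseteq> V1"
    using open_contains_cball_eq[OF V(1)] bc(1) by auto
  obtain e3 where e3: "e3 > 0" "cball c e3 \<subseteq> V2"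
    using open_contains_cball_eq[OF V(2)] bc(2) by auto
  show ?thesis
  proof (intro exI[of _ "min e1 (min e2 e3)"] conjI allI impI)
    fix x y z assume "\<bar>x - a\<bar> \<le> min e1 (min e2 e3)" "\<bar>y - b\<bar> \<le> min e1 (min e2 e3)"
      "\<bar>z - c\<bar> \<le> min e1 (min e2 e3)"
    then have "x \<in> cball a e1" "y \<in> cball b e2" "z \<in> cball c e3"
      by (auto simp: dist_real_def abs_minus_commute)
    then have "x \<in> U" "(y, z) \<in> V1 \<times> V2" using e1(2) e2(2) e3(2) by auto
    then show "(x, y, z) \<in> S" using U(4) V(4) by blast
  qed (use e1 e2 e3 in auto)
qed

lemma compact_bounded_real:
  fixes g :: "'a::topological_space \<Rightarrow> real"
  assumes "compact K" "continuous_on K g"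
  shows "\<exists>C\<ge>0. \<forall>x\<in>K. \<bar>g x\<bar> \<le> C"
proof -
  have "bounded (g ` K)" by (intro compact_imp_bounded compact_continuous_image assms)
  then obtain C where C: "\<forall>x\<in>K. \<bar>g x\<bar> \<le> C" unfolding bounded_iff by auto
  then show ?thesis by (intro exI[of _ "max C 0"]) fastforce
qed

context reversible_family
begin

abbreviation "dx \<equiv> axis 1 1 :: real^2"
abbreviation "dy \<equiv> axis 2 1 :: real^2"

definition Tx :: "nat \<Rightarrow> real \<Rightarrow> real^2 \<Rightarrow> real" where "Tx n \<mu> z = T n \<mu> z $ 1"
definition Ty :: "nat \<Rightarrow> real \<Rightarrow> real^2 \<Rightarrow> real" where "Ty n \<mu> z = T n \<mu> z $ 2"

lemma T_component_smooth: "Ck_fibre_on 3 (E n) (Tx n)" "Ck_fibre_on 3 (E n) (Ty n)"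
  unfolding Tx_def[abs_def] Ty_def[abs_def]
  by (rule Ck_fibre_on_linear[OF bounded_linear_vec_nth T_smooth])+

lemma T_component_Suc: "Ck_fibre_on (Suc 2) (E n) (Tx n)" "Ck_fibre_on (Suc 2) (E n) (Ty n)"
  using T_component_smooth[of n] by (simp_all add: numeral_3_eq_3 numeral_2_eq_2)

lemma pd_component_Suc:
  "Ck_fibre_on (Suc 1) (E n) (pd v (Tx n))" "Ck_fibre_on (Suc 1) (E n) (pd v (Ty n))"
  using pd_smooth[OF T_component_Suc(1)[of n] E_open, where v = v] pd_smooth[OF T_component_Suc(2)[of n] E_open, where v = v]
  by (simp_all add: numeral_2_eq_2)

lemma pd2_component_Suc:
  "Ck_fibre_on (Suc 0) (E n) (pd w (pd v (Tx n)))" "Ck_fibre_on (Suc 0) (E n) (pd w (pd v (Ty n)))"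
  using pd_smooth[OF pd_component_Suc(1)[of n v] E_open, where v = w] pd_smooth[OF pd_component_Suc(2)[of n v] E_open, where v = w]
  by simp_all

lemma pd3_component:
  "Ck_fibre_on 0 (E n) (pd u (pd w (pd v (Tx n))))" "Ck_fibre_on 0 (E n) (pd u (pd w (pd v (Ty n))))"
  using pd_smooth[OF pd2_component_Suc(1)[of n w v] E_open, where v = u] pd_smooth[OF pd2_component_Suc(2)[of n w v] E_open, where v = u]
  by simp_all

lemma DT_components:
  assumes "(\<mu>, z) \<in> E n"
  shows "DT n \<mu> z v = vector [pd dx (Tx n) \<mu> z * v $ 1 + pd dy (Tx n) \<mu> z * v $ 2,
    pd dx (Ty n) \<mu> z * v $ 1 + pd dy (Ty n) \<mu> z * v $ 2]"
proof -
  have l: "linear (DT n \<mu> z)" by (rule DT_linear[OF assms])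
  have *: "DT n \<mu> z v = v $ 1 *\<^sub>R DT n \<mu> z dx + v $ 2 *\<^sub>R DT n \<mu> z dy"
  proof -
    have "DT n \<mu> z (v $ 1 *\<^sub>R dx + v $ 2 *\<^sub>R dy) = v $ 1 *\<^sub>R DT n \<mu> z dx + v $ 2 *\<^sub>R DT n \<mu> z dy"
      by (simp only: linear_add[OF l] linear_scale[OF l])
    then show ?thesis unfolding vector2_decomp[symmetric] by simp
  qed
  have c: "DT n \<mu> z w $ 1 = pd w (Tx n) \<mu> z" "DT n \<mu> z w $ 2 = pd w (Ty n) \<mu> z" for w
  proof -
    have "(Tx n \<mu> has_derivative (\<lambda>w. DT n \<mu> z w $ 1)) (at z)"
      unfolding Tx_def[abs_def]
      by (rule bounded_linear.has_derivative[OF bounded_linear_vec_nth T_has_derivative[OF assms]])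
    from has_derivative_unique[OF this Ck_fibre_on_has_derivative[OF T_component_Suc(1) assms]]
    show "DT n \<mu> z w $ 1 = pd w (Tx n) \<mu> z" by metis
    have "(Ty n \<mu> has_derivative (\<lambda>w. DT n \<mu> z w $ 2)) (at z)"
      unfolding Ty_def[abs_def]
      by (rule bounded_linear.has_derivative[OF bounded_linear_vec_nth T_has_derivative[OF assms]])
    from has_derivative_unique[OF this Ck_fibre_on_has_derivative[OF T_component_Suc(2) assms]]
    show "DT n \<mu> z w $ 2 = pd w (Ty n) \<mu> z" by metis
  qed
  show ?thesis unfolding * by (simp add: vec2_eq_iff c)
qed

lemma open_line_slices:
  "open {x. (\<mu>, vector [x, y]) \<in> E n}" "open {y. (\<mu>, vector [x, y]) \<in> E n}"
proof -
  have "open ((\<lambda>x. vector [x, y]) -` {z. (\<mu>, z) \<in> E n})"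
    by (rule open_vimage[OF open_E_slice]) (intro continuous_intros)
  then show "open {x. (\<mu>, vector [x, y]) \<in> E n}" by (simp add: vimage_def)
  have "open ((\<lambda>y. vector [x, y]) -` {z. (\<mu>, z) \<in> E n})"
    by (rule open_vimage[OF open_E_slice]) (intro continuous_intros)
  then show "open {y. (\<mu>, vector [x, y]) \<in> E n}" by (simp add: vimage_def)
qed

declare One_nat_def [simp del]

lemma T1_on_unstable:
  assumes "(\<mu>, vector [0, y]) \<in> E 1"
  shows "Tx 1 \<mu> (vector [0, y]) = 0" "Ty 1 \<mu> (vector [0, y]) = y / l \<mu>"
  using T1_cross[OF assms] l_bounds[OF E_I[OF assms]] unfolding Tx_def Ty_def
  by (auto simp: field_simps)

lemma T1_on_stable:
  assumes "(\<mu>, vector [x, 0]) \<in> E 1"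
  shows "Ty 1 \<mu> (vector [x, 0]) = 0"
  using stable_E1(2)[OF subsetD[OF E_subset assms]] unfolding Ty_def by simp

lemma pd_on_unstable:
  assumes E: "(\<mu>, vector [0, y]) \<in> E 1"
  shows "pd dy (Tx 1) \<mu> (vector [0, y]) = 0" "pd dy (Ty 1) \<mu> (vector [0, y]) = 1 / l \<mu>"
    "pd dx (Tx 1) \<mu> (vector [0, y]) = l \<mu>"
proof -
  note l = l_bounds[OF E_I[OF E]]
  have "DERIV (\<lambda>y. Tx 1 \<mu> (vector [0, y])) y :> 0"
    by (rule has_field_derivative_transform_within_open[OF _ open_line_slices(2), of "\<lambda>y. 0"])
      (use E in \<open>auto intro!: derivative_eq_intros simp: T1_on_unstable\<close>)
  from DERIV_unique[OF pd_DERIV(2)[OF T_component_Suc(1) E] this]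
  show "pd dy (Tx 1) \<mu> (vector [0, y]) = 0" .
  have "DERIV (\<lambda>y. Ty 1 \<mu> (vector [0, y])) y :> 1 / l \<mu>"
    by (rule has_field_derivative_transform_within_open[OF _ open_line_slices(2), of "\<lambda>y. y / l \<mu>"])
      (use E l in \<open>auto intro!: derivative_eq_intros simp: T1_on_unstable\<close>)
  from DERIV_unique[OF pd_DERIV(2)[OF T_component_Suc(2) E] this]
  show "pd dy (Ty 1) \<mu> (vector [0, y]) = 1 / l \<mu>" .
  define S where "S = {x. (\<mu>, vector [x, y]) \<in> E 1}"
  have oS: "open S" "0 \<in> S" unfolding S_def using open_line_slices(1) E by auto
  let ?y = "\<lambda>x. Ty 1 \<mu> (vector [x, y])"
  have cy: "continuous_on S ?y"
    unfolding S_def by (rule DERIV_atLeastAtMost_imp_continuous_on | rule continuous_at_imp_continuous_on,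
      use pd_DERIV(1)[OF T_component_Suc(2)] DERIV_isCont in blast)
  let ?H = "{(\<mu>, \<psi> \<mu> p $ 1, \<psi> \<mu> (f \<mu> p) $ 2) | \<mu> p. \<mu> \<in> I \<and> p \<in> U0 \<and> f \<mu> p \<in> U0}"
  have "(\<lambda>x. (\<mu>, x, ?y x)) ` S \<subseteq> ?H"
  proof clarify
    fix x assume "x \<in> S"
    then have x: "(\<mu>, vector [x, y]) \<in> E 1" unfolding S_def by simp
    show "\<exists>\<mu>' p. (\<mu>, x, ?y x) = (\<mu>', \<psi> \<mu>' p $ 1, \<psi> \<mu>' (f \<mu>' p) $ 2) \<and> \<mu>' \<in> I \<and> p \<in> U0 \<and> f \<mu>' p \<in> U0"
      using x E_psi[OF x] E_I[OF x] unfolding E1_iff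
      by (intro exI[of _ \<mu>] exI[of _ "pt \<mu> (vector [x, y])"]) (simp add: Ty_def T_def One_nat_def)
  qed
  moreover have "continuous_on S (\<lambda>x. (\<mu>, x, ?y x))" by (intro continuous_intros cy)
  ultimately have "continuous_on S (\<lambda>x. h \<mu> x (?y x))"
    using continuous_on_compose2[OF h_continuous, of S "\<lambda>x. (\<mu>, x, ?y x)"] by (simp add: case_prod_unfold)
  then have ch: "isCont (\<lambda>x. h \<mu> x (?y x)) 0" using oS continuous_on_eq_continuous_at by blast
  have cy0: "isCont ?y 0" using cy oS continuous_on_eq_continuous_at by blast
  \<comment> \<open>The cross form writes \<open>Tx 1\<close> as \<open>x\<close> times this factor.
    As \<open>h\<close> is only continuous, the product is differentiated by the criterion of
    Caratheodory, which asks for continuity of the factor at 0 only.\<close>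
  let ?g = "\<lambda>x. l \<mu> + h \<mu> x (?y x) * x * ?y x"
  have "DERIV (\<lambda>x. x * ?g x) 0 :> l \<mu>"
    unfolding CARAT_DERIV by (rule exI[of _ ?g]) (use ch cy0 in \<open>auto intro!: continuous_intros\<close>)
  then have "DERIV (\<lambda>x. Tx 1 \<mu> (vector [x, y])) 0 :> l \<mu>"
  proof (rule has_field_derivative_transform_within_open[OF _ oS])
    fix x assume "x \<in> S"
    then have x: "(\<mu>, vector [x, y]) \<in> E 1" unfolding S_def by simp
    show "x * ?g x = Tx 1 \<mu> (vector [x, y])"
      unfolding Tx_def Ty_def T1_cross(1)[OF x] by (simp add: power2_eq_square algebra_simps)
  qed
  from DERIV_unique[OF pd_DERIV(1)[OF T_component_Suc(1) E] this]
  show "pd dx (Tx 1) \<mu> (vector [0, y]) = l \<mu>" .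
qed

lemma pd_on_stable:
  assumes E: "(\<mu>, vector [x, 0]) \<in> E 1"
  shows "pd dx (Ty 1) \<mu> (vector [x, 0]) = 0"
proof -
  have "DERIV (\<lambda>x. Ty 1 \<mu> (vector [x, 0])) x :> 0"
    by (rule has_field_derivative_transform_within_open[OF _ open_line_slices(1), of "\<lambda>x. 0"])
      (use E in \<open>auto intro!: derivative_eq_intros simp: T1_on_stable\<close>)
  from DERIV_unique[OF pd_DERIV(1)[OF T_component_Suc(2) E] this] show ?thesis .
qed

text \<open>
  The cross form only says that \<open>x' = \<lambda> x + O(x\<^sup>2)\<close> for each \<open>y\<close>, with no control of derivatives of \<open>h\<close>.
  The mixed derivative is recovered from the difference quotient in both variables, which tends to
  \<open>\<lambda> - \<lambda>\<close>.
\<close>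

lemma mixed_pd_on_unstable:
  assumes E: "(\<mu>, vector [0, y0]) \<in> E 1"
  shows "pd dx (pd dy (Tx 1)) \<mu> (vector [0, y0]) = 0"
proof (rule ccontr)
  let ?B = "pd dx (pd dy (Tx 1)) \<mu>"
  assume nz: "?B (vector [0, y0]) \<noteq> 0"
  define \<kappa> where "\<kappa> = \<bar>?B (vector [0, y0])\<bar> / 2"
  have \<kappa>: "\<kappa> > 0" using nz unfolding \<kappa>_def by simp
  have "continuous_on {(x, y). (\<mu>, vector [x, y]) \<in> E 1} (\<lambda>(x, y). ?B (vector [x, y]))"
  proof -
    have "continuous_on {(x, y). (\<mu>, vector [x, y]) \<in> E 1} (\<lambda>u. (\<mu>, vector [fst u, snd u] :: real^2))"
      by (intro continuous_intros)
    from continuous_on_compose2[OF Ck_fibre_on_continuous[OF pd2_component_Suc(1)] this, of 1 dx dy]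
    show ?thesis by (auto simp: case_prod_unfold)
  qed
  moreover have "open {(x, y). (\<mu>, vector [x, y]) \<in> E 1}"
  proof -
    have "open ((\<lambda>u. vector [fst u, snd u]) -` {z. (\<mu>, z) \<in> E 1})"
      by (rule open_vimage[OF open_E_slice]) (intro continuous_intros)
    then show ?thesis by (simp add: vimage_def case_prod_unfold)
  qed
  ultimately have "open ({(x, y). (\<mu>, vector [x, y]) \<in> E 1} \<inter>
      (\<lambda>(x, y). ?B (vector [x, y])) -` {b. \<bar>b\<bar> > \<kappa>})"
    by (rule continuous_open_preimage) (auto intro!: open_Collect_less continuous_intros)
  moreover have "(0, y0) \<in> {(x, y). (\<mu>, vector [x, y]) \<in> E 1} \<inter>
      (\<lambda>(x, y). ?B (vector [x, y])) -` {b. \<bar>b\<bar> > \<kappa>}"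
    using E nz unfolding \<kappa>_def by auto
  ultimately obtain e where e: "e > 0" "ball (0, y0) e \<subseteq> {(x, y). (\<mu>, vector [x, y]) \<in> E 1} \<inter>
      (\<lambda>(x, y). ?B (vector [x, y])) -` {b. \<bar>b\<bar> > \<kappa>}"
    using open_contains_ball by blast
  define d where "d = e / 2"
  have d: "d > 0" using e unfolding d_def by simp
  have box: "(\<mu>, vector [x, y]) \<in> E 1" "\<bar>?B (vector [x, y])\<bar> > \<kappa>" if "\<bar>x\<bar> < d" "\<bar>y - y0\<bar> \<le> d / 2" for x y
  proof -
    have "dist (0, y0) (x, y) \<le> \<bar>x\<bar> + \<bar>y - y0\<bar>"
      using dist_Pair_Pair[of 0 y0 x y] sqrt_sum_squares_le_sum_abs[of x "y - y0"]
      by (simp add: dist_real_def power2_commute)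
    then have "(x, y) \<in> ball (0, y0) e" using that d unfolding d_def by auto
    then show "(\<mu>, vector [x, y]) \<in> E 1" "\<bar>?B (vector [x, y])\<bar> > \<kappa>" using e(2) by auto
  qed
  let ?y1 = "y0 + d / 2"
  let ?q = "\<lambda>x. Tx 1 \<mu> (vector [x, ?y1]) - Tx 1 \<mu> (vector [x, y0])"
  \<comment> \<open>The mean value theorem in \<open>y\<close>, then in \<open>x\<close> starting
    from the axis, where \<open>pd dy (Tx 1)\<close> vanishes: the quotient is \<open>d / 2\<close>
    times a value of the mixed derivative, whose modulus exceeds \<kappa> on the box.\<close>
  have big: "\<bar>?q x / x\<bar> \<ge> \<kappa> * (d / 2)" if x: "x \<noteq> 0" "\<bar>x\<bar> < d" for x
  proof -
    obtain y where y: "y0 < y" "y < ?y1" "?q x = (?y1 - y0) * pd dy (Tx 1) \<mu> (vector [x, y])"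
      using MVT2[of y0 ?y1 "\<lambda>y. Tx 1 \<mu> (vector [x, y])" "\<lambda>y. pd dy (Tx 1) \<mu> (vector [x, y])"]
        pd_DERIV(2)[OF T_component_Suc(1) box(1)] x d by auto
    have yb: "\<bar>y - y0\<bar> \<le> d / 2" using y by auto
    have "\<exists>t. \<bar>t\<bar> < d \<and> pd dy (Tx 1) \<mu> (vector [x, y]) = x * ?B (vector [t, y])"
    proof -
      have D: "DERIV (\<lambda>x. pd dy (Tx 1) \<mu> (vector [x, y])) t :> ?B (vector [t, y])" if "\<bar>t\<bar> < d" for t
        by (rule pd_DERIV(1)[OF pd_component_Suc(1) box(1)[OF that yb]])
      have z: "pd dy (Tx 1) \<mu> (vector [0, y]) = 0" using pd_on_unstable(1)[OF box(1)] yb d by simp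
      show ?thesis
      proof (cases "x > 0")
        case True
        then obtain t where "0 < t" "t < x"
          "pd dy (Tx 1) \<mu> (vector [x, y]) - pd dy (Tx 1) \<mu> (vector [0, y]) = (x - 0) * ?B (vector [t, y])"
          using MVT2[of 0 x "\<lambda>x. pd dy (Tx 1) \<mu> (vector [x, y])" "\<lambda>t. ?B (vector [t, y])"] D x by auto
        then show ?thesis using z x by (intro exI[of _ t]) auto
      next
        case False
        then obtain t where "x < t" "t < 0"
          "pd dy (Tx 1) \<mu> (vector [0, y]) - pd dy (Tx 1) \<mu> (vector [x, y]) = (0 - x) * ?B (vector [t, y])"
          using MVT2[of x 0 "\<lambda>x. pd dy (Tx 1) \<mu> (vector [x, y])" "\<lambda>t. ?B (vector [t, y])"] D x by auto
        then show ?thesis using z x by (intro exI[of _ t]) auto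
      qed
    qed
    then obtain t where t: "\<bar>t\<bar> < d" "pd dy (Tx 1) \<mu> (vector [x, y]) = x * ?B (vector [t, y])" by blast
    have "?q x / x = (d / 2) * ?B (vector [t, y])" using y(3) t(2) x by simp
    then have "\<bar>?q x / x\<bar> = (d / 2) * \<bar>?B (vector [t, y])\<bar>" using d by (simp only: abs_mult)
    then show ?thesis using box(2)[OF t(1) yb] d mult_left_mono[of \<kappa> "\<bar>?B (vector [t, y])\<bar>" "d / 2"]
      by (simp only: mult.commute[of \<kappa>])
  qed
  have "((\<lambda>x. ?q x / x) \<longlongrightarrow> l \<mu> - l \<mu>) (at 0)"
  proof -
    have D: "((\<lambda>x. Tx 1 \<mu> (vector [x, y]) / x) \<longlongrightarrow> l \<mu>) (at 0)" if "\<bar>y - y0\<bar> \<le> d / 2" for y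
    proof -
      have E': "(\<mu>, vector [0, y]) \<in> E 1" using box(1)[OF _ that] d by simp
      from pd_DERIV(1)[OF T_component_Suc(1) E'] show ?thesis
        unfolding DERIV_def pd_on_unstable(3)[OF E'] T1_on_unstable(1)[OF E'] by simp
    qed
    from tendsto_diff[OF D[of ?y1] D[of y0]] d show ?thesis by (simp add: diff_divide_distrib)
  qed
  then have "((\<lambda>x. \<bar>?q x / x\<bar>) \<longlongrightarrow> 0) (at 0)" using tendsto_rabs_zero by fastforce
  moreover have "eventually (\<lambda>x. \<kappa> * (d / 2) \<le> \<bar>?q x / x\<bar>) (at 0)"
    unfolding eventually_at using big d by (intro exI[of _ d]) (auto simp: dist_real_def)
  ultimately have "\<kappa> * (d / 2) \<le> 0" by (rule tendsto_lowerbound) simp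
  then show False using \<kappa> d by (simp add: mult_le_0_iff)
qed

end

text \<open>For the linear saddle \<open>x n / lam ^ n\<close>, \<open>lam ^ n * y n\<close>,
  \<open>u n / lam ^ n\<close> and \<open>lam ^ n * v n\<close> are constant; here each step moves
  them by at most \<open>K * t\<^sup>2\<close> or \<open>K * \<bar>t\<bar>\<close>. The condition
  \<open>Q\<close> is carried along with the bounds, since \<open>step\<close> may be invoked only
  while the orbit is known to be close to the linear one. The quadratic coefficient of
  \<open>v\<close> in the equation for \<open>u\<close> matters: after rescaling it contributes
  without any power of \<open>lam ^ n\<close>, whereas a bound by
  \<open>\<bar>x n\<bar> * \<bar>v n\<bar>\<close> would bring in \<open>1 / lam ^ n\<close>. The
  constant 12 is 4 + 8, from the two terms in that equation, which is the worst of the four.\<close>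

lemma saddle_sequence:
  fixes x y u v :: "nat \<Rightarrow> real"
  assumes lam: "0 < lam" "lam \<le> 1" and C: "C \<ge> 0" and K: "12 * C / lam \<le> K"
    and t: "\<bar>t\<bar> \<le> 1" "real j * K * \<bar>t\<bar> \<le> 1"
    and init: "x 0 = t" "y 0 = t" "\<bar>u 0\<bar> = 1" "\<bar>v 0\<bar> = 1" "Q 0"
    and step: "\<And>n. n < j \<Longrightarrow> Q n \<Longrightarrow> \<bar>x n / lam ^ n - t\<bar> \<le> real n * K * t\<^sup>2 \<Longrightarrow>
      \<bar>lam ^ n * y n - t\<bar> \<le> real n * K * t\<^sup>2 \<Longrightarrow> Q (Suc n) \<and>
      \<bar>x (Suc n) - lam * x n\<bar> \<le> C * (x n)\<^sup>2 \<and>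
      \<bar>y (Suc n) - y n / lam\<bar> \<le> C * \<bar>x n\<bar> * \<bar>y n\<bar> \<and>
      \<bar>u (Suc n) - lam * u n\<bar> \<le> C * \<bar>x n\<bar> * \<bar>u n\<bar> + C * (x n)\<^sup>2 * \<bar>v n\<bar> \<and>
      \<bar>v (Suc n) - v n / lam\<bar> \<le> C * \<bar>x n\<bar> * \<bar>v n\<bar> + C * \<bar>y n\<bar> * \<bar>u n\<bar>"
  shows "n \<le> j \<Longrightarrow> Q n \<and> \<bar>x n / lam ^ n - t\<bar> \<le> real n * K * t\<^sup>2 \<and>
    \<bar>lam ^ n * y n - t\<bar> \<le> real n * K * t\<^sup>2 \<and>
    \<bar>u n / lam ^ n - u 0\<bar> \<le> real n * K * \<bar>t\<bar> \<and> \<bar>lam ^ n * v n - v 0\<bar> \<le> real n * K * \<bar>t\<bar>"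
proof (induction n)
  case 0
  then show ?case using init by simp
next
  case (Suc n)
  then have n: "n < j" and Q: "Q n" and b: "\<bar>x n / lam ^ n - t\<bar> \<le> real n * K * t\<^sup>2"
    "\<bar>lam ^ n * y n - t\<bar> \<le> real n * K * t\<^sup>2" "\<bar>u n / lam ^ n - u 0\<bar> \<le> real n * K * \<bar>t\<bar>"
    "\<bar>lam ^ n * v n - v 0\<bar> \<le> real n * K * \<bar>t\<bar>" by auto
  note s = step[OF n Q b(1,2)]
  define p where "p = lam ^ n"
  have p: "0 < p" "p \<le> 1" using lam unfolding p_def by (auto simp: power_le_one)
  have lp: "lam * p \<le> 1" using lam p by (simp add: mult_le_one)
  define X Y U V where "X = x n / p" and "Y = p * y n" and "U = u n / p" and "V = p * v n"
  have e: "x n = p * X" "y n = Y / p" "u n = p * U" "v n = V / p"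
    unfolding X_def Y_def U_def V_def using p by auto
  have K0: "K \<ge> 0" using K C lam by (smt (verit) divide_nonneg_pos)
  have CK: "12 * C \<le> K" "12 * C \<le> K * lam"
  proof -
    show *: "12 * C \<le> K * lam" using K lam by (simp add: pos_divide_le_eq)
    show "12 * C \<le> K" using * mult_left_le[OF lam(2) K0] by linarith
  qed
  have nK: "real n * K * \<bar>t\<bar> \<le> 1"
  proof -
    have "real n * K * \<bar>t\<bar> \<le> real j * K * \<bar>t\<bar>" using n K0 by (intro mult_right_mono) auto
    then show ?thesis using t(2) by simp
  qed
  have nK2: "real n * K * t\<^sup>2 \<le> \<bar>t\<bar>"
  proof -
    have "real n * K * t\<^sup>2 = (real n * K * \<bar>t\<bar>) * \<bar>t\<bar>"
      using abs_mult_self[of t] by (simp add: power2_eq_square mult.assoc)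
    then show ?thesis using mult_right_mono[OF nK, of "\<bar>t\<bar>"] by linarith
  qed
  have b2: "\<bar>X\<bar> \<le> 2 * \<bar>t\<bar>" "\<bar>Y\<bar> \<le> 2 * \<bar>t\<bar>" "\<bar>U\<bar> \<le> 2" "\<bar>V\<bar> \<le> 2"
    using b nK nK2 init(3,4) unfolding X_def Y_def U_def V_def p_def by linarith+
  have sq: "X\<^sup>2 \<le> 4 * t\<^sup>2" using power_mono[OF b2(1), of 2] by (simp add: power_mult_distrib)
  have t2: "t\<^sup>2 \<le> \<bar>t\<bar>" using mult_left_mono[OF t(1), of "\<bar>t\<bar>"] by (simp add: power2_eq_square)
  have XU: "\<bar>X\<bar> * \<bar>U\<bar> \<le> 4 * \<bar>t\<bar>" "\<bar>X\<bar> * \<bar>V\<bar> \<le> 4 * \<bar>t\<bar>" "\<bar>Y\<bar> * \<bar>U\<bar> \<le> 4 * \<bar>t\<bar>" "X\<^sup>2 * \<bar>V\<bar> \<le> 8 * \<bar>t\<bar>"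
    "\<bar>X\<bar> * \<bar>Y\<bar> \<le> 4 * t\<^sup>2"
  proof -
    show "\<bar>X\<bar> * \<bar>U\<bar> \<le> 4 * \<bar>t\<bar>" using mult_mono[OF b2(1,3)] by simp
    show "\<bar>X\<bar> * \<bar>V\<bar> \<le> 4 * \<bar>t\<bar>" using mult_mono[OF b2(1,4)] by simp
    show "\<bar>Y\<bar> * \<bar>U\<bar> \<le> 4 * \<bar>t\<bar>" using mult_mono[OF b2(2,3)] by simp
    show "X\<^sup>2 * \<bar>V\<bar> \<le> 8 * \<bar>t\<bar>" using mult_mono[OF sq b2(4)] t2 by simp
    show "\<bar>X\<bar> * \<bar>Y\<bar> \<le> 4 * t\<^sup>2" using mult_mono[OF b2(1,2)] by (simp add: power2_eq_square)
  qed
  have dx: "\<bar>x (Suc n) / lam ^ Suc n - X\<bar> \<le> K * t\<^sup>2"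
  proof -
    have "x (Suc n) / lam ^ Suc n - X = (x (Suc n) - lam * x n) / (lam * p)"
      unfolding e using p lam by (simp add: field_simps p_def[symmetric])
    then have "\<bar>x (Suc n) / lam ^ Suc n - X\<bar> = \<bar>x (Suc n) - lam * x n\<bar> / (lam * p)"
      using p lam by (simp add: abs_mult)
    also have "\<dots> \<le> C * (x n)\<^sup>2 / (lam * p)" using s p lam by (intro divide_right_mono) auto
    also have "\<dots> = C * X\<^sup>2 * p / lam" unfolding e using p lam by (simp add: power2_eq_square field_simps)
    also have "\<dots> \<le> C * X\<^sup>2 / lam" using p lam C by (intro divide_right_mono mult_left_le) auto
    also have "\<dots> \<le> C * (4 * t\<^sup>2) / lam" using sq lam C by (intro divide_right_mono mult_left_mono) auto
    also have "\<dots> = (4 * C) * t\<^sup>2 / lam" by simp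
    also have "\<dots> \<le> (K * lam) * t\<^sup>2 / lam"
      using CK lam C by (intro divide_right_mono mult_right_mono) auto
    finally show ?thesis using lam by simp
  qed
  have dyy: "\<bar>lam ^ Suc n * y (Suc n) - Y\<bar> \<le> K * t\<^sup>2"
  proof -
    have "\<bar>lam ^ Suc n * y (Suc n) - Y\<bar> = (lam * p) * \<bar>y (Suc n) - y n / lam\<bar>"
    proof -
      have "lam ^ Suc n * y (Suc n) - Y = (lam * p) * (y (Suc n) - y n / lam)"
        unfolding e p_def[symmetric] using p lam by (simp add: field_simps p_def[symmetric])
      then show ?thesis using p lam by (simp add: abs_mult)
    qed
    also have "\<dots> \<le> (lam * p) * (C * \<bar>x n\<bar> * \<bar>y n\<bar>)" using s p lam by (intro mult_left_mono) auto
    also have "\<dots> = (lam * p) * (C * (\<bar>X\<bar> * \<bar>Y\<bar>))" unfolding e using p by (simp add: abs_mult)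
    also have "\<dots> \<le> 1 * (C * (4 * t\<^sup>2))"
      by (rule mult_mono[OF lp mult_left_mono[OF XU(5) C]]) (use C in auto)
    also have "\<dots> \<le> K * t\<^sup>2" using mult_right_mono[of "4 * C" K "t\<^sup>2"] CK C by simp
    finally show ?thesis .
  qed
  have du: "\<bar>u (Suc n) / lam ^ Suc n - U\<bar> \<le> K * \<bar>t\<bar>"
  proof -
    have "u (Suc n) / lam ^ Suc n - U = (u (Suc n) - lam * u n) / (lam * p)"
      unfolding e using p lam by (simp add: field_simps p_def[symmetric])
    then have "\<bar>u (Suc n) / lam ^ Suc n - U\<bar> = \<bar>u (Suc n) - lam * u n\<bar> / (lam * p)"
      using p lam by (simp add: abs_mult)
    also have "\<dots> \<le> (C * \<bar>x n\<bar> * \<bar>u n\<bar> + C * (x n)\<^sup>2 * \<bar>v n\<bar>) / (lam * p)"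
      using s p lam by (intro divide_right_mono) auto
    also have "\<dots> = C * (p * (\<bar>X\<bar> * \<bar>U\<bar>) + X\<^sup>2 * \<bar>V\<bar>) / lam"
      unfolding e using p lam by (simp add: power2_eq_square field_simps abs_mult)
    also have "\<dots> \<le> C * (1 * (4 * \<bar>t\<bar>) + 8 * \<bar>t\<bar>) / lam"
      by (rule divide_right_mono[OF mult_left_mono[OF add_mono[OF mult_mono[OF p(2) XU(1)] XU(4)] C]])
        (use lam in auto)
    also have "\<dots> = (12 * C) * \<bar>t\<bar> / lam" by simp
    also have "\<dots> \<le> (K * lam) * \<bar>t\<bar> / lam"
      using CK lam C by (intro divide_right_mono mult_right_mono) auto
    finally show ?thesis using lam by simp
  qed
  have dv: "\<bar>lam ^ Suc n * v (Suc n) - V\<bar> \<le> K * \<bar>t\<bar>"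
  proof -
    have "\<bar>lam ^ Suc n * v (Suc n) - V\<bar> = (lam * p) * \<bar>v (Suc n) - v n / lam\<bar>"
    proof -
      have "lam ^ Suc n * v (Suc n) - V = (lam * p) * (v (Suc n) - v n / lam)"
        unfolding e p_def[symmetric] using p lam by (simp add: field_simps p_def[symmetric])
      then show ?thesis using p lam by (simp add: abs_mult)
    qed
    also have "\<dots> \<le> (lam * p) * (C * \<bar>x n\<bar> * \<bar>v n\<bar> + C * \<bar>y n\<bar> * \<bar>u n\<bar>)"
      using s p lam by (intro mult_left_mono) auto
    also have "\<dots> = (lam * p) * (C * (\<bar>X\<bar> * \<bar>V\<bar> + \<bar>Y\<bar> * \<bar>U\<bar>))"
      unfolding e using p by (simp add: abs_mult algebra_simps)
    also have "\<dots> \<le> 1 * (C * (4 * \<bar>t\<bar> + 4 * \<bar>t\<bar>))"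
      by (rule mult_mono[OF lp mult_left_mono[OF add_mono[OF XU(2,3)] C]]) (use C in auto)
    also have "\<dots> \<le> K * \<bar>t\<bar>" using mult_right_mono[of "8 * C" K "\<bar>t\<bar>"] CK C by simp
    finally show ?thesis .
  qed
  have "real (Suc n) * K * t\<^sup>2 = real n * K * t\<^sup>2 + K * t\<^sup>2"
    "real (Suc n) * K * \<bar>t\<bar> = real n * K * \<bar>t\<bar> + K * \<bar>t\<bar>" by (simp_all add: algebra_simps)
  note sc = this
  have tri: "\<bar>a - w\<bar> \<le> d + e" if "\<bar>a - b\<bar> \<le> e" "\<bar>b - w\<bar> \<le> d" for a b w d e :: real
    using that by linarith
  show ?case
    unfolding sc
    using s tri[OF dx b(1)[folded p_def, folded X_def]] tri[OF dyy b(2)[folded p_def, folded Y_def]]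
      tri[OF du b(3)[folded p_def, folded U_def]] tri[OF dv b(4)[folded p_def, folded V_def]] by blast
qed

context reversible_family
begin

text \<open>Compares one step with the linear saddle, in the form that
  \<open>saddle_sequence\<close> demands of each step.\<close>

definition saddle_estimates :: "real \<Rightarrow> real \<Rightarrow> real^2 \<Rightarrow> bool" where
  "saddle_estimates C \<mu> z \<longleftrightarrow> (\<mu>, z) \<in> E 1 \<and>
     \<bar>Tx 1 \<mu> z - l \<mu> * z $ 1\<bar> \<le> C * (z $ 1)\<^sup>2 \<and>
     \<bar>Ty 1 \<mu> z - z $ 2 / l \<mu>\<bar> \<le> C * \<bar>z $ 1\<bar> * \<bar>z $ 2\<bar> \<and>
     (\<forall>v. \<bar>DT 1 \<mu> z v $ 1 - l \<mu> * v $ 1\<bar> \<le> C * \<bar>z $ 1\<bar> * \<bar>v $ 1\<bar> + C * (z $ 1)\<^sup>2 * \<bar>v $ 2\<bar> \<and>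
          \<bar>DT 1 \<mu> z v $ 2 - v $ 2 / l \<mu>\<bar> \<le> C * \<bar>z $ 1\<bar> * \<bar>v $ 2\<bar> + C * \<bar>z $ 2\<bar> * \<bar>v $ 1\<bar>)"

text \<open>The bounds on higher derivatives are integrated from the axes, where the map and some of
  its derivatives are known exactly: horizontally from \<open>x = 0\<close>, and for
  \<open>pd dx (Ty 1)\<close> vertically from \<open>y = 0\<close>. The vertical segment is
  available only for \<open>\<bar>y\<bar> \<le> \<rho>\<close>; above that height \<open>C\<close>
  itself is at most \<open>(C / \<rho>) * \<bar>y\<bar>\<close>.\<close>

lemma saddle_estimates_local:
  assumes C: "C \<ge> 0" and D: "D \<ge> C" "D \<ge> C / \<rho>" "\<rho> > 0"
    and hor: "\<And>t. \<bar>t\<bar> \<le> \<bar>x\<bar> \<Longrightarrow> (\<mu>, vector [t, y]) \<in> K"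
    and ver: "\<And>t s. \<bar>y\<bar> \<le> \<rho> \<Longrightarrow> \<bar>t\<bar> \<le> \<bar>x\<bar> \<Longrightarrow> \<bar>s\<bar> \<le> \<bar>y\<bar> \<Longrightarrow> (\<mu>, vector [t, s]) \<in> K"
    and K: "K \<subseteq> E 1"
    and bd: "\<And>\<mu> z. (\<mu>, z) \<in> K \<Longrightarrow> \<bar>pd dx (pd dx (Tx 1)) \<mu> z\<bar> \<le> C \<and>
      \<bar>pd dx (pd dx (pd dy (Tx 1))) \<mu> z\<bar> \<le> C \<and> \<bar>pd dx (pd dy (Ty 1)) \<mu> z\<bar> \<le> C \<and>
      \<bar>pd dy (pd dx (Ty 1)) \<mu> z\<bar> \<le> C \<and> \<bar>pd dx (Ty 1) \<mu> z\<bar> \<le> C"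
  shows "saddle_estimates D \<mu> (vector [x, y])"
proof -
  let ?z = "vector [x, y] :: real^2"
  have E: "(\<mu>, vector [t, y]) \<in> E 1" if "\<bar>t\<bar> \<le> \<bar>x\<bar>" for t using hor[OF that] K by auto
  have Ez: "(\<mu>, ?z) \<in> E 1" and E0': "(\<mu>, vector [0, y]) \<in> E 1" using E by auto
  have A11: "\<bar>pd dx (Tx 1) \<mu> (vector [t, y]) - l \<mu>\<bar> \<le> C * \<bar>t\<bar>" if t: "\<bar>t\<bar> \<le> \<bar>x\<bar>" for t
  proof -
    have "\<bar>pd dx (Tx 1) \<mu> (vector [t, y]) - pd dx (Tx 1) \<mu> (vector [0, y])\<bar> \<le> C * \<bar>t\<bar>"
      by (rule MVT_bound_zero[where \<phi>' = "\<lambda>t. pd dx (pd dx (Tx 1)) \<mu> (vector [t, y])"])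
        (use pd_DERIV(1)[OF pd_component_Suc(1) E] bd[OF hor] t in \<open>meson order_trans\<close>)+
    then show ?thesis using pd_on_unstable(3)[OF E0'] by simp
  qed
  have A12x: "\<bar>pd dx (pd dy (Tx 1)) \<mu> (vector [t, y])\<bar> \<le> C * \<bar>t\<bar>" if t: "\<bar>t\<bar> \<le> \<bar>x\<bar>" for t
  proof -
    have "\<bar>pd dx (pd dy (Tx 1)) \<mu> (vector [t, y]) - pd dx (pd dy (Tx 1)) \<mu> (vector [0, y])\<bar> \<le> C * \<bar>t\<bar>"
      by (rule MVT_bound_zero[where \<phi>' = "\<lambda>t. pd dx (pd dx (pd dy (Tx 1))) \<mu> (vector [t, y])"])
        (use pd_DERIV(1)[OF pd2_component_Suc(1) E] bd[OF hor] t in \<open>meson order_trans\<close>)+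
    then show ?thesis using mixed_pd_on_unstable[OF E0'] by simp
  qed
  have A12: "\<bar>pd dy (Tx 1) \<mu> ?z\<bar> \<le> C * x\<^sup>2"
  proof -
    have "\<bar>pd dx (pd dy (Tx 1)) \<mu> (vector [t, y])\<bar> \<le> C * \<bar>x\<bar>" if t: "\<bar>t\<bar> \<le> \<bar>x\<bar>" for t
      using A12x[OF t] mult_left_mono[OF t C] by linarith
    then have "\<bar>pd dy (Tx 1) \<mu> ?z - pd dy (Tx 1) \<mu> (vector [0, y])\<bar> \<le> (C * \<bar>x\<bar>) * \<bar>x\<bar>"
      by (intro MVT_bound_zero[of x "\<lambda>t. pd dy (Tx 1) \<mu> (vector [t, y])"
        "\<lambda>t. pd dx (pd dy (Tx 1)) \<mu> (vector [t, y])"] pd_DERIV(1)[OF pd_component_Suc(1)] E)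
    then show ?thesis using pd_on_unstable(1)[OF E0'] by (simp add: power2_eq_square)
  qed
  have "\<bar>pd dy (Ty 1) \<mu> ?z - pd dy (Ty 1) \<mu> (vector [0, y])\<bar> \<le> C * \<bar>x\<bar>"
    by (rule MVT_bound_zero[where \<phi>' = "\<lambda>t. pd dx (pd dy (Ty 1)) \<mu> (vector [t, y])"])
      (use pd_DERIV(1)[OF pd_component_Suc(2) E] bd[OF hor] in blast)+
  then have A22: "\<bar>pd dy (Ty 1) \<mu> ?z - 1 / l \<mu>\<bar> \<le> C * \<bar>x\<bar>"
    using pd_on_unstable(2)[OF E0'] by simp
  have A21: "\<bar>pd dx (Ty 1) \<mu> (vector [t, y])\<bar> \<le> D * \<bar>y\<bar>"
    if t: "\<bar>t\<bar> \<le> \<bar>x\<bar>" for t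
  proof (cases "\<bar>y\<bar> \<le> \<rho>")
    case True
    then have v': "(\<mu>, vector [t, s]) \<in> K" if "\<bar>s\<bar> \<le> \<bar>y\<bar>" for s using ver t that by blast
    then have Et: "(\<mu>, vector [t, 0]) \<in> E 1" using K by force
    have "\<bar>pd dx (Ty 1) \<mu> (vector [t, y]) - pd dx (Ty 1) \<mu> (vector [t, 0])\<bar> \<le> C * \<bar>y\<bar>"
    proof (rule MVT_bound_zero[where \<phi>' = "\<lambda>s. pd dy (pd dx (Ty 1)) \<mu> (vector [t, s])"])
      fix s assume s: "\<bar>s\<bar> \<le> \<bar>y\<bar>"
      show "DERIV (\<lambda>s. pd dx (Ty 1) \<mu> (vector [t, s])) s :> pd dy (pd dx (Ty 1)) \<mu> (vector [t, s])"
        by (rule pd_DERIV(2)[OF pd_component_Suc(2) subsetD[OF K v'[OF s]]])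
      show "\<bar>pd dy (pd dx (Ty 1)) \<mu> (vector [t, s])\<bar> \<le> C" using bd[OF v'[OF s]] by blast
    qed
    then have "\<bar>pd dx (Ty 1) \<mu> (vector [t, y])\<bar> \<le> C * \<bar>y\<bar>"
      using pd_on_stable[OF Et] by simp
    then show ?thesis using mult_right_mono[OF D(1), of "\<bar>y\<bar>"] by linarith
  next
    case False
    have "\<bar>pd dx (Ty 1) \<mu> (vector [t, y])\<bar> \<le> C" using bd hor[OF t] by blast
    also have "\<dots> = C / \<rho> * \<rho>" using D by simp
    also have "\<dots> \<le> D * \<bar>y\<bar>" using False D C by (intro mult_mono) auto
    finally show ?thesis .
  qed
  have "\<bar>Tx 1 \<mu> ?z - l \<mu> * x\<bar> \<le> C * x\<^sup>2"
  proof -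
    have "\<bar>(\<lambda>t. Tx 1 \<mu> (vector [t, y]) - l \<mu> * t) x - (\<lambda>t. Tx 1 \<mu> (vector [t, y]) - l \<mu> * t) 0\<bar>
        \<le> (C * \<bar>x\<bar>) * \<bar>x\<bar>"
    proof (rule MVT_bound_zero[where \<phi>' = "\<lambda>t. pd dx (Tx 1) \<mu> (vector [t, y]) - l \<mu>"])
      fix t assume t: "\<bar>t\<bar> \<le> \<bar>x\<bar>"
      show "DERIV (\<lambda>t. Tx 1 \<mu> (vector [t, y]) - l \<mu> * t) t :> pd dx (Tx 1) \<mu> (vector [t, y]) - l \<mu>"
        by (auto intro!: derivative_eq_intros pd_DERIV(1)[OF T_component_Suc(1) E[OF t]])
      show "\<bar>pd dx (Tx 1) \<mu> (vector [t, y]) - l \<mu>\<bar> \<le> C * \<bar>x\<bar>"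
        using A11[OF t] mult_left_mono[OF t C] by linarith
    qed
    then show ?thesis using T1_on_unstable(1)[OF E0'] by (simp add: power2_eq_square)
  qed
  then have e1: "\<bar>Tx 1 \<mu> ?z - l \<mu> * x\<bar> \<le> D * x\<^sup>2"
    using mult_right_mono[OF D(1), of "x\<^sup>2"] by simp
  have "\<bar>Ty 1 \<mu> ?z - Ty 1 \<mu> (vector [0, y])\<bar> \<le> (D * \<bar>y\<bar>) * \<bar>x\<bar>"
    by (rule MVT_bound_zero[where \<phi>' = "\<lambda>t. pd dx (Ty 1) \<mu> (vector [t, y])"])
      (use pd_DERIV(1)[OF T_component_Suc(2) E] A21 in blast)+
  then have e2: "\<bar>Ty 1 \<mu> ?z - y / l \<mu>\<bar> \<le> D * \<bar>x\<bar> * \<bar>y\<bar>"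
    using T1_on_unstable(2)[OF E0'] by (simp add: mult_ac)
  have A: "\<bar>pd dx (Tx 1) \<mu> ?z - l \<mu>\<bar> \<le> D * \<bar>x\<bar>" "\<bar>pd dy (Tx 1) \<mu> ?z\<bar> \<le> D * x\<^sup>2"
    "\<bar>pd dx (Ty 1) \<mu> ?z\<bar> \<le> D * \<bar>y\<bar>" "\<bar>pd dy (Ty 1) \<mu> ?z - 1 / l \<mu>\<bar> \<le> D * \<bar>x\<bar>"
    using A11[of x] A12 A21[of x] A22 mult_right_mono[OF D(1), of "\<bar>x\<bar>"]
      mult_right_mono[OF D(1), of "x\<^sup>2"] by auto
  have "\<bar>DT 1 \<mu> ?z v $ 1 - l \<mu> * v $ 1\<bar> \<le> D * \<bar>x\<bar> * \<bar>v $ 1\<bar> + D * x\<^sup>2 * \<bar>v $ 2\<bar>" for v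
  proof -
    have "DT 1 \<mu> ?z v $ 1 - l \<mu> * v $ 1 =
        (pd dx (Tx 1) \<mu> ?z - l \<mu>) * v $ 1 + pd dy (Tx 1) \<mu> ?z * v $ 2"
      unfolding DT_components[OF Ez] by (simp add: algebra_simps)
    also have "\<bar>\<dots>\<bar> \<le> \<bar>pd dx (Tx 1) \<mu> ?z - l \<mu>\<bar> * \<bar>v $ 1\<bar> + \<bar>pd dy (Tx 1) \<mu> ?z\<bar> * \<bar>v $ 2\<bar>"
      by (rule order_trans[OF abs_triangle_ineq]) (simp add: abs_mult)
    finally show ?thesis
      using mult_right_mono[OF A(1), of "\<bar>v $ 1\<bar>"] mult_right_mono[OF A(2), of "\<bar>v $ 2\<bar>"] by linarith
  qed
  moreover have "\<bar>DT 1 \<mu> ?z v $ 2 - v $ 2 / l \<mu>\<bar> \<le> D * \<bar>x\<bar> * \<bar>v $ 2\<bar> + D * \<bar>y\<bar> * \<bar>v $ 1\<bar>" for v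
  proof -
    have "DT 1 \<mu> ?z v $ 2 - v $ 2 / l \<mu> =
        (pd dy (Ty 1) \<mu> ?z - 1 / l \<mu>) * v $ 2 + pd dx (Ty 1) \<mu> ?z * v $ 1"
      unfolding DT_components[OF Ez] by (simp add: algebra_simps)
    also have "\<bar>\<dots>\<bar> \<le> \<bar>pd dy (Ty 1) \<mu> ?z - 1 / l \<mu>\<bar> * \<bar>v $ 2\<bar> + \<bar>pd dx (Ty 1) \<mu> ?z\<bar> * \<bar>v $ 1\<bar>"
      by (rule order_trans[OF abs_triangle_ineq]) (simp add: abs_mult)
    finally show ?thesis
      using mult_right_mono[OF A(4), of "\<bar>v $ 2\<bar>"] mult_right_mono[OF A(3), of "\<bar>v $ 1\<bar>"] by linarith
  qed
  ultimately show ?thesis unfolding saddle_estimates_def using e1 e2 Ez by simp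
qed

end

context reversible_family
begin

text \<open>The unstable axis between the saddle and the height \<open>ys\<close> need not lie in
  the domain as a whole; what is known to lie there is the backward orbit
  \<open>l \<mu> ^ i * ys\<close>. Uniform constants therefore come from one box around the origin
  and finitely many compact boxes around the points of this orbit which are outside of it. The
  exponent \<open>Suc i\<close> leaves out the last point, whose image may be outside of
  \<open>U0\<close>.\<close>

lemma saddle_bounds:
  assumes I0: "0 \<in> I" and ys: "(0, vector [0, ys]) \<in> E 0"
  obtains e C where "e > 0" "C > 0"
    "\<And>\<mu> x s i. \<bar>\<mu>\<bar> \<le> e \<Longrightarrow> \<bar>x\<bar> \<le> e \<Longrightarrow> \<bar>s - ys\<bar> \<le> e \<Longrightarrow>
      saddle_estimates C \<mu> (vector [x, l \<mu> ^ Suc i * s])"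
proof -
  have v0: "vector [0, 0] = (0 :: real^2)" by (simp add: vec2_eq_iff)
  have "open ((\<lambda>u. (fst u, vector [fst (snd u), snd (snd u)])) -` E 1)"
    by (rule open_vimage[OF E_open]) (intro continuous_intros)
  moreover have "(0, 0, 0) \<in> (\<lambda>u. (fst u, vector [fst (snd u), snd (snd u)])) -` E 1"
    using origin_E[OF I0] by (simp add: v0)
  ultimately obtain \<rho> where \<rho>: "\<rho> > 0"
    "\<And>\<mu> x y. \<bar>\<mu>\<bar> \<le> \<rho> \<Longrightarrow> \<bar>x\<bar> \<le> \<rho> \<Longrightarrow> \<bar>y\<bar> \<le> \<rho> \<Longrightarrow> (\<mu>, vector [x, y]) \<in> E 1"
    using open_box3[of "(\<lambda>u. (fst u, vector [fst (snd u), snd (snd u)])) -` E 1" 0 0 0]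
    unfolding vimage_def by auto
  define \<Lambda> where "\<Lambda> = (1 + l 0) / 2"
  have \<Lambda>: "0 < \<Lambda>" "\<Lambda> < 1" "l 0 < \<Lambda>" using l_bounds[OF I0] unfolding \<Lambda>_def by auto
  have "open (I \<inter> l -` {..<\<Lambda>})" by (rule continuous_open_preimage[OF l_cont open_I open_lessThan])
  moreover have "0 \<in> I \<inter> l -` {..<\<Lambda>}" using I0 \<Lambda>(3) by simp
  ultimately obtain d where d: "d > 0" "ball 0 d \<subseteq> I \<inter> l -` {..<\<Lambda>}"
    using open_contains_ball_eq by blast
  have d': "\<mu> \<in> I \<and> l \<mu> < \<Lambda>" if "\<bar>\<mu>\<bar> < d" for \<mu>
  proof -
    have "\<mu> \<in> ball 0 d" using that by simp
    then show ?thesis using d(2) by blast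
  qed
  \<comment> \<open>From the exponent \<open>n0\<close> on, the backward orbit is inside the box
    around the origin, uniformly in \<mu>.\<close>
  obtain n0 where n0: "\<Lambda> ^ n0 * (\<bar>ys\<bar> + 1) \<le> \<rho>"
  proof -
    obtain n where "\<Lambda> ^ n < \<rho> / (\<bar>ys\<bar> + 1)"
      using real_arch_pow_inv[of "\<rho> / (\<bar>ys\<bar> + 1)" \<Lambda>] \<rho> \<Lambda> by auto
    then show ?thesis using that[of n] by (simp add: pos_less_divide_eq less_imp_le)
  qed
  have "\<exists>e>0. \<forall>i<n. \<forall>\<mu> x s. \<bar>\<mu>\<bar> \<le> e \<longrightarrow> \<bar>x\<bar> \<le> e \<longrightarrow> \<bar>s - ys\<bar> \<le> e \<longrightarrow>
      (\<mu>, vector [x, l \<mu> ^ Suc i * s]) \<in> E 1" for n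
  proof (induction n)
    case 0
    then show ?case by (intro exI[of _ 1]) simp
  next
    case (Suc n)
    then obtain e1 where e1: "e1 > 0" "\<forall>i<n. \<forall>\<mu> x s. \<bar>\<mu>\<bar> \<le> e1 \<longrightarrow> \<bar>x\<bar> \<le> e1 \<longrightarrow> \<bar>s - ys\<bar> \<le> e1 \<longrightarrow>
      (\<mu>, vector [x, l \<mu> ^ Suc i * s]) \<in> E 1" by blast
    let ?g = "\<lambda>u::real\<times>real\<times>real. (fst u, vector [fst (snd u), l (fst u) ^ Suc n * snd (snd u)]) :: real \<times> (real^2)"
    have c: "continuous_on (I \<times> UNIV) ?g"
      by (intro continuous_intros continuous_on_compose2[OF l_cont]) auto
    have "open (I \<times> (UNIV :: (real \<times> real) set))" by (simp add: open_I open_Times)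
    from continuous_open_preimage[OF c this E_open[of 1]]
    have o: "open (I \<times> UNIV \<inter> ?g -` E 1)" .
    have "(0, 0, ys) \<in> I \<times> UNIV \<inter> ?g -` E 1"
      using unstable_power_E1[OF ys, of n] I0 by simp
    from open_box3[OF o this] obtain e2 where e2: "e2 > 0"
      "\<forall>\<mu> x s. \<bar>\<mu> - 0\<bar> \<le> e2 \<longrightarrow> \<bar>x - 0\<bar> \<le> e2 \<longrightarrow> \<bar>s - ys\<bar> \<le> e2 \<longrightarrow> (\<mu>, x, s) \<in> I \<times> UNIV \<inter> ?g -` E 1"
      by blast
    show ?case
    proof (intro exI[of _ "min e1 e2"] conjI allI impI)
      fix i \<mu> x s assume "i < Suc n" and b: "\<bar>\<mu>\<bar> \<le> min e1 e2" "\<bar>x\<bar> \<le> min e1 e2" "\<bar>s - ys\<bar> \<le> min e1 e2"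
      then consider "i < n" | "i = n" by linarith
      then show "(\<mu>, vector [x, l \<mu> ^ Suc i * s]) \<in> E 1"
      proof cases
        case 1
        then show ?thesis using e1(2) b by simp
      next
        case 2
        have "(\<mu>, x, s) \<in> I \<times> UNIV \<inter> ?g -` E 1" using e2(2)[rule_format, of \<mu> x s] b by simp
        then show ?thesis using 2 by simp
      qed
    qed (use e1 e2 in auto)
  qed
  from this[of n0] obtain e2 where e2': "e2 > 0"
    "\<forall>i<n0. \<forall>\<mu> x s. \<bar>\<mu>\<bar> \<le> e2 \<longrightarrow> \<bar>x\<bar> \<le> e2 \<longrightarrow> \<bar>s - ys\<bar> \<le> e2 \<longrightarrow>
      (\<mu>, vector [x, l \<mu> ^ Suc i * s]) \<in> E 1" by (elim exE conjE)
  have e2: "e2 > 0"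
    "\<And>i \<mu> x s. i < n0 \<Longrightarrow> \<bar>\<mu>\<bar> \<le> e2 \<Longrightarrow> \<bar>x\<bar> \<le> e2 \<Longrightarrow> \<bar>s - ys\<bar> \<le> e2 \<Longrightarrow>
      (\<mu>, vector [x, l \<mu> ^ Suc i * s]) \<in> E 1"
    using e2'(1) by (simp, use e2'(2)[rule_format] in simp)
  define e where "e = min (min \<rho> (d / 2)) (min e2 1)"
  have e: "e > 0" "e \<le> \<rho>" "e < d" "e \<le> e2" "e \<le> 1" unfolding e_def using \<rho> d e2 by auto
  define K1 where "K1 = (\<lambda>u. (fst u, vector [fst (snd u), snd (snd u)]) :: real \<times> (real^2)) `
      ({-e..e} \<times> {-e..e} \<times> {-\<rho>..\<rho>})"
  define K2 where "K2 = (\<lambda>i. (\<lambda>u. (fst u, vector [fst (snd u), l (fst u) ^ Suc i * snd (snd u)]) :: real \<times> (real^2)) `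
      ({-e..e} \<times> {-e..e} \<times> {ys-e..ys+e}))"
  define K where "K = K1 \<union> (\<Union>i\<in>{..<n0}. K2 i)"
  have I: "\<mu> \<in> I" "l \<mu> < \<Lambda>" "0 < l \<mu>" if "\<bar>\<mu>\<bar> \<le> e" for \<mu>
    using d'[of \<mu>] that e l_bounds[of \<mu>] by auto
  have "compact K1" unfolding K1_def
    by (intro compact_continuous_image compact_Times compact_Icc continuous_intros)
  moreover have "compact (K2 i)" for i unfolding K2_def
  proof (intro compact_continuous_image compact_Times compact_Icc continuous_intros
      continuous_on_compose2[OF l_cont])
    show "fst ` ({- e..e} \<times> {- e..e} \<times> {ys - e..ys + e}) \<subseteq> I" using I by auto
  qed
  ultimately have cK: "compact K" unfolding K_def by (intro compact_Un compact_UN) auto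
  have KE: "K \<subseteq> E 1"
  proof -
    have "K1 \<subseteq> E 1" unfolding K1_def using \<rho>(2) e by auto
    moreover have "K2 i \<subseteq> E 1" if "i < n0" for i
      unfolding K2_def using e2(2)[OF that] e by (auto simp: abs_le_iff)
    ultimately show ?thesis unfolding K_def by auto
  qed
  have K1I: "(\<mu>, vector [x, y]) \<in> K" if "\<bar>\<mu>\<bar> \<le> e" "\<bar>x\<bar> \<le> e" "\<bar>y\<bar> \<le> \<rho>" for \<mu> x y
    unfolding K_def K1_def using that by (intro UnI1 image_eqI[of _ _ "(\<mu>, x, y)"]) auto
  have K2I: "(\<mu>, vector [x, l \<mu> ^ Suc i * s]) \<in> K" if "\<bar>\<mu>\<bar> \<le> e" "\<bar>x\<bar> \<le> e" "\<bar>s - ys\<bar> \<le> e" "i < n0" for \<mu> x s i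
    unfolding K_def K2_def using that
    by (intro UnI2 UN_I[of i] image_eqI[of _ _ "(\<mu>, x, s)"]) auto
  have KI: "(\<mu>, vector [x, l \<mu> ^ Suc i * s]) \<in> K" if *: "\<bar>\<mu>\<bar> \<le> e" "\<bar>x\<bar> \<le> e" "\<bar>s - ys\<bar> \<le> e" for \<mu> x s i
  proof (cases "i < n0")
    case False
    have "l \<mu> ^ Suc i \<le> l \<mu> ^ n0" using I[OF *(1)] \<Lambda> False by (intro power_decreasing) auto
    also have "\<dots> \<le> \<Lambda> ^ n0" using I[OF *(1)] by (intro power_mono) auto
    finally have "l \<mu> ^ Suc i * \<bar>s\<bar> \<le> \<Lambda> ^ n0 * (\<bar>ys\<bar> + 1)" using * e \<Lambda> by (intro mult_mono) auto
    then have "\<bar>l \<mu> ^ Suc i * s\<bar> \<le> \<rho>" using n0 I[OF *(1)] by (simp add: abs_mult)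
    then show ?thesis using K1I * by blast
  qed (use K2I * in blast)
  have bound: "\<exists>C\<ge>0. \<forall>\<mu> z. (\<mu>, z) \<in> K \<longrightarrow> \<bar>g \<mu> z\<bar> \<le> C" if "Ck_fibre_on k (E 1) g" for k and g :: "real \<Rightarrow> real^2 \<Rightarrow> real"
    using compact_bounded_real[OF cK continuous_on_subset[OF Ck_fibre_on_continuous[OF that] KE]]
    by auto
  obtain C1 where C1: "C1 \<ge> 0" "\<And>\<mu> z. (\<mu>, z) \<in> K \<Longrightarrow> \<bar>pd dx (pd dx (Tx 1)) \<mu> z\<bar> \<le> C1"
    using bound[OF pd2_component_Suc(1)] by blast
  obtain C2 where C2: "C2 \<ge> 0" "\<And>\<mu> z. (\<mu>, z) \<in> K \<Longrightarrow> \<bar>pd dx (pd dx (pd dy (Tx 1))) \<mu> z\<bar> \<le> C2"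
    using bound[OF pd3_component(1)] by blast
  obtain C3 where C3: "C3 \<ge> 0" "\<And>\<mu> z. (\<mu>, z) \<in> K \<Longrightarrow> \<bar>pd dx (pd dy (Ty 1)) \<mu> z\<bar> \<le> C3"
    using bound[OF pd2_component_Suc(2)] by blast
  obtain C4 where C4: "C4 \<ge> 0" "\<And>\<mu> z. (\<mu>, z) \<in> K \<Longrightarrow> \<bar>pd dy (pd dx (Ty 1)) \<mu> z\<bar> \<le> C4"
    using bound[OF pd2_component_Suc(2)] by blast
  obtain C5 where C5: "C5 \<ge> 0" "\<And>\<mu> z. (\<mu>, z) \<in> K \<Longrightarrow> \<bar>pd dx (Ty 1) \<mu> z\<bar> \<le> C5"
    using bound[OF pd_component_Suc(2)] by blast
  define C where "C = C1 + C2 + C3 + C4 + C5"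
  \<comment> \<open>The first two summands meet the demands of
    \<open>saddle_estimates_local\<close>, the last one makes the constant positive.\<close>
  define D where "D = C + C / \<rho> + 1"
  have C: "C \<ge> 0" unfolding C_def using C1 C2 C3 C4 C5 by simp
  have D: "D \<ge> C" "D \<ge> C / \<rho>" "D > 0" unfolding D_def using C \<rho> by (auto simp: add_nonneg_pos)
  show ?thesis
  proof (rule that[OF e(1) D(3)])
    fix \<mu> x s i assume *: "\<bar>\<mu>\<bar> \<le> e" "\<bar>x\<bar> \<le> e" "\<bar>s - ys\<bar> \<le> e"
    show "saddle_estimates D \<mu> (vector [x, l \<mu> ^ Suc i * s])"
    proof (rule saddle_estimates_local[OF C D(1,2) \<rho>(1) _ _ KE])
      show "(\<mu>, vector [t, l \<mu> ^ Suc i * s]) \<in> K" if "\<bar>t\<bar> \<le> \<bar>x\<bar>" for t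
        by (rule KI) (use that * in auto)
      show "(\<mu>, vector [t, y]) \<in> K" if "\<bar>l \<mu> ^ Suc i * s\<bar> \<le> \<rho>" "\<bar>t\<bar> \<le> \<bar>x\<bar>" "\<bar>y\<bar> \<le> \<bar>l \<mu> ^ Suc i * s\<bar>" for t y
        by (rule K1I) (use that * in linarith)+
      show "\<bar>pd dx (pd dx (Tx 1)) \<mu> z\<bar> \<le> C \<and>
        \<bar>pd dx (pd dx (pd dy (Tx 1))) \<mu> z\<bar> \<le> C \<and> \<bar>pd dx (pd dy (Ty 1)) \<mu> z\<bar> \<le> C \<and>
        \<bar>pd dy (pd dx (Ty 1)) \<mu> z\<bar> \<le> C \<and> \<bar>pd dx (Ty 1) \<mu> z\<bar> \<le> C" if "(\<mu>, z) \<in> K" for \<mu> z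
        using C1(2)[OF that] C2(2)[OF that] C3(2)[OF that] C4(2)[OF that] C5(2)[OF that]
          C1(1) C2(1) C3(1) C4(1) C5(1) unfolding C_def by linarith
    qed
  qed
qed

text \<open>The bootstrap of \<open>saddle_sequence\<close> with membership in \<open>E n\<close> as
  the condition \<open>Q n\<close>. The start \<open>t = l \<mu> ^ j * s\<close> on the diagonal is
  chosen such that the orbit has ordinate close to \<open>s\<close> after \<open>j\<close>
  steps.\<close>

lemma orbit_estimates:
  assumes est: "\<And>x s i. \<bar>x\<bar> \<le> e \<Longrightarrow> \<bar>s - ys\<bar> \<le> e \<Longrightarrow> saddle_estimates C \<mu> (vector [x, l \<mu> ^ Suc i * s])"
    and mu: "\<mu> \<in> I" and C: "C \<ge> 0" and K: "12 * C / l \<mu> \<le> K"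
    and j: "j > 0" and t: "t = l \<mu> ^ j * s" "\<bar>s - ys\<bar> \<le> e / 2" "2 * \<bar>t\<bar> \<le> e" "\<bar>t\<bar> \<le> 1"
      "real j * K * \<bar>t\<bar> \<le> 1" "real j * K * \<bar>t\<bar> * \<bar>s\<bar> \<le> e / 2"
    and v: "\<bar>v $ 1\<bar> = 1" "\<bar>v $ 2\<bar> = 1" and n: "n \<le> j"
  shows "(\<mu>, vector [t, t]) \<in> E n \<and> \<bar>Tx n \<mu> (vector [t, t]) / l \<mu> ^ n - t\<bar> \<le> real n * K * t\<^sup>2 \<and>
    \<bar>l \<mu> ^ n * Ty n \<mu> (vector [t, t]) - t\<bar> \<le> real n * K * t\<^sup>2 \<and>
    \<bar>DT n \<mu> (vector [t, t]) v $ 1 / l \<mu> ^ n - v $ 1\<bar> \<le> real n * K * \<bar>t\<bar> \<and>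
    \<bar>l \<mu> ^ n * DT n \<mu> (vector [t, t]) v $ 2 - v $ 2\<bar> \<le> real n * K * \<bar>t\<bar>"
proof -
  let ?z = "vector [t, t] :: real^2"
  note l = l_bounds[OF mu]
  have K0: "K \<ge> 0" using K C l by (smt (verit) divide_nonneg_pos)
  have e: "e \<ge> 0" using t(2) by linarith
  have "saddle_estimates C \<mu> (vector [t, l \<mu> ^ Suc (j - 1) * s])" by (rule est) (use t e in linarith)+
  then have "(\<mu>, ?z) \<in> E 1" unfolding saddle_estimates_def using j t(1) by simp
  then have z0: "(\<mu>, ?z) \<in> E 0" using E_subset by blast
  have "(\<mu>, ?z) \<in> E n \<and> \<bar>Tx n \<mu> ?z / l \<mu> ^ n - t\<bar> \<le> real n * K * t\<^sup>2 \<and>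
    \<bar>l \<mu> ^ n * Ty n \<mu> ?z - t\<bar> \<le> real n * K * t\<^sup>2 \<and>
    \<bar>DT n \<mu> ?z v $ 1 / l \<mu> ^ n - DT 0 \<mu> ?z v $ 1\<bar> \<le> real n * K * \<bar>t\<bar> \<and>
    \<bar>l \<mu> ^ n * DT n \<mu> ?z v $ 2 - DT 0 \<mu> ?z v $ 2\<bar> \<le> real n * K * \<bar>t\<bar>"
  proof (rule saddle_sequence[OF l(1) less_imp_le[OF l(2)] C K t(4,5)])
    show "Tx 0 \<mu> ?z = t" "Ty 0 \<mu> ?z = t" by (simp_all add: Tx_def Ty_def T_zero[OF z0])
    show "\<bar>DT 0 \<mu> ?z v $ 1\<bar> = 1" "\<bar>DT 0 \<mu> ?z v $ 2\<bar> = 1" using v by (simp_all add: DT_zero[OF z0])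
    show "(\<mu>, ?z) \<in> E 0" by (rule z0)
    show "n \<le> j" by (rule n)
    fix n assume n: "n < j" and En: "(\<mu>, ?z) \<in> E n"
      and b: "\<bar>Tx n \<mu> ?z / l \<mu> ^ n - t\<bar> \<le> real n * K * t\<^sup>2" "\<bar>l \<mu> ^ n * Ty n \<mu> ?z - t\<bar> \<le> real n * K * t\<^sup>2"
    have nj: "real n * K * t\<^sup>2 \<le> real j * K * \<bar>t\<bar> * \<bar>t\<bar>"
    proof -
      have "real n * K * t\<^sup>2 \<le> real j * K * t\<^sup>2" using n K0 by (intro mult_right_mono) auto
      then show ?thesis using abs_mult_self[of t] by (simp add: power2_eq_square mult.assoc)
    qed
    have nt: "real n * K * t\<^sup>2 \<le> \<bar>t\<bar>" using nj mult_right_mono[OF t(5), of "\<bar>t\<bar>"] by linarith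
    have x: "\<bar>Tx n \<mu> ?z\<bar> \<le> e"
    proof -
      have "\<bar>Tx n \<mu> ?z / l \<mu> ^ n\<bar> \<le> 2 * \<bar>t\<bar>" using b(1) nt by linarith
      then have "\<bar>Tx n \<mu> ?z\<bar> \<le> 2 * \<bar>t\<bar> * l \<mu> ^ n" using l by (simp add: abs_divide pos_divide_le_eq)
      also have "\<dots> \<le> 2 * \<bar>t\<bar>" using l by (intro mult_left_le) (auto simp: power_le_one)
      finally show ?thesis using t(3) by simp
    qed
    \<comment> \<open>Brings the orbit into the region covered by \<open>saddle_bounds\<close>: at
      time \<open>n\<close> the ordinate is \<open>l \<mu> ^ (j - n) * s'\<close>, with exponent at
      least 1 because of \<open>n < j\<close>, and \<open>s'\<close> differs from \<open>s\<close>
      by at most \<open>j * K * \<bar>t\<bar> * \<bar>s\<bar>\<close>.\<close>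
    define s' where "s' = l \<mu> ^ n * Ty n \<mu> ?z / l \<mu> ^ j"
    have y: "Ty n \<mu> ?z = l \<mu> ^ Suc (j - n - 1) * s'"
    proof -
      have "l \<mu> ^ j = l \<mu> ^ n * l \<mu> ^ Suc (j - n - 1)" 
        unfolding power_add[symmetric] using n by (intro arg_cong[where f = "\<lambda>i. l \<mu> ^ i"]) arith
      then show ?thesis unfolding s'_def using l by simp
    qed
    have s': "\<bar>s' - ys\<bar> \<le> e"
    proof -
      have "s' - s = (l \<mu> ^ n * Ty n \<mu> ?z - t) / l \<mu> ^ j" unfolding s'_def t(1) using l by (simp add: field_simps)
      then have "\<bar>s' - s\<bar> = \<bar>l \<mu> ^ n * Ty n \<mu> ?z - t\<bar> / l \<mu> ^ j" using l by (simp add: abs_divide)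
      also have "\<dots> \<le> (real j * K * \<bar>t\<bar> * \<bar>t\<bar>) / l \<mu> ^ j" using b(2) nj l by (intro divide_right_mono) auto
      also have "\<bar>t\<bar> = l \<mu> ^ j * \<bar>s\<bar>" unfolding t(1) using l by (simp add: abs_mult)
      finally have "\<bar>s' - s\<bar> \<le> real j * K * \<bar>t\<bar> * \<bar>s\<bar>"
        unfolding \<open>\<bar>t\<bar> = l \<mu> ^ j * \<bar>s\<bar>\<close> using l by (simp add: mult_ac)
      then show ?thesis using t(2,6) by linarith
    qed
    have Tn: "T n \<mu> ?z = vector [Tx n \<mu> ?z, l \<mu> ^ Suc (j - n - 1) * s']"
      unfolding y[symmetric] by (simp add: Tx_def Ty_def)
    have se: "saddle_estimates C \<mu> (T n \<mu> ?z)" unfolding Tn by (rule est[OF x s'])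
    then have E1: "(\<mu>, T n \<mu> ?z) \<in> E 1" unfolding saddle_estimates_def by blast
    have ES: "(\<mu>, ?z) \<in> E (Suc n)" using E_add[OF En, of 1] E1 by (simp add: plus_1_eq_Suc)
    have TS: "T (Suc n) \<mu> ?z = T 1 \<mu> (T n \<mu> ?z)" using T_add[OF En, of 1] by (simp add: plus_1_eq_Suc)
    have DS: "DT (Suc n) \<mu> ?z v = DT 1 \<mu> (T n \<mu> ?z) (DT n \<mu> ?z v)" using DT_add[OF En E1] by (simp add: plus_1_eq_Suc)
    show "(\<mu>, ?z) \<in> E (Suc n) \<and>
      \<bar>Tx (Suc n) \<mu> ?z - l \<mu> * Tx n \<mu> ?z\<bar> \<le> C * (Tx n \<mu> ?z)\<^sup>2 \<and>
      \<bar>Ty (Suc n) \<mu> ?z - Ty n \<mu> ?z / l \<mu>\<bar> \<le> C * \<bar>Tx n \<mu> ?z\<bar> * \<bar>Ty n \<mu> ?z\<bar> \<and>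
      \<bar>DT (Suc n) \<mu> ?z v $ 1 - l \<mu> * DT n \<mu> ?z v $ 1\<bar>
        \<le> C * \<bar>Tx n \<mu> ?z\<bar> * \<bar>DT n \<mu> ?z v $ 1\<bar> + C * (Tx n \<mu> ?z)\<^sup>2 * \<bar>DT n \<mu> ?z v $ 2\<bar> \<and>
      \<bar>DT (Suc n) \<mu> ?z v $ 2 - DT n \<mu> ?z v $ 2 / l \<mu>\<bar>
        \<le> C * \<bar>Tx n \<mu> ?z\<bar> * \<bar>DT n \<mu> ?z v $ 2\<bar> + C * \<bar>Ty n \<mu> ?z\<bar> * \<bar>DT n \<mu> ?z v $ 1\<bar>"
      using se ES unfolding saddle_estimates_def DS Tx_def Ty_def TS by blast
  qed
  then show ?thesis by (simp add: DT_zero[OF z0])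
qed

end

subsection \<open>Symmetric arcs\<close>

context reversible_family
begin

text \<open>
  \<open>(g, 1)\<close> and \<open>(- k, 1)\<close> are the directions into which the derivative of \<open>T\<^sub>0\<^sup>j\<close> takes the eigenvectors
  \<open>(1, 1)\<close> and \<open>(1, -1)\<close> of the reflection; the first one is tangent to the arc.
\<close>

definition symmetric_arc ::
  "real \<Rightarrow> real \<Rightarrow> real \<Rightarrow> nat \<Rightarrow> (real \<Rightarrow> real \<Rightarrow> real) \<Rightarrow> (real \<Rightarrow> real \<Rightarrow> real) \<Rightarrow>
    (real \<Rightarrow> real \<Rightarrow> real) \<Rightarrow> (real \<Rightarrow> real \<Rightarrow> real) \<Rightarrow> bool" where
  "symmetric_arc ys \<sigma> \<delta> j \<gamma> \<tau> g k \<longleftrightarrow>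
     continuous_on ({-\<sigma>..\<sigma>} \<times> {ys-\<sigma>..ys+\<sigma>}) (\<lambda>(\<mu>, s). \<gamma> \<mu> s) \<and>
     (\<forall>\<mu> s. \<bar>\<mu>\<bar> \<le> \<sigma> \<longrightarrow> \<bar>s - ys\<bar> \<le> \<sigma> \<longrightarrow>
       (\<forall>n\<le>j. (\<mu>, vector [\<tau> \<mu> s, \<tau> \<mu> s]) \<in> E n) \<and>
       T j \<mu> (vector [\<tau> \<mu> s, \<tau> \<mu> s]) = vector [\<gamma> \<mu> s, s] \<and>
       DERIV (\<gamma> \<mu>) s :> g \<mu> s \<and> \<bar>\<gamma> \<mu> s\<bar> \<le> \<delta> \<and>
       \<bar>g \<mu> s - l \<mu> ^ (2 * j)\<bar> \<le> \<delta> * l \<mu> ^ (2 * j) \<and>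
       \<bar>k \<mu> s - l \<mu> ^ (2 * j)\<bar> \<le> \<delta> * l \<mu> ^ (2 * j) \<and>
       (\<exists>a b. a \<noteq> 0 \<and> b \<noteq> 0 \<and>
         DT j \<mu> (vector [\<tau> \<mu> s, \<tau> \<mu> s]) (vector [1, 1]) = a *\<^sub>R vector [g \<mu> s, 1] \<and>
         DT j \<mu> (vector [\<tau> \<mu> s, \<tau> \<mu> s]) (vector [1, -1]) = b *\<^sub>R vector [- k \<mu> s, 1]))"

lemma quotient_near_one:
  fixes U V :: real
  assumes "\<bar>U - 1\<bar> \<le> a" "\<bar>V - 1\<bar> \<le> a" "a \<le> 1 / 2"
  shows "V > 0" "\<bar>U / V - 1\<bar> \<le> 4 * a"
proof -
  have V: "V \<ge> 1 / 2" using assms by linarith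
  then show "V > 0" by simp
  have "U / V - 1 = (U - V) / V" using V by (simp add: diff_divide_distrib)
  then have "\<bar>U / V - 1\<bar> = \<bar>U - V\<bar> / V" using V by simp
  also have "\<dots> \<le> (2 * a) / (1 / 2)" using assms V by (intro frac_le) auto
  finally show "\<bar>U / V - 1\<bar> \<le> 4 * a" by simp
qed

lemma diagonal_DERIV:
  assumes "(\<mu>, vector [c * s, c * s]) \<in> E j"
  shows "DERIV (\<lambda>s. Tx j \<mu> (vector [c * s, c * s])) s :> c * DT j \<mu> (vector [c * s, c * s]) (vector [1, 1]) $ 1"
    "DERIV (\<lambda>s. Ty j \<mu> (vector [c * s, c * s])) s :> c * DT j \<mu> (vector [c * s, c * s]) (vector [1, 1]) $ 2"
proof -
  let ?D = "DT j \<mu> (vector [c * s, c * s])"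
  have e: "vector [c * s, c * s] = (c * s) *\<^sub>R (vector [1, 1] :: real^2)" for s
    by (simp add: vec2_eq_iff)
  have "((\<lambda>s. vector [c * s, c * s] :: real^2) has_derivative (\<lambda>h. (c * h) *\<^sub>R vector [1, 1])) (at s)"
    unfolding e by (auto intro!: derivative_eq_intros)
  from has_derivative_compose[OF this T_has_derivative[OF assms]]
  have d: "((\<lambda>s. T j \<mu> (vector [c * s, c * s])) has_derivative (\<lambda>h. (c * h) *\<^sub>R ?D (vector [1, 1]))) (at s)"
    by (simp add: linear_scale[OF DT_linear[OF assms]])
  show "DERIV (\<lambda>s. Tx j \<mu> (vector [c * s, c * s])) s :> c * ?D (vector [1, 1]) $ 1"
    unfolding Tx_def has_field_derivative_def
    by (rule has_derivative_eq_rhs[OF bounded_linear.has_derivative[OF bounded_linear_vec_nth d]])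
      (simp add: fun_eq_iff)
  show "DERIV (\<lambda>s. Ty j \<mu> (vector [c * s, c * s])) s :> c * ?D (vector [1, 1]) $ 2"
    unfolding Ty_def has_field_derivative_def
    by (rule has_derivative_eq_rhs[OF bounded_linear.has_derivative[OF bounded_linear_vec_nth d]])
      (simp add: fun_eq_iff)
qed

text \<open>The diagonal point at height \<open>l \<mu> ^ j * s\<close> arrives with an ordinate
  that increases with \<open>s\<close> and is close to it, so the image of the diagonal can be
  parametrised by the ordinate. Its tangent is \<open>(u, v)\<close> with \<open>u\<close> close to
  \<open>l \<mu> ^ j\<close> and \<open>v\<close> close to the inverse of that, whence the slope
  close to \<open>l \<mu> ^ (2 * j)\<close>. The width \<sigma> is fixed before the accuracy
  \<delta>, because \<delta> will later be chosen in dependence on the width.\<close>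

lemma symmetric_arc_exists:
  assumes I0: "0 \<in> I" and ys: "(0, vector [0, ys]) \<in> E 0"
  obtains \<sigma> where "\<sigma> > 0" "\<And>\<mu>. \<bar>\<mu>\<bar> \<le> \<sigma> \<Longrightarrow> \<mu> \<in> I"
    "\<And>\<delta>. \<delta> > 0 \<Longrightarrow> \<exists>J. \<forall>j\<ge>J. \<exists>\<gamma> \<tau> g k. symmetric_arc ys \<sigma> \<delta> j \<gamma> \<tau> g k"
proof -
  obtain e C where e: "e > 0" and C: "C > 0" and est: "\<And>\<mu> x s i. \<bar>\<mu>\<bar> \<le> e \<Longrightarrow> \<bar>x\<bar> \<le> e \<Longrightarrow> \<bar>s - ys\<bar> \<le> e \<Longrightarrow>
      saddle_estimates C \<mu> (vector [x, l \<mu> ^ Suc i * s])"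
    using saddle_bounds[OF I0 ys] by (metis (no_types, lifting))
  define L1 L2 where "L1 = l 0 / 2" and "L2 = (1 + l 0) / 2"
  have L: "0 < L1" "0 < L2" "L2 < 1" "L1 < l 0" "l 0 < L2"
    using l_bounds[OF I0] unfolding L1_def L2_def by auto
  have "open (I \<inter> l -` {L1<..<L2})"
    by (rule continuous_open_preimage[OF l_cont open_I open_greaterThanLessThan])
  moreover have "0 \<in> I \<inter> l -` {L1<..<L2}" using I0 L by simp
  ultimately obtain d where d: "d > 0" "ball 0 d \<subseteq> I \<inter> l -` {L1<..<L2}"
    using open_contains_ball_eq by blast
  define \<sigma> where "\<sigma> = min (e / 4) (d / 2)"
  have \<sigma>: "\<sigma> > 0" "\<sigma> \<le> e / 4" "\<sigma> < d" using e d unfolding \<sigma>_def by auto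
  have lI: "\<mu> \<in> I" "L1 < l \<mu>" "l \<mu> < L2" if "\<bar>\<mu>\<bar> \<le> \<sigma>" for \<mu>
  proof -
    have "\<mu> \<in> ball 0 d" using that \<sigma> by simp
    then show "\<mu> \<in> I" "L1 < l \<mu>" "l \<mu> < L2" using d(2) by auto
  qed
  define K where "K = 12 * C / L1"
  define S where "S = \<bar>ys\<bar> + e"
  have K: "K > 0" and S: "S > 0" using C L e unfolding K_def S_def by auto
  show ?thesis
  proof (rule that[OF \<sigma>(1) lI(1)])
    fix \<delta> :: real assume \<delta>: "\<delta> > 0"
    \<comment> \<open>The entries \<open>\<delta> / 4\<close> and \<open>1 / 2\<close> are for
      \<open>quotient_near_one\<close>, \<open>e / (8 * S)\<close> keeps the arriving ordinate
      within \<open>e / 8\<close> of \<open>s\<close>, and \<open>e\<close> limits the starting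
      height.\<close>
    define a where "a = min (min (\<delta> / 4) (1 / 2)) (min (e / (8 * S)) e)"
    have a: "a > 0" "4 * a \<le> \<delta>" "a \<le> 1 / 2" "a * S \<le> e / 8" "a \<le> e"
    proof -
      show "a > 0" "4 * a \<le> \<delta>" "a \<le> 1 / 2" "a \<le> e" unfolding a_def using \<delta> e S by auto
      have "a \<le> e / (8 * S)" unfolding a_def by simp
      then show "a * S \<le> e / 8" using S by (simp add: pos_le_divide_eq mult_ac)
    qed
    \<comment> \<open>The errors accumulated in \<open>j\<close> steps are at most
      \<open>j * K * \<bar>t\<bar>\<close>, and \<open>t\<close> decays like \<open>L2 ^ j\<close>,
      uniformly in \<mu>.\<close>
    have "(\<lambda>j. K * S * (real j * L2 ^ j) + 2 * S * L2 ^ j) \<longlonglongrightarrow> K * S * 0 + 2 * S * 0"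
      using L by (intro tendsto_intros powser_times_n_limit_0 LIMSEQ_realpow_zero) auto
    then have "eventually (\<lambda>j. K * S * (real j * L2 ^ j) + 2 * S * L2 ^ j < a) sequentially"
      using a by (simp add: order_tendstoD(2))
    then obtain J where J: "\<And>j. j \<ge> J \<Longrightarrow> K * S * (real j * L2 ^ j) + 2 * S * L2 ^ j < a"
      unfolding eventually_sequentially by blast
    show "\<exists>J. \<forall>j\<ge>J. \<exists>\<gamma> \<tau> g k. symmetric_arc ys \<sigma> \<delta> j \<gamma> \<tau> g k"
    proof (intro exI[of _ "Suc J"] allI impI)
      fix j assume "j \<ge> Suc J"
      then have j: "j > 0" "j \<ge> J" by auto
      have "0 \<le> K * S * (real j * L2 ^ j)" "0 \<le> 2 * S * L2 ^ j" using K S L by simp_all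
      then have Ja: "K * S * (real j * L2 ^ j) \<le> a" "2 * S * L2 ^ j \<le> a" using J[OF j(2)] by linarith+
      define Z :: "real \<Rightarrow> real \<Rightarrow> real^2" where "Z = (\<lambda>\<mu> s. vector [l \<mu> ^ j * s, l \<mu> ^ j * s])"
      define u v u' v' where "u = (\<lambda>\<mu> s. DT j \<mu> (Z \<mu> s) (vector [1, 1]) $ 1)"
        and "v = (\<lambda>\<mu> s. DT j \<mu> (Z \<mu> s) (vector [1, 1]) $ 2)"
        and "u' = (\<lambda>\<mu> s. DT j \<mu> (Z \<mu> s) (vector [1, -1]) $ 1)"
        and "v' = (\<lambda>\<mu> s. DT j \<mu> (Z \<mu> s) (vector [1, -1]) $ 2)"
      have facts: "(\<forall>n\<le>j. (\<mu>, Z \<mu> s) \<in> E n) \<and> \<bar>Tx j \<mu> (Z \<mu> s)\<bar> \<le> \<delta> \<and> \<bar>Ty j \<mu> (Z \<mu> s) - s\<bar> \<le> e / 8 \<and>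
        \<bar>u \<mu> s / l \<mu> ^ j - 1\<bar> \<le> a \<and> \<bar>l \<mu> ^ j * v \<mu> s - 1\<bar> \<le> a \<and>
        \<bar>u' \<mu> s / l \<mu> ^ j - 1\<bar> \<le> a \<and> \<bar>l \<mu> ^ j * v' \<mu> s + 1\<bar> \<le> a"
        if \<mu>: "\<bar>\<mu>\<bar> \<le> \<sigma>" and s: "\<bar>s - ys\<bar> \<le> e / 2" for \<mu> s
      proof -
        define t where "t = l \<mu> ^ j * s"
        note l = lI[OF \<mu>]
        have l1: "0 < l \<mu>" "l \<mu> < 1" using l L by linarith+
        have sS: "\<bar>s\<bar> \<le> S" using s e unfolding S_def by linarith
        have tb: "\<bar>t\<bar> \<le> L2 ^ j * S"
          unfolding t_def abs_mult using l l1 sS L by (intro mult_mono) (auto intro: power_mono)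
        have jK: "real j * K * \<bar>t\<bar> \<le> a"
        proof -
          have "real j * K * \<bar>t\<bar> \<le> real j * K * (L2 ^ j * S)" using tb K by (intro mult_left_mono) auto
          then show ?thesis using Ja(1) by (simp add: mult_ac)
        qed
        have t2: "2 * \<bar>t\<bar> \<le> a" using tb Ja(2) by (simp add: mult_ac)
        have jKs: "real j * K * \<bar>t\<bar> * \<bar>s\<bar> \<le> e / 8"
        proof -
          have "real j * K * \<bar>t\<bar> * \<bar>s\<bar> \<le> a * S" using jK sS a(1) by (intro mult_mono) auto
          then show ?thesis using a(4) by linarith
        qed
        have KK: "12 * C / l \<mu> \<le> K" unfolding K_def using l L C by (intro divide_left_mono) auto
        have est': "\<And>x s i. \<bar>x\<bar> \<le> e \<Longrightarrow> \<bar>s - ys\<bar> \<le> e \<Longrightarrow> saddle_estimates C \<mu> (vector [x, l \<mu> ^ Suc i * s])"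
          by (rule est) (use \<mu> \<sigma> e in auto)
        have b: "2 * \<bar>t\<bar> \<le> e" "\<bar>t\<bar> \<le> 1" "real j * K * \<bar>t\<bar> \<le> 1" "real j * K * \<bar>t\<bar> * \<bar>s\<bar> \<le> e / 2"
          using t2 jK jKs a e by linarith+
        note oe = orbit_estimates[OF est' l(1) less_imp_le[OF C] KK j(1) t_def s b]
        have Zt: "Z \<mu> s = vector [t, t]" unfolding Z_def t_def ..
        have o1: "(\<mu>, Z \<mu> s) \<in> E n \<and> \<bar>Tx n \<mu> (Z \<mu> s) / l \<mu> ^ n - t\<bar> \<le> real n * K * t\<^sup>2 \<and>
            \<bar>l \<mu> ^ n * Ty n \<mu> (Z \<mu> s) - t\<bar> \<le> real n * K * t\<^sup>2 \<and>
            \<bar>DT n \<mu> (Z \<mu> s) (vector [1, 1]) $ 1 / l \<mu> ^ n - 1\<bar> \<le> real n * K * \<bar>t\<bar> \<and>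
            \<bar>l \<mu> ^ n * DT n \<mu> (Z \<mu> s) (vector [1, 1]) $ 2 - 1\<bar> \<le> real n * K * \<bar>t\<bar>" if "n \<le> j" for n
          using oe[of "vector [1, 1]" n] that unfolding Zt by simp
        have o2: "\<bar>DT j \<mu> (Z \<mu> s) (vector [1, -1]) $ 1 / l \<mu> ^ j - 1\<bar> \<le> real j * K * \<bar>t\<bar> \<and>
            \<bar>l \<mu> ^ j * DT j \<mu> (Z \<mu> s) (vector [1, -1]) $ 2 + 1\<bar> \<le> real j * K * \<bar>t\<bar>"
          using oe[of "vector [1, -1]" j] unfolding Zt by simp
        note oj = o1[OF order_refl]
        have jt: "real j * K * t\<^sup>2 = real j * K * \<bar>t\<bar> * \<bar>t\<bar>"
          using abs_mult_self[of t] by (simp add: power2_eq_square mult.assoc)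
        have "\<bar>Tx j \<mu> (Z \<mu> s)\<bar> \<le> \<delta>"
        proof -
          have "real j * K * \<bar>t\<bar> * \<bar>t\<bar> \<le> \<bar>t\<bar>" using mult_right_mono[OF b(3), of "\<bar>t\<bar>"] by linarith
          then have "\<bar>Tx j \<mu> (Z \<mu> s) / l \<mu> ^ j\<bar> \<le> 2 * \<bar>t\<bar>" using oj jt by linarith
          then have "\<bar>Tx j \<mu> (Z \<mu> s)\<bar> \<le> 2 * \<bar>t\<bar> * l \<mu> ^ j" using l1 by (simp add: abs_divide pos_divide_le_eq)
          also have "\<dots> \<le> 2 * \<bar>t\<bar>" using l1 by (intro mult_left_le) (auto simp: power_le_one)
          finally show ?thesis using t2 a by linarith
        qed
        moreover have "\<bar>Ty j \<mu> (Z \<mu> s) - s\<bar> \<le> e / 8"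
        proof -
          have "Ty j \<mu> (Z \<mu> s) - s = (l \<mu> ^ j * Ty j \<mu> (Z \<mu> s) - t) / l \<mu> ^ j"
            unfolding t_def using l1 by (simp add: field_simps)
          then have "\<bar>Ty j \<mu> (Z \<mu> s) - s\<bar> = \<bar>l \<mu> ^ j * Ty j \<mu> (Z \<mu> s) - t\<bar> / l \<mu> ^ j"
            using l1 by (simp add: abs_divide)
          also have "\<dots> \<le> (real j * K * \<bar>t\<bar> * \<bar>t\<bar>) / l \<mu> ^ j"
            using oj l1 unfolding jt by (intro divide_right_mono) auto
          also have "(real j * K * \<bar>t\<bar> * \<bar>t\<bar>) / l \<mu> ^ j = real j * K * \<bar>t\<bar> * \<bar>s\<bar>"
            using l1 by (simp add: t_def abs_mult)
          finally show ?thesis using jKs by linarith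
        qed
        moreover have "\<forall>n\<le>j. (\<mu>, Z \<mu> s) \<in> E n" using o1 by blast
        moreover have "\<bar>u \<mu> s / l \<mu> ^ j - 1\<bar> \<le> a" "\<bar>l \<mu> ^ j * v \<mu> s - 1\<bar> \<le> a"
          "\<bar>u' \<mu> s / l \<mu> ^ j - 1\<bar> \<le> a" "\<bar>l \<mu> ^ j * v' \<mu> s + 1\<bar> \<le> a"
          using oj o2 jK unfolding u_def v_def u'_def v'_def by (meson order_trans)+
        ultimately show ?thesis by blast
      qed
      define Q where "Q = {-\<sigma>..\<sigma>} \<times> {ys - e / 2..ys + e / 2}"
      have Qmem: "(\<mu>, s) \<in> Q \<longleftrightarrow> \<bar>\<mu>\<bar> \<le> \<sigma> \<and> \<bar>s - ys\<bar> \<le> e / 2" for \<mu> s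
        unfolding Q_def mem_Times_iff fst_conv snd_conv atLeastAtMost_iff by linarith
      have cT: "continuous_on Q (\<lambda>x. T j (fst x) (Z (fst x) (snd x)))"
      proof -
        have c: "continuous_on Q (\<lambda>x. (fst x, Z (fst x) (snd x)))" unfolding Z_def
          by (intro continuous_intros continuous_on_compose2[OF l_cont]) (use Qmem lI in auto)
        have "(\<lambda>x. (fst x, Z (fst x) (snd x))) ` Q \<subseteq> E j" using facts Qmem by auto
        from continuous_on_compose2[OF Ck_fibre_on_continuous[OF T_smooth] c this]
        show ?thesis by (simp add: case_prod_unfold)
      qed
      have cX: "continuous_on Q (\<lambda>x. Tx j (fst x) (Z (fst x) (snd x)))"
        and cY: "continuous_on Q (\<lambda>x. Ty j (fst x) (Z (fst x) (snd x)))"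
        unfolding Tx_def Ty_def by (intro continuous_intros cT)+
      have DX: "DERIV (\<lambda>s. Tx j \<mu> (Z \<mu> s)) s :> l \<mu> ^ j * u \<mu> s"
        and DY: "DERIV (\<lambda>s. Ty j \<mu> (Z \<mu> s)) s :> l \<mu> ^ j * v \<mu> s"
        if "\<bar>\<mu>\<bar> \<le> \<sigma>" "\<bar>s - ys\<bar> \<le> e / 2" for \<mu> s
        using facts[OF that] diagonal_DERIV[of \<mu> "l \<mu> ^ j" s j] unfolding Z_def u_def v_def by blast+
      have pos: "l \<mu> ^ j * v \<mu> s > 0" if "\<bar>\<mu>\<bar> \<le> \<sigma>" "\<bar>s - ys\<bar> \<le> e / 2" for \<mu> s
        using facts[OF that] a by linarith
      \<comment> \<open>Inverting in \<mu> and \<open>s\<close> at once, on a compact rectangle,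
        yields an inverse that is continuous in both variables; an inversion for each \<mu>
        separately would not.\<close>
      define H where "H = (\<lambda>x. (fst x, Ty j (fst x) (Z (fst x) (snd x))))"
      have cH: "continuous_on Q H" unfolding H_def by (intro continuous_intros cY)
      have inj: "inj_on H Q"
      proof (rule inj_onI)
        have mono: "Ty j \<mu> (Z \<mu> s1) < Ty j \<mu> (Z \<mu> s2)"
          if "\<bar>\<mu>\<bar> \<le> \<sigma>" "\<bar>s1 - ys\<bar> \<le> e / 2" "\<bar>s2 - ys\<bar> \<le> e / 2" "s1 < s2" for \<mu> s1 s2
        proof (rule DERIV_pos_imp_increasing[OF that(4)])
          fix x assume "s1 \<le> x" "x \<le> s2"
          then have "\<bar>x - ys\<bar> \<le> e / 2" using that by linarith
          then show "\<exists>y. DERIV (\<lambda>s. Ty j \<mu> (Z \<mu> s)) x :> y \<and> y > 0" using DY pos that(1) by blast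
        qed
        fix x y assume "x \<in> Q" "y \<in> Q" and eq: "H x = H y"
        then obtain \<mu> s1 s2 where xy: "x = (\<mu>, s1)" "y = (\<mu>, s2)" by (cases x, cases y) (auto simp: H_def)
        have "\<not> s1 < s2" "\<not> s2 < s1"
          using mono[of \<mu> s1 s2] mono[of \<mu> s2 s1] eq \<open>x \<in> Q\<close> \<open>y \<in> Q\<close> unfolding xy Qmem H_def by auto
        then show "x = y" unfolding xy by simp
      qed
      have cQ: "compact Q" unfolding Q_def by (intro compact_Times compact_Icc)
      define G where "G = inv_into Q H"
      have cG: "continuous_on (H ` Q) G" unfolding G_def
        by (rule continuous_on_inv[OF cH cQ]) (use inv_into_f_f[OF inj] in blast)
      \<comment> \<open>The parameter runs over \<open>e / 2\<close> to either side and the ordinate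
        deviates from it by at most \<open>e / 8\<close>, so all ordinates within
        \<open>3 * e / 8\<close> are attained. As \<sigma> is at most \<open>e / 4\<close>, a margin
        remains for differentiating the inverse.\<close>
      have HQ: "(\<mu>, s) \<in> H ` Q" if m: "\<bar>\<mu>\<bar> \<le> \<sigma>" and s: "\<bar>s - ys\<bar> \<le> 3 * e / 8" for \<mu> s
      proof -
        have b1: "\<bar>Ty j \<mu> (Z \<mu> (ys - e / 2)) - (ys - e / 2)\<bar> \<le> e / 8"
          using facts[OF m, of "ys - e / 2"] e by simp
        have b2: "\<bar>Ty j \<mu> (Z \<mu> (ys + e / 2)) - (ys + e / 2)\<bar> \<le> e / 8"
          using facts[OF m, of "ys + e / 2"] e by simp
        have "\<exists>x. ys - e / 2 \<le> x \<and> x \<le> ys + e / 2 \<and> Ty j \<mu> (Z \<mu> x) = s"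
        proof (rule IVT)
          show "Ty j \<mu> (Z \<mu> (ys - e / 2)) \<le> s" "s \<le> Ty j \<mu> (Z \<mu> (ys + e / 2))" "ys - e / 2 \<le> ys + e / 2"
            using b1 b2 s e by linarith+
          show "\<forall>x. ys - e / 2 \<le> x \<and> x \<le> ys + e / 2 \<longrightarrow> isCont (\<lambda>x. Ty j \<mu> (Z \<mu> x)) x"
          proof clarify
            fix x assume "ys - e / 2 \<le> x" "x \<le> ys + e / 2"
            then have "\<bar>x - ys\<bar> \<le> e / 2" by linarith
            from DERIV_isCont[OF DY[OF m this]] show "isCont (\<lambda>x. Ty j \<mu> (Z \<mu> x)) x" .
          qed
        qed
        then obtain x where x: "ys - e / 2 \<le> x" "x \<le> ys + e / 2" "Ty j \<mu> (Z \<mu> x) = s" by blast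
        have "(\<mu>, x) \<in> Q" unfolding Qmem using m x by linarith
        then show ?thesis using x(3) by (intro image_eqI[of _ _ "(\<mu>, x)"]) (auto simp: H_def)
      qed
      define p where "p = (\<lambda>\<mu> s. snd (G (\<mu>, s)))"
      have p: "\<bar>p \<mu> s - ys\<bar> \<le> e / 2" "Ty j \<mu> (Z \<mu> (p \<mu> s)) = s" "G (\<mu>, s) = (\<mu>, p \<mu> s)"
        if m: "\<bar>\<mu>\<bar> \<le> \<sigma>" and s: "\<bar>s - ys\<bar> \<le> 3 * e / 8" for \<mu> s
      proof -
        have "G (\<mu>, s) \<in> Q" "H (G (\<mu>, s)) = (\<mu>, s)"
          unfolding G_def using inv_into_into[OF HQ[OF m s]] f_inv_into_f[OF HQ[OF m s]] by auto
        moreover from this(2) have "fst (G (\<mu>, s)) = \<mu>" unfolding H_def by simp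
        ultimately show "\<bar>p \<mu> s - ys\<bar> \<le> e / 2" "Ty j \<mu> (Z \<mu> (p \<mu> s)) = s" "G (\<mu>, s) = (\<mu>, p \<mu> s)"
          unfolding p_def H_def using Qmem[of \<mu> "snd (G (\<mu>, s))"] by (metis prod.collapse, simp, simp add: prod_eq_iff)
      qed
      have Dp: "DERIV (p \<mu>) s :> inverse (l \<mu> ^ j * v \<mu> (p \<mu> s))"
        if m: "\<bar>\<mu>\<bar> \<le> \<sigma>" and s: "\<bar>s - ys\<bar> \<le> \<sigma>" for \<mu> s
      proof (rule DERIV_inverse_function[where f = "\<lambda>s. Ty j \<mu> (Z \<mu> s)" and a = "ys - 3 * e / 8" and b = "ys + 3 * e / 8"])
        have s3: "\<bar>s - ys\<bar> \<le> 3 * e / 8" using s \<sigma> e by linarith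
        show "DERIV (\<lambda>s. Ty j \<mu> (Z \<mu> s)) (p \<mu> s) :> l \<mu> ^ j * v \<mu> (p \<mu> s)" by (rule DY[OF m p(1)[OF m s3]])
        show "l \<mu> ^ j * v \<mu> (p \<mu> s) \<noteq> 0" using pos[OF m p(1)[OF m s3]] by (rule less_imp_neq[symmetric])
        show lt: "ys - 3 * e / 8 < s" "s < ys + 3 * e / 8" using s \<sigma> e by linarith+
        show "Ty j \<mu> (Z \<mu> (p \<mu> y)) = y" if "ys - 3 * e / 8 < y" "y < ys + 3 * e / 8" for y
        proof (rule p(2)[OF m])
          show "\<bar>y - ys\<bar> \<le> 3 * e / 8" using that by linarith
        qed
        have "continuous_on {ys - 3 * e / 8<..<ys + 3 * e / 8} (\<lambda>s. snd (G (\<mu>, s)))"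
        proof (intro continuous_on_snd continuous_on_compose2[OF cG] continuous_intros subsetI)
          fix w assume "w \<in> Pair \<mu> ` {ys - 3 * e / 8<..<ys + 3 * e / 8}"
          then obtain y where y: "w = (\<mu>, y)" "ys - 3 * e / 8 < y" "y < ys + 3 * e / 8" by auto
          then have "\<bar>y - ys\<bar> \<le> 3 * e / 8" by linarith
          then show "w \<in> H ` Q" using HQ[OF m] y by simp
        qed
        then show "isCont (p \<mu>) s"
          unfolding p_def using lt by (simp add: continuous_on_eq_continuous_at)
      qed
      define \<gamma> where "\<gamma> = (\<lambda>\<mu> s. Tx j \<mu> (Z \<mu> (p \<mu> s)))"
      define \<tau> where "\<tau> = (\<lambda>\<mu> s. l \<mu> ^ j * p \<mu> s)"
      define g where "g = (\<lambda>\<mu> s. u \<mu> (p \<mu> s) / v \<mu> (p \<mu> s))"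
      define k where "k = (\<lambda>\<mu> s. - (u' \<mu> (p \<mu> s) / v' \<mu> (p \<mu> s)))"
      have "symmetric_arc ys \<sigma> \<delta> j \<gamma> \<tau> g k"
        unfolding symmetric_arc_def
      proof (intro conjI allI impI)
        have c: "continuous_on ({-\<sigma>..\<sigma>} \<times> {ys-\<sigma>..ys+\<sigma>}) G"
        proof (rule continuous_on_subset[OF cG], clarify)
          fix \<mu> s assume "\<mu> \<in> {-\<sigma>..\<sigma>}" "s \<in> {ys-\<sigma>..ys+\<sigma>}"
          then have "\<bar>\<mu>\<bar> \<le> \<sigma>" "\<bar>s - ys\<bar> \<le> 3 * e / 8" using \<sigma> e unfolding atLeastAtMost_iff by linarith+
          then show "(\<mu>, s) \<in> H ` Q" by (rule HQ)
        qed
        have "G ` ({-\<sigma>..\<sigma>} \<times> {ys-\<sigma>..ys+\<sigma>}) \<subseteq> Q"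
        proof (rule image_subsetI)
          fix x assume x: "x \<in> {-\<sigma>..\<sigma>} \<times> {ys-\<sigma>..ys+\<sigma>}"
          obtain \<mu> s where xe: "x = (\<mu>, s)" by (cases x)
          have *: "\<bar>\<mu>\<bar> \<le> \<sigma>" "\<bar>s - ys\<bar> \<le> 3 * e / 8"
            using x \<sigma> e unfolding xe mem_Times_iff fst_conv snd_conv atLeastAtMost_iff by linarith+
          show "G x \<in> Q" using p[OF *] * unfolding xe by (simp add: Qmem)
        qed
        note cc = continuous_on_compose2[OF cX c this]
        have c\<gamma>: "continuous_on ({-\<sigma>..\<sigma>} \<times> {ys-\<sigma>..ys+\<sigma>})
            (\<lambda>x. Tx j (fst (G x)) (Z (fst (G x)) (snd (G x))))"
          using cc by simp
        have "Tx j (fst (G x)) (Z (fst (G x)) (snd (G x))) = (\<lambda>(\<mu>, s). \<gamma> \<mu> s) x"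
          if x: "x \<in> {-\<sigma>..\<sigma>} \<times> {ys-\<sigma>..ys+\<sigma>}" for x
        proof -
          obtain \<mu> s where xe: "x = (\<mu>, s)" by (cases x)
          have *: "\<bar>\<mu>\<bar> \<le> \<sigma>" "\<bar>s - ys\<bar> \<le> 3 * e / 8"
            using x \<sigma> e unfolding xe mem_Times_iff fst_conv snd_conv atLeastAtMost_iff by linarith+
          show ?thesis unfolding xe p(3)[OF *] \<gamma>_def by simp
        qed
        then show "continuous_on ({-\<sigma>..\<sigma>} \<times> {ys-\<sigma>..ys+\<sigma>}) (\<lambda>(\<mu>, s). \<gamma> \<mu> s)"
          by (rule continuous_on_eq[OF c\<gamma>])
        fix \<mu> s assume m: "\<bar>\<mu>\<bar> \<le> \<sigma>" and s: "\<bar>s - ys\<bar> \<le> \<sigma>"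
        have s3: "\<bar>s - ys\<bar> \<le> 3 * e / 8" using s \<sigma> e by linarith
        note pp = p[OF m s3]
        note fa = facts[OF m pp(1)]
        have Z\<tau>: "vector [\<tau> \<mu> s, \<tau> \<mu> s] = Z \<mu> (p \<mu> s)" unfolding \<tau>_def Z_def ..
        have lpos: "0 < l \<mu> ^ j" and lne: "l \<mu> \<noteq> 0" using lI[OF m] L by simp_all
        show "(\<mu>, vector [\<tau> \<mu> s, \<tau> \<mu> s]) \<in> E n" if "n \<le> j" for n using fa that unfolding Z\<tau> by blast
        show "T j \<mu> (vector [\<tau> \<mu> s, \<tau> \<mu> s]) = vector [\<gamma> \<mu> s, s]"
          using pp(2) unfolding Z\<tau> \<gamma>_def Tx_def Ty_def by (simp add: vec2_eq_iff)
        show "\<bar>\<gamma> \<mu> s\<bar> \<le> \<delta>" unfolding \<gamma>_def using fa by blast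
        have "DERIV (\<lambda>s. Tx j \<mu> (Z \<mu> (p \<mu> s))) s :>
            l \<mu> ^ j * u \<mu> (p \<mu> s) * inverse (l \<mu> ^ j * v \<mu> (p \<mu> s))"
          by (rule DERIV_chain2[OF DX[OF m pp(1)] Dp[OF m s]])
        moreover have "v \<mu> (p \<mu> s) \<noteq> 0" using pos[OF m pp(1)] by auto
        then have "l \<mu> ^ j * u \<mu> (p \<mu> s) * inverse (l \<mu> ^ j * v \<mu> (p \<mu> s)) = g \<mu> s"
          unfolding g_def using lpos by (simp add: divide_simps del: power_eq_0_iff)
        ultimately show "DERIV (\<gamma> \<mu>) s :> g \<mu> s" unfolding \<gamma>_def by simp
        let ?U = "u \<mu> (p \<mu> s) / l \<mu> ^ j" and ?V = "l \<mu> ^ j * v \<mu> (p \<mu> s)"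
        let ?U' = "u' \<mu> (p \<mu> s) / l \<mu> ^ j" and ?V' = "- (l \<mu> ^ j * v' \<mu> (p \<mu> s))"
        have q1: "?V > 0" "\<bar>?U / ?V - 1\<bar> \<le> 4 * a" using quotient_near_one[of ?U a ?V] fa a by auto
        have V': "\<bar>?V' - 1\<bar> \<le> a" using fa by linarith
        have q2: "?V' > 0" "\<bar>?U' / ?V' - 1\<bar> \<le> 4 * a" using quotient_near_one[of ?U' a ?V'] V' fa a by auto
        have near: "\<bar>w - l \<mu> ^ (2 * j)\<bar> \<le> \<delta> * l \<mu> ^ (2 * j)"
          if "w = l \<mu> ^ (2 * j) * q" "\<bar>q - 1\<bar> \<le> 4 * a" for w q
        proof -
          have "w - l \<mu> ^ (2 * j) = l \<mu> ^ (2 * j) * (q - 1)" using that(1) by (simp add: algebra_simps)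
          then have "\<bar>w - l \<mu> ^ (2 * j)\<bar> = l \<mu> ^ (2 * j) * \<bar>q - 1\<bar>"
            using lI[OF m] L by (simp add: abs_mult)
          also have "\<dots> \<le> l \<mu> ^ (2 * j) * \<delta>" using that(2) a(2) lI[OF m] L by (intro mult_left_mono) auto
          finally show ?thesis by (simp add: mult.commute)
        qed
        have l2: "l \<mu> ^ (2 * j) = l \<mu> ^ j * l \<mu> ^ j" by (simp add: mult_2 power_add)
        have nz: "v \<mu> (p \<mu> s) \<noteq> 0" "v' \<mu> (p \<mu> s) \<noteq> 0" using q1(1) q2(1) by auto
        show "\<bar>g \<mu> s - l \<mu> ^ (2 * j)\<bar> \<le> \<delta> * l \<mu> ^ (2 * j)"
          by (rule near[OF _ q1(2)]) (use lne nz in \<open>simp add: g_def l2\<close>)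
        show "\<bar>k \<mu> s - l \<mu> ^ (2 * j)\<bar> \<le> \<delta> * l \<mu> ^ (2 * j)"
          by (rule near[OF _ q2(2)]) (use lne nz in \<open>simp add: k_def l2\<close>)
        show "\<exists>a b. a \<noteq> 0 \<and> b \<noteq> 0 \<and>
         DT j \<mu> (vector [\<tau> \<mu> s, \<tau> \<mu> s]) (vector [1, 1]) = a *\<^sub>R vector [g \<mu> s, 1] \<and>
         DT j \<mu> (vector [\<tau> \<mu> s, \<tau> \<mu> s]) (vector [1, -1]) = b *\<^sub>R vector [- k \<mu> s, 1]"
          unfolding Z\<tau> using nz
          by (intro exI[of _ "v \<mu> (p \<mu> s)"] exI[of _ "v' \<mu> (p \<mu> s)"])
            (simp add: vec2_eq_iff g_def k_def u_def v_def u'_def v'_def)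
      qed
      then show "\<exists>\<gamma> \<tau> g k. symmetric_arc ys \<sigma> \<delta> j \<gamma> \<tau> g k" by blast
    qed
  qed
qed

end

subsection \<open>Folds and matrices with determinant one\<close>

text \<open>Instead of a second derivative there are only bounds \<open>d1\<close> and
  \<open>d2\<close> for the growth of \<open>F'\<close>, up to an error \<theta>. Let
  \<open>h\<close> be the distance from the minimum to the zero. Then
  \<open>m \<le> h * (d2 * h + \<theta>)\<close>, so \<open>small\<close> rules out
  \<open>h \<le> \<theta> / d1\<close>, and the slope at the zero is positive. In the other
  direction \<open>d1 * h\<^sup>2 \<le> 8 * m\<close> unless
  \<open>h \<le> 4 * \<theta> / d1\<close>, which bounds \<open>h\<close> and with it the slope from
  above.\<close>

lemma fold_zero_right:
  fixes F F' :: "real \<Rightarrow> real"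
  assumes D: "\<And>s. s1 \<le> s \<Longrightarrow> s \<le> s2 \<Longrightarrow> DERIV F s :> F' s"
    and ends: "F s1 > 0" "F s2 > 0"
    and slope: "\<And>s s'. s1 \<le> s \<Longrightarrow> s \<le> s' \<Longrightarrow> s' \<le> s2 \<Longrightarrow>
      d1 * (s' - s) - \<theta> \<le> F' s' - F' s \<and> F' s' - F' s \<le> d2 * (s' - s) + \<theta>"
    and pos: "d1 > 0" "d2 > 0" "\<theta> \<ge> 0" "m > 0"
    and min: "s1 \<le> sm" "sm \<le> s2" "F sm = - m" "\<And>s. s1 \<le> s \<Longrightarrow> s \<le> s2 \<Longrightarrow> F sm \<le> F s"
    and small: "\<theta>\<^sup>2 * (d2 / d1\<^sup>2 + 1 / d1) < m"
    and bound: "d2 * (4 * \<theta> / d1 + sqrt (8 * m / d1)) + \<theta> \<le> \<kappa>"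
  shows "\<exists>b. s1 < b \<and> b < s2 \<and> F b = 0 \<and> 0 < F' b \<and> F' b \<le> \<kappa>"
proof -
  have sm: "s1 < sm" "sm < s2" using min ends pos by (metis less_eq_real_def neg_less_0_iff_less not_less_iff_gr_or_eq)+
  have F'0: "F' sm = 0"
  proof (rule DERIV_local_min[OF D[OF min(1,2)]])
    show "0 < min (sm - s1) (s2 - sm)" using sm by simp
    show "\<forall>y. \<bar>sm - y\<bar> < min (sm - s1) (s2 - sm) \<longrightarrow> F sm \<le> F y" using min(4) by auto
  qed
  have "\<exists>x. sm \<le> x \<and> x \<le> s2 \<and> F x = 0"
  proof (rule IVT)
    show "\<forall>x. sm \<le> x \<and> x \<le> s2 \<longrightarrow> isCont F x" using D DERIV_isCont min(1) by (meson order_trans)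
  qed (use min(3) pos ends sm in auto)
  then obtain b where b: "sm \<le> b" "b \<le> s2" "F b = 0" by blast
  then have b': "sm < b" "b < s2" using min(3) pos ends by (auto simp: less_le)
  define h where "h = b - sm"
  have h: "h > 0" using b' unfolding h_def by simp
  obtain z where z: "sm < z" "z < b" "F b - F sm = (b - sm) * F' z"
    using MVT2[OF b'(1), of F F'] D min(1) b by auto
  have "F' z \<le> d2 * (z - sm) + \<theta>" using slope[of sm z] F'0 z b min(1) by auto
  also have "\<dots> \<le> d2 * h + \<theta>" using z pos unfolding h_def by simp
  finally have "m \<le> h * (d2 * h + \<theta>)" using z(3) b(3) min(3) h unfolding h_def
    by (metis diff_minus_eq_add add_0 mult_left_mono less_imp_le)
  have "h > \<theta> / d1"
  proof (rule ccontr)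
    assume "\<not> h > \<theta> / d1"
    then have le: "h \<le> \<theta> / d1" by simp
    have "h * (d2 * h + \<theta>) \<le> (\<theta> / d1) * (d2 * (\<theta> / d1) + \<theta>)"
      using le h pos by (intro mult_mono add_mono mult_left_mono) auto
    also have "\<dots> = \<theta>\<^sup>2 * (d2 / d1\<^sup>2 + 1 / d1)" using pos by (simp add: field_simps power2_eq_square)
    finally show False using small \<open>m \<le> h * (d2 * h + \<theta>)\<close> by linarith
  qed
  then have "d1 * h > \<theta>" using pos by (simp add: field_simps)
  moreover have sl: "d1 * h - \<theta> \<le> F' b" "F' b \<le> d2 * h + \<theta>"
    using slope[of sm b] F'0 b min(1) unfolding h_def by auto
  ultimately have F'pos: "F' b > 0" by linarith
  have hb: "h \<le> 4 * \<theta> / d1 + sqrt (8 * m / d1)"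
  proof (cases "h \<le> 4 * \<theta> / d1")
    case True
    then show ?thesis using pos real_sqrt_ge_zero[of "8 * m / d1"] by (smt (verit) divide_nonneg_pos)
  next
    case False
    \<comment> \<open>On the right half of the interval the slope is at least
      \<open>d1 * h / 2 - \<theta>\<close>, and in this case \<theta> takes away at most half of
      that.\<close>
    define c where "c = sm + h / 2"
    have c: "sm < c" "c < b" using h unfolding c_def h_def by (auto simp: field_simps)
    obtain w where w: "c < w" "w < b" "F b - F c = (b - c) * F' w"
      using MVT2[OF c(2), of F F'] D min(1) b c by auto
    have "d1 * (w - sm) - \<theta> \<le> F' w" using slope[of sm w] F'0 w b c min(1) by auto
    moreover have "d1 * (w - sm) \<ge> d1 * (h / 2)" using w pos unfolding c_def by (intro mult_left_mono) auto
    moreover have "\<theta> \<le> d1 * h / 4" using False pos by (simp add: field_simps)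
    ultimately have "F' w \<ge> d1 * h / 4" by linarith
    then have "(h / 2) * (d1 * h / 4) \<le> (h / 2) * F' w" using h by (intro mult_left_mono) auto
    also have "\<dots> = - F c" using w(3) b(3) unfolding c_def h_def by (simp add: field_simps)
    also have "\<dots> \<le> m" using min(4)[of c] min(1,3) c b by auto
    finally have "h\<^sup>2 \<le> 8 * m / d1" using pos by (simp add: field_simps power2_eq_square)
    then have "h \<le> sqrt (8 * m / d1)" by (rule real_le_rsqrt)
    then show ?thesis using pos by (smt (verit) divide_nonneg_pos)
  qed
  have "F' b \<le> d2 * (4 * \<theta> / d1 + sqrt (8 * m / d1)) + \<theta>" using sl(2) mult_left_mono[OF hb, of d2] pos by linarith
  then show ?thesis using b b' F'pos bound sm by (intro exI[of _ b]) auto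
qed

text \<open>The zero to the left of the minimum is the one to the right for the reflected function
  \<open>F (- s)\<close>.\<close>

lemma fold_zeros:
  fixes F F' :: "real \<Rightarrow> real"
  assumes D: "\<And>s. s1 \<le> s \<Longrightarrow> s \<le> s2 \<Longrightarrow> DERIV F s :> F' s"
    and ends: "F s1 > 0" "F s2 > 0"
    and slope: "\<And>s s'. s1 \<le> s \<Longrightarrow> s \<le> s' \<Longrightarrow> s' \<le> s2 \<Longrightarrow>
      d1 * (s' - s) - \<theta> \<le> F' s' - F' s \<and> F' s' - F' s \<le> d2 * (s' - s) + \<theta>"
    and pos: "d1 > 0" "d2 > 0" "\<theta> \<ge> 0" "m > 0"
    and min: "s1 \<le> sm" "sm \<le> s2" "F sm = - m" "\<And>s. s1 \<le> s \<Longrightarrow> s \<le> s2 \<Longrightarrow> F sm \<le> F s"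
    and small: "\<theta>\<^sup>2 * (d2 / d1\<^sup>2 + 1 / d1) < m"
    and bound: "d2 * (4 * \<theta> / d1 + sqrt (8 * m / d1)) + \<theta> \<le> \<kappa>"
  shows "\<exists>a b. s1 \<le> a \<and> a \<le> s2 \<and> s1 \<le> b \<and> b \<le> s2 \<and> F a = 0 \<and> F b = 0 \<and>
    F' a < 0 \<and> 0 < F' b \<and> \<bar>F' a\<bar> \<le> \<kappa> \<and> \<bar>F' b\<bar> \<le> \<kappa>"
proof -
  obtain b where b: "s1 < b" "b < s2" "F b = 0" "0 < F' b" "F' b \<le> \<kappa>"
    using fold_zero_right[OF assms] by blast
  have "\<exists>b. - s2 < b \<and> b < - s1 \<and> F (- b) = 0 \<and> 0 < - F' (- b) \<and> - F' (- b) \<le> \<kappa>"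
  proof (rule fold_zero_right[where sm = "- sm", OF _ _ _ _ pos _ _ _ _ small bound])
    show "DERIV (\<lambda>s. F (- s)) s :> - F' (- s)" if "- s2 \<le> s" "s \<le> - s1" for s
      using DERIV_mirror[of F "F' (- s)" s] D[of "- s"] that by auto
    show "d1 * (s' - s) - \<theta> \<le> - F' (- s') - (- F' (- s)) \<and> - F' (- s') - (- F' (- s)) \<le> d2 * (s' - s) + \<theta>"
      if "- s2 \<le> s" "s \<le> s'" "s' \<le> - s1" for s s'
      using slope[of "- s'" "- s"] that by (auto simp: algebra_simps)
    show "F (- (- sm)) \<le> F (- s)" if "- s2 \<le> s" "s \<le> - s1" for s using min(4)[of "- s"] that by auto
  qed (use ends min in auto)
  then obtain a where "- s2 < a" "a < - s1" "F (- a) = 0" "0 < - F' (- a)" "- F' (- a) \<le> \<kappa>" by blast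
  then show ?thesis using b by (intro exI[of _ "- a"] exI[of _ b]) auto
qed

text \<open>Replaces following a nondegenerate critical point by the implicit function theorem: the
  gap is only continuous in \<mu>, but its minimum over a compact interval still depends
  continuously on \<mu>, by uniform continuity.\<close>

lemma continuous_minimum:
  fixes F :: "'a::metric_space \<Rightarrow> 'b::metric_space \<Rightarrow> real"
  assumes "compact M" "compact S" "S \<noteq> {}" "continuous_on (M \<times> S) (\<lambda>(\<mu>, s). F \<mu> s)"
  obtains mn where "continuous_on M mn" "\<And>\<mu>. \<mu> \<in> M \<Longrightarrow> \<exists>s\<in>S. F \<mu> s = mn \<mu>"
    "\<And>\<mu> s. \<mu> \<in> M \<Longrightarrow> s \<in> S \<Longrightarrow> mn \<mu> \<le> F \<mu> s"
proof -
  have c: "continuous_on S (F \<mu>)" if "\<mu> \<in> M" for \<mu>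
  proof -
    have "continuous_on S (Pair \<mu>)" by (intro continuous_intros)
    moreover have "Pair \<mu> ` S \<subseteq> M \<times> S" using that by auto
    ultimately show ?thesis using continuous_on_compose2[OF assms(4), of S "Pair \<mu>"] by simp
  qed
  have "\<exists>v. (\<exists>s\<in>S. F \<mu> s = v) \<and> (\<forall>s\<in>S. v \<le> F \<mu> s)" if "\<mu> \<in> M" for \<mu>
    using continuous_attains_inf[OF assms(2,3) c[OF that]] by blast
  then obtain mn where mn: "\<And>\<mu>. \<mu> \<in> M \<Longrightarrow> (\<exists>s\<in>S. F \<mu> s = mn \<mu>) \<and> (\<forall>s\<in>S. mn \<mu> \<le> F \<mu> s)"
    by metis
  have uc: "uniformly_continuous_on (M \<times> S) (\<lambda>(\<mu>, s). F \<mu> s)"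
    by (rule compact_uniformly_continuous[OF assms(4) compact_Times[OF assms(1,2)]])
  have "continuous_on M mn" unfolding continuous_on_iff
  proof (intro ballI allI impI)
    fix \<mu> and e :: real assume \<mu>: "\<mu> \<in> M" and e: "e > 0"
    obtain d where d: "d > 0" "\<And>x x'. x \<in> M \<times> S \<Longrightarrow> x' \<in> M \<times> S \<Longrightarrow> dist x' x < d \<Longrightarrow>
        dist ((\<lambda>(\<mu>, s). F \<mu> s) x') ((\<lambda>(\<mu>, s). F \<mu> s) x) < e"
      using uc e unfolding uniformly_continuous_on_def by blast
    have close: "\<bar>F \<mu>' s - F \<mu> s\<bar> < e" if "\<mu>' \<in> M" "dist \<mu>' \<mu> < d" "s \<in> S" for \<mu>' s
      using d(2)[of "(\<mu>, s)" "(\<mu>', s)"] that \<mu> by (simp add: dist_Pair_Pair dist_real_def)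
    have "dist (mn \<mu>') (mn \<mu>) < e" if m: "\<mu>' \<in> M" "dist \<mu>' \<mu> < d" for \<mu>'
    proof -
      obtain s where s: "s \<in> S" "F \<mu> s = mn \<mu>" using mn[OF \<mu>] by blast
      obtain s' where s': "s' \<in> S" "F \<mu>' s' = mn \<mu>'" using mn[OF m(1)] by blast
      have "mn \<mu>' \<le> F \<mu>' s" "mn \<mu> \<le> F \<mu> s'" using mn[OF \<mu>] mn[OF m(1)] s(1) s'(1) by auto
      then show ?thesis using close[OF m s(1)] close[OF m s'(1)] s(2) s'(2) by (simp add: dist_real_def)
    qed
    then show "\<exists>d>0. \<forall>x'\<in>M. dist x' \<mu> < d \<longrightarrow> dist (mn x') (mn \<mu>) < e" using d(1) by blast
  qed
  then show ?thesis using that mn by blast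
qed

section \<open>Traces, determinants and signs for reversible return maps\<close>

lemma linear_matrix_components:
  fixes L :: "real^2 \<Rightarrow> real^2"
  assumes "linear L"
  shows "L v $ i = matrix L $ i $ 1 * v $ 1 + matrix L $ i $ 2 * v $ 2"
proof -
  have "L v = matrix L *v v" using matrix_works[of L v] assms by (simp add: linear_def scalar_mult_eq_scaleR)
  then show ?thesis by (simp add: matrix_vector_mult_def sum_2)
qed

lemma char_poly_2:
  fixes D :: "real^2^2"
  shows "det (mat t - (\<chi> i j. complex_of_real (D $ i $ j))) =
    t\<^sup>2 - complex_of_real (trace D) * t + complex_of_real (det D)"
  by (simp add: det_2 trace_def sum_2 mat_def power2_eq_square algebra_simps)

lemma elliptic_roots:
  fixes D :: "real^2^2"
  assumes "det D = 1" "(trace D)\<^sup>2 < 4"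
  shows "\<exists>\<theta>. 0 < \<theta> \<and> \<theta> < pi \<and> (\<forall>t. det (mat t - (\<chi> i j. complex_of_real (D $ i $ j))) =
    (t - exp (\<i> * of_real \<theta>)) * (t - exp (- \<i> * of_real \<theta>)))"
proof -
  have "\<bar>trace D\<bar> < 2" using assms(2) abs_square_less_1[of "trace D / 2"] by (simp add: power_divide)
  then have b: "-1 < trace D / 2" "trace D / 2 < 1" by auto
  define \<theta> where "\<theta> = arccos (trace D / 2)"
  have \<theta>: "0 < \<theta>" "\<theta> < pi" "cos \<theta> = trace D / 2"
    using arccos_lt_bounded[OF b] cos_arccos[of "trace D / 2"] b unfolding \<theta>_def by auto
  have s: "exp (\<i> * of_real \<theta>) + exp (- \<i> * of_real \<theta>) = complex_of_real (trace D)"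
    using \<theta>(3) by (simp add: complex_eq_iff Re_exp Im_exp)
  have p: "exp (\<i> * of_real \<theta>) * exp (- \<i> * of_real \<theta>) = 1"
    by (simp flip: exp_add)
  have "(t - exp (\<i> * of_real \<theta>)) * (t - exp (- \<i> * of_real \<theta>)) =
      t\<^sup>2 - (exp (\<i> * of_real \<theta>) + exp (- \<i> * of_real \<theta>)) * t + exp (\<i> * of_real \<theta>) * exp (- \<i> * of_real \<theta>)" for t
    by (simp add: power2_eq_square algebra_simps)
  then show ?thesis using \<theta> unfolding char_poly_2 s p assms(1) by auto
qed

lemma saddle_roots:
  fixes D :: "real^2^2"
  assumes "det D = 1" "(trace D)\<^sup>2 > 4"
  shows "\<exists>\<nu> \<nu>'. 0 < \<bar>\<nu>\<bar> \<and> \<bar>\<nu>\<bar> < 1 \<and> 1 < \<bar>\<nu>'\<bar> \<and> (\<forall>t. det (mat t - (\<chi> i j. complex_of_real (D $ i $ j))) =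
    (t - of_real \<nu>) * (t - of_real \<nu>'))"
proof -
  let ?\<tau> = "trace D"
  define s where "s = sqrt (?\<tau>\<^sup>2 - 4)"
  have s: "s\<^sup>2 = ?\<tau>\<^sup>2 - 4" "s > 0" using assms(2) unfolding s_def by auto
  have t2: "\<bar>?\<tau>\<bar> > 2" using assms(2) abs_le_square_iff[of ?\<tau> 2] by auto
  have "\<exists>\<nu> \<nu>'. \<nu> + \<nu>' = ?\<tau> \<and> \<nu> * \<nu>' = 1 \<and> 1 < \<bar>\<nu>'\<bar>"
  \<comment> \<open>The root of larger modulus has the sign of the trace; a negative trace leads to
    a saddle with negative multipliers.\<close>
  proof (cases "?\<tau> > 0")
    case True
    then show ?thesis using s t2
      by (intro exI[of _ "(?\<tau> - s) / 2"] exI[of _ "(?\<tau> + s) / 2"]) (auto simp: field_simps power2_eq_square)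
  next
    case False
    then show ?thesis using s t2
      by (intro exI[of _ "(?\<tau> + s) / 2"] exI[of _ "(?\<tau> - s) / 2"]) (auto simp: field_simps power2_eq_square)
  qed
  then obtain \<nu> \<nu>' where n: "\<nu> + \<nu>' = ?\<tau>" "\<nu> * \<nu>' = 1" "1 < \<bar>\<nu>'\<bar>" by blast
  have ab: "\<bar>\<nu>\<bar> * \<bar>\<nu>'\<bar> = 1" using n(2) by (simp flip: abs_mult)
  then have p: "0 < \<bar>\<nu>\<bar>" by (metis abs_ge_zero less_eq_real_def mult_zero_left zero_neq_one)
  then have "\<bar>\<nu>\<bar> < 1" using ab n(3) by (metis mult.right_neutral mult_less_cancel_left_pos)
  moreover have "det (mat t - (\<chi> i j. complex_of_real (D $ i $ j))) = (t - of_real \<nu>) * (t - of_real \<nu>')" for t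
  proof -
    have "(t - of_real \<nu>) * (t - of_real \<nu>') = t\<^sup>2 - complex_of_real (\<nu> + \<nu>') * t + complex_of_real (\<nu> * \<nu>')"
      by (simp add: power2_eq_square algebra_simps)
    then show ?thesis unfolding char_poly_2 n(1,2) assms(1) by simp
  qed
  ultimately show ?thesis using p n(3) by blast
qed

text \<open>By \<open>rev\<close>, \<open>V\<close> is the inverse of \<open>W\<close> conjugated by
  the reflection, hence determinant 1. In the eigenbasis of the reflection the trace of
  \<open>V \<circ> W\<close> is \<open>2 * (\<alpha> * \<delta> + \<beta> * \<gamma>) / (\<alpha> *
  \<delta> - \<beta> * \<gamma>)\<close>, and
  \<open>(x + y)\<^sup>2 - (x - y)\<^sup>2 = 4 * x * y\<close> gives the factor 16 over the squared
  determinant of \<open>W\<close>.\<close>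

lemma reversible_trace:
  fixes W V :: "real^2 \<Rightarrow> real^2"
  assumes lin: "linear W" "linear V" and rev: "\<And>v. V (swap (W v)) = swap v"
    and W: "W (vector [1, 1]) = \<alpha> *\<^sub>R vector [1, 1] + \<gamma> *\<^sub>R vector [1, -1]"
      "W (vector [1, -1]) = \<beta> *\<^sub>R vector [1, 1] + \<delta> *\<^sub>R vector [1, -1]"
  shows "\<exists>c>0. (trace (matrix (V \<circ> W)))\<^sup>2 - 4 = c * (\<alpha> * \<beta> * \<gamma> * \<delta>)" "det (matrix (V \<circ> W)) = 1"
proof -
  define w11 w12 w21 w22 where "w11 = matrix W $ 1 $ 1" and "w12 = matrix W $ 1 $ 2"
    and "w21 = matrix W $ 2 $ 1" and "w22 = matrix W $ 2 $ 2"
  define v11 v12 v21 v22 where "v11 = matrix V $ 1 $ 1" and "v12 = matrix V $ 1 $ 2"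
    and "v21 = matrix V $ 2 $ 1" and "v22 = matrix V $ 2 $ 2"
  note cW = linear_matrix_components[OF lin(1)] and cV = linear_matrix_components[OF lin(2)]
  have w: "w11 + w12 = \<alpha> + \<gamma>" "w21 + w22 = \<alpha> - \<gamma>" "w11 - w12 = \<beta> + \<delta>" "w21 - w22 = \<beta> - \<delta>"
    using arg_cong[OF W(1), of "\<lambda>z. z $ 1"] arg_cong[OF W(1), of "\<lambda>z. z $ 2"]
      arg_cong[OF W(2), of "\<lambda>z. z $ 1"] arg_cong[OF W(2), of "\<lambda>z. z $ 2"]
    unfolding w11_def w12_def w21_def w22_def by (simp_all add: cW)
  have r: "v11 * w21 + v12 * w11 = 0" "v21 * w21 + v22 * w11 = 1" "v11 * w22 + v12 * w12 = 1" "v21 * w22 + v22 * w12 = 0"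
    using arg_cong[OF rev[of "vector [1, 0]"], of "\<lambda>z. z $ 1"] arg_cong[OF rev[of "vector [1, 0]"], of "\<lambda>z. z $ 2"]
      arg_cong[OF rev[of "vector [0, 1]"], of "\<lambda>z. z $ 1"] arg_cong[OF rev[of "vector [0, 1]"], of "\<lambda>z. z $ 2"]
    unfolding w11_def w12_def w21_def w22_def v11_def v12_def v21_def v22_def by (simp_all add: cW cV)
  define \<Delta> where "\<Delta> = w11 * w22 - w12 * w21"
  have dd: "(v11 * v22 - v12 * v21) * \<Delta> = 1"
  proof -
    have "(v11 * v22 - v12 * v21) * \<Delta> = (v21 * w21 + v22 * w11) * (v11 * w22 + v12 * w12)
        - (v11 * w21 + v12 * w11) * (v21 * w22 + v22 * w12)" unfolding \<Delta>_def by algebra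
    then show ?thesis using r by simp
  qed
  then have \<Delta>: "\<Delta> \<noteq> 0" by auto
  have v: "v11 * \<Delta> = w11" "v12 * \<Delta> = - w21" "v21 * \<Delta> = - w12" "v22 * \<Delta> = w22"
    using r unfolding \<Delta>_def by algebra+
  have m: "matrix (V \<circ> W) = matrix V ** matrix W" by (rule matrix_compose[OF lin])
  have tr: "trace (matrix (V \<circ> W)) = v11 * w11 + v12 * w21 + v21 * w12 + v22 * w22"
    unfolding m v11_def v12_def v21_def v22_def w11_def w12_def w21_def w22_def
    by (simp add: trace_def sum_2 matrix_matrix_mult_def)
  have trD: "trace (matrix (V \<circ> W)) * \<Delta> = w11\<^sup>2 - w21\<^sup>2 - w12\<^sup>2 + w22\<^sup>2"
  proof -
    have "trace (matrix (V \<circ> W)) * \<Delta> =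
        (v11 * \<Delta>) * w11 + (v12 * \<Delta>) * w21 + (v21 * \<Delta>) * w12 + (v22 * \<Delta>) * w22"
      unfolding tr by (simp add: algebra_simps)
    then show ?thesis unfolding v by (simp add: power2_eq_square)
  qed
  show "det (matrix (V \<circ> W)) = 1"
    using dd unfolding m det_mul unfolding det_2 \<Delta>_def v11_def v12_def v21_def v22_def w11_def w12_def w21_def w22_def by simp
  have W4: "w11 = (\<alpha> + \<gamma> + \<beta> + \<delta>) / 2" "w12 = (\<alpha> + \<gamma> - \<beta> - \<delta>) / 2"
    "w21 = (\<alpha> - \<gamma> + \<beta> - \<delta>) / 2" "w22 = (\<alpha> - \<gamma> - \<beta> + \<delta>) / 2"
    using w by (simp_all add: field_simps)
  have "((trace (matrix (V \<circ> W)))\<^sup>2 - 4) * \<Delta>\<^sup>2 = 16 * (\<alpha> * \<beta> * \<gamma> * \<delta>)"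
  proof -
    have "((trace (matrix (V \<circ> W)))\<^sup>2 - 4) * \<Delta>\<^sup>2 = (trace (matrix (V \<circ> W)) * \<Delta>)\<^sup>2 - 4 * \<Delta>\<^sup>2" by algebra
    also have "\<dots> = 16 * (\<alpha> * \<beta> * \<gamma> * \<delta>)"
      unfolding trD unfolding \<Delta>_def W4 by (simp add: field_simps power2_eq_square)
    finally show ?thesis .
  qed
  then show "\<exists>c>0. (trace (matrix (V \<circ> W)))\<^sup>2 - 4 = c * (\<alpha> * \<beta> * \<gamma> * \<delta>)"
    using \<Delta> by (intro exI[of _ "16 / \<Delta>\<^sup>2"]) (simp add: field_simps)
qed

text \<open>Cramer's rule for two image vectors in the basis \<open>c * (1, g')\<close>,
  \<open>e * (1, - k')\<close>. The lengths \<open>a\<close>, \<open>b\<close>, \<open>c\<close>,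
  \<open>e\<close>, about which nothing is known, enter the product only through the square of
  \<open>a * b / (c * e * t\<^sup>2)\<close> with \<open>t = g' + k'\<close>, so its sign depends on
  directions alone.\<close>

lemma transition_coefficients:
  fixes a b c e g g' k k' Px Py Gx Gy :: real
  assumes nz: "a \<noteq> 0" "b \<noteq> 0" "c \<noteq> 0" "e \<noteq> 0" "g' + k' \<noteq> 0"
  shows "\<exists>\<alpha> \<beta> \<gamma> \<delta> p. p > 0 \<and>
    a * (Px * g + Py) = \<alpha> * c + \<gamma> * e \<and> a * (Gx * g + Gy) = \<alpha> * (c * g') - \<gamma> * (e * k') \<and>
    b * (Py - Px * k) = \<beta> * c + \<delta> * e \<and> b * (Gy - Gx * k) = \<beta> * (c * g') - \<delta> * (e * k') \<and>
    \<alpha> * \<beta> * \<gamma> * \<delta> = p * ((k' * (Px * g + Py) + (Gx * g + Gy)) * (k' * (Py - Px * k) + (Gy - Gx * k)) *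
      ((Gx * g + Gy) - g' * (Px * g + Py)) * ((Gy - Gx * k) - g' * (Py - Px * k)))"
proof -
  define X where "X = Px * g + Py"
  define Y where "Y = Gx * g + Gy"
  define X' where "X' = Py - Px * k"
  define Y' where "Y' = Gy - Gx * k"
  define t where "t = g' + k'"
  have t: "t \<noteq> 0" "k' = t - g'" using nz unfolding t_def by auto
  show ?thesis
    unfolding X_def[symmetric] Y_def[symmetric] X'_def[symmetric] Y'_def[symmetric]
  proof (intro exI conjI)
    show "0 < (a * b / (c * e * t\<^sup>2))\<^sup>2" using nz t by simp
    show "a * X = (a * (k' * X + Y) / (c * t)) * c + (- a * (Y - g' * X) / (e * t)) * e"
      using nz t(1) unfolding t(2) by (simp add: field_simps)
    show "a * Y = (a * (k' * X + Y) / (c * t)) * (c * g') - (- a * (Y - g' * X) / (e * t)) * (e * k')"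
      using nz t(1) unfolding t(2) by (simp add: field_simps)
    show "b * X' = (b * (k' * X' + Y') / (c * t)) * c + (- b * (Y' - g' * X') / (e * t)) * e"
      using nz t(1) unfolding t(2) by (simp add: field_simps)
    show "b * Y' = (b * (k' * X' + Y') / (c * t)) * (c * g') - (- b * (Y' - g' * X') / (e * t)) * (e * k')"
      using nz t(1) unfolding t(2) by (simp add: field_simps)
    show "a * (k' * X + Y) / (c * t) * (b * (k' * X' + Y') / (c * t)) * (- a * (Y - g' * X) / (e * t)) * (- b * (Y' - g' * X') / (e * t)) =
      (a * b / (c * e * t\<^sup>2))\<^sup>2 * ((k' * X + Y) * (k' * X' + Y') * (Y - g' * X) * (Y' - g' * X'))"
      using nz t(1) by (simp add: power2_eq_square divide_simps)
  qed
qed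

lemma product_error:
  fixes X Y x y :: real
  assumes "\<bar>X - x\<bar> \<le> p" "\<bar>Y\<bar> \<le> B" "\<bar>x\<bar> \<le> u" "\<bar>Y - y\<bar> \<le> e"
  shows "\<bar>X * Y - x * y\<bar> \<le> p * B + u * e"
proof -
  have "X * Y - x * y = (X - x) * Y + x * (Y - y)" by (simp add: algebra_simps)
  then have "\<bar>X * Y - x * y\<bar> \<le> \<bar>X - x\<bar> * \<bar>Y\<bar> + \<bar>x\<bar> * \<bar>Y - y\<bar>"
    by (metis abs_mult abs_triangle_ineq)
  also have "\<dots> \<le> p * B + u * e"
    using assms by (intro add_mono mult_mono) auto
  finally show ?thesis .
qed

lemma same_sign:
  fixes X x m :: real
  assumes "\<bar>X - 2 * x\<bar> \<le> m" "m \<le> \<bar>x\<bar>" "m > 0"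
  shows "X * x > 0"
  using assms by (cases "x > 0") (auto simp: zero_less_mult_iff abs_le_iff)

text \<open>\<open>Gy\<close> is the derivative that vanishes at the tangency and the only one whose
  size relative to \<open>w\<close> is not known. It occurs in all four expressions with coefficient
  1, so subtracting \<open>Fs\<close> removes it from the other three. What remains is evaluated at
  \<open>g = k = w\<close> and \<open>g' = k' = \<Lambda> * w\<close>. Once \<open>Fs\<close> is
  small, these constants determine the signs.\<close>

lemma transition_estimates:
  fixes g g' k k' Px Py Gx Gy a0 b0 c0 w \<Lambda> \<epsilon> B :: real
  assumes w: "0 < w" "w \<le> \<epsilon>" and eps: "\<epsilon> \<le> 1" and Lam: "0 \<le> \<Lambda>" "\<Lambda> \<le> 1"
    and g: "\<bar>g - w\<bar> \<le> \<epsilon> * w" "\<bar>k - w\<bar> \<le> \<epsilon> * w" "\<bar>g' - \<Lambda> * w\<bar> \<le> \<epsilon> * w" "\<bar>k' - \<Lambda> * w\<bar> \<le> \<epsilon> * w"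
    and P: "\<bar>Px - a0\<bar> \<le> \<epsilon>" "\<bar>Py - b0\<bar> \<le> \<epsilon>" "\<bar>Gx - c0\<bar> \<le> \<epsilon>"
    and B: "B = 1 + \<bar>a0\<bar> + \<bar>b0\<bar> + \<bar>c0\<bar>"
  defines "Fs \<equiv> (Gx * g + Gy) - g' * (Px * g + Py)"
  shows "\<bar>Fs - Gy - (c0 - \<Lambda> * b0) * w\<bar> \<le> 8 * \<epsilon> * B * w"
    "\<bar>k' * (Px * g + Py) + (Gx * g + Gy) - Fs - 2 * (\<Lambda> * b0) * w\<bar> \<le> 16 * \<epsilon> * B * w"
    "\<bar>k' * (Py - Px * k) + (Gy - Gx * k) - Fs - 2 * (\<Lambda> * b0 - c0) * w\<bar> \<le> 16 * \<epsilon> * B * w"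
    "\<bar>(Gy - Gx * k) - g' * (Py - Px * k) - Fs - 2 * (- c0) * w\<bar> \<le> 16 * \<epsilon> * B * w"
proof -
  define G1 K1 G2 K2 where "G1 = g / w" and "K1 = k / w" and "G2 = g' / w" and "K2 = k' / w"
  have e: "g = w * G1" "k = w * K1" "g' = w * G2" "k' = w * K2"
    unfolding G1_def K1_def G2_def K2_def using w by auto
  have near: "\<bar>y - x\<bar> \<le> \<epsilon>" if "\<bar>w * y - x * w\<bar> \<le> \<epsilon> * w" for x y
  proof -
    have "w * y - x * w = w * (y - x)" by (simp add: algebra_simps)
    then have "\<bar>y - x\<bar> * w \<le> \<epsilon> * w" using that w by (simp add: abs_mult mult.commute)
    then show ?thesis using w by simp
  qed
  have n: "\<bar>G1 - 1\<bar> \<le> \<epsilon>" "\<bar>K1 - 1\<bar> \<le> \<epsilon>" "\<bar>G2 - \<Lambda>\<bar> \<le> \<epsilon>" "\<bar>K2 - \<Lambda>\<bar> \<le> \<epsilon>"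
    using near[of G1 1] near[of K1 1] near[of G2 \<Lambda>] near[of K2 \<Lambda>] g unfolding e by auto
  have e0: "\<epsilon> \<ge> 0" using w by linarith
  have b: "\<bar>G1\<bar> \<le> 2" "\<bar>K1\<bar> \<le> 2" "\<bar>G2\<bar> \<le> 2" "\<bar>K2\<bar> \<le> 2" using n eps Lam by linarith+
  have B1: "B \<ge> 1" unfolding B by simp
  have PB: "\<bar>Px\<bar> \<le> B" "\<bar>Py\<bar> \<le> B" "\<bar>Gx\<bar> \<le> B" using P eps unfolding B by linarith+
  have eB: "\<epsilon> \<le> \<epsilon> * B" using e0 B1 by (simp add: mult_le_cancel_left1)
  have PG: "\<bar>Px * (w * G1)\<bar> \<le> 2 * (\<epsilon> * B)" "\<bar>Px * (w * K1)\<bar> \<le> 2 * (\<epsilon> * B)" "\<bar>Px * (w * G2)\<bar> \<le> 2 * (\<epsilon> * B)"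
  proof -
    have *: "\<bar>Px * (w * y)\<bar> \<le> 2 * (\<epsilon> * B)" if "\<bar>y\<bar> \<le> 2" for y
    proof -
      have "\<bar>Px * (w * y)\<bar> = \<bar>Px\<bar> * (w * \<bar>y\<bar>)" using w by (simp add: abs_mult)
      also have "\<dots> \<le> B * (\<epsilon> * 2)" using PB w that e0 by (intro mult_mono) auto
      finally show ?thesis by (simp add: mult_ac)
    qed
    show "\<bar>Px * (w * G1)\<bar> \<le> 2 * (\<epsilon> * B)" "\<bar>Px * (w * K1)\<bar> \<le> 2 * (\<epsilon> * B)" "\<bar>Px * (w * G2)\<bar> \<le> 2 * (\<epsilon> * B)"
      using * b by auto
  qed
  have \<epsilon>B: "\<epsilon> * B \<le> B" using eps B1 by (simp add: mult_le_cancel_right2)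
  define X where "X = Px * (w * G1) + Py"
  have X: "\<bar>X\<bar> \<le> 3 * B" "\<bar>X - b0\<bar> \<le> 3 * (\<epsilon> * B)" using PG(1) PB(2) P(2) eB \<epsilon>B unfolding X_def by linarith+
  have "\<bar>G2 * X - \<Lambda> * b0\<bar> \<le> \<epsilon> * (3 * B) + 1 * (3 * (\<epsilon> * B))"
    by (rule product_error[OF n(3) X(1) _ X(2)]) (use Lam in simp)
  then have r1: "\<bar>G2 * X - \<Lambda> * b0\<bar> \<le> 6 * (\<epsilon> * B)" by linarith
  have "\<bar>K2 * X - \<Lambda> * b0\<bar> \<le> \<epsilon> * (3 * B) + 1 * (3 * (\<epsilon> * B))"
    by (rule product_error[OF n(4) X(1) _ X(2)]) (use Lam in simp)
  then have r2: "\<bar>K2 * X - \<Lambda> * b0\<bar> \<le> 6 * (\<epsilon> * B)" by linarith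
  have "\<bar>G1 * Gx - 1 * c0\<bar> \<le> \<epsilon> * B + 1 * \<epsilon>" by (rule product_error[OF n(1) PB(3) _ P(3)]) simp
  then have r3: "\<bar>G1 * Gx - c0\<bar> \<le> 2 * (\<epsilon> * B)" using eB by linarith
  have "\<bar>K1 * Gx - 1 * c0\<bar> \<le> \<epsilon> * B + 1 * \<epsilon>" by (rule product_error[OF n(2) PB(3) _ P(3)]) simp
  then have r4: "\<bar>K1 * Gx - c0\<bar> \<le> 2 * (\<epsilon> * B)" using eB by linarith
  have "\<bar>K2 * Py - \<Lambda> * b0\<bar> \<le> \<epsilon> * B + 1 * \<epsilon>" by (rule product_error[OF n(4) PB(2) _ P(2)]) (use Lam in simp)
  then have r5: "\<bar>K2 * Py - \<Lambda> * b0\<bar> \<le> 2 * (\<epsilon> * B)" using eB by linarith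
  have "\<bar>G2 * Py - \<Lambda> * b0\<bar> \<le> \<epsilon> * B + 1 * \<epsilon>" by (rule product_error[OF n(3) PB(2) _ P(2)]) (use Lam in simp)
  then have r6: "\<bar>G2 * Py - \<Lambda> * b0\<bar> \<le> 2 * (\<epsilon> * B)" using eB by linarith
  have prod: "\<bar>Y * y\<bar> \<le> 4 * (\<epsilon> * B)" if "\<bar>Y\<bar> \<le> 2 * (\<epsilon> * B)" "\<bar>y\<bar> \<le> 2" for Y y
    using mult_mono[OF that] e0 B1 unfolding abs_mult by simp
  have r7: "\<bar>(Px * (w * G1)) * G2 - (Px * (w * K1)) * K2\<bar> \<le> 8 * (\<epsilon> * B)"
    using prod[OF PG(1) b(3)] prod[OF PG(2) b(4)] by linarith
  have r8: "\<bar>(Px * (w * G2)) * G1 + (Px * (w * G2)) * K1\<bar> \<le> 8 * (\<epsilon> * B)"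
    using prod[OF PG(3) b(1)] prod[OF PG(3) b(2)] by linarith
  have scale: "\<bar>Y\<bar> \<le> t * \<epsilon> * B * w" if "Y = w * y" "\<bar>y\<bar> \<le> t * (\<epsilon> * B)" for Y y t
    using that w by (simp add: abs_mult mult.assoc mult.commute[of w] mult_right_mono)
  show "\<bar>Fs - Gy - (c0 - \<Lambda> * b0) * w\<bar> \<le> 8 * \<epsilon> * B * w"
  proof (rule scale)
    show "Fs - Gy - (c0 - \<Lambda> * b0) * w = w * ((G1 * Gx - c0) - (G2 * X - \<Lambda> * b0))"
      unfolding Fs_def X_def e by (simp add: algebra_simps)
    show "\<bar>(G1 * Gx - c0) - (G2 * X - \<Lambda> * b0)\<bar> \<le> 8 * (\<epsilon> * B)" using r1 r3 by linarith
  qed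
  show "\<bar>k' * (Px * g + Py) + (Gx * g + Gy) - Fs - 2 * (\<Lambda> * b0) * w\<bar> \<le> 16 * \<epsilon> * B * w"
  proof (rule scale)
    show "k' * (Px * g + Py) + (Gx * g + Gy) - Fs - 2 * (\<Lambda> * b0) * w =
        w * ((K2 * X - \<Lambda> * b0) + (G2 * X - \<Lambda> * b0))"
      unfolding Fs_def X_def e by (simp add: algebra_simps)
    show "\<bar>(K2 * X - \<Lambda> * b0) + (G2 * X - \<Lambda> * b0)\<bar> \<le> 16 * (\<epsilon> * B)" using r1 r2 e0 B1 eB by linarith
  qed
  show "\<bar>k' * (Py - Px * k) + (Gy - Gx * k) - Fs - 2 * (\<Lambda> * b0 - c0) * w\<bar> \<le> 16 * \<epsilon> * B * w"
  proof (rule scale)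
    show "k' * (Py - Px * k) + (Gy - Gx * k) - Fs - 2 * (\<Lambda> * b0 - c0) * w =
        w * ((K2 * Py - \<Lambda> * b0) + (G2 * Py - \<Lambda> * b0) - (G1 * Gx - c0) - (K1 * Gx - c0)
          + ((Px * (w * G1)) * G2 - (Px * (w * K1)) * K2))"
      unfolding Fs_def e by (simp add: algebra_simps)
    show "\<bar>(K2 * Py - \<Lambda> * b0) + (G2 * Py - \<Lambda> * b0) - (G1 * Gx - c0) - (K1 * Gx - c0)
          + ((Px * (w * G1)) * G2 - (Px * (w * K1)) * K2)\<bar> \<le> 16 * (\<epsilon> * B)"
      using r3 r4 r5 r6 r7 by linarith
  qed
  show "\<bar>(Gy - Gx * k) - g' * (Py - Px * k) - Fs - 2 * (- c0) * w\<bar> \<le> 16 * \<epsilon> * B * w"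
  proof (rule scale)
    show "(Gy - Gx * k) - g' * (Py - Px * k) - Fs - 2 * (- c0) * w =
        w * (- (G1 * Gx - c0) - (K1 * Gx - c0) + ((Px * (w * G2)) * G1 + (Px * (w * G2)) * K1))"
      unfolding Fs_def e by (simp add: algebra_simps)
    show "\<bar>- (G1 * Gx - c0) - (K1 * Gx - c0) + ((Px * (w * G2)) * G1 + (Px * (w * G2)) * K1)\<bar> \<le> 16 * (\<epsilon> * B)"
      using r3 r4 r8 e0 B1 eB by linarith
  qed
qed

section \<open>Multipliers in the local coordinates and in the atlas\<close>

context reversible_family
begin

text \<open>\<open>multipliers\<close> asks for a chart from \<open>A\<close>, while the derivative
  is computed in the coordinates \<open>\<psi> \<mu>\<close>, which belong to the surface only up to
  order \<open>r - 1\<close>. The derivatives \<open>L\<close> and \<open>L'\<close> of the two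
  coordinate changes at the fixed point are inverse to each other, and conjugation by them preserves
  trace and determinant.\<close>

lemma conjugate_multipliers:
  assumes \<mu>: "\<mu> \<in> I" and p: "p \<in> U0" "(f \<mu> ^^ n) p = p"
    and D: "D = matrix (DT n \<mu> (\<psi> \<mu> p))"
  shows "\<exists>D'. det D' = det D \<and> trace D' = trace D \<and>
    (\<exists>(U, \<phi>)\<in>A. p \<in> U \<and>
      ((\<phi> \<circ> (f \<mu> ^^ n) \<circ> inv_into U \<phi>) has_derivative (\<lambda>v. D' *v v)) (at (\<phi> p)))"
proof -
  obtain U \<phi> where U: "(U, \<phi>) \<in> A" "p \<in> U" by (rule atlas_cover)
  note ch = is_chartD[OF atlas_chart[OF U(1)]]
  let ?z = "\<psi> \<mu> p" and ?w = "\<phi> p"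
  have pz: "pt \<mu> ?z = p" using \<mu> p by simp
  have Ez: "(\<mu>, ?z) \<in> E n" unfolding E_def using \<mu> p by simp
  have r1: "Suc 0 \<le> r - 1" using r by simp
  define L where "L = (\<lambda>v. pd v (\<lambda>\<mu> z. \<phi> (pt \<mu> z)) \<mu> ?z)"
  define L' where "L' = (\<lambda>v. pd v (\<lambda>\<mu> w. \<psi> \<mu> (inv_into U \<phi> w)) \<mu> ?w)"
  have dL: "((\<lambda>z. \<phi> (pt \<mu> z)) has_derivative L) (at ?z)" unfolding L_def
    by (rule Ck_fibre_on_has_derivative[OF Ck_fibre_on_le[OF psi_smooth(2)[OF U(1)] r1]])
      (use \<mu> p U in auto)
  have dL': "((\<lambda>w. \<psi> \<mu> (inv_into U \<phi> w)) has_derivative L') (at ?w)" unfolding L'_def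
    by (rule Ck_fibre_on_has_derivative[OF Ck_fibre_on_le[OF psi_smooth(1)[OF U(1)] r1]])
      (use \<mu> p U in auto)
  have w: "\<psi> \<mu> (inv_into U \<phi> ?w) = ?z" using ch(6)[OF U(2)] by simp
  have Tz: "T n \<mu> ?z = ?z" unfolding T_def pz p(2) ..
  have inv: "L' (L v) = v" for v
  proof -
    have "((\<lambda>z. \<psi> \<mu> (inv_into U \<phi> (\<phi> (pt \<mu> z)))) has_derivative (\<lambda>v. L' (L v))) (at ?z)"
      by (rule has_derivative_compose[OF dL]) (use dL' pz in simp)
    then have "((\<lambda>z. z) has_derivative (\<lambda>v. L' (L v))) (at ?z)"
    proof (rule has_derivative_transform_within_open[OF _ open_slice[OF pt_preimage_open[OF ch(1)]]])
      show "?z \<in> {z. (\<mu>, z) \<in> {(\<mu>, z). (\<mu>, z) \<in> E 0 \<and> pt \<mu> z \<in> U}}"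
        using Ez E_subset pz U by auto
      show "\<psi> \<mu> (inv_into U \<phi> (\<phi> (pt \<mu> z))) = z"
        if "z \<in> {z. (\<mu>, z) \<in> {(\<mu>, z). (\<mu>, z) \<in> E 0 \<and> pt \<mu> z \<in> U}}" for z
        using that ch(6) E_psi(1) by auto
    qed
    from has_derivative_unique[OF this has_derivative_ident] show ?thesis by metis
  qed
  have d1: "((\<lambda>w. T n \<mu> (\<psi> \<mu> (inv_into U \<phi> w))) has_derivative (\<lambda>v. DT n \<mu> ?z (L' v))) (at ?w)"
    by (rule has_derivative_compose[OF dL']) (use T_has_derivative[OF Ez] w in simp)
  have "((\<lambda>w. \<phi> (pt \<mu> (T n \<mu> (\<psi> \<mu> (inv_into U \<phi> w))))) has_derivative (\<lambda>v. L (DT n \<mu> ?z (L' v)))) (at ?w)"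
    by (rule has_derivative_compose[OF d1]) (use dL w Tz in simp)
  then have d2: "((\<phi> \<circ> (f \<mu> ^^ n) \<circ> inv_into U \<phi>) has_derivative (\<lambda>v. L (DT n \<mu> ?z (L' v)))) (at ?w)"
  proof (rule has_derivative_transform_within_open)
    let ?N = "{z. (\<mu>, z) \<in> {(\<mu>, z). \<mu> \<in> I \<and> z \<in> \<phi> ` {p \<in> U. (f \<mu> ^^ 0) p \<in> U0}}} \<inter>
      {z. (\<mu>, z) \<in> {(\<mu>, z). \<mu> \<in> I \<and> z \<in> \<phi> ` {p \<in> U. (f \<mu> ^^ n) p \<in> U0}}}"
    show "open ?N"
      by (rule open_Int[OF open_slice[OF iterate_chart[OF U(1) open_U0]] open_slice[OF iterate_chart[OF U(1) open_U0]]])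
    show "?w \<in> ?N" using \<mu> U p by auto
    show "\<phi> (pt \<mu> (T n \<mu> (\<psi> \<mu> (inv_into U \<phi> z)))) = (\<phi> \<circ> (f \<mu> ^^ n) \<circ> inv_into U \<phi>) z" if "z \<in> ?N" for z
    proof -
      have "inv_into U \<phi> z \<in> U0" "(f \<mu> ^^ n) (inv_into U \<phi> z) \<in> U0"
        using that unfolding Int_iff mem_Collect_eq prod.case mem_image_inv_into[OF ch(3)] by simp_all
      then show ?thesis using \<mu> by (simp add: T_def)
    qed
  qed
  have lL: "linear L" "linear L'" "linear (DT n \<mu> ?z)"
    using has_derivative_linear[OF dL] has_derivative_linear[OF dL'] DT_linear[OF Ez] by auto
  define D' where "D' = matrix L ** (D ** matrix L')"
  have "L (DT n \<mu> ?z (L' v)) = D' *v v" for v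
  proof -
    have "matrix (L \<circ> (DT n \<mu> ?z \<circ> L')) = D'"
      unfolding D'_def D by (simp add: matrix_compose lL linear_compose)
    moreover have "linear (L \<circ> (DT n \<mu> ?z \<circ> L'))" by (intro linear_compose lL)
    ultimately show ?thesis using linear_matrix_components[of "L \<circ> (DT n \<mu> ?z \<circ> L')" v]
      by (simp add: vec2_eq_iff matrix_vector_mult_def sum_2)
  qed
  then have d3: "((\<phi> \<circ> (f \<mu> ^^ n) \<circ> inv_into U \<phi>) has_derivative (\<lambda>v. D' *v v)) (at ?w)" using d2 by simp
  have one: "matrix L' ** matrix L = mat 1"
  proof -
    have "L' \<circ> L = id" using inv by (simp add: fun_eq_iff)
    then show ?thesis using matrix_compose[OF lL(1,2)] by (simp add: matrix_id_mat_1)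
  qed
  have "trace D' = trace ((D ** matrix L') ** matrix L)" unfolding D'_def by (rule trace_mul_sym)
  also have "\<dots> = trace D" unfolding matrix_mul_assoc[symmetric] one by simp
  finally have "trace D' = trace D" .
  moreover have "det D' = det D"
  proof -
    have "det (matrix L') * det (matrix L) = 1" using one by (metis det_mul det_I)
    then show ?thesis unfolding D'_def det_mul by (simp add: algebra_simps)
  qed
  ultimately show ?thesis using d3 U by blast
qed

lemma elliptic_or_saddle:
  assumes \<mu>: "\<mu> \<in> I" and p: "p \<in> U0" "(f \<mu> ^^ n) p = p"
    and D: "D = matrix (DT n \<mu> (\<psi> \<mu> p))" and det: "det D = 1"
  shows "(trace D)\<^sup>2 < 4 \<Longrightarrow> elliptic A (f \<mu> ^^ n) p" "(trace D)\<^sup>2 > 4 \<Longrightarrow> saddle A (f \<mu> ^^ n) p"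
proof -
  obtain D' U \<phi> where D': "det D' = 1" "trace D' = trace D" "(U, \<phi>) \<in> A" "p \<in> U"
    "((\<phi> \<circ> (f \<mu> ^^ n) \<circ> inv_into U \<phi>) has_derivative (\<lambda>v. D' *v v)) (at (\<phi> p))"
    using conjugate_multipliers[OF \<mu> p D] det by auto
  have m: "multipliers A (f \<mu> ^^ n) p z w"
    if "\<forall>t. det (mat t - (\<chi> i j. complex_of_real (D' $ i $ j))) = (t - z) * (t - w)" for z w
    unfolding multipliers_def using D' that p by blast
  show "elliptic A (f \<mu> ^^ n) p" if "(trace D)\<^sup>2 < 4"
    unfolding elliptic_def using elliptic_roots[OF D'(1)] that m unfolding D'(2) by blast
  show "saddle A (f \<mu> ^^ n) p" if "(trace D)\<^sup>2 > 4"
    unfolding saddle_def using saddle_roots[OF D'(1)] that m unfolding D'(2) by blast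
qed

end

subsection \<open>Symmetric fixed points of the first return map\<close>

lemma inv_iterate_iterate:
  fixes g :: "'a \<Rightarrow> 'a"
  assumes "bij g"
  shows "(inv g ^^ n) ((g ^^ n) x) = x"
  using inv_fn_o_fn_is_id[OF assms, of n] by (metis comp_apply)

locale splitting_family = reversible_family A R f P \<psi> h l U0 r I
  for A :: "'m::{t2_space, second_countable_topology} chart set"
    and R f P \<psi> h l U0 r I +
  fixes N1m N1p :: "'m set" and Mm Mp :: 'm and q :: nat
    and xp ym a b c d :: "real \<Rightarrow> real"
  assumes I0: "0 \<in> I"
    and N1m: "open N1m" "N1m \<subseteq> U0" "Mm \<in> N1m" and N1p: "open N1p" "N1p \<subseteq> U0" "Mp \<in> N1p"
    and Mm_Mp: "(f 0 ^^ q) Mm = Mp" "\<psi> 0 Mm = vector [0, ym 0]" "\<psi> 0 Mp = vector [xp 0, 0]"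
    and splitting: "splitting_form I f \<psi> q N1m N1p xp ym a b c d"
begin

text \<open>The two symmetric points \<open>z0\<close> and \<open>w0\<close> cut the orbit into
  halves. It starts at \<open>p = R c0\<close> and passes \<open>z0\<close> after \<open>j\<close>
  steps, \<open>c0\<close> after \<open>j\<close> more, \<open>y0\<close> after \<open>q\<close>,
  \<open>w0\<close> after \<open>i\<close>, \<open>R y0\<close> after \<open>i\<close> more and
  \<open>R c0\<close> again after \<open>q\<close>. By \<open>iterate_reverse\<close> each piece
  after a symmetric point is the reflection of the piece before it.\<close>

lemma symmetric_point_exists:
  assumes E: "\<forall>n\<le>j. (\<mu>, z) \<in> E n" "\<forall>n\<le>i. (\<mu>, z') \<in> E n" and sym: "swap z = z" "swap z' = z'"
    and N: "pt \<mu> (T j \<mu> z) \<in> N1m" "(f \<mu> ^^ q) (pt \<mu> (T j \<mu> z)) \<in> N1p"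
    and conn: "(\<mu>, T j \<mu> z) \<in> E q" "T q \<mu> (T j \<mu> z) = swap (T i \<mu> z')"
    and p: "p = R (pt \<mu> (T j \<mu> z))"
  shows "symmetric_fixed_point R (f \<mu>) U0 N1m N1p q (2 * i) (2 * j) p"
proof -
  define g where "g = f \<mu>"
  define z0 c0 y0 w0 where "z0 = pt \<mu> z" and "c0 = pt \<mu> (T j \<mu> z)"
    and "y0 = (g ^^ q) c0" and "w0 = pt \<mu> z'"
  have z00: "(\<mu>, z) \<in> E 0" "(\<mu>, z') \<in> E 0" using E by auto
  have I: "\<mu> \<in> I" by (rule E_I[OF z00(1)])
  have bij: "bij g" unfolding g_def by (rule f_bij[OF I])
  have rev: "(g ^^ n) (R ((g ^^ n) x)) = R x" for n x unfolding g_def by (rule iterate_reverse[OF I])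
  have Rz: "R z0 = z0" "R w0 = w0" using swap_E0[OF z00(1)] swap_E0[OF z00(2)] sym unfolding z0_def w0_def by auto
  have zU: "(g ^^ n) z0 \<in> U0" if "n \<le> j" for n using E(1) that unfolding z0_def g_def E_def by auto
  have wU: "(g ^^ n) w0 \<in> U0" if "n \<le> i" for n using E(2) that unfolding w0_def g_def E_def by auto
  have c0: "c0 = (g ^^ j) z0" unfolding c0_def z0_def g_def using E by (intro pt_T) auto
  have "y0 = R ((g ^^ i) w0)"
  proof -
    have "(\<mu>, z') \<in> E i" using E by auto
    from swap_E0[OF T_E0[OF this]] pt_T[OF this] show ?thesis
      unfolding y0_def c0_def w0_def g_def pt_T[OF conn(1), symmetric] conn(2) by simp
  qed
  then have y0: "(g ^^ i) w0 = R y0" by simp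
  have p0: "p = R c0" unfolding p c0_def ..
  have jp: "(g ^^ j) p = z0" unfolding p0 c0 rev Rz ..
  have iy: "(g ^^ i) y0 = w0" using rev[of i w0] unfolding y0 Rz by simp
  have j2: "(g ^^ (2 * j)) p = c0" unfolding mult_2 funpow_add comp_apply jp c0 ..
  have i2: "(g ^^ (2 * i)) y0 = R y0" unfolding mult_2 funpow_add comp_apply iy y0 ..
  have qR: "(g ^^ q) (R y0) = p" unfolding y0_def rev p0 ..
  have pU: "(g ^^ n) p \<in> U0" if "n \<le> 2 * j" for n
  proof (cases "n \<le> j")
    case True
    have "(g ^^ n) p = (g ^^ n) (R ((g ^^ n) ((g ^^ (j - n)) z0)))"
      unfolding p0 c0 comp_apply[of "g ^^ n", symmetric] funpow_add[symmetric] using True by simp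
    then show ?thesis unfolding rev using zU[of "j - n"] by simp
  next
    case False
    have "(g ^^ n) p = (g ^^ (n - j)) ((g ^^ j) p)"
      unfolding comp_apply[of "g ^^ (n - j)", symmetric] funpow_add[symmetric] using False by simp
    then show ?thesis unfolding jp using zU[of "n - j"] that by simp
  qed
  have yU: "(g ^^ n) y0 \<in> U0" if "n \<le> 2 * i" for n
  proof (cases "n \<le> i")
    case True
    have "R ((g ^^ i) w0) = y0" using y0 by simp
    then have "(g ^^ n) y0 = (g ^^ n) (R ((g ^^ n) ((g ^^ (i - n)) w0)))"
      unfolding comp_apply[of "g ^^ n" "g ^^ (i - n)", symmetric] funpow_add[symmetric] using True by simp
    then show ?thesis unfolding rev using wU[of "i - n"] by simp
  next
    case False
    have "(g ^^ n) y0 = (g ^^ (n - i)) ((g ^^ i) y0)"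
      unfolding comp_apply[of "g ^^ (n - i)", symmetric] funpow_add[symmetric] using False by simp
    then show ?thesis unfolding iy using wU[of "n - i"] that by simp
  qed
  have N': "c0 \<in> N1m" "y0 \<in> N1p" using N unfolding c0_def y0_def g_def by auto
  have "p \<in> first_return_dom R g U0 N1m N1p q (2 * i) (2 * j)"
    unfolding first_return_dom_def Let_def mem_Collect_eq j2 y0_def[symmetric] i2 qR
    using pU yU N' p0 by blast
  moreover have "first_return g q (2 * i) (2 * j) p = p"
    unfolding first_return_def comp_apply j2 y0_def[symmetric] i2 qR ..
  moreover have "R ` full_orbit g p = full_orbit g p"
  proof -
    \<comment> \<open>One point of the orbit whose mirror image is again on the orbit is enough: by
      \<open>rev\<close>, reflection exchanges forward and backward iterates.\<close>
    have Rp: "R p = (g ^^ (2 * j)) p" unfolding j2 unfolding p0 by simp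
    have "R x \<in> full_orbit g p" if xo: "x \<in> full_orbit g p" for x
    proof -
      consider n where "x = (g ^^ n) p" | n where "x = (inv g ^^ n) p"
        using xo unfolding full_orbit_def by auto
      then show ?thesis
      proof cases
        case 1
        have "R x = (inv g ^^ n) ((g ^^ n) (R x))" by (simp add: inv_iterate_iterate[OF bij])
        also have "\<dots> = (inv g ^^ n) ((g ^^ (2 * j)) p)" unfolding 1 rev Rp ..
        finally have Rx: "R x = (inv g ^^ n) ((g ^^ (2 * j)) p)" .
        show ?thesis
        proof (cases "n \<le> 2 * j")
          case True
          have "(g ^^ (2 * j)) p = (g ^^ n) ((g ^^ (2 * j - n)) p)"
            unfolding comp_apply[of "g ^^ n", symmetric] funpow_add[symmetric] using True by simp
          then show ?thesis unfolding Rx full_orbit_def by (simp add: inv_iterate_iterate[OF bij])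
        next
          case False
          have "(inv g ^^ n) ((g ^^ (2 * j)) p) = (inv g ^^ (n - 2 * j)) ((inv g ^^ (2 * j)) ((g ^^ (2 * j)) p))"
            unfolding comp_apply[of "inv g ^^ (n - 2 * j)", symmetric] funpow_add[symmetric] using False by simp
          then show ?thesis unfolding Rx full_orbit_def by (simp add: inv_iterate_iterate[OF bij])
        qed
      next
        case 2
        have gx: "(g ^^ n) x = p" unfolding 2 using fn_o_inv_fn_is_id[OF bij, of n] by (metis comp_apply)
        have "R x = (g ^^ n) (R ((g ^^ n) x))" by (simp add: rev)
        also have "\<dots> = (g ^^ (n + 2 * j)) p" unfolding gx Rp funpow_add comp_apply ..
        finally show ?thesis unfolding full_orbit_def by simp
      qed
    qed
    then show ?thesis by (force intro!: image_eqI[where x = "R _"])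
  qed
  ultimately show ?thesis unfolding symmetric_fixed_point_def g_def by blast
qed

text \<open>The derivative of the full turn at \<open>p\<close> is
  \<open>L \<circ> (W \<circ> K)\<close>, where \<open>K\<close> leads from \<open>p\<close> to the
  first symmetric point, \<open>W\<close> on to the second one and \<open>L\<close> back to
  \<open>p\<close>. The trace is invariant under cyclic permutation, and
  \<open>V = K \<circ> L\<close> is the passage from the second symmetric point to the first, so
  \<open>reversible_trace\<close> applies to \<open>V \<circ> W\<close>.\<close>

lemma first_return_multipliers:
  assumes E: "\<forall>n\<le>j. (\<mu>, z) \<in> E n" "\<forall>n\<le>i. (\<mu>, z') \<in> E n" and sym: "swap z = z" "swap z' = z'"
    and conn: "(\<mu>, T j \<mu> z) \<in> E q" "T q \<mu> (T j \<mu> z) = swap (T i \<mu> z')"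
    and W1: "DT q \<mu> (T j \<mu> z) (DT j \<mu> z (vector [1, 1])) =
      \<alpha> *\<^sub>R swap (DT i \<mu> z' (vector [1, 1])) - \<gamma> *\<^sub>R swap (DT i \<mu> z' (vector [1, -1]))"
    and W2: "DT q \<mu> (T j \<mu> z) (DT j \<mu> z (vector [1, -1])) =
      \<beta> *\<^sub>R swap (DT i \<mu> z' (vector [1, 1])) - \<delta> *\<^sub>R swap (DT i \<mu> z' (vector [1, -1]))"
    and p: "p = R (pt \<mu> (T j \<mu> z))"
    and fixed: "first_return (f \<mu>) q (2 * i) (2 * j) p = p"
  shows "\<alpha> * \<beta> * \<gamma> * \<delta> < 0 \<Longrightarrow> elliptic A (first_return (f \<mu>) q (2 * i) (2 * j)) p"
    "\<alpha> * \<beta> * \<gamma> * \<delta> > 0 \<Longrightarrow> saddle A (first_return (f \<mu>) q (2 * i) (2 * j)) p"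
proof -
  define c where "c = T j \<mu> z"
  have Ej: "(\<mu>, z) \<in> E j" and Ei: "(\<mu>, z') \<in> E i" using E by auto
  have Eq: "(\<mu>, c) \<in> E q" using conn unfolding c_def by simp
  have I: "\<mu> \<in> I" by (rule E_I[OF Ej])
  have E1: "(\<mu>, T q \<mu> c) \<in> E i" "T i \<mu> (T q \<mu> c) = z'"
    using T_reverse[OF Ei] conn(2) sym(2) unfolding c_def by auto
  have Eqj: "(\<mu>, z) \<in> E (q + j)" "T (q + j) \<mu> z = T q \<mu> c"
    using E_add[OF Ej] Eq T_add[OF Ej] unfolding c_def by auto
  have EN: "(\<mu>, z) \<in> E (i + (q + j))" "T (i + (q + j)) \<mu> z = z'"
    using E_add[OF Eqj(1)] T_add[OF Eqj(1)] E1 Eqj(2) by auto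
  let ?N = "i + (q + j)"
  have ENz': "(\<mu>, z') \<in> E ?N" "T ?N \<mu> z' = z"
    using T_reverse[OF EN(1)] EN(2) sym by auto
  define W V where "W = DT ?N \<mu> z" and "V = DT ?N \<mu> z'"
  have lin: "linear W" "linear V" unfolding W_def V_def by (rule DT_linear[OF EN(1)], rule DT_linear[OF ENz'(1)])
  have rev: "V (swap (W v)) = swap v" for v
    using DT_reverse[OF EN(1), of v] EN(2) sym unfolding W_def V_def by simp
  have Wv: "W v = DT i \<mu> (T q \<mu> c) (DT q \<mu> c (DT j \<mu> z v))" for v
    unfolding W_def using DT_add[OF Eqj(1), of i] DT_add[OF Ej, of q] Eq E1 Eqj(2) unfolding c_def by simp
  have rev_i: "DT i \<mu> (T q \<mu> c) (swap (DT i \<mu> z' v)) = swap v" for v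
    using DT_reverse[OF Ei, of v] conn(2) unfolding c_def by simp
  \<comment> \<open>The second eigenvector changes its sign under the reflection, which is where the
    minus signs in \<open>W1\<close> and \<open>W2\<close> come from.\<close>
  have sw: "swap (vector [1, 1]) = vector [1, 1]" "swap (vector [1, -1]) = - vector [1, -1]"
    by (simp_all add: vec2_eq_iff)
  note li = DT_linear[OF E1(1)]
  have W: "W (vector [1, 1]) = \<alpha> *\<^sub>R vector [1, 1] + \<gamma> *\<^sub>R vector [1, -1]"
    "W (vector [1, -1]) = \<beta> *\<^sub>R vector [1, 1] + \<delta> *\<^sub>R vector [1, -1]"
    unfolding Wv W1[folded c_def] W2[folded c_def] linear_diff[OF li] linear_scale[OF li] rev_i sw by simp_all
  obtain k where k: "k > 0" "(trace (matrix (V \<circ> W)))\<^sup>2 - 4 = k * (\<alpha> * \<beta> * \<gamma> * \<delta>)"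
    using reversible_trace(1)[OF lin rev W] by blast
  have det1: "det (matrix (V \<circ> W)) = 1" by (rule reversible_trace(2)[OF lin rev W])
  have Es: "(\<mu>, swap c) \<in> E j" "T j \<mu> (swap c) = z"
    using T_reverse[OF Ej] sym unfolding c_def by auto
  have Eq': "(\<mu>, T i \<mu> z') \<in> E q" "T q \<mu> (T i \<mu> z') = swap c"
  proof -
    have "swap (T q \<mu> c) = T i \<mu> z'" using conn(2) unfolding c_def by simp
    then show "(\<mu>, T i \<mu> z') \<in> E q" "T q \<mu> (T i \<mu> z') = swap c"
      using T_reverse[OF Eq] by auto
  qed
  have Eqi: "(\<mu>, z') \<in> E (q + i)" "T (q + i) \<mu> z' = swap c"
    using E_add[OF Ei] T_add[OF Ei] Eq' by auto
  define K L where "K = DT j \<mu> (swap c)" and "L = DT (q + i) \<mu> z'"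
  have lKL: "linear K" "linear L" unfolding K_def L_def by (rule DT_linear[OF Es(1)], rule DT_linear[OF Eqi(1)])
  have V: "V = K \<circ> L"
  proof
    fix v
    have "DT ?N \<mu> z' v = DT (j + (q + i)) \<mu> z' v" by (simp add: add_ac)
    then show "V v = (K \<circ> L) v"
      unfolding V_def K_def L_def comp_apply using DT_add[OF Eqi(1), of j v] Es Eqi(2) by simp
  qed
  have E3: "(\<mu>, swap c) \<in> E (?N + j)" "T (?N + j) \<mu> (swap c) = z'"
    using E_add[OF Es(1)] T_add[OF Es(1)] Es(2) EN by auto
  let ?Q = "(q + i) + (?N + j)"
  have D: "DT ?Q \<mu> (swap c) = L \<circ> (W \<circ> K)"
  proof
    fix v
    show "DT ?Q \<mu> (swap c) v = (L \<circ> (W \<circ> K)) v"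
      using DT_add[OF E3(1), of "q + i" v] DT_add[OF Es(1), of ?N v] E3(2) Eqi(1) Es(2) EN(1)
      unfolding L_def W_def K_def by simp
  qed
  have mD: "matrix (DT ?Q \<mu> (swap c)) = matrix L ** (matrix W ** matrix K)"
    unfolding D by (simp add: matrix_compose lKL lin linear_compose)
  have mV: "matrix (V \<circ> W) = matrix K ** matrix L ** matrix W"
    unfolding V by (simp add: matrix_compose lKL lin linear_compose)
  have tr: "trace (matrix (DT ?Q \<mu> (swap c))) = trace (matrix (V \<circ> W))"
    unfolding mD mV by (metis matrix_mul_assoc trace_mul_sym)
  have det: "det (matrix (DT ?Q \<mu> (swap c))) = 1"
    using det1 unfolding mD mV det_mul by (simp add: mult_ac)
  have c0: "(\<mu>, c) \<in> E 0" using E_subset Eq by blast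
  have pU: "p \<in> U0" unfolding p c_def[symmetric] using E_psi(2)[OF c0] by simp
  have psi_p: "\<psi> \<mu> p = swap c"
    unfolding p c_def[symmetric] using psi_R[OF I E_psi(2)[OF c0]] E_psi(1)[OF c0] by simp
  have fr: "first_return (f \<mu>) q (2 * i) (2 * j) = (f \<mu> ^^ ?Q)"
  proof -
    show ?thesis unfolding first_return_def mult_2 by (simp add: funpow_add comp_assoc)
  qed
  note es = elliptic_or_saddle[OF I pU fixed[unfolded fr] refl, unfolded psi_p, OF det, unfolded tr]
  show "elliptic A (first_return (f \<mu>) q (2 * i) (2 * j)) p" if "\<alpha> * \<beta> * \<gamma> * \<delta> < 0"
    unfolding fr using es(1) k mult_pos_neg[OF k(1) that] by linarith
  show "saddle A (first_return (f \<mu>) q (2 * i) (2 * j)) p" if "\<alpha> * \<beta> * \<gamma> * \<delta> > 0"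
    unfolding fr using es(2) k mult_pos_pos[OF k(1) that] by linarith
qed

section \<open>The global map and its derivatives near the tangency\<close>

definition dom1 :: "(real \<times> (real^2)) set" where
  "dom1 = {(\<mu>, z). (\<mu>, z) \<in> E q \<and> pt \<mu> z \<in> N1m \<and> (f \<mu> ^^ q) (pt \<mu> z) \<in> N1p}"

lemma dom1_open: "open dom1"
proof -
  have "dom1 = E q \<inter> {(\<mu>, z). (\<mu>, z) \<in> E 0 \<and> pt \<mu> z \<in> N1m} \<inter>
      {(\<mu>, z). (\<mu>, z) \<in> E 0 \<and> (f \<mu> ^^ q) (pt \<mu> z) \<in> N1p}"
    unfolding dom1_def using E_subset by auto
  then show ?thesis using E_open pt_preimage_open[OF N1m(1)] iterate_preimage_open[OF N1p(1)]
    by (simp add: open_Int)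
qed

abbreviation "base \<equiv> vector [0, ym 0] :: real^2"

lemma base_dom1: "(0, base) \<in> dom1" and T_base: "T q 0 base = vector [xp 0, 0]"
proof -
  have Mm: "Mm \<in> U0" "Mp \<in> U0" using N1m N1p by auto
  have pt: "pt 0 base = Mm" using pt_psi[OF I0 Mm(1)] Mm_Mp by simp
  have "base \<in> \<psi> 0 ` U0" using Mm Mm_Mp by (metis imageI)
  then show "(0, base) \<in> dom1" unfolding dom1_def E_def using I0 pt Mm_Mp N1m N1p Mm by simp
  show "T q 0 base = vector [xp 0, 0]" unfolding T_def pt using Mm_Mp by simp
qed

lemma splitting_bounds:
  obtains C where "C \<ge> 0" "\<And>\<mu> y. (\<mu>, vector [0, y]) \<in> dom1 \<Longrightarrow>
    \<bar>Ty q \<mu> (vector [0, y]) - (\<mu> + d \<mu> * (y - ym \<mu>)\<^sup>2)\<bar> \<le> C * \<bar>y - ym \<mu>\<bar> ^ 3"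
proof -
  obtain C where C: "\<And>\<mu> p. \<mu> \<in> I \<Longrightarrow> p \<in> N1m \<Longrightarrow> (f \<mu> ^^ q) p \<in> N1p \<Longrightarrow>
        (let x = \<psi> \<mu> p $ 1; v = \<psi> \<mu> p $ 2 - ym \<mu>;
             x' = \<psi> \<mu> ((f \<mu> ^^ q) p) $ 1; y' = \<psi> \<mu> ((f \<mu> ^^ q) p) $ 2 in
           \<bar>x' - xp \<mu> - (a \<mu> * x + b \<mu> * v)\<bar> \<le> C * (v\<^sup>2 + x\<^sup>2) \<and>
           \<bar>y' - (\<mu> + c \<mu> * x + d \<mu> * v\<^sup>2)\<bar> \<le> C * (x\<^sup>2 + \<bar>v\<bar> ^ 3 + \<bar>x\<bar> * \<bar>v\<bar>))"
    using splitting unfolding splitting_form_def by blast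
  show ?thesis
  proof (rule that[of "max C 0"])
    fix \<mu> y assume m: "(\<mu>, vector [0, y]) \<in> dom1"
    then have E: "(\<mu>, vector [0, y]) \<in> E q" and N: "pt \<mu> (vector [0, y]) \<in> N1m"
      "(f \<mu> ^^ q) (pt \<mu> (vector [0, y])) \<in> N1p" unfolding dom1_def by auto
    have "\<bar>Ty q \<mu> (vector [0, y]) - (\<mu> + d \<mu> * (y - ym \<mu>)\<^sup>2)\<bar> \<le> C * \<bar>y - ym \<mu>\<bar> ^ 3"
      using C[OF E_I[OF E] N] E_psi(1)[OF E] unfolding Let_def Ty_def T_def by simp
    also have "\<dots> \<le> max C 0 * \<bar>y - ym \<mu>\<bar> ^ 3" by (intro mult_right_mono) auto
    finally show "\<bar>Ty q \<mu> (vector [0, y]) - (\<mu> + d \<mu> * (y - ym \<mu>)\<^sup>2)\<bar> \<le> max C 0 * \<bar>y - ym \<mu>\<bar> ^ 3" .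
  qed simp
qed

lemma dom1_E: "(\<mu>, z) \<in> dom1 \<Longrightarrow> (\<mu>, z) \<in> E q" unfolding dom1_def by auto

text \<open>On the axis \<open>x = 0\<close> the remainder of the splitting form is cubic, so height
  and slope at the vertex \<open>ym \<mu>\<close> are exact for every \<mu>, although the vertex may
  move. Here \<mu> becomes the height of the parabola.\<close>

lemma Ty_vertex:
  assumes "(\<mu>, vector [0, ym \<mu>]) \<in> dom1"
  shows "Ty q \<mu> (vector [0, ym \<mu>]) = \<mu>" "pd dy (Ty q) \<mu> (vector [0, ym \<mu>]) = 0"
proof -
  obtain C where C: "C \<ge> 0" "\<And>\<mu> y. (\<mu>, vector [0, y]) \<in> dom1 \<Longrightarrow>
    \<bar>Ty q \<mu> (vector [0, y]) - (\<mu> + d \<mu> * (y - ym \<mu>)\<^sup>2)\<bar> \<le> C * \<bar>y - ym \<mu>\<bar> ^ 3"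
    by (rule splitting_bounds) blast
  show v: "Ty q \<mu> (vector [0, ym \<mu>]) = \<mu>" using C(2)[OF assms] by simp
  let ?S = "{y. (\<mu>, vector [0, y]) \<in> dom1}"
  have "open ((\<lambda>y. vector [0, y]) -` {z. (\<mu>, z) \<in> dom1})"
    by (rule open_vimage[OF open_slice[OF dom1_open]]) (intro continuous_intros)
  then have oS: "open ?S" by (simp add: vimage_def)
  then obtain e where e: "e > 0" "ball (ym \<mu>) e \<subseteq> ?S" using assms open_contains_ball_eq by blast
  let ?\<phi> = "\<lambda>y. Ty q \<mu> (vector [0, y])"
  have "((\<lambda>k. (?\<phi> (ym \<mu> + k) - ?\<phi> (ym \<mu>)) / k) \<longlongrightarrow> 0) (at 0)"
  proof (rule Lim_null_comparison)
    show "((\<lambda>k. \<bar>d \<mu>\<bar> * \<bar>k\<bar> + C * \<bar>k\<bar> ^ 2) \<longlongrightarrow> 0) (at 0)"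
      by (rule tendsto_eq_intros refl | simp)+
    show "\<forall>\<^sub>F k in at 0. norm ((?\<phi> (ym \<mu> + k) - ?\<phi> (ym \<mu>)) / k) \<le> \<bar>d \<mu>\<bar> * \<bar>k\<bar> + C * \<bar>k\<bar> ^ 2"
      unfolding eventually_at
    proof (intro exI[of _ e] conjI ballI impI)
      fix k :: real assume k: "k \<noteq> 0 \<and> dist k 0 < e"
      then have "ym \<mu> + k \<in> ball (ym \<mu>) e" by (simp add: dist_real_def)
      then have "(\<mu>, vector [0, ym \<mu> + k]) \<in> dom1" using e(2) by blast
      from C(2)[OF this] have "\<bar>?\<phi> (ym \<mu> + k) - \<mu> - d \<mu> * k\<^sup>2\<bar> \<le> C * \<bar>k\<bar> ^ 3"
        by (simp add: algebra_simps)
      then have "\<bar>?\<phi> (ym \<mu> + k) - \<mu>\<bar> \<le> \<bar>d \<mu> * k\<^sup>2\<bar> + C * \<bar>k\<bar> ^ 3" by linarith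
      also have "\<dots> = (\<bar>d \<mu>\<bar> * \<bar>k\<bar> + C * \<bar>k\<bar> ^ 2) * \<bar>k\<bar>"
        by (simp add: abs_mult power2_eq_square power3_eq_cube algebra_simps)
      finally show "norm ((?\<phi> (ym \<mu> + k) - ?\<phi> (ym \<mu>)) / k) \<le> \<bar>d \<mu>\<bar> * \<bar>k\<bar> + C * \<bar>k\<bar> ^ 2"
        using k unfolding v by (simp add: pos_divide_le_eq)
    qed (rule e(1))
  qed
  then have "DERIV ?\<phi> (ym \<mu>) :> 0" unfolding DERIV_def .
  from DERIV_unique[OF pd_DERIV(2)[OF T_component_Suc(2) dom1_E[OF assms]] this]
  show "pd dy (Ty q) \<mu> (vector [0, ym \<mu>]) = 0" .
qed

text \<open>The splitting form bounds values, not derivatives. If the second derivative vanished,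
  then the slope at distance \<open>k\<close> from the vertex would be at most a quarter of
  \<open>\<bar>d 0\<bar> * k\<close> for small \<open>k\<close>, and the height at most a quarter of
  \<open>\<bar>d 0\<bar> * k\<^sup>2\<close>; the form demands
  \<open>\<bar>d 0\<bar> * k\<^sup>2\<close> up to another quarter.\<close>

lemma tangency_quadratic: "pd dy (pd dy (Ty q)) 0 base \<noteq> 0"
proof
  assume z: "pd dy (pd dy (Ty q)) 0 base = 0"
  have d0: "d 0 \<noteq> 0" using splitting I0 unfolding splitting_form_def by blast
  obtain C where C: "C \<ge> 0" "\<And>\<mu> y. (\<mu>, vector [0, y]) \<in> dom1 \<Longrightarrow>
    \<bar>Ty q \<mu> (vector [0, y]) - (\<mu> + d \<mu> * (y - ym \<mu>)\<^sup>2)\<bar> \<le> C * \<bar>y - ym \<mu>\<bar> ^ 3"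
    by (rule splitting_bounds) blast
  let ?S = "{y. (0, vector [0, y]) \<in> dom1}"
  have "open ((\<lambda>y. vector [0, y]) -` {z. (0, z) \<in> dom1})"
    by (rule open_vimage[OF open_slice[OF dom1_open]]) (intro continuous_intros)
  then have oS: "open ?S" by (simp add: vimage_def)
  then obtain e where e: "e > 0" "ball (ym 0) e \<subseteq> ?S" using base_dom1 open_contains_ball_eq by blast
  let ?\<phi> = "\<lambda>y. Ty q 0 (vector [0, y])" and ?\<phi>' = "\<lambda>y. pd dy (Ty q) 0 (vector [0, y])"
  have "DERIV ?\<phi>' (ym 0) :> 0"
    using pd_DERIV(2)[OF pd_component_Suc(2)[of q dy] dom1_E[OF base_dom1]] unfolding z .
  then have "((\<lambda>k. (?\<phi>' (ym 0 + k) - ?\<phi>' (ym 0)) / k) \<longlongrightarrow> 0) (at 0)" unfolding DERIV_def .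
  then have "\<forall>\<^sub>F k in at 0. dist ((?\<phi>' (ym 0 + k) - ?\<phi>' (ym 0)) / k) 0 < \<bar>d 0\<bar> / 4"
    using d0 by (intro tendstoD) auto
  then obtain e1 where e1: "e1 > 0" "\<And>k. k \<noteq> 0 \<Longrightarrow> \<bar>k\<bar> < e1 \<Longrightarrow> \<bar>?\<phi>' (ym 0 + k) / k\<bar> < \<bar>d 0\<bar> / 4"
    unfolding eventually_at using Ty_vertex(2)[OF base_dom1] by (auto simp: dist_real_def)
  define k where "k = min (min (e / 2) (e1 / 2)) (\<bar>d 0\<bar> / (4 * (C + 1)))"
  have k: "k > 0" "k < e" "k < e1" "C * k \<le> \<bar>d 0\<bar> / 4"
  proof -
    show "k > 0" "k < e" "k < e1" unfolding k_def using e e1 d0 C by auto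
    have "k \<le> \<bar>d 0\<bar> / (4 * (C + 1))" unfolding k_def by simp
    then have "(C + 1) * k \<le> \<bar>d 0\<bar> / 4" using C by (simp add: field_simps)
    then show "C * k \<le> \<bar>d 0\<bar> / 4" using \<open>k > 0\<close> by (simp add: algebra_simps)
  qed
  have inS: "(0, vector [0, ym 0 + t]) \<in> dom1" if "\<bar>t\<bar> \<le> k" for t
  proof -
    have "ym 0 + t \<in> ball (ym 0) e" using that k by (simp add: dist_real_def)
    then show ?thesis using e(2) by blast
  qed
  have der: "DERIV (\<lambda>t. ?\<phi> (ym 0 + t)) t :> ?\<phi>' (ym 0 + t)" if "\<bar>t\<bar> \<le> k" for t
    using DERIV_shift[of ?\<phi> "?\<phi>' (ym 0 + t)" t "ym 0"]
      pd_DERIV(2)[OF T_component_Suc(2) dom1_E[OF inS[OF that]]] by (simp add: add.commute)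
  have "\<bar>(\<lambda>t. ?\<phi> (ym 0 + t)) k - (\<lambda>t. ?\<phi> (ym 0 + t)) 0\<bar> \<le> (\<bar>d 0\<bar> / 4 * k) * \<bar>k\<bar>"
  proof (rule MVT_bound_zero[OF der])
    fix t assume t: "\<bar>t\<bar> \<le> \<bar>k\<bar>"
    then show "\<bar>t\<bar> \<le> k" using k by simp
    show "\<bar>?\<phi>' (ym 0 + t)\<bar> \<le> \<bar>d 0\<bar> / 4 * k"
    proof (cases "t = 0")
      case True
      then show ?thesis using Ty_vertex(2)[OF base_dom1] k by simp
    next
      case False
      then have "\<bar>?\<phi>' (ym 0 + t)\<bar> \<le> \<bar>d 0\<bar> / 4 * \<bar>t\<bar>"
        using e1(2)[of t] t k by (simp add: abs_divide pos_divide_less_eq less_imp_le)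
      also have "\<dots> \<le> \<bar>d 0\<bar> / 4 * k" using t k by (intro mult_left_mono) auto
      finally show ?thesis .
    qed
  qed
  then have "\<bar>?\<phi> (ym 0 + k)\<bar> \<le> \<bar>d 0\<bar> / 4 * k\<^sup>2"
    using Ty_vertex(1)[OF base_dom1] k by (simp add: power2_eq_square)
  moreover have "\<bar>?\<phi> (ym 0 + k) - d 0 * k\<^sup>2\<bar> \<le> C * k ^ 3"
    using C(2)[OF inS[of k]] k by simp
  moreover have "C * k ^ 3 \<le> \<bar>d 0\<bar> / 4 * k\<^sup>2"
    using mult_right_mono[OF k(4), of "k\<^sup>2"] by (simp add: power2_eq_square power3_eq_cube)
  moreover have "\<bar>d 0 * k\<^sup>2\<bar> = \<bar>d 0\<bar> * k\<^sup>2" by (simp add: abs_mult)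
  moreover have "\<bar>d 0\<bar> * k\<^sup>2 > 0" using d0 k by simp
  ultimately show False by linarith
qed

text \<open>By \<open>DT_reverse\<close> the derivative of the global map is injective. Its entry
  \<open>pd dy (Ty q)\<close> vanishes at the tangency, so neither of the two off-diagonal entries
  can.\<close>

lemma transversal_derivatives: "pd dy (Tx q) 0 base \<noteq> 0" "pd dx (Ty q) 0 base \<noteq> 0"
proof -
  note E = dom1_E[OF base_dom1]
  have l: "linear (DT q 0 (swap (T q 0 base)))" by (rule DT_linear[OF T_reverse(1)[OF E]])
  have inj: "v = 0" if "DT q 0 base v = 0" for v
  proof -
    have "swap v = 0" using DT_reverse[OF E, of v] that linear_0[OF l]
      by (simp add: linear_0[OF bounded_linear.linear[OF bounded_linear_swap]])
    then show ?thesis by (metis swap_swap linear_0[OF bounded_linear.linear[OF bounded_linear_swap]])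
  qed
  note z = Ty_vertex(2)[OF base_dom1]
  show b: "pd dy (Tx q) 0 base \<noteq> 0"
  proof
    assume "pd dy (Tx q) 0 base = 0"
    then have "DT q 0 base (vector [0, 1]) = 0" unfolding DT_components[OF E] using z by (simp add: vec2_eq_iff)
    from inj[OF this] show False by (simp add: vec2_eq_iff)
  qed
  show "pd dx (Ty q) 0 base \<noteq> 0"
  proof
    assume "pd dx (Ty q) 0 base = 0"
    then have "DT q 0 base (vector [pd dy (Tx q) 0 base, - pd dx (Tx q) 0 base]) = 0"
      unfolding DT_components[OF E] using z by (simp add: vec2_eq_iff)
    from inj[OF this] show False using b by (simp add: vec2_eq_iff)
  qed
qed

lemma open_close:
  fixes g :: "real \<Rightarrow> real^2 \<Rightarrow> real"
  assumes "Ck_fibre_on k (E q) g"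
  shows "open {(\<mu>, z). (\<mu>, z) \<in> dom1 \<and> \<bar>g \<mu> z - v\<bar> < \<epsilon>}"
proof -
  have c: "continuous_on dom1 (\<lambda>(\<mu>, z). g \<mu> z)"
    by (rule continuous_on_subset[OF Ck_fibre_on_continuous[OF assms]]) (use dom1_E in auto)
  have "open {w. \<bar>w - v\<bar> < \<epsilon>}" by (intro open_Collect_less continuous_intros)
  from continuous_open_preimage[OF c dom1_open this] show ?thesis
    by (rule back_subst[of "open"]) auto
qed

lemma box_estimates:
  assumes "\<epsilon> > 0"
  obtains \<rho> where "\<rho> > 0" "\<And>\<mu> x y. \<bar>\<mu>\<bar> \<le> \<rho> \<Longrightarrow> \<bar>x\<bar> \<le> \<rho> \<Longrightarrow> \<bar>y - ym 0\<bar> \<le> \<rho> \<Longrightarrow>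
    (\<mu>, vector [x, y]) \<in> dom1 \<and> \<bar>Tx q \<mu> (vector [x, y]) - xp 0\<bar> < \<epsilon> \<and>
    \<bar>pd dx (Tx q) \<mu> (vector [x, y]) - pd dx (Tx q) 0 base\<bar> < \<epsilon> \<and>
    \<bar>pd dy (Tx q) \<mu> (vector [x, y]) - pd dy (Tx q) 0 base\<bar> < \<epsilon> \<and>
    \<bar>pd dx (Ty q) \<mu> (vector [x, y]) - pd dx (Ty q) 0 base\<bar> < \<epsilon> \<and>
    \<bar>pd dx (pd dy (Ty q)) \<mu> (vector [x, y]) - pd dx (pd dy (Ty q)) 0 base\<bar> < \<epsilon> \<and>
    \<bar>pd dy (pd dy (Ty q)) \<mu> (vector [x, y]) - pd dy (pd dy (Ty q)) 0 base\<bar> < \<epsilon>"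
proof -
  let ?B = "\<lambda>g v. {(\<mu>, z). (\<mu>, z) \<in> dom1 \<and> \<bar>g \<mu> z - v\<bar> < \<epsilon>}"
  define S where "S = ?B (Tx q) (xp 0) \<inter> ?B (pd dx (Tx q)) (pd dx (Tx q) 0 base) \<inter>
    ?B (pd dy (Tx q)) (pd dy (Tx q) 0 base) \<inter> ?B (pd dx (Ty q)) (pd dx (Ty q) 0 base) \<inter>
    ?B (pd dx (pd dy (Ty q))) (pd dx (pd dy (Ty q)) 0 base) \<inter>
    ?B (pd dy (pd dy (Ty q))) (pd dy (pd dy (Ty q)) 0 base)"
  have "open S" unfolding S_def
    by (intro open_Int open_close[OF T_component_Suc(1)] open_close[OF pd_component_Suc(1)]
        open_close[OF pd_component_Suc(2)] open_close[OF pd2_component_Suc(2)])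
  then have o: "open ((\<lambda>u. (fst u, vector [fst (snd u), snd (snd u)])) -` S)"
    by (rule open_vimage) (intro continuous_intros)
  have "(0, 0, ym 0) \<in> (\<lambda>u. (fst u, vector [fst (snd u), snd (snd u)])) -` S"
    unfolding S_def using base_dom1 T_base assms by (simp add: Tx_def)
  from open_box3[OF o this] obtain \<rho> where \<rho>: "\<rho> > 0" "\<And>\<mu> x y. \<bar>\<mu> - 0\<bar> \<le> \<rho> \<Longrightarrow> \<bar>x - 0\<bar> \<le> \<rho> \<Longrightarrow>
      \<bar>y - ym 0\<bar> \<le> \<rho> \<Longrightarrow> (\<mu>, x, y) \<in> (\<lambda>u. (fst u, vector [fst (snd u), snd (snd u)])) -` S" by blast
  show ?thesis
  proof (rule that[OF \<rho>(1)])
    fix \<mu> x y assume "\<bar>\<mu>\<bar> \<le> \<rho>" "\<bar>x\<bar> \<le> \<rho>" "\<bar>y - ym 0\<bar> \<le> \<rho>"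
    then have "(\<mu>, vector [x, y]) \<in> S" using \<rho>(2)[of \<mu> x y] by simp
    then show "(\<mu>, vector [x, y]) \<in> dom1 \<and> \<bar>Tx q \<mu> (vector [x, y]) - xp 0\<bar> < \<epsilon> \<and>
    \<bar>pd dx (Tx q) \<mu> (vector [x, y]) - pd dx (Tx q) 0 base\<bar> < \<epsilon> \<and>
    \<bar>pd dy (Tx q) \<mu> (vector [x, y]) - pd dy (Tx q) 0 base\<bar> < \<epsilon> \<and>
    \<bar>pd dx (Ty q) \<mu> (vector [x, y]) - pd dx (Ty q) 0 base\<bar> < \<epsilon> \<and>
    \<bar>pd dx (pd dy (Ty q)) \<mu> (vector [x, y]) - pd dx (pd dy (Ty q)) 0 base\<bar> < \<epsilon> \<and>
    \<bar>pd dy (pd dy (Ty q)) \<mu> (vector [x, y]) - pd dy (pd dy (Ty q)) 0 base\<bar> < \<epsilon>"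
      unfolding S_def by simp
  qed
qed

end

subsection \<open>Unfolding the tangency\<close>

lemma continuous_near:
  fixes g :: "real \<Rightarrow> real"
  assumes "continuous_on S g" "open S" "0 \<in> S" "\<epsilon> > 0"
  shows "\<exists>e>0. \<forall>\<mu>. \<bar>\<mu>\<bar> \<le> e \<longrightarrow> \<mu> \<in> S \<and> \<bar>g \<mu> - g 0\<bar> \<le> \<epsilon>"
proof -
  have "open {w. \<bar>w - g 0\<bar> < \<epsilon>}" by (intro open_Collect_less continuous_intros)
  from continuous_open_preimage[OF assms(1,2) this]
  have "open (S \<inter> g -` {w. \<bar>w - g 0\<bar> < \<epsilon>})" .
  moreover have "0 \<in> S \<inter> g -` {w. \<bar>w - g 0\<bar> < \<epsilon>}" using assms by simp
  ultimately obtain e where e: "e > 0" "cball 0 e \<subseteq> S \<inter> g -` {w. \<bar>w - g 0\<bar> < \<epsilon>}"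
    using open_contains_cball_eq by blast
  have "\<mu> \<in> S \<and> \<bar>g \<mu> - g 0\<bar> \<le> \<epsilon>" if "\<bar>\<mu>\<bar> \<le> e" for \<mu>
  proof -
    have "\<mu> \<in> cball 0 e" using that by simp
    then show ?thesis using e(2) by auto
  qed
  then show ?thesis using e(1) by blast
qed

lemma curve_DERIV:
  fixes F :: "real \<Rightarrow> real^2 \<Rightarrow> real"
  assumes "Ck_fibre_on (Suc k) S F" "(\<mu>, vector [\<gamma> s, s]) \<in> S" "DERIV \<gamma> s :> g"
  shows "DERIV (\<lambda>s. F \<mu> (vector [\<gamma> s, s])) s :>
    pd (axis 1 1) F \<mu> (vector [\<gamma> s, s]) * g + pd (axis 2 1) F \<mu> (vector [\<gamma> s, s])"
proof -
  note d = Ck_fibre_on_has_derivative[OF assms(1,2)]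
  have l: "linear (\<lambda>v. pd v F \<mu> (vector [\<gamma> s, s]))" using has_derivative_linear[OF d] .
  have "(\<gamma> has_derivative (\<lambda>t. g * t)) (at s)" using assms(3) unfolding has_field_derivative_def .
  then have "((\<lambda>s. vector [\<gamma> s, s] :: real^2) has_derivative (\<lambda>t. (g * t) *\<^sub>R axis 1 1 + t *\<^sub>R axis 2 1)) (at s)"
    unfolding vector2_decomp by (auto intro!: derivative_eq_intros)
  from has_derivative_compose[OF this d] show ?thesis
    unfolding has_field_derivative_def
    by (rule has_derivative_eq_rhs) (simp add: fun_eq_iff linear_add[OF l] linear_scale[OF l] algebra_simps)
qed

text \<open>Different pairs might share an interval, and intervals may contain 0. If there were only
  finitely many, choose a nonzero point in each of them; a late interval is closer to 0 than all the
  chosen points, including its own.\<close>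

lemma infinite_accumulating_intervals:
  fixes \<delta> :: "nat \<Rightarrow> nat \<Rightarrow> real set"
  assumes S: "\<forall>N. \<exists>(k, m)\<in>S. k \<ge> N \<and> m \<ge> N"
    and iv: "\<forall>(k, m)\<in>S. \<exists>u v. u < v \<and> \<delta> k m = {u<..<v}"
    and acc: "\<forall>\<epsilon>>0. \<exists>N. \<forall>(k, m)\<in>S. k \<ge> N \<and> m \<ge> N \<longrightarrow> \<delta> k m \<subseteq> {-\<epsilon><..<\<epsilon>}"
  shows "infinite {\<delta> k m | k m. (k, m) \<in> S}"
proof
  let ?D = "{\<delta> k m | k m. (k, m) \<in> S}"
  assume fin: "finite ?D"
  have ex: "\<exists>x. x \<in> X \<and> x \<noteq> 0" if XD: "X \<in> ?D" for X
  proof -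
    obtain k m where km: "X = \<delta> k m" "(k, m) \<in> S" using XD by blast
    obtain u v where uv: "u < v" "X = {u<..<v}" using bspec[OF iv km(2)] unfolding km(1) by auto
    show ?thesis
    proof (cases "(u + v) / 2 = 0")
      case True
      then show ?thesis using uv by (intro exI[of _ "v / 2"]) auto
    next
      case False
      then show ?thesis using uv by (intro exI[of _ "(u + v) / 2"]) auto
    qed
  qed
  define pick where "pick = (\<lambda>X. SOME x::real. x \<in> X \<and> x \<noteq> 0)"
  have pick: "pick X \<in> X \<and> pick X \<noteq> 0" if "X \<in> ?D" for X
    unfolding pick_def by (rule someI_ex[OF ex[OF that]])
  define e where "e = Min (insert 1 ((\<lambda>X. \<bar>pick X\<bar>) ` ?D))"
  have e: "e > 0" unfolding e_def using fin pick by (subst Min_gr_iff) auto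
  obtain N where N: "\<forall>(k, m)\<in>S. k \<ge> N \<and> m \<ge> N \<longrightarrow> \<delta> k m \<subseteq> {-e<..<e}" using acc e by blast
  obtain k m where km: "(k, m) \<in> S" "k \<ge> N" "m \<ge> N" using S by blast
  have D: "\<delta> k m \<in> ?D" using km by blast
  have "pick (\<delta> k m) \<in> {-e<..<e}" using pick[OF D] N km by blast
  moreover have "e \<le> \<bar>pick (\<delta> k m)\<bar>" unfolding e_def using fin D by (intro Min_le) auto
  ultimately show False by auto
qed

section \<open>The gap between the two arcs and the type of its zeros\<close>

context splitting_family
begin

text \<open>The mirror image of the second arc is the graph \<open>y = \<gamma>' \<mu> x\<close>;
  this is the height of the image of the first arc above that graph.\<close>

definition arc_gap :: "(real \<Rightarrow> real \<Rightarrow> real) \<Rightarrow> (real \<Rightarrow> real \<Rightarrow> real) \<Rightarrow> real \<Rightarrow> real \<Rightarrow> real" where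
  "arc_gap \<gamma> \<gamma>' \<mu> s = Ty q \<mu> (vector [\<gamma> \<mu> s, s]) - \<gamma>' \<mu> (Tx q \<mu> (vector [\<gamma> \<mu> s, s]))"

text \<open>The same expression is \<open>Fs\<close> in \<open>transition_estimates\<close> and, up
  to a nonzero factor, the entry \<gamma> of \<open>W\<close>. In this way the slope of the gap
  decides the type of the fixed point.\<close>

definition arc_gap' :: "(real \<Rightarrow> real \<Rightarrow> real) \<Rightarrow> (real \<Rightarrow> real \<Rightarrow> real) \<Rightarrow> (real \<Rightarrow> real \<Rightarrow> real) \<Rightarrow> real \<Rightarrow> real \<Rightarrow> real" where
  "arc_gap' \<gamma> g g' \<mu> s =
    (pd dx (Ty q) \<mu> (vector [\<gamma> \<mu> s, s]) * g \<mu> s + pd dy (Ty q) \<mu> (vector [\<gamma> \<mu> s, s])) -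
    g' \<mu> (Tx q \<mu> (vector [\<gamma> \<mu> s, s])) *
      (pd dx (Tx q) \<mu> (vector [\<gamma> \<mu> s, s]) * g \<mu> s + pd dy (Tx q) \<mu> (vector [\<gamma> \<mu> s, s]))"

lemma arc_gap_DERIV:
  assumes arc: "symmetric_arc (ym 0) \<sigma> \<delta> j \<gamma> \<tau> g k" "symmetric_arc (xp 0) \<sigma>' \<delta> i \<gamma>' \<tau>' g' k'"
    and b: "\<bar>\<mu>\<bar> \<le> \<sigma>" "\<bar>\<mu>\<bar> \<le> \<sigma>'" "\<bar>s - ym 0\<bar> \<le> \<sigma>" "(\<mu>, vector [\<gamma> \<mu> s, s]) \<in> E q"
      "\<bar>Tx q \<mu> (vector [\<gamma> \<mu> s, s]) - xp 0\<bar> \<le> \<sigma>'"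
  shows "DERIV (arc_gap \<gamma> \<gamma>' \<mu>) s :> arc_gap' \<gamma> g g' \<mu> s"
proof -
  have dg: "DERIV (\<gamma> \<mu>) s :> g \<mu> s" using arc(1) b unfolding symmetric_arc_def by blast
  have dg': "DERIV (\<gamma>' \<mu>) (Tx q \<mu> (vector [\<gamma> \<mu> s, s])) :> g' \<mu> (Tx q \<mu> (vector [\<gamma> \<mu> s, s]))"
    using arc(2) b unfolding symmetric_arc_def by blast
  show ?thesis unfolding arc_gap_def[abs_def] arc_gap'_def
    by (rule DERIV_diff[OF curve_DERIV[OF T_component_Suc(2) b(4) dg]
          DERIV_chain2[OF dg' curve_DERIV[OF T_component_Suc(1) b(4) dg]]])
qed

text \<open>Each of the other three factors is \<open>Fs + 2 * x * w\<close> up to an error, for a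
  constant with \<open>m0 \<le> \<bar>x\<bar>\<close>. The slope \<open>Fs\<close> and the error use
  up at most \<open>m0 / 2 * w\<close> each, so the factor has the sign of \<open>x\<close>, and
  only the sign of \<open>Fs\<close> remains free.\<close>

lemma arc_point_type:
  assumes arc: "symmetric_arc (ym 0) \<sigma> \<delta> j \<gamma> \<tau> g k" "symmetric_arc (xp 0) \<sigma>' \<delta> i \<gamma>' \<tau>' g' k'"
    and b: "\<bar>\<mu>\<bar> \<le> \<sigma>" "\<bar>\<mu>\<bar> \<le> \<sigma>'" "\<bar>s - ym 0\<bar> \<le> \<sigma>" "(\<mu>, vector [\<gamma> \<mu> s, s]) \<in> dom1"
      "\<bar>Tx q \<mu> (vector [\<gamma> \<mu> s, s]) - xp 0\<bar> \<le> \<sigma>'"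
    and w: "w = l \<mu> ^ (2 * j)" "w \<le> \<epsilon>" and eps: "\<epsilon> \<le> 1" and Lam: "0 < \<Lambda>" "\<Lambda> \<le> 1"
    and gk: "\<bar>g \<mu> s - w\<bar> \<le> \<epsilon> * w" "\<bar>k \<mu> s - w\<bar> \<le> \<epsilon> * w"
      "\<bar>g' \<mu> (Tx q \<mu> (vector [\<gamma> \<mu> s, s])) - \<Lambda> * w\<bar> \<le> \<epsilon> * w"
      "\<bar>k' \<mu> (Tx q \<mu> (vector [\<gamma> \<mu> s, s])) - \<Lambda> * w\<bar> \<le> \<epsilon> * w"
    and P: "\<bar>pd dx (Tx q) \<mu> (vector [\<gamma> \<mu> s, s]) - a0\<bar> \<le> \<epsilon>" "\<bar>pd dy (Tx q) \<mu> (vector [\<gamma> \<mu> s, s]) - b0\<bar> \<le> \<epsilon>"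
      "\<bar>pd dx (Ty q) \<mu> (vector [\<gamma> \<mu> s, s]) - c0\<bar> \<le> \<epsilon>"
    and B: "B = 1 + \<bar>a0\<bar> + \<bar>b0\<bar> + \<bar>c0\<bar>"
    and m0: "m0 > 0" "m0 \<le> \<bar>\<Lambda> * b0\<bar>" "m0 \<le> \<bar>c0\<bar>" "m0 \<le> \<bar>\<Lambda> * b0 - c0\<bar>" "16 * \<epsilon> * B \<le> m0 / 2"
    and zero: "arc_gap \<gamma> \<gamma>' \<mu> s = 0" and slope: "arc_gap' \<gamma> g g' \<mu> s \<noteq> 0" "\<bar>arc_gap' \<gamma> g g' \<mu> s\<bar> \<le> m0 / 2 * w"
  shows "\<exists>p. symmetric_fixed_point R (f \<mu>) U0 N1m N1p q (2 * i) (2 * j) p \<and>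
    (\<Lambda> * b0 * (\<Lambda> * b0 - c0) * (- c0) * arc_gap' \<gamma> g g' \<mu> s < 0 \<longrightarrow>
      elliptic A (first_return (f \<mu>) q (2 * i) (2 * j)) p) \<and>
    (\<Lambda> * b0 * (\<Lambda> * b0 - c0) * (- c0) * arc_gap' \<gamma> g g' \<mu> s > 0 \<longrightarrow>
      saddle A (first_return (f \<mu>) q (2 * i) (2 * j)) p)"
proof -
  define zz where "zz = (vector [\<gamma> \<mu> s, s] :: real^2)"
  define s' where "s' = Tx q \<mu> zz"
  define z z' where "z = (vector [\<tau> \<mu> s, \<tau> \<mu> s] :: real^2)" and "z' = (vector [\<tau>' \<mu> s', \<tau>' \<mu> s'] :: real^2)"
  have d1: "(\<mu>, zz) \<in> dom1" using b(4) unfolding zz_def .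
  have Eq: "(\<mu>, zz) \<in> E q" by (rule dom1_E[OF d1])
  have I: "\<mu> \<in> I" by (rule E_I[OF Eq])
  have wpos: "w > 0" unfolding w(1) using l_bounds[OF I] by simp
  have s': "\<bar>s' - xp 0\<bar> \<le> \<sigma>'" using b(5) unfolding s'_def zz_def .
  have A1: "\<forall>n\<le>j. (\<mu>, z) \<in> E n" "T j \<mu> z = zz"
    using arc(1) b(1,3) unfolding symmetric_arc_def z_def zz_def by blast+
  have A2: "\<forall>n\<le>i. (\<mu>, z') \<in> E n" "T i \<mu> z' = vector [\<gamma>' \<mu> s', s']"
    using arc(2) b(2) s' unfolding symmetric_arc_def z'_def by blast+
  obtain a1 a2 where a: "a1 \<noteq> 0" "a2 \<noteq> 0" "DT j \<mu> z (vector [1, 1]) = a1 *\<^sub>R vector [g \<mu> s, 1]"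
    "DT j \<mu> z (vector [1, -1]) = a2 *\<^sub>R vector [- k \<mu> s, 1]"
    using arc(1) b(1,3) unfolding symmetric_arc_def z_def by blast
  obtain a3 a4 where a': "a3 \<noteq> 0" "a4 \<noteq> 0" "DT i \<mu> z' (vector [1, 1]) = a3 *\<^sub>R vector [g' \<mu> s', 1]"
    "DT i \<mu> z' (vector [1, -1]) = a4 *\<^sub>R vector [- k' \<mu> s', 1]"
    using arc(2) b(2) s' unfolding symmetric_arc_def z'_def by blast
  have sw: "swap z = z" "swap z' = z'" unfolding z_def z'_def by (simp_all add: vec2_eq_iff)
  have conn: "(\<mu>, T j \<mu> z) \<in> E q" "T q \<mu> (T j \<mu> z) = swap (T i \<mu> z')"
  proof -
    show "(\<mu>, T j \<mu> z) \<in> E q" using Eq A1(2) by simp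
    have "Ty q \<mu> zz = \<gamma>' \<mu> s'" using zero unfolding arc_gap_def zz_def[symmetric] s'_def by simp
    then show "T q \<mu> (T j \<mu> z) = swap (T i \<mu> z')"
      unfolding A1(2) A2(2) by (simp add: vec2_eq_iff s'_def Tx_def Ty_def)
  qed
  define p where "p = R (pt \<mu> (T j \<mu> z))"
  have sfp: "symmetric_fixed_point R (f \<mu>) U0 N1m N1p q (2 * i) (2 * j) p"
    by (rule symmetric_point_exists[OF A1(1) A2(1) sw _ _ conn p_def]) (use d1 A1(2) in \<open>auto simp: dom1_def\<close>)
  define Px Py Gx Gy where "Px = pd dx (Tx q) \<mu> zz" and "Py = pd dy (Tx q) \<mu> zz"
    and "Gx = pd dx (Ty q) \<mu> zz" and "Gy = pd dy (Ty q) \<mu> zz"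
  define Fs where "Fs = arc_gap' \<gamma> g g' \<mu> s"
  have Fs: "Fs = (Gx * g \<mu> s + Gy) - g' \<mu> s' * (Px * g \<mu> s + Py)"
    unfolding Fs_def arc_gap'_def zz_def[symmetric] s'_def[symmetric] Px_def Py_def Gx_def Gy_def ..
  \<comment> \<open>From \<open>m0 \<le> \<bar>\<Lambda> * b0\<bar>\<close> and
    \<open>\<bar>b0\<bar> \<le> B\<close>, smallness of \<epsilon> against \<open>m0\<close> is also
    smallness against \<Lambda>. It makes \<open>g'\<close> and \<open>k'\<close> positive, so the
    two directions at the second arc are independent.\<close>
  have \<epsilon>B: "\<epsilon> * B < \<Lambda> * B"
  proof -
    have "\<bar>\<Lambda> * b0\<bar> \<le> \<Lambda> * B" using Lam unfolding B abs_mult by (simp add: mult_left_mono)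
    then show ?thesis using m0 by linarith
  qed
  have B1: "B \<ge> 1" unfolding B by simp
  have eL: "\<epsilon> < \<Lambda>" using \<epsilon>B B1 by (metis less_le_trans mult_less_cancel_right_pos zero_less_one)
  have "g' \<mu> s' + k' \<mu> s' > 0"
  proof -
    have "\<epsilon> * w < \<Lambda> * w" using eL wpos by simp
    then show ?thesis using gk(3,4) unfolding zz_def[symmetric] s'_def[symmetric] by linarith
  qed
  then have gk': "g' \<mu> s' + k' \<mu> s' \<noteq> 0" by simp
  \<comment> \<open>After the reflection the directions at the second arc are
    \<open>a3 * (1, g')\<close> and \<open>a4 * (1, - k')\<close>; the minus sign in
    \<open>W1\<close> and \<open>W2\<close> is absorbed into the second one.\<close>
  have "- a4 \<noteq> 0" using a' by simp
  from transition_coefficients[OF a(1,2) a'(1) this gk', of Px "g \<mu> s" Py Gx Gy "k \<mu> s"]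
  obtain \<alpha> \<beta> \<gamma>0 \<delta>0 pp where co: "pp > 0"
    "a1 * (Px * g \<mu> s + Py) = \<alpha> * a3 + \<gamma>0 * - a4" "a1 * (Gx * g \<mu> s + Gy) = \<alpha> * (a3 * g' \<mu> s') - \<gamma>0 * (- a4 * k' \<mu> s')"
    "a2 * (Py - Px * k \<mu> s) = \<beta> * a3 + \<delta>0 * - a4" "a2 * (Gy - Gx * k \<mu> s) = \<beta> * (a3 * g' \<mu> s') - \<delta>0 * (- a4 * k' \<mu> s')"
    "\<alpha> * \<beta> * \<gamma>0 * \<delta>0 = pp * ((k' \<mu> s' * (Px * g \<mu> s + Py) + (Gx * g \<mu> s + Gy)) * (k' \<mu> s' * (Py - Px * k \<mu> s) + (Gy - Gx * k \<mu> s)) *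
      ((Gx * g \<mu> s + Gy) - g' \<mu> s' * (Px * g \<mu> s + Py)) * ((Gy - Gx * k \<mu> s) - g' \<mu> s' * (Py - Px * k \<mu> s)))"
    by blast
  have W1: "DT q \<mu> (T j \<mu> z) (DT j \<mu> z (vector [1, 1])) =
      \<alpha> *\<^sub>R swap (DT i \<mu> z' (vector [1, 1])) - \<gamma>0 *\<^sub>R swap (DT i \<mu> z' (vector [1, -1]))"
    unfolding a a' A1(2) DT_components[OF Eq] Px_def[symmetric] Py_def[symmetric] Gx_def[symmetric] Gy_def[symmetric]
    using co(2,3) by (simp add: vec2_eq_iff algebra_simps)
  have W2: "DT q \<mu> (T j \<mu> z) (DT j \<mu> z (vector [1, -1])) =
      \<beta> *\<^sub>R swap (DT i \<mu> z' (vector [1, 1])) - \<delta>0 *\<^sub>R swap (DT i \<mu> z' (vector [1, -1]))"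
    unfolding a a' A1(2) DT_components[OF Eq] Px_def[symmetric] Py_def[symmetric] Gx_def[symmetric] Gy_def[symmetric]
    using co(4,5) by (simp add: vec2_eq_iff algebra_simps)
  have fixed: "first_return (f \<mu>) q (2 * i) (2 * j) p = p" using sfp unfolding symmetric_fixed_point_def by blast
  note types = first_return_multipliers[OF A1(1) A2(1) sw conn W1 W2 p_def fixed]
  note est = transition_estimates[OF wpos w(2) eps less_imp_le[OF Lam(1)] Lam(2) gk(1,2)
      gk(3,4)[folded zz_def, folded s'_def] P[folded zz_def, folded Px_def Py_def Gx_def] B,
      of Gy, folded Fs]
  have sl: "Fs \<noteq> 0" "\<bar>Fs\<bar> \<le> m0 / 2 * w" using slope unfolding Fs_def by auto
  have e16: "16 * \<epsilon> * B * w \<le> m0 / 2 * w" using m0(5) wpos by (intro mult_right_mono) auto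
  have sgn: "Y * x > 0" if "\<bar>Y - Fs - 2 * x * w\<bar> \<le> 16 * \<epsilon> * B * w" "m0 \<le> \<bar>x\<bar>" for Y x
  proof -
    have "\<bar>Y - 2 * (x * w)\<bar> \<le> m0 * w" using that(1) sl(2) e16 by (simp add: mult.assoc)
    moreover have "m0 * w \<le> \<bar>x * w\<bar>" using that(2) wpos by (simp add: abs_mult)
    ultimately have "Y * (x * w) > 0" using m0(1) wpos by (intro same_sign[of Y "x * w" "m0 * w"]) auto
    then show ?thesis using wpos by (simp add: zero_less_mult_iff mult.assoc[symmetric])
  qed
  define X1 X2 X3 where "X1 = k' \<mu> s' * (Px * g \<mu> s + Py) + (Gx * g \<mu> s + Gy)"
    and "X2 = k' \<mu> s' * (Py - Px * k \<mu> s) + (Gy - Gx * k \<mu> s)"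
    and "X3 = (Gy - Gx * k \<mu> s) - g' \<mu> s' * (Py - Px * k \<mu> s)"
  have pos: "X1 * (\<Lambda> * b0) > 0" "X2 * (\<Lambda> * b0 - c0) > 0" "X3 * (- c0) > 0"
    unfolding X1_def X2_def X3_def
    using sgn[OF est(2) m0(2)] sgn[OF est(3) m0(4)] sgn[OF est(4)] m0(3) by simp_all
  have prod: "\<alpha> * \<beta> * \<gamma>0 * \<delta>0 = pp * (X1 * X2 * Fs * X3)"
    unfolding co(6) X1_def X2_def X3_def Fs ..
  \<comment> \<open>The leading constants pair every factor with one of the same sign, and
    \<open>Fs\<close> appears squared.\<close>
  have key: "(\<alpha> * \<beta> * \<gamma>0 * \<delta>0) * (\<Lambda> * b0 * (\<Lambda> * b0 - c0) * (- c0) * Fs) > 0"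
  proof -
    have "(\<alpha> * \<beta> * \<gamma>0 * \<delta>0) * (\<Lambda> * b0 * (\<Lambda> * b0 - c0) * (- c0) * Fs) =
        pp * (X1 * (\<Lambda> * b0)) * (X2 * (\<Lambda> * b0 - c0)) * (X3 * (- c0)) * (Fs * Fs)"
      unfolding prod by (simp add: algebra_simps)
    then show ?thesis using co(1) pos sl(1) by (metis mult_pos_pos not_real_square_gt_zero)
  qed
  have "X < 0" if "X * Y > 0" "Y < 0" for X Y :: real using that by (auto simp: zero_less_mult_iff)
  moreover have "X > 0" if "X * Y > 0" "Y > 0" for X Y :: real using that by (auto simp: zero_less_mult_iff)
  ultimately show ?thesis
    unfolding Fs_def[symmetric] using sfp types key by blast
qed

end

section \<open>Parameter intervals with a fold of prescribed depth\<close>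

lemma MVT_abs_bound:
  fixes \<phi> :: "real \<Rightarrow> real"
  assumes "\<And>t. min x y \<le> t \<Longrightarrow> t \<le> max x y \<Longrightarrow> DERIV \<phi> t :> \<phi>' t"
    "\<And>t. min x y \<le> t \<Longrightarrow> t \<le> max x y \<Longrightarrow> \<bar>\<phi>' t\<bar> \<le> B"
  shows "\<bar>\<phi> y - \<phi> x\<bar> \<le> B * \<bar>y - x\<bar>"
proof -
  have "norm (\<phi> y - \<phi> x) \<le> B * norm (y - x)"
  proof (rule field_differentiable_bound[of "{min x y..max x y}" \<phi> \<phi>'])
    show "(\<phi> has_field_derivative \<phi>' t) (at t within {min x y..max x y})" if "t \<in> {min x y..max x y}" for t
      using assms(1)[of t] that by (auto intro: has_field_derivative_at_within)
  qed (use assms(2) in auto)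
  then show ?thesis by simp
qed

lemma half_slope:
  fixes X D t :: real
  assumes "\<bar>X - D * t\<bar> \<le> D / 2 * \<bar>t\<bar>"
  shows "0 \<le> t \<Longrightarrow> 0 \<le> X - D / 2 * t" "t \<le> 0 \<Longrightarrow> X - D / 2 * t \<le> 0"
proof -
  have e: "D * t = D / 2 * t + D / 2 * t" by simp
  show "0 \<le> X - D / 2 * t" if "0 \<le> t" using assms[unfolded abs_of_nonneg[OF that]] e by linarith
  have "D / 2 * - t = - (D / 2 * t)" by simp
  then show "X - D / 2 * t \<le> 0" if "t \<le> 0" using assms[unfolded abs_of_nonpos[OF that]] e by linarith
qed

lemma sqrt_fold_constant:
  assumes "D > 0" "m0 > 0"
  shows "sqrt (32 * (D * (m0 / (8 * D))\<^sup>2 / 32) / D) = m0 / (8 * D)"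
proof -
  have "32 * (D * (m0 / (8 * D))\<^sup>2 / 32) / D = (m0 / (8 * D))\<^sup>2" using assms by simp
  then show ?thesis using assms by simp
qed

lemma (in reversible_family) symmetric_arcD:
  assumes "symmetric_arc ys \<sigma> \<delta> j \<gamma> \<tau> g k" "\<bar>\<mu>\<bar> \<le> \<sigma>" "\<bar>s - ys\<bar> \<le> \<sigma>"
  shows "DERIV (\<gamma> \<mu>) s :> g \<mu> s" "\<bar>\<gamma> \<mu> s\<bar> \<le> \<delta>"
    "\<bar>g \<mu> s - l \<mu> ^ (2 * j)\<bar> \<le> \<delta> * l \<mu> ^ (2 * j)"
    "\<bar>k \<mu> s - l \<mu> ^ (2 * j)\<bar> \<le> \<delta> * l \<mu> ^ (2 * j)"
  using assms(1)[unfolded symmetric_arc_def, THEN conjunct2, rule_format, OF assms(2,3)] by simp_all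

context splitting_family
begin

definition elliptic_and_saddle :: "nat \<Rightarrow> nat \<Rightarrow> real \<Rightarrow> bool" where
  "elliptic_and_saddle m k \<mu> \<longleftrightarrow>
     (\<exists>p. symmetric_fixed_point R (f \<mu>) U0 N1m N1p q m k p \<and>
          elliptic A (first_return (f \<mu>) q m k) p) \<and>
     (\<exists>p. symmetric_fixed_point R (f \<mu>) U0 N1m N1p q m k p \<and>
          saddle A (first_return (f \<mu>) q m k) p)"

text \<open>As \<mu> runs through its range the rescaled minimum \<open>mn\<close> of the gap
  changes from positive values to values below \<open>- 2 * \<kappa>\<close>, and it is inside the
  band \<open>(- 2 * \<kappa>, - \<kappa>)\<close> only for
  \<open>\<bar>\<mu>\<bar> < \<eta>\<close>. The order of choices matters: \<kappa> before
  \<epsilon>, since the errors have to be small against the slopes at the zeros; \<epsilon> before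
  the boxes on which it holds; the accuracy \<delta> of the arcs after \<eta>, and \<open>j\<close>
  last.\<close>

lemma elliptic_saddle_intervals:
  assumes \<mu>0: "\<mu>0 > 0"
  shows "\<exists>n \<mu>1. 0 < \<mu>1 \<and> \<mu>1 \<le> \<mu>0 \<and> (\<forall>\<eta>. 0 < \<eta> \<and> \<eta> \<le> \<mu>1 \<longrightarrow> (\<exists>J. \<forall>j\<ge>J. \<exists>u v. u < v \<and>
    {u<..<v} \<subseteq> {-\<eta><..<\<eta>} \<and> (\<forall>\<mu>\<in>{u<..<v}.
      elliptic_and_saddle (2 * (j + n)) (2 * j) \<mu>)))"
proof -
  define a0 b0 c0 where "a0 = pd dx (Tx q) 0 base" and "b0 = pd dy (Tx q) 0 base"
    and "c0 = pd dx (Ty q) 0 base"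
  define e0 D2 where "e0 = pd dx (pd dy (Ty q)) 0 base" and "D2 = pd dy (pd dy (Ty q)) 0 base"
  have nz: "b0 \<noteq> 0" "c0 \<noteq> 0" "D2 \<noteq> 0"
    using transversal_derivatives tangency_quadratic unfolding b0_def c0_def D2_def by auto
  note l0 = l_bounds[OF I0]
  obtain n where n: "l 0 ^ (2 * n) * b0 \<noteq> c0" \<comment> \<open>otherwise \<open>\<beta> = 0\<close> at the fold, to leading order\<close>
  proof (cases "b0 = c0")
    case False
    then show ?thesis using that[of 0] by simp
  next
    case True
    have "(l 0)\<^sup>2 < 1" using l0 by (simp add: power_less_one_iff)
    then have "(l 0)\<^sup>2 * b0 \<noteq> b0" using nz(1) by simp
    then show ?thesis using that[of 1] True by (simp add: power2_eq_square)
  qed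
  define \<Lambda> where "\<Lambda> = l 0 ^ (2 * n)"
  have Lam: "0 < \<Lambda>" "\<Lambda> \<le> 1" using l0 unfolding \<Lambda>_def by (auto simp: power_le_one)
  define m0 where "m0 = min \<bar>\<Lambda> * b0\<bar> (min \<bar>c0\<bar> \<bar>\<Lambda> * b0 - c0\<bar>)"
  have m0: "m0 > 0" "m0 \<le> \<bar>\<Lambda> * b0\<bar>" "m0 \<le> \<bar>c0\<bar>" "m0 \<le> \<bar>\<Lambda> * b0 - c0\<bar>"
    using nz Lam n[folded \<Lambda>_def] unfolding m0_def by auto
  define B where "B = 1 + \<bar>a0\<bar> + \<bar>b0\<bar> + \<bar>c0\<bar>"
  have B: "B \<ge> 1" "B > 0" unfolding B_def by auto
  \<comment> \<open>Multiplication by \<open>sg\<close> makes the fold open upwards, so that a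
    minimum serves for both signs of \<open>D2\<close>.\<close>
  define D sg where "D = \<bar>D2\<bar>" and "sg = sgn D2"
  have D: "D > 0" "sg * D2 = D" and sg: "sg * sg = 1" "sg = 1 \<or> sg = -1"
    using nz unfolding D_def sg_def by (auto simp: sgn_if)
  have sgabs: "\<bar>sg * x\<bar> = \<bar>x\<bar>" for x using sg(2) by auto
  \<comment> \<open>With depth at most \<open>2 * \<kappa> * w\<^sup>2\<close> and
    \<open>d1 = D / 2\<close>, the square root in \<open>fold_zeros\<close> is at most
    \<open>sqrt (32 * \<kappa> / D) * w\<close>. This \<kappa> makes it
    \<open>m0 / (8 * D) * w\<close>; times \<open>d2 = 2 * D\<close> it contributes
    \<open>m0 / 4 * w\<close>, half of the slope that \<open>arc_point_type\<close> admits.\<close>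
  define \<kappa> where "\<kappa> = D * (m0 / (8 * D))\<^sup>2 / 32"
  have \<kappa>: "\<kappa> > 0" "sqrt (32 * \<kappa> / D) = m0 / (8 * D)"
    using sqrt_fold_constant[OF D(1) m0(1)] D m0 unfolding \<kappa>_def by auto
  have Ey: "(0, vector [0, ym 0]) \<in> E 0" using base_dom1 dom1_E E_subset by blast
  have Ex: "(0, vector [0, xp 0]) \<in> E 0"
  proof -
    have "(0, swap (T q 0 base)) \<in> E 0" using swap_E0[OF T_E0[OF dom1_E[OF base_dom1]]] by blast
    then show ?thesis unfolding T_base by (simp add: swap_def)
  qed
  obtain \<sigma>y where \<sigma>y: "\<sigma>y > 0" "\<And>\<mu>. \<bar>\<mu>\<bar> \<le> \<sigma>y \<Longrightarrow> \<mu> \<in> I"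
    "\<And>\<delta>. \<delta> > 0 \<Longrightarrow> \<exists>J. \<forall>j\<ge>J. \<exists>\<gamma> \<tau> g k. symmetric_arc (ym 0) \<sigma>y \<delta> j \<gamma> \<tau> g k"
    using symmetric_arc_exists[OF I0 Ey] by (metis (no_types, lifting))
  obtain \<sigma>x where \<sigma>x: "\<sigma>x > 0"
    "\<And>\<delta>. \<delta> > 0 \<Longrightarrow> \<exists>J. \<forall>j\<ge>J. \<exists>\<gamma> \<tau> g k. symmetric_arc (xp 0) \<sigma>x \<delta> j \<gamma> \<tau> g k"
    using symmetric_arc_exists[OF I0 Ex] by (metis (no_types, lifting))
  \<comment> \<open>In \<open>fold_zeros\<close> the error will be
    \<open>\<theta> = 16 * \<epsilon> * B * w\<close>. Its contribution to the slope is
    \<open>4 * d2 * \<theta> / d1 + \<theta> = 272 * \<epsilon> * B * w\<close>, which may take the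
    other half \<open>m0 / 4 * w\<close>, and the left side of \<open>small\<close> is
    \<open>2560 * \<epsilon>\<^sup>2 * B\<^sup>2 / D * w\<^sup>2\<close>, to stay below
    \<open>\<kappa> * w\<^sup>2\<close>. The factor \<open>3 + 2 * \<bar>e0\<bar>\<close> collects
    the deviation of \<open>pd dy (Ty q)\<close> along the arc from linear growth; \<sigma>x is the
    width of the second arc.\<close>
  define \<epsilon> where "\<epsilon> = min (min 1 (m0 / (1088 * B)))
    (min (\<kappa> * D / (2561 * B\<^sup>2)) (min (D / (2 * (3 + 2 * \<bar>e0\<bar>))) \<sigma>x))"
  have \<epsilon>: "\<epsilon> > 0" "\<epsilon> \<le> 1" "272 * \<epsilon> * B \<le> m0 / 4" "2560 * \<epsilon>\<^sup>2 * B\<^sup>2 < \<kappa> * D"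
    "(3 + 2 * \<bar>e0\<bar>) * \<epsilon> \<le> D / 2" "\<epsilon> \<le> \<sigma>x"
  proof -
    show e: "\<epsilon> > 0" "\<epsilon> \<le> 1" "\<epsilon> \<le> \<sigma>x" unfolding \<epsilon>_def using m0 B \<kappa> D \<sigma>x by auto
    have "\<epsilon> \<le> m0 / (1088 * B)" unfolding \<epsilon>_def by simp
    then show "272 * \<epsilon> * B \<le> m0 / 4" using B by (simp add: field_simps)
    have "\<epsilon> \<le> \<kappa> * D / (2561 * B\<^sup>2)" unfolding \<epsilon>_def by simp
    then have "2561 * \<epsilon> * B\<^sup>2 \<le> \<kappa> * D" using B by (simp add: field_simps)
    moreover have "\<epsilon>\<^sup>2 \<le> \<epsilon>" using e by (simp add: power2_eq_square mult_left_le)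
    then have "2560 * \<epsilon>\<^sup>2 * B\<^sup>2 \<le> 2560 * \<epsilon> * B\<^sup>2" by (intro mult_right_mono) auto
    moreover have "0 < \<epsilon> * B\<^sup>2" using e B by simp
    ultimately show "2560 * \<epsilon>\<^sup>2 * B\<^sup>2 < \<kappa> * D" by linarith
    have "\<epsilon> \<le> D / (2 * (3 + 2 * \<bar>e0\<bar>))" unfolding \<epsilon>_def by simp
    then show "(3 + 2 * \<bar>e0\<bar>) * \<epsilon> \<le> D / 2" by (simp add: field_simps)
  qed
  have eD: "\<epsilon> \<le> D / 2"
  proof -
    have "1 * \<epsilon> \<le> (3 + 2 * \<bar>e0\<bar>) * \<epsilon>" using \<epsilon>(1) by (intro mult_right_mono) auto
    then show ?thesis using \<epsilon>(5) by linarith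
  qed
  obtain \<rho> where \<rho>: "\<rho> > 0" and box: "\<And>\<mu> x y. \<bar>\<mu>\<bar> \<le> \<rho> \<Longrightarrow> \<bar>x\<bar> \<le> \<rho> \<Longrightarrow> \<bar>y - ym 0\<bar> \<le> \<rho> \<Longrightarrow>
    (\<mu>, vector [x, y]) \<in> dom1 \<and> \<bar>Tx q \<mu> (vector [x, y]) - xp 0\<bar> < \<epsilon> \<and>
    \<bar>pd dx (Tx q) \<mu> (vector [x, y]) - a0\<bar> < \<epsilon> \<and> \<bar>pd dy (Tx q) \<mu> (vector [x, y]) - b0\<bar> < \<epsilon> \<and>
    \<bar>pd dx (Ty q) \<mu> (vector [x, y]) - c0\<bar> < \<epsilon> \<and> \<bar>pd dx (pd dy (Ty q)) \<mu> (vector [x, y]) - e0\<bar> < \<epsilon> \<and>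
    \<bar>pd dy (pd dy (Ty q)) \<mu> (vector [x, y]) - D2\<bar> < \<epsilon>"
    using box_estimates[OF \<epsilon>(1)] unfolding a0_def b0_def c0_def e0_def D2_def by (metis (no_types, lifting))
  define \<sigma> where "\<sigma> = min \<rho> \<sigma>y"
  have \<sigma>: "\<sigma> > 0" "\<sigma> \<le> \<rho>" "\<sigma> \<le> \<sigma>y" unfolding \<sigma>_def using \<rho> \<sigma>y by auto
  define L2 where "L2 = (1 + l 0) / 2"
  have L2: "0 < L2" "L2 < 1" "(1 - l 0) / 2 > 0" using l0 unfolding L2_def by auto
  have ymc: "continuous_on I ym" using splitting unfolding splitting_form_def by blast
  obtain e1 where e1: "e1 > 0" "\<And>\<mu>. \<bar>\<mu>\<bar> \<le> e1 \<Longrightarrow> \<mu> \<in> I \<and> \<bar>ym \<mu> - ym 0\<bar> \<le> \<sigma> / 2"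
    using continuous_near[OF ymc open_I I0, of "\<sigma> / 2"] \<sigma>(1) by auto
  obtain e2 where e2: "e2 > 0" "\<And>\<mu>. \<bar>\<mu>\<bar> \<le> e2 \<Longrightarrow> \<mu> \<in> I \<and> \<bar>l \<mu> ^ (2 * n) - \<Lambda>\<bar> \<le> \<epsilon> / 2"
    using continuous_near[OF continuous_on_power[OF l_cont] open_I I0, of "\<epsilon> / 2" "2 * n"] \<epsilon>(1)
    unfolding \<Lambda>_def by auto
  obtain e3 where e3: "e3 > 0" "\<And>\<mu>. \<bar>\<mu>\<bar> \<le> e3 \<Longrightarrow> \<mu> \<in> I \<and> \<bar>l \<mu> - l 0\<bar> \<le> (1 - l 0) / 2"
    using continuous_near[OF l_cont open_I I0 L2(3)] by auto
  define \<mu>1 where "\<mu>1 = min (min \<sigma> (min \<sigma>x \<mu>0)) (min (min e1 e2) (min e3 (D * \<sigma>\<^sup>2 / 64)))"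
  have \<mu>1: "\<mu>1 > 0" "\<mu>1 \<le> \<sigma>" "\<mu>1 \<le> \<sigma>x" "\<mu>1 \<le> \<mu>0" "\<mu>1 \<le> e1" "\<mu>1 \<le> e2" "\<mu>1 \<le> e3" "\<mu>1 \<le> D * \<sigma>\<^sup>2 / 64"
    unfolding \<mu>1_def using \<sigma> \<sigma>x \<mu>0 e1 e2 e3 D by auto
  have M: "\<mu> \<in> I" "\<bar>ym \<mu> - ym 0\<bar> \<le> \<sigma> / 2" "\<bar>l \<mu> ^ (2 * n) - \<Lambda>\<bar> \<le> \<epsilon> / 2" "0 < l \<mu>" "l \<mu> \<le> L2"
    "\<bar>\<mu>\<bar> \<le> \<rho>" "\<bar>\<mu>\<bar> \<le> \<sigma>y" "\<bar>\<mu>\<bar> \<le> \<sigma>x"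
    if "\<bar>\<mu>\<bar> \<le> \<mu>1" for \<mu>
  proof -
    show "\<mu> \<in> I" "\<bar>ym \<mu> - ym 0\<bar> \<le> \<sigma> / 2" using e1(2)[of \<mu>] that \<mu>1 by auto
    show "\<bar>l \<mu> ^ (2 * n) - \<Lambda>\<bar> \<le> \<epsilon> / 2" using e2(2)[of \<mu>] that \<mu>1 by auto
    show "0 < l \<mu>" using l_bounds[OF \<open>\<mu> \<in> I\<close>] by simp
    have "\<bar>l \<mu> - l 0\<bar> \<le> (1 - l 0) / 2" using e3(2)[of \<mu>] that \<mu>1 by auto
    then show "l \<mu> \<le> L2" unfolding L2_def abs_le_iff by (simp add: field_simps)
    show "\<bar>\<mu>\<bar> \<le> \<rho>" "\<bar>\<mu>\<bar> \<le> \<sigma>y" "\<bar>\<mu>\<bar> \<le> \<sigma>x" using that \<mu>1 \<sigma> by linarith+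
  qed
  have Gy_diff: "\<bar>pd dy (Ty q) \<mu> (vector [x', y']) - pd dy (Ty q) \<mu> (vector [x, y]) - D2 * (y' - y)\<bar> \<le>
      \<epsilon> * \<bar>y' - y\<bar> + (\<bar>e0\<bar> + 1) * \<bar>x' - x\<bar>"
    if m: "\<bar>\<mu>\<bar> \<le> \<mu>1" and b: "\<bar>x\<bar> \<le> \<rho>" "\<bar>x'\<bar> \<le> \<rho>" "\<bar>y - ym 0\<bar> \<le> \<rho>" "\<bar>y' - ym 0\<bar> \<le> \<rho>" for \<mu> x x' y y'
  proof -
    have "\<bar>(\<lambda>t. pd dy (Ty q) \<mu> (vector [t, y'])) x' - (\<lambda>t. pd dy (Ty q) \<mu> (vector [t, y'])) x\<bar> \<le> (\<bar>e0\<bar> + 1) * \<bar>x' - x\<bar>"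
    proof (rule MVT_abs_bound[where \<phi> = "\<lambda>t. pd dy (Ty q) \<mu> (vector [t, y'])" and
          \<phi>' = "\<lambda>t. pd dx (pd dy (Ty q)) \<mu> (vector [t, y'])"])
      fix t assume "min x x' \<le> t" "t \<le> max x x'"
      then have "\<bar>t\<bar> \<le> \<rho>" using b by linarith
      note bt = box[OF M(6)[OF m] this b(4)]
      show "DERIV (\<lambda>t. pd dy (Ty q) \<mu> (vector [t, y'])) t :> pd dx (pd dy (Ty q)) \<mu> (vector [t, y'])"
        by (rule pd_DERIV(1)[OF pd_component_Suc(2)]) (use bt dom1_E in blast)
      show "\<bar>pd dx (pd dy (Ty q)) \<mu> (vector [t, y'])\<bar> \<le> \<bar>e0\<bar> + 1" using bt \<epsilon>(2) by linarith
    qed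
    moreover have "\<bar>(\<lambda>t. pd dy (Ty q) \<mu> (vector [x, t]) - D2 * t) y' - (\<lambda>t. pd dy (Ty q) \<mu> (vector [x, t]) - D2 * t) y\<bar> \<le> \<epsilon> * \<bar>y' - y\<bar>"
    proof (rule MVT_abs_bound[where \<phi> = "\<lambda>t. pd dy (Ty q) \<mu> (vector [x, t]) - D2 * t" and
          \<phi>' = "\<lambda>t. pd dy (pd dy (Ty q)) \<mu> (vector [x, t]) - D2"])
      fix t assume "min y y' \<le> t" "t \<le> max y y'"
      then have "\<bar>t - ym 0\<bar> \<le> \<rho>" using b by linarith
      note bt = box[OF M(6)[OF m] b(1) this]
      show "DERIV (\<lambda>t. pd dy (Ty q) \<mu> (vector [x, t]) - D2 * t) t :> pd dy (pd dy (Ty q)) \<mu> (vector [x, t]) - D2"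
      proof -
        have "(\<mu>, vector [x, t]) \<in> E q" using bt dom1_E by blast
        from pd_DERIV(2)[OF pd_component_Suc(2) this, of dy] show ?thesis
          by (auto intro!: derivative_eq_intros)
      qed
      show "\<bar>pd dy (pd dy (Ty q)) \<mu> (vector [x, t]) - D2\<bar> \<le> \<epsilon>" using bt by linarith
    qed
    moreover have "pd dy (Ty q) \<mu> (vector [x', y']) - pd dy (Ty q) \<mu> (vector [x, y]) - D2 * (y' - y) =
      ((\<lambda>t. pd dy (Ty q) \<mu> (vector [t, y'])) x' - (\<lambda>t. pd dy (Ty q) \<mu> (vector [t, y'])) x) +
      ((\<lambda>t. pd dy (Ty q) \<mu> (vector [x, t]) - D2 * t) y' - (\<lambda>t. pd dy (Ty q) \<mu> (vector [x, t]) - D2 * t) y)"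
      by (simp add: algebra_simps)
    ultimately show ?thesis by linarith
  qed
  have vertex: "Ty q \<mu> (vector [0, ym \<mu>]) = \<mu>" "pd dy (Ty q) \<mu> (vector [0, ym \<mu>]) = 0"
    "\<bar>ym \<mu> - ym 0\<bar> \<le> \<rho>" if m: "\<bar>\<mu>\<bar> \<le> \<mu>1" for \<mu>
  proof -
    show *: "\<bar>ym \<mu> - ym 0\<bar> \<le> \<rho>" using M(2)[OF m] \<sigma> by linarith
    have "(\<mu>, vector [0, ym \<mu>]) \<in> dom1" using box[OF M(6)[OF m] _ *, of 0] \<rho> by simp
    from Ty_vertex[OF this] show "Ty q \<mu> (vector [0, ym \<mu>]) = \<mu>" "pd dy (Ty q) \<mu> (vector [0, ym \<mu>]) = 0" .
  qed
  \<comment> \<open>Only half of the slope \<open>D * (y - ym \<mu>)\<close> is guaranteed, hence a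
    parabola with \<open>D / 4\<close> instead of \<open>D / 2\<close>. Subtracting it leaves a
    function which is monotone on either side of the vertex.\<close>
  have lower: "sg * \<mu> + D / 4 * (s - ym \<mu>)\<^sup>2 \<le> sg * Ty q \<mu> (vector [0, s])"
    if m: "\<bar>\<mu>\<bar> \<le> \<mu>1" and s: "\<bar>s - ym 0\<bar> \<le> \<rho>" for \<mu> s
  proof -
    define \<phi> where "\<phi> = (\<lambda>y. sg * Ty q \<mu> (vector [0, y]) - D / 4 * (y - ym \<mu>)\<^sup>2)"
    define \<phi>' where "\<phi>' = (\<lambda>y. sg * pd dy (Ty q) \<mu> (vector [0, y]) - D / 2 * (y - ym \<mu>))"
    have in_dom: "(\<mu>, vector [0, y]) \<in> E q" if "\<bar>y - ym 0\<bar> \<le> \<rho>" for y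
      using box[OF M(6)[OF m] _ that, of 0] \<rho> dom1_E by auto
    have der: "DERIV \<phi> y :> \<phi>' y" if "\<bar>y - ym 0\<bar> \<le> \<rho>" for y
      unfolding \<phi>_def \<phi>'_def using pd_DERIV(2)[OF T_component_Suc(2) in_dom[OF that]]
      by (auto intro!: derivative_eq_intros)
    have sl: "\<bar>sg * pd dy (Ty q) \<mu> (vector [0, y]) - D * (y - ym \<mu>)\<bar> \<le> D / 2 * \<bar>y - ym \<mu>\<bar>"
      if y: "\<bar>y - ym 0\<bar> \<le> \<rho>" for y
    proof -
      have "\<bar>pd dy (Ty q) \<mu> (vector [0, y]) - D2 * (y - ym \<mu>)\<bar> \<le> \<epsilon> * \<bar>y - ym \<mu>\<bar>"
        using Gy_diff[OF m, of 0 0 "ym \<mu>" y] \<rho> vertex[OF m] y by simp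
      moreover have "sg * pd dy (Ty q) \<mu> (vector [0, y]) - D * (y - ym \<mu>) =
          sg * (pd dy (Ty q) \<mu> (vector [0, y]) - D2 * (y - ym \<mu>))"
        unfolding D(2)[symmetric] by (simp add: algebra_simps)
      moreover have "\<epsilon> * \<bar>y - ym \<mu>\<bar> \<le> D / 2 * \<bar>y - ym \<mu>\<bar>" using eD by (intro mult_right_mono) auto
      ultimately show ?thesis using sgabs by (metis order_trans)
    qed
    have "\<phi> (ym \<mu>) \<le> \<phi> s"
    proof (cases "ym \<mu> \<le> s")
      case True
      show ?thesis
      proof (rule DERIV_nonneg_imp_nondecreasing[OF True])
        fix y assume y: "ym \<mu> \<le> y" "y \<le> s"
        then have yb: "\<bar>y - ym 0\<bar> \<le> \<rho>" using s vertex(3)[OF m] by linarith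
        have "\<phi>' y \<ge> 0" unfolding \<phi>'_def by (rule half_slope(1)[OF sl[OF yb]]) (use y in simp)
        then show "\<exists>w. DERIV \<phi> y :> w \<and> 0 \<le> w" using der[OF yb] by blast
      qed
    next
      case False
      then have le: "s \<le> ym \<mu>" by simp
      show ?thesis
      proof (rule DERIV_nonpos_imp_nonincreasing[OF le])
        fix y assume y: "s \<le> y" "y \<le> ym \<mu>"
        then have yb: "\<bar>y - ym 0\<bar> \<le> \<rho>" using s vertex(3)[OF m] by linarith
        have "\<phi>' y \<le> 0" unfolding \<phi>'_def by (rule half_slope(2)[OF sl[OF yb]]) (use y in simp)
        then show "\<exists>w. DERIV \<phi> y :> w \<and> w \<le> 0" using der[OF yb] by blast
      qed
    qed
    then show ?thesis unfolding \<phi>_def using vertex(1)[OF m] by simp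
  qed
  show ?thesis
  proof (rule exI[of _ n], rule exI[of _ \<mu>1], intro conjI allI impI)
    fix \<eta> :: real assume "0 < \<eta> \<and> \<eta> \<le> \<mu>1"
    then have \<eta>: "0 < \<eta>" "\<eta> \<le> \<mu>1" by auto
    \<comment> \<open>The gap differs from \<open>sg\<close>-independent \<open>Ty q\<close> on the
      axis by at most \<open>(\<bar>c0\<bar> + 2) * \<delta>\<close>. This has to be small against
      \<eta>, so that \<mu> decides the sign of the minimum from
      \<open>\<bar>\<mu>\<bar> = \<eta>\<close> on, and small against the height of the parabola at
      the ends of the interval.\<close>
    define \<delta> where "\<delta> = min (min (\<epsilon> / 2) \<rho>) (min (\<eta> / (4 * (\<bar>c0\<bar> + 2))) (D * \<sigma>\<^sup>2 / 128 / (\<bar>c0\<bar> + 2)))"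
    have \<delta>: "\<delta> > 0" "\<delta> \<le> \<epsilon> / 2" "\<delta> \<le> \<rho>" "(\<bar>c0\<bar> + 2) * \<delta> \<le> \<eta> / 4" "(\<bar>c0\<bar> + 2) * \<delta> \<le> D * \<sigma>\<^sup>2 / 128"
    proof -
      show "\<delta> > 0" unfolding \<delta>_def using \<epsilon>(1) \<rho> \<eta>(1) D(1) \<sigma>(1) by (simp add: add_nonneg_pos)
      show "\<delta> \<le> \<epsilon> / 2" "\<delta> \<le> \<rho>"
        unfolding \<delta>_def by (meson min.cobounded1 min.cobounded2 order_trans)+
      have "\<delta> \<le> \<eta> / (4 * (\<bar>c0\<bar> + 2))" "\<delta> \<le> D * \<sigma>\<^sup>2 / 128 / (\<bar>c0\<bar> + 2)"
        unfolding \<delta>_def by (meson min.cobounded1 min.cobounded2 order_trans)+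
      then show "(\<bar>c0\<bar> + 2) * \<delta> \<le> \<eta> / 4" "(\<bar>c0\<bar> + 2) * \<delta> \<le> D * \<sigma>\<^sup>2 / 128" by (simp_all add: field_simps)
    qed
    obtain J1 where J1: "\<And>j. j \<ge> J1 \<Longrightarrow> \<exists>\<gamma> \<tau> g k. symmetric_arc (ym 0) \<sigma>y \<delta> j \<gamma> \<tau> g k"
      using \<sigma>y(3)[OF \<delta>(1)] by blast
    obtain J2 where J2: "\<And>j. j \<ge> J2 \<Longrightarrow> \<exists>\<gamma> \<tau> g k. symmetric_arc (xp 0) \<sigma>x \<delta> j \<gamma> \<tau> g k"
      using \<sigma>x(2)[OF \<delta>(1)] by blast
    \<comment> \<open>The second bound on \<open>w\<close> makes the depth
      \<open>2 * \<kappa> * w\<^sup>2\<close> small against \<eta>, so that the fold is deeper than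
      the band when \<open>sg * \<mu> \<le> - \<eta>\<close>.\<close>
    have "min \<epsilon> (\<eta> / (8 * \<kappa>)) > 0" using \<epsilon> \<eta> \<kappa> by simp
    from real_arch_pow_inv[OF this L2(2)] obtain J3 where J3: "L2 ^ J3 < min \<epsilon> (\<eta> / (8 * \<kappa>))" by blast
    show "\<exists>J. \<forall>j\<ge>J. \<exists>u v. u < v \<and> {u<..<v} \<subseteq> {-\<eta><..<\<eta>} \<and> (\<forall>\<mu>\<in>{u<..<v}.
      elliptic_and_saddle (2 * (j + n)) (2 * j) \<mu>)"
    proof (rule exI[of _ "max J1 (max J2 J3)"], intro allI impI)
      fix j assume "j \<ge> max J1 (max J2 J3)"
      then have j: "j \<ge> J1" "j + n \<ge> J2" "j \<ge> J3" by auto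
      obtain \<gamma> \<tau> g k where arc: "symmetric_arc (ym 0) \<sigma>y \<delta> j \<gamma> \<tau> g k" using J1[OF j(1)] by blast
      obtain \<gamma>' \<tau>' g' k' where arc': "symmetric_arc (xp 0) \<sigma>x \<delta> (j + n) \<gamma>' \<tau>' g' k'" using J2[OF j(2)] by blast
      define w where "w = (\<lambda>\<mu>. l \<mu> ^ (2 * j))"
      have w: "w \<mu> > 0" "w \<mu> \<le> \<epsilon>" "w \<mu> \<le> \<eta> / (8 * \<kappa>)" if m: "\<bar>\<mu>\<bar> \<le> \<mu>1" for \<mu>
      proof -
        show "w \<mu> > 0" unfolding w_def using M(4)[OF m] by simp
        have "w \<mu> \<le> L2 ^ (2 * j)" unfolding w_def using M(4,5)[OF m] by (intro power_mono) auto
        also have "\<dots> \<le> L2 ^ J3" using j(3) L2 by (intro power_decreasing) auto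
        finally show "w \<mu> \<le> \<epsilon>" "w \<mu> \<le> \<eta> / (8 * \<kappa>)" using J3 by auto
      qed
      define F where "F = arc_gap \<gamma> \<gamma>'"
      define F' where "F' = arc_gap' \<gamma> g g'"
      have gam: "\<bar>\<gamma> \<mu> s\<bar> \<le> \<delta>" "DERIV (\<gamma> \<mu>) s :> g \<mu> s" "\<bar>g \<mu> s - w \<mu>\<bar> \<le> \<delta> * w \<mu>" "\<bar>k \<mu> s - w \<mu>\<bar> \<le> \<delta> * w \<mu>"
        if "\<bar>\<mu>\<bar> \<le> \<mu>1" "\<bar>s - ym 0\<bar> \<le> \<sigma>" for \<mu> s
      proof -
        have "\<bar>\<mu>\<bar> \<le> \<sigma>y" "\<bar>s - ym 0\<bar> \<le> \<sigma>y" using M(7)[OF that(1)] that(2) \<sigma> by auto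
        then show "\<bar>\<gamma> \<mu> s\<bar> \<le> \<delta>" "DERIV (\<gamma> \<mu>) s :> g \<mu> s" "\<bar>g \<mu> s - w \<mu>\<bar> \<le> \<delta> * w \<mu>" "\<bar>k \<mu> s - w \<mu>\<bar> \<le> \<delta> * w \<mu>"
          unfolding w_def by (rule symmetric_arcD[OF arc])+
      qed
      have bx: "(\<mu>, vector [x, s]) \<in> dom1 \<and> \<bar>Tx q \<mu> (vector [x, s]) - xp 0\<bar> < \<epsilon> \<and>
        \<bar>pd dx (Tx q) \<mu> (vector [x, s]) - a0\<bar> < \<epsilon> \<and> \<bar>pd dy (Tx q) \<mu> (vector [x, s]) - b0\<bar> < \<epsilon> \<and>
        \<bar>pd dx (Ty q) \<mu> (vector [x, s]) - c0\<bar> < \<epsilon>"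
        if "\<bar>\<mu>\<bar> \<le> \<mu>1" "\<bar>s - ym 0\<bar> \<le> \<sigma>" "\<bar>x\<bar> \<le> \<delta>" for \<mu> s x
      proof -
        have "\<bar>x\<bar> \<le> \<rho>" "\<bar>s - ym 0\<bar> \<le> \<rho>" using that \<delta>(3) \<sigma>(2) by linarith+
        from box[OF M(6)[OF that(1)] this] show ?thesis by simp
      qed
      \<comment> \<open>The second arc has slope close to \<open>l \<mu> ^ (2 * (j + n))\<close>.
        Half of \<epsilon> pays for the accuracy of the arc, the other half for replacing
        \<open>l \<mu> ^ (2 * n)\<close> by its value \<Lambda> at 0.\<close>
      have gam': "\<bar>\<gamma>' \<mu> s'\<bar> \<le> \<delta>" "\<bar>g' \<mu> s' - \<Lambda> * w \<mu>\<bar> \<le> \<epsilon> * w \<mu>" "\<bar>k' \<mu> s' - \<Lambda> * w \<mu>\<bar> \<le> \<epsilon> * w \<mu>"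
        if m: "\<bar>\<mu>\<bar> \<le> \<mu>1" and "\<bar>s' - xp 0\<bar> \<le> \<epsilon>" for \<mu> s'
      proof -
        have b: "\<bar>\<mu>\<bar> \<le> \<sigma>x" "\<bar>s' - xp 0\<bar> \<le> \<sigma>x" using M(8)[OF m] that(2) \<epsilon>(6) by auto
        have lw: "l \<mu> ^ (2 * (j + n)) = w \<mu> * l \<mu> ^ (2 * n)" unfolding w_def by (simp add: power_add algebra_simps)
        have a: "\<bar>\<gamma>' \<mu> s'\<bar> \<le> \<delta>" "\<bar>g' \<mu> s' - w \<mu> * l \<mu> ^ (2 * n)\<bar> \<le> \<delta> * (w \<mu> * l \<mu> ^ (2 * n))"
          "\<bar>k' \<mu> s' - w \<mu> * l \<mu> ^ (2 * n)\<bar> \<le> \<delta> * (w \<mu> * l \<mu> ^ (2 * n))"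
          unfolding lw[symmetric] by (rule symmetric_arcD[OF arc' b])+
        show "\<bar>\<gamma>' \<mu> s'\<bar> \<le> \<delta>" by (rule a(1))
        have "l \<mu> ^ (2 * n) \<le> 1" using M(4,5)[OF m] L2 by (intro power_le_one) auto
        then have d1: "\<delta> * (w \<mu> * l \<mu> ^ (2 * n)) \<le> \<epsilon> / 2 * (w \<mu> * 1)"
          using \<delta>(1,2) w(1)[OF m] M(4)[OF m] by (intro mult_mono mult_left_mono) auto
        have "\<bar>w \<mu> * l \<mu> ^ (2 * n) - \<Lambda> * w \<mu>\<bar> = w \<mu> * \<bar>l \<mu> ^ (2 * n) - \<Lambda>\<bar>"
        proof -
          have "w \<mu> * l \<mu> ^ (2 * n) - \<Lambda> * w \<mu> = w \<mu> * (l \<mu> ^ (2 * n) - \<Lambda>)" by (simp add: algebra_simps)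
          then show ?thesis using w(1)[OF m] by (simp add: abs_mult)
        qed
        also have "\<dots> \<le> w \<mu> * (\<epsilon> / 2)" using M(3)[OF m] w(1)[OF m] by (intro mult_left_mono) auto
        finally have d2: "\<bar>w \<mu> * l \<mu> ^ (2 * n) - \<Lambda> * w \<mu>\<bar> \<le> w \<mu> * (\<epsilon> / 2)" .
        have "\<epsilon> / 2 * (w \<mu> * 1) + w \<mu> * (\<epsilon> / 2) = \<epsilon> * w \<mu>" by (simp add: field_simps)
        then show "\<bar>g' \<mu> s' - \<Lambda> * w \<mu>\<bar> \<le> \<epsilon> * w \<mu>" "\<bar>k' \<mu> s' - \<Lambda> * w \<mu>\<bar> \<le> \<epsilon> * w \<mu>"
          using abs_triangle_ineq[of "g' \<mu> s' - w \<mu> * l \<mu> ^ (2 * n)" "w \<mu> * l \<mu> ^ (2 * n) - \<Lambda> * w \<mu>"]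
            abs_triangle_ineq[of "k' \<mu> s' - w \<mu> * l \<mu> ^ (2 * n)" "w \<mu> * l \<mu> ^ (2 * n) - \<Lambda> * w \<mu>"]
            a(2,3) d1 d2 by (simp_all add: mult.commute[of "w \<mu>" \<epsilon>])
      qed
      have de: "\<delta> * w \<mu> \<le> \<epsilon> * w \<mu>" if "\<bar>\<mu>\<bar> \<le> \<mu>1" for \<mu>
        using \<delta>(2) \<epsilon>(1) w(1)[OF that] by (intro mult_right_mono) auto
      have F_DERIV: "DERIV (F \<mu>) s :> F' \<mu> s" if m: "\<bar>\<mu>\<bar> \<le> \<mu>1" and s: "\<bar>s - ym 0\<bar> \<le> \<sigma>" for \<mu> s
        unfolding F_def F'_def
      proof (rule arc_gap_DERIV[OF arc arc'])
        note b = bx[OF m s gam(1)[OF m s]]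
        show "(\<mu>, vector [\<gamma> \<mu> s, s]) \<in> E q" using b dom1_E by blast
        show "\<bar>Tx q \<mu> (vector [\<gamma> \<mu> s, s]) - xp 0\<bar> \<le> \<sigma>x" using b \<epsilon>(6) by linarith
      qed (use M[OF m] s \<sigma> in linarith)+
      define Y where "Y = (\<lambda>\<mu> s. pd dy (Ty q) \<mu> (vector [\<gamma> \<mu> s, s]))"
      have F'_est: "\<bar>F' \<mu> s - Y \<mu> s - (c0 - \<Lambda> * b0) * w \<mu>\<bar> \<le> 8 * \<epsilon> * B * w \<mu>"
        if m: "\<bar>\<mu>\<bar> \<le> \<mu>1" and s: "\<bar>s - ym 0\<bar> \<le> \<sigma>" for \<mu> s
      proof -
        note b = bx[OF m s gam(1)[OF m s]]
        let ?s' = "Tx q \<mu> (vector [\<gamma> \<mu> s, s])"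
        have s': "\<bar>?s' - xp 0\<bar> \<le> \<epsilon>" using b by linarith
        have e: "\<bar>g \<mu> s - w \<mu>\<bar> \<le> \<epsilon> * w \<mu>" "\<bar>k \<mu> s - w \<mu>\<bar> \<le> \<epsilon> * w \<mu>"
          using gam(3,4)[OF m s] de[OF m] by linarith+
        have P: "\<bar>pd dx (Tx q) \<mu> (vector [\<gamma> \<mu> s, s]) - a0\<bar> \<le> \<epsilon>" "\<bar>pd dy (Tx q) \<mu> (vector [\<gamma> \<mu> s, s]) - b0\<bar> \<le> \<epsilon>"
          "\<bar>pd dx (Ty q) \<mu> (vector [\<gamma> \<mu> s, s]) - c0\<bar> \<le> \<epsilon>" using b by linarith+
        show ?thesis unfolding F'_def arc_gap'_def Y_def
          by (rule transition_estimates(1)[OF w(1,2)[OF m] \<epsilon>(2) less_imp_le[OF Lam(1)] Lam(2) e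
                gam'(2,3)[OF m s'] P B_def])
      qed
      \<comment> \<open>The slopes \<open>g\<close> and \<open>g'\<close> of the arcs come with a
        relative error and no bound on their variation, so \<open>F'\<close> is not differentiated.
        It is compared with \<open>Y\<close>, whose growth along the arc is known; the error of
        \<open>F'_est\<close> counts twice, hence 16 instead of 8.\<close>
      have slope: "D / 2 * (s' - s) - 16 * \<epsilon> * B * w \<mu> \<le> sg * F' \<mu> s' - sg * F' \<mu> s \<and>
          sg * F' \<mu> s' - sg * F' \<mu> s \<le> 2 * D * (s' - s) + 16 * \<epsilon> * B * w \<mu>"
        if m: "\<bar>\<mu>\<bar> \<le> \<mu>1" and s: "\<bar>s - ym 0\<bar> \<le> \<sigma>" "\<bar>s' - ym 0\<bar> \<le> \<sigma>" "s \<le> s'" for \<mu> s s'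
      proof -
        have "\<bar>\<gamma> \<mu> s' - \<gamma> \<mu> s\<bar> \<le> (2 * \<epsilon>) * \<bar>s' - s\<bar>"
        proof (rule MVT_abs_bound)
          fix t assume "min s s' \<le> t" "t \<le> max s s'"
          then have t: "\<bar>t - ym 0\<bar> \<le> \<sigma>" using s by linarith
          show "DERIV (\<gamma> \<mu>) t :> g \<mu> t" by (rule gam(2)[OF m t])
          have "\<epsilon> * w \<mu> \<le> w \<mu>" using \<epsilon>(2) w(1)[OF m] by simp
          then show "\<bar>g \<mu> t\<bar> \<le> 2 * \<epsilon>" using gam(3)[OF m t] de[OF m] w(1,2)[OF m] by linarith
        qed
        then have g1: "\<bar>\<gamma> \<mu> s' - \<gamma> \<mu> s\<bar> \<le> 2 * \<epsilon> * (s' - s)" using s by simp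
        have "\<bar>Y \<mu> s' - Y \<mu> s - D2 * (s' - s)\<bar> \<le> \<epsilon> * \<bar>s' - s\<bar> + (\<bar>e0\<bar> + 1) * \<bar>\<gamma> \<mu> s' - \<gamma> \<mu> s\<bar>"
          unfolding Y_def using gam(1)[OF m s(1)] gam(1)[OF m s(2)] s \<delta>(3) \<sigma>(2) by (intro Gy_diff[OF m]) auto
        also have "\<dots> \<le> \<epsilon> * (s' - s) + (\<bar>e0\<bar> + 1) * (2 * \<epsilon> * (s' - s))"
          using g1 s \<epsilon>(1) by (intro add_mono mult_left_mono) auto
        also have "\<dots> = ((3 + 2 * \<bar>e0\<bar>) * \<epsilon>) * (s' - s)" by (simp add: algebra_simps)
        also have "\<dots> \<le> (D / 2) * (s' - s)" using \<epsilon>(5) s by (intro mult_right_mono) auto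
        finally have y1: "\<bar>Y \<mu> s' - Y \<mu> s - D2 * (s' - s)\<bar> \<le> D / 2 * (s' - s)" .
        have "sg * (Y \<mu> s' - Y \<mu> s - D2 * (s' - s)) = sg * Y \<mu> s' - sg * Y \<mu> s - D * (s' - s)"
          unfolding D(2)[symmetric] by (simp add: algebra_simps)
        then have y2: "\<bar>sg * Y \<mu> s' - sg * Y \<mu> s - D * (s' - s)\<bar> \<le> D / 2 * (s' - s)" using y1 sgabs by metis
        have f: "\<bar>sg * F' \<mu> s - sg * Y \<mu> s - sg * (c0 - \<Lambda> * b0) * w \<mu>\<bar> \<le> 8 * \<epsilon> * B * w \<mu>"
          if "\<bar>s - ym 0\<bar> \<le> \<sigma>" for s
        proof -
          have "sg * F' \<mu> s - sg * Y \<mu> s - sg * (c0 - \<Lambda> * b0) * w \<mu> = sg * (F' \<mu> s - Y \<mu> s - (c0 - \<Lambda> * b0) * w \<mu>)"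
            by (simp add: algebra_simps)
          then show ?thesis using F'_est[OF m that] sgabs by metis
        qed
        have DD: "D * (s' - s) = D / 2 * (s' - s) + D / 2 * (s' - s)" "2 * D * (s' - s) = D * (s' - s) + D * (s' - s)"
          "0 \<le> D / 2 * (s' - s)" using D(1) s by (simp_all add: algebra_simps)
        show ?thesis using y2 f[OF s(1)] f[OF s(2)] DD by linarith
      qed
      have close: "\<bar>F \<mu> s - Ty q \<mu> (vector [0, s])\<bar> \<le> (\<bar>c0\<bar> + 2) * \<delta>"
        if m: "\<bar>\<mu>\<bar> \<le> \<mu>1" and s: "\<bar>s - ym 0\<bar> \<le> \<sigma>" for \<mu> s
      proof -
        have "\<bar>Ty q \<mu> (vector [\<gamma> \<mu> s, s]) - Ty q \<mu> (vector [0, s])\<bar> \<le> (\<bar>c0\<bar> + 1) * \<bar>\<gamma> \<mu> s - 0\<bar>"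
        proof (rule MVT_abs_bound[where \<phi> = "\<lambda>t. Ty q \<mu> (vector [t, s])" and \<phi>' = "\<lambda>t. pd dx (Ty q) \<mu> (vector [t, s])"])
          fix t assume "min 0 (\<gamma> \<mu> s) \<le> t" "t \<le> max 0 (\<gamma> \<mu> s)"
          then have "\<bar>t\<bar> \<le> \<delta>" using gam(1)[OF m s] by linarith
          note b = bx[OF m s this]
          show "DERIV (\<lambda>t. Ty q \<mu> (vector [t, s])) t :> pd dx (Ty q) \<mu> (vector [t, s])"
            by (rule pd_DERIV(1)[OF T_component_Suc(2)]) (use b dom1_E in blast)
          show "\<bar>pd dx (Ty q) \<mu> (vector [t, s])\<bar> \<le> \<bar>c0\<bar> + 1" using b \<epsilon>(2) by linarith
        qed
        also have "\<dots> \<le> (\<bar>c0\<bar> + 1) * \<delta>" using gam(1)[OF m s] by (intro mult_left_mono) auto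
        finally have c1: "\<bar>Ty q \<mu> (vector [\<gamma> \<mu> s, s]) - Ty q \<mu> (vector [0, s])\<bar> \<le> (\<bar>c0\<bar> + 1) * \<delta>" .
        have "\<bar>Tx q \<mu> (vector [\<gamma> \<mu> s, s]) - xp 0\<bar> \<le> \<epsilon>" using bx[OF m s gam(1)[OF m s]] by linarith
        then have c2: "\<bar>\<gamma>' \<mu> (Tx q \<mu> (vector [\<gamma> \<mu> s, s]))\<bar> \<le> \<delta>" by (rule gam'(1)[OF m])
        have "(\<bar>c0\<bar> + 2) * \<delta> = (\<bar>c0\<bar> + 1) * \<delta> + \<delta>" by (simp add: algebra_simps)
        then show ?thesis unfolding F_def arc_gap_def using c1 c2 by linarith
      qed
      define M0 S0 where "M0 = {-\<mu>1..\<mu>1}" and "S0 = {ym 0 - \<sigma>..ym 0 + \<sigma>}"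
      have MS: "\<mu> \<in> M0 \<longleftrightarrow> \<bar>\<mu>\<bar> \<le> \<mu>1" "s \<in> S0 \<longleftrightarrow> \<bar>s - ym 0\<bar> \<le> \<sigma>" for \<mu> s
        unfolding M0_def S0_def atLeastAtMost_iff by linarith+
      have contF: "continuous_on (M0 \<times> S0) (\<lambda>x. F (fst x) (snd x))"
      proof -
        have "M0 \<times> S0 \<subseteq> {-\<sigma>y..\<sigma>y} \<times> {ym 0 - \<sigma>y..ym 0 + \<sigma>y}" unfolding M0_def S0_def using \<mu>1(2) \<sigma>(3) by auto
        then have c\<gamma>: "continuous_on (M0 \<times> S0) (\<lambda>x. \<gamma> (fst x) (snd x))"
          using continuous_on_subset[OF arc[unfolded symmetric_arc_def, THEN conjunct1]] by (simp add: case_prod_unfold)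
        then have cp: "continuous_on (M0 \<times> S0) (\<lambda>x. (fst x, vector [\<gamma> (fst x) (snd x), snd x]) :: real \<times> (real^2))"
          by (intro continuous_intros)
        have im: "(\<lambda>x. (fst x, vector [\<gamma> (fst x) (snd x), snd x])) ` (M0 \<times> S0) \<subseteq> E q"
          using bx gam(1) dom1_E MS by auto
        have cy: "continuous_on (M0 \<times> S0) (\<lambda>x. Ty q (fst x) (vector [\<gamma> (fst x) (snd x), snd x]))"
          using continuous_on_compose2[OF Ck_fibre_on_continuous[OF T_component_Suc(2)] cp im] by (simp add: case_prod_unfold)
        have cx: "continuous_on (M0 \<times> S0) (\<lambda>x. Tx q (fst x) (vector [\<gamma> (fst x) (snd x), snd x]))"
          using continuous_on_compose2[OF Ck_fibre_on_continuous[OF T_component_Suc(1)] cp im] by (simp add: case_prod_unfold)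
        have cq: "continuous_on (M0 \<times> S0) (\<lambda>x. (fst x, Tx q (fst x) (vector [\<gamma> (fst x) (snd x), snd x])))"
          by (intro continuous_intros cx)
        have im': "(\<lambda>x. (fst x, Tx q (fst x) (vector [\<gamma> (fst x) (snd x), snd x]))) ` (M0 \<times> S0) \<subseteq>
            {-\<sigma>x..\<sigma>x} \<times> {xp 0 - \<sigma>x..xp 0 + \<sigma>x}"
        proof (rule image_subsetI)
          fix x assume "x \<in> M0 \<times> S0"
          then obtain \<mu> s where x: "x = (\<mu>, s)" "\<bar>\<mu>\<bar> \<le> \<mu>1" "\<bar>s - ym 0\<bar> \<le> \<sigma>" using MS by auto
          have "\<bar>Tx q \<mu> (vector [\<gamma> \<mu> s, s]) - xp 0\<bar> \<le> \<sigma>x" "\<bar>\<mu>\<bar> \<le> \<sigma>x"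
            using bx[OF x(2,3) gam(1)[OF x(2,3)]] \<epsilon>(6) M(8)[OF x(2)] by linarith+
          then show "(fst x, Tx q (fst x) (vector [\<gamma> (fst x) (snd x), snd x])) \<in> {-\<sigma>x..\<sigma>x} \<times> {xp 0 - \<sigma>x..xp 0 + \<sigma>x}"
            unfolding x(1) mem_Times_iff fst_conv snd_conv atLeastAtMost_iff by linarith
        qed
        have "continuous_on (M0 \<times> S0) (\<lambda>x. \<gamma>' (fst x) (Tx q (fst x) (vector [\<gamma> (fst x) (snd x), snd x])))"
          using continuous_on_compose2[OF arc'[unfolded symmetric_arc_def, THEN conjunct1] cq im'] by (simp add: case_prod_unfold)
        then show ?thesis unfolding F_def arc_gap_def by (intro continuous_intros cy)
      qed
      have cw: "continuous_on M0 w" unfolding w_def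
        by (intro continuous_intros continuous_on_subset[OF l_cont]) (use M(1) MS in auto)
      \<comment> \<open>Dividing by \<open>w\<^sup>2\<close>, which depends on \<mu>, puts the
        depths of the folds on one scale, so that the condition on \<mu> becomes a fixed band of
        values.\<close>
      have cFh: "continuous_on (M0 \<times> S0) (\<lambda>(\<mu>, s). sg * F \<mu> s / (w \<mu>)\<^sup>2)"
      proof -
        have "continuous_on (M0 \<times> S0) (\<lambda>x. w (fst x))"
          by (rule continuous_on_compose2[OF cw continuous_on_fst[OF continuous_on_id]]) auto
        moreover have "\<forall>x\<in>M0 \<times> S0. (w (fst x))\<^sup>2 \<noteq> 0" using w(1) MS by fastforce
        ultimately show ?thesis unfolding case_prod_unfold by (intro continuous_intros contF)
      qed
      have "S0 \<noteq> {}" "compact M0" "compact S0" unfolding M0_def S0_def using \<sigma>(1) by auto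
      from continuous_minimum[OF this(2,3,1) cFh]
      obtain mn where mn: "continuous_on M0 mn" "\<And>\<mu>. \<mu> \<in> M0 \<Longrightarrow> \<exists>s\<in>S0. sg * F \<mu> s / (w \<mu>)\<^sup>2 = mn \<mu>"
        "\<And>\<mu> s. \<mu> \<in> M0 \<Longrightarrow> s \<in> S0 \<Longrightarrow> mn \<mu> \<le> sg * F \<mu> s / (w \<mu>)\<^sup>2" by blast
      have sgF: "sg * \<mu> + D / 4 * (s - ym \<mu>)\<^sup>2 - (\<bar>c0\<bar> + 2) * \<delta> \<le> sg * F \<mu> s"
        if m: "\<bar>\<mu>\<bar> \<le> \<mu>1" and s: "\<bar>s - ym 0\<bar> \<le> \<sigma>" for \<mu> s
      proof -
        have "sg * F \<mu> s - sg * Ty q \<mu> (vector [0, s]) = sg * (F \<mu> s - Ty q \<mu> (vector [0, s]))" by (simp add: algebra_simps)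
        then have "\<bar>sg * F \<mu> s - sg * Ty q \<mu> (vector [0, s])\<bar> \<le> (\<bar>c0\<bar> + 2) * \<delta>" using close[OF m s] sgabs by metis
        moreover have "\<bar>s - ym 0\<bar> \<le> \<rho>" using s \<sigma> by linarith
        ultimately show ?thesis using lower[OF m] by fastforce
      qed
      have mn_pos: "mn \<mu> > 0" if m: "\<bar>\<mu>\<bar> \<le> \<mu>1" and e: "sg * \<mu> \<ge> \<eta>" for \<mu>
      proof -
        obtain s where s: "s \<in> S0" "sg * F \<mu> s / (w \<mu>)\<^sup>2 = mn \<mu>" using mn(2) m MS by blast
        have "0 \<le> D / 4 * (s - ym \<mu>)\<^sup>2" using D(1) by simp
        then have "sg * F \<mu> s > 0" using sgF[OF m] s(1) e \<delta>(4) \<eta>(1) MS by fastforce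
        then show ?thesis using s(2) w(1)[OF m] by (metis divide_pos_pos zero_less_power)
      qed
      \<comment> \<open>It suffices to look at the vertex, where the gap is \<open>\<mu>\<close> up
        to \<open>\<eta> / 4\<close>.\<close>
      have mn_neg: "mn \<mu> < - 2 * \<kappa>" if m: "\<bar>\<mu>\<bar> \<le> \<mu>1" and e: "sg * \<mu> \<le> - \<eta>" for \<mu>
      proof -
        have ys: "\<bar>ym \<mu> - ym 0\<bar> \<le> \<sigma>" using M(2)[OF m] \<sigma>(1) by linarith
        have "sg * F \<mu> (ym \<mu>) - sg * \<mu> = sg * (F \<mu> (ym \<mu>) - Ty q \<mu> (vector [0, ym \<mu>]))"
          unfolding vertex(1)[OF m] by (simp add: algebra_simps)
        then have "\<bar>sg * F \<mu> (ym \<mu>) - sg * \<mu>\<bar> \<le> (\<bar>c0\<bar> + 2) * \<delta>" using close[OF m ys] sgabs by metis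
        then have f: "sg * F \<mu> (ym \<mu>) \<le> - \<eta> / 2" using e \<delta>(4) \<eta>(1) by linarith
        have w1: "w \<mu> \<le> 1" using w(2)[OF m] \<epsilon>(2) by linarith
        have "(w \<mu>)\<^sup>2 \<le> w \<mu>" using w1 w(1)[OF m] by (simp add: power2_eq_square mult_left_le)
        then have "8 * \<kappa> * (w \<mu>)\<^sup>2 \<le> 8 * \<kappa> * w \<mu>" using \<kappa>(1) by (intro mult_left_mono) auto
        moreover have "8 * \<kappa> * w \<mu> \<le> \<eta>" using w(3)[OF m] \<kappa>(1) by (simp add: field_simps)
        ultimately have w2: "8 * \<kappa> * (w \<mu>)\<^sup>2 \<le> \<eta>" by linarith
        have "- 2 * \<kappa> * (w \<mu>)\<^sup>2 > - \<eta> / 2" using w2 \<eta>(1) by linarith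
        then have "sg * F \<mu> (ym \<mu>) < - 2 * \<kappa> * (w \<mu>)\<^sup>2" using f by linarith
        then have "sg * F \<mu> (ym \<mu>) / (w \<mu>)\<^sup>2 < - 2 * \<kappa>" using w(1)[OF m] by (simp add: pos_divide_less_eq)
        moreover have "mn \<mu> \<le> sg * F \<mu> (ym \<mu>) / (w \<mu>)\<^sup>2" using mn(3) m ys MS by blast
        ultimately show ?thesis by linarith
      qed
      \<comment> \<open>At the ends the parabola contributes at least
        \<open>D * \<sigma>\<^sup>2 / 16\<close>, against at most
        \<open>D * \<sigma>\<^sup>2 / 64\<close> from \<mu> and
        \<open>D * \<sigma>\<^sup>2 / 128\<close> from replacing the gap by
        \<open>Ty q\<close>.\<close>
      have ends: "sg * F \<mu> (ym 0 + \<sigma>) > 0" "sg * F \<mu> (ym 0 - \<sigma>) > 0" if m: "\<bar>\<mu>\<bar> \<le> \<mu>1" for \<mu>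
      proof -
        have *: "sg * F \<mu> s > 0" if s: "\<bar>s - ym 0\<bar> = \<sigma>" for s
        proof -
          have "\<sigma> / 2 \<le> \<bar>s - ym \<mu>\<bar>" using s M(2)[OF m] by linarith
          then have "(\<sigma> / 2)\<^sup>2 \<le> (s - ym \<mu>)\<^sup>2" using \<sigma>(1) by (metis abs_le_square_iff abs_of_pos half_gt_zero)
          then have "D / 4 * (\<sigma> / 2)\<^sup>2 \<le> D / 4 * (s - ym \<mu>)\<^sup>2" using D(1) by (intro mult_left_mono) auto
          moreover have "D / 4 * (\<sigma> / 2)\<^sup>2 = D * \<sigma>\<^sup>2 / 16" by (simp add: power_divide)
          moreover have "sg * \<mu> \<ge> - (D * \<sigma>\<^sup>2 / 64)" using m \<mu>1(8) sgabs[of \<mu>] by linarith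
          moreover have "D * \<sigma>\<^sup>2 > 0" using D(1) \<sigma>(1) by simp
          ultimately show ?thesis using sgF[OF m, of s] s \<delta>(5) by linarith
        qed
        show "sg * F \<mu> (ym 0 + \<sigma>) > 0" "sg * F \<mu> (ym 0 - \<sigma>) > 0" using * \<sigma>(1) by auto
      qed
      have main: "elliptic_and_saddle (2 * (j + n)) (2 * j) \<mu>"
        if m: "\<bar>\<mu>\<bar> \<le> \<mu>1" and mnb: "- 2 * \<kappa> < mn \<mu>" "mn \<mu> < - \<kappa>" for \<mu>
      proof -
        note w1 = w(1)[OF m]
        obtain sm where sm: "\<bar>sm - ym 0\<bar> \<le> \<sigma>" "sg * F \<mu> sm / (w \<mu>)\<^sup>2 = mn \<mu>"
          using mn(2)[of \<mu>] m MS by blast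
        have smF: "sg * F \<mu> sm = mn \<mu> * (w \<mu>)\<^sup>2" using sm(2) w1 by (simp add: field_simps)
        have mW: "mn \<mu> * (w \<mu>)\<^sup>2 \<le> sg * F \<mu> s" if "\<bar>s - ym 0\<bar> \<le> \<sigma>" for s
          using mn(3)[of \<mu> s] m that MS w1 by (simp add: pos_le_divide_eq)
        have w2: "(w \<mu>)\<^sup>2 > 0" using w1 by simp
        have rng: "\<bar>s - ym 0\<bar> \<le> \<sigma>" if "ym 0 - \<sigma> \<le> s" "s \<le> ym 0 + \<sigma>" for s using that by linarith
        have "\<exists>a b. ym 0 - \<sigma> \<le> a \<and> a \<le> ym 0 + \<sigma> \<and> ym 0 - \<sigma> \<le> b \<and> b \<le> ym 0 + \<sigma> \<and>
          sg * F \<mu> a = 0 \<and> sg * F \<mu> b = 0 \<and> sg * F' \<mu> a < 0 \<and> 0 < sg * F' \<mu> b \<and>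
          \<bar>sg * F' \<mu> a\<bar> \<le> m0 / 2 * w \<mu> \<and> \<bar>sg * F' \<mu> b\<bar> \<le> m0 / 2 * w \<mu>"
        proof (rule fold_zeros[where ?d1.0 = "D / 2" and ?d2.0 = "2 * D" and \<theta> = "16 * \<epsilon> * B * w \<mu>"
              and m = "- mn \<mu> * (w \<mu>)\<^sup>2" and sm = sm])
          show "DERIV (\<lambda>s. sg * F \<mu> s) s :> sg * F' \<mu> s" if "ym 0 - \<sigma> \<le> s" "s \<le> ym 0 + \<sigma>" for s
            by (rule DERIV_cmult[OF F_DERIV[OF m rng[OF that]]])
          show "0 < sg * F \<mu> (ym 0 - \<sigma>)" "0 < sg * F \<mu> (ym 0 + \<sigma>)" using ends[OF m] by auto
          show "D / 2 * (s' - s) - 16 * \<epsilon> * B * w \<mu> \<le> sg * F' \<mu> s' - sg * F' \<mu> s \<and>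
              sg * F' \<mu> s' - sg * F' \<mu> s \<le> 2 * D * (s' - s) + 16 * \<epsilon> * B * w \<mu>"
            if "ym 0 - \<sigma> \<le> s" "s \<le> s'" "s' \<le> ym 0 + \<sigma>" for s s'
            by (rule slope[OF m]) (use that in linarith)+
          show "0 < D / 2" "0 < 2 * D" using D(1) by auto
          show "0 \<le> 16 * \<epsilon> * B * w \<mu>" using \<epsilon>(1) B w1 by simp
          show "0 < - mn \<mu> * (w \<mu>)\<^sup>2" using mnb \<kappa>(1) w2 by (intro mult_pos_pos) auto
          show "ym 0 - \<sigma> \<le> sm" "sm \<le> ym 0 + \<sigma>" using sm(1) by linarith+
          show "sg * F \<mu> sm = - (- mn \<mu> * (w \<mu>)\<^sup>2)" using smF by simp
          show "sg * F \<mu> sm \<le> sg * F \<mu> s" if "ym 0 - \<sigma> \<le> s" "s \<le> ym 0 + \<sigma>" for s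
            using mW[OF rng[OF that]] smF by simp
          have "(16 * \<epsilon> * B * w \<mu>)\<^sup>2 * (2 * D / (D / 2)\<^sup>2 + 1 / (D / 2)) = (2560 * \<epsilon>\<^sup>2 * B\<^sup>2 / D) * (w \<mu>)\<^sup>2"
            using D(1) by (simp add: power2_eq_square field_simps)
          also have "\<dots> < \<kappa> * (w \<mu>)\<^sup>2"
            using \<epsilon>(4) D(1) w2 by (intro mult_strict_right_mono) (auto simp: pos_divide_less_eq)
          also have "\<dots> \<le> - mn \<mu> * (w \<mu>)\<^sup>2" using mnb by (intro mult_right_mono) auto
          finally show "(16 * \<epsilon> * B * w \<mu>)\<^sup>2 * (2 * D / (D / 2)\<^sup>2 + 1 / (D / 2)) < - mn \<mu> * (w \<mu>)\<^sup>2" .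
          have "8 * (- mn \<mu> * (w \<mu>)\<^sup>2) / (D / 2) \<le> 8 * (2 * \<kappa> * (w \<mu>)\<^sup>2) / (D / 2)"
            using mnb D(1) by (intro divide_right_mono mult_left_mono mult_right_mono) auto
          also have "\<dots> = 32 * \<kappa> / D * (w \<mu>)\<^sup>2" by simp
          finally have "sqrt (8 * (- mn \<mu> * (w \<mu>)\<^sup>2) / (D / 2)) \<le> sqrt (32 * \<kappa> / D * (w \<mu>)\<^sup>2)" by (rule real_sqrt_le_mono)
          also have "\<dots> = m0 / (8 * D) * w \<mu>" unfolding real_sqrt_mult \<kappa>(2) using w1 by simp
          finally have sq: "2 * D * sqrt (8 * (- mn \<mu> * (w \<mu>)\<^sup>2) / (D / 2)) \<le> 2 * D * (m0 / (8 * D) * w \<mu>)"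
            using D(1) by (intro mult_left_mono) auto
          have e1: "2 * D * (m0 / (8 * D) * w \<mu>) = m0 / 4 * w \<mu>" using D(1) by simp
          have e2: "2 * D * (4 * (16 * \<epsilon> * B * w \<mu>) / (D / 2)) + 16 * \<epsilon> * B * w \<mu> = (272 * \<epsilon> * B) * w \<mu>"
            using D(1) by (simp add: field_simps)
          have e3: "(272 * \<epsilon> * B) * w \<mu> \<le> m0 / 4 * w \<mu>" using \<epsilon>(3) w1 by (intro mult_right_mono) auto
          have e4: "m0 / 2 * w \<mu> = m0 / 4 * w \<mu> + m0 / 4 * w \<mu>" by simp
          \<comment> \<open>The final inequality is linear in a few products; stating it for
            variables keeps these products as atoms.\<close>
          have sum: "a + b + c \<le> v" if "a + c = x" "x \<le> y" "b \<le> z" "z = y" "v = y + y" for a b c v x y z :: real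
            using that by linarith
          show "2 * D * (4 * (16 * \<epsilon> * B * w \<mu>) / (D / 2) + sqrt (8 * (- mn \<mu> * (w \<mu>)\<^sup>2) / (D / 2))) +
              16 * \<epsilon> * B * w \<mu> \<le> m0 / 2 * w \<mu>"
            unfolding distrib_left by (rule sum[OF e2 e3 sq e1 e4])
        qed
        then obtain s1 s2 where ss: "\<bar>s1 - ym 0\<bar> \<le> \<sigma>" "\<bar>s2 - ym 0\<bar> \<le> \<sigma>" "sg * F \<mu> s1 = 0" "sg * F \<mu> s2 = 0"
          "sg * F' \<mu> s1 < 0" "0 < sg * F' \<mu> s2" "\<bar>sg * F' \<mu> s1\<bar> \<le> m0 / 2 * w \<mu>" "\<bar>sg * F' \<mu> s2\<bar> \<le> m0 / 2 * w \<mu>"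
          using rng by blast
        \<comment> \<open>The sign of \<open>K0\<close> tells which of the two zeros is elliptic.
          The slopes at the zeros have opposite signs, so there is one point of each type in either
          case.\<close>
        define K0 where "K0 = \<Lambda> * b0 * (\<Lambda> * b0 - c0) * (- c0)"
        have type: "\<exists>p. symmetric_fixed_point R (f \<mu>) U0 N1m N1p q (2 * (j + n)) (2 * j) p \<and>
          (K0 * F' \<mu> s < 0 \<longrightarrow> elliptic A (first_return (f \<mu>) q (2 * (j + n)) (2 * j)) p) \<and>
          (K0 * F' \<mu> s > 0 \<longrightarrow> saddle A (first_return (f \<mu>) q (2 * (j + n)) (2 * j)) p)"
          if s: "\<bar>s - ym 0\<bar> \<le> \<sigma>" "sg * F \<mu> s = 0" "sg * F' \<mu> s \<noteq> 0" "\<bar>sg * F' \<mu> s\<bar> \<le> m0 / 2 * w \<mu>" for s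
        proof -
          have F0: "F \<mu> s = 0" "F' \<mu> s \<noteq> 0" "\<bar>F' \<mu> s\<bar> \<le> m0 / 2 * w \<mu>" using s sg(2) by auto
          note b = bx[OF m s(1) gam(1)[OF m s(1)]]
          have s': "\<bar>Tx q \<mu> (vector [\<gamma> \<mu> s, s]) - xp 0\<bar> \<le> \<epsilon>" using b by linarith
          have "16 * \<epsilon> * B \<le> 272 * \<epsilon> * B" using \<epsilon>(1) B by simp
          then have e16: "16 * \<epsilon> * B \<le> m0 / 2" using \<epsilon>(3) m0(1) by linarith
          show ?thesis unfolding K0_def F'_def
          proof (rule arc_point_type[OF arc arc' M(7,8)[OF m] _ _ _ w_def[THEN fun_cong] w(2)[OF m] \<epsilon>(2) Lam _ _
                gam'(2,3)[OF m s'] _ _ _ B_def m0 e16 F0[unfolded F_def F'_def]])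
            show "\<bar>s - ym 0\<bar> \<le> \<sigma>y" using s(1) \<sigma>(3) by linarith
            show "(\<mu>, vector [\<gamma> \<mu> s, s]) \<in> dom1" using b by blast
            show "\<bar>Tx q \<mu> (vector [\<gamma> \<mu> s, s]) - xp 0\<bar> \<le> \<sigma>x" using s' \<epsilon>(6) by linarith
            show "\<bar>g \<mu> s - w \<mu>\<bar> \<le> \<epsilon> * w \<mu>" "\<bar>k \<mu> s - w \<mu>\<bar> \<le> \<epsilon> * w \<mu>"
              using gam(3,4)[OF m s(1)] de[OF m] by linarith+
          qed (use b in linarith)+
        qed
        obtain p1 where p1: "symmetric_fixed_point R (f \<mu>) U0 N1m N1p q (2 * (j + n)) (2 * j) p1"
          "K0 * F' \<mu> s1 < 0 \<Longrightarrow> elliptic A (first_return (f \<mu>) q (2 * (j + n)) (2 * j)) p1"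
          "K0 * F' \<mu> s1 > 0 \<Longrightarrow> saddle A (first_return (f \<mu>) q (2 * (j + n)) (2 * j)) p1"
          using type[OF ss(1,3) less_imp_neq[OF ss(5)] ss(7)] by blast
        obtain p2 where p2: "symmetric_fixed_point R (f \<mu>) U0 N1m N1p q (2 * (j + n)) (2 * j) p2"
          "K0 * F' \<mu> s2 < 0 \<Longrightarrow> elliptic A (first_return (f \<mu>) q (2 * (j + n)) (2 * j)) p2"
          "K0 * F' \<mu> s2 > 0 \<Longrightarrow> saddle A (first_return (f \<mu>) q (2 * (j + n)) (2 * j)) p2"
          using type[OF ss(2,4) less_imp_neq[OF ss(6), symmetric] ss(8)] by blast
        have "K0 \<noteq> 0" using nz Lam n[folded \<Lambda>_def] unfolding K0_def by auto
        moreover have "F' \<mu> s1 * F' \<mu> s2 < 0" using ss(5,6) sg(2) by (auto simp: mult_less_0_iff)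
        ultimately have "K0 * F' \<mu> s1 < 0 \<and> K0 * F' \<mu> s2 > 0 \<or> K0 * F' \<mu> s1 > 0 \<and> K0 * F' \<mu> s2 < 0"
          by (auto simp: mult_less_0_iff zero_less_mult_iff)
        then show ?thesis unfolding elliptic_and_saddle_def using p1 p2 by blast
      qed
      \<comment> \<open>The middle of the band is attained, because the minimum is positive at
        \<open>sg * \<mu>1\<close> and below the band at \<open>- sg * \<mu>1\<close>. Continuity of
        \<open>mn\<close> then supplies a whole interval around this parameter.\<close>
      have "\<exists>\<mu>. \<bar>\<mu>\<bar> \<le> \<mu>1 \<and> mn \<mu> = - (3 / 2) * \<kappa>"
      proof -
        have b: "mn (sg * \<mu>1) > 0" "mn (- sg * \<mu>1) < - 2 * \<kappa>"
        proof -
          show "mn (sg * \<mu>1) > 0" by (rule mn_pos) (use sg \<mu>1(1) \<eta>(2) sgabs[of \<mu>1] in \<open>auto simp: mult.assoc[symmetric]\<close>)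
          show "mn (- sg * \<mu>1) < - 2 * \<kappa>" by (rule mn_neg) (use sg \<mu>1(1) \<eta>(2) sgabs[of \<mu>1] in \<open>auto simp: mult.assoc[symmetric]\<close>)
        qed
        from sg(2) show ?thesis
        proof
          assume "sg = 1"
          then have "\<exists>x. - \<mu>1 \<le> x \<and> x \<le> \<mu>1 \<and> mn x = - (3 / 2) * \<kappa>"
            using b \<kappa>(1) \<mu>1(1) by (intro IVT'[OF _ _ _ mn(1)[unfolded M0_def]]) auto
          then show ?thesis by (metis abs_le_iff minus_le_iff)
        next
          assume "sg = -1"
          then have "\<exists>x. - \<mu>1 \<le> x \<and> x \<le> \<mu>1 \<and> mn x = - (3 / 2) * \<kappa>"
            using b \<kappa>(1) \<mu>1(1) by (intro IVT2'[OF _ _ _ mn(1)[unfolded M0_def]]) auto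
          then show ?thesis by (metis abs_le_iff minus_le_iff)
        qed
      qed
      then obtain \<mu>c where \<mu>c: "\<bar>\<mu>c\<bar> \<le> \<mu>1" "mn \<mu>c = - (3 / 2) * \<kappa>" by blast
      \<comment> \<open>By \<open>mn_pos\<close> and \<open>mn_neg\<close> the band is missed when
        \<open>\<bar>\<mu>\<bar> \<ge> \<eta>\<close>. This locates the interval and, with \<eta>
        tending to 0, makes the intervals accumulate at 0.\<close>
      have inside: "\<bar>\<mu>\<bar> < \<eta>" if m: "\<bar>\<mu>\<bar> \<le> \<mu>1" and mnb: "- 2 * \<kappa> < mn \<mu>" "mn \<mu> < - \<kappa>" for \<mu>
      proof -
        have "\<not> sg * \<mu> \<ge> \<eta>" using mn_pos[OF m] mnb \<kappa>(1) by linarith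
        moreover have "\<not> sg * \<mu> \<le> - \<eta>" using mn_neg[OF m] mnb by linarith
        ultimately have "\<bar>sg * \<mu>\<bar> < \<eta>" by linarith
        then show ?thesis using sgabs by simp
      qed
      have c\<eta>: "\<bar>\<mu>c\<bar> < \<eta>" by (rule inside) (use \<mu>c \<kappa>(1) in auto)
      have "continuous_on {-\<mu>1<..<\<mu>1} mn" by (rule continuous_on_subset[OF mn(1)]) (auto simp: M0_def)
      then have o: "open ({-\<mu>1<..<\<mu>1} \<inter> mn -` {- 2 * \<kappa><..<- \<kappa>})" by (rule continuous_open_preimage) auto
      have "\<mu>c \<in> {-\<mu>1<..<\<mu>1} \<inter> mn -` {- 2 * \<kappa><..<- \<kappa>}" using \<mu>c c\<eta> \<eta>(2) \<kappa>(1) by auto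
      then obtain e where e: "e > 0" "ball \<mu>c e \<subseteq> {-\<mu>1<..<\<mu>1} \<inter> mn -` {- 2 * \<kappa><..<- \<kappa>}"
        using o open_contains_ball_eq by blast
      have in_e: "\<bar>\<mu>\<bar> \<le> \<mu>1 \<and> - 2 * \<kappa> < mn \<mu> \<and> mn \<mu> < - \<kappa>" if "\<mu> \<in> {\<mu>c - e<..<\<mu>c + e}" for \<mu>
      proof -
        have "\<mu> \<in> ball \<mu>c e" using that by (simp add: dist_real_def abs_less_iff)
        then have "\<mu> \<in> {-\<mu>1<..<\<mu>1} \<inter> mn -` {- 2 * \<kappa><..<- \<kappa>}" using e(2) by blast
        then show ?thesis by auto
      qed
      show "\<exists>u v. u < v \<and> {u<..<v} \<subseteq> {-\<eta><..<\<eta>} \<and> (\<forall>\<mu>\<in>{u<..<v}.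
      elliptic_and_saddle (2 * (j + n)) (2 * j) \<mu>)"
      proof (rule exI[of _ "\<mu>c - e"], rule exI[of _ "\<mu>c + e"], intro conjI[OF _ conjI])
        show "\<mu>c - e < \<mu>c + e" using e(1) by simp
        show "{\<mu>c - e<..<\<mu>c + e} \<subseteq> {-\<eta><..<\<eta>}"
        proof (rule subsetI)
          fix \<mu> assume "\<mu> \<in> {\<mu>c - e<..<\<mu>c + e}"
          from in_e[OF this] show "\<mu> \<in> {-\<eta><..<\<eta>}" using inside[of \<mu>] by auto
        qed
      qed (use main in_e in blast)
    qed
  qed (use \<mu>1 in auto)
qed

text \<open>A diagonal choice: the \<open>N\<close>-th interval is taken within
  \<open>\<mu>1 / (N + 1)\<close> of 0, from a value of \<open>j\<close> that is large enough for
  this accuracy. The same shift \<open>n\<close> serves for all of them.\<close>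

lemma elliptic_saddle_cascade:
  assumes \<mu>0: "\<mu>0 > 0"
  shows "\<exists>(S :: (nat \<times> nat) set) (\<delta> :: nat \<Rightarrow> nat \<Rightarrow> real set).
       (\<forall>N. \<exists>(k, m)\<in>S. k \<ge> N \<and> m \<ge> N) \<and>
       (\<forall>(k, m)\<in>S. (\<exists>u v. u < v \<and> \<delta> k m = {u<..<v}) \<and> \<delta> k m \<subseteq> {-\<mu>0..\<mu>0}) \<and>
       (\<forall>\<epsilon>>0. \<exists>N. \<forall>(k, m)\<in>S. k \<ge> N \<and> m \<ge> N \<longrightarrow> \<delta> k m \<subseteq> {-\<epsilon><..<\<epsilon>}) \<and>
       (\<forall>(k, m)\<in>S. \<forall>\<mu>\<in>\<delta> k m. elliptic_and_saddle m k \<mu>)"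
proof -
  obtain n \<mu>1 where \<mu>1: "0 < \<mu>1" "\<mu>1 \<le> \<mu>0" and iv0: "\<forall>\<eta>. 0 < \<eta> \<and> \<eta> \<le> \<mu>1 \<longrightarrow> (\<exists>J. \<forall>j\<ge>J. \<exists>u v. u < v \<and>
      {u<..<v} \<subseteq> {-\<eta><..<\<eta>} \<and> (\<forall>\<mu>\<in>{u<..<v}. elliptic_and_saddle (2 * (j + n)) (2 * j) \<mu>))"
    using elliptic_saddle_intervals[OF \<mu>0] by (elim exE conjE)
  have iv: "\<exists>J. \<forall>j\<ge>J. \<exists>u v. u < v \<and> {u<..<v} \<subseteq> {-\<eta><..<\<eta>} \<and>
      (\<forall>\<mu>\<in>{u<..<v}. elliptic_and_saddle (2 * (j + n)) (2 * j) \<mu>)" if "0 < \<eta>" "\<eta> \<le> \<mu>1" for \<eta>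
    by (rule iv0[rule_format]) (use that in blast)
  define \<eta> where "\<eta> = (\<lambda>N. \<mu>1 / real (Suc N))"
  have \<eta>: "0 < \<eta> N" "\<eta> N \<le> \<mu>1" for N unfolding \<eta>_def using \<mu>1 by (auto simp: divide_le_eq)
  have "\<forall>N. \<exists>J. \<forall>j\<ge>J. \<exists>u v. u < v \<and> {u<..<v} \<subseteq> {-\<eta> N<..<\<eta> N} \<and>
      (\<forall>\<mu>\<in>{u<..<v}. elliptic_and_saddle (2 * (j + n)) (2 * j) \<mu>)" using iv[OF \<eta>] by (intro allI)
  from choice[OF this] obtain JJ where JJ: "\<And>N j. j \<ge> JJ N \<Longrightarrow> \<exists>u v. u < v \<and> {u<..<v} \<subseteq> {-\<eta> N<..<\<eta> N} \<and>
      (\<forall>\<mu>\<in>{u<..<v}. elliptic_and_saddle (2 * (j + n)) (2 * j) \<mu>)" by blast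
  \<comment> \<open>The partial sums dominate \<open>JJ N\<close>, and the summand \<open>N\<close>
    makes the sequence strictly increasing. It is therefore injective, and \<delta> can recover
    \<open>N\<close> from \<open>k = 2 * jj N\<close>.\<close>
  define jj where "jj = (\<lambda>N. N + (\<Sum>k\<le>N. JJ k))"
  have jj: "jj N \<ge> JJ N" "jj N \<ge> N" for N
    unfolding jj_def using member_le_sum[of N "{..N}" JJ] by (auto intro: trans_le_add2)
  have mono: "strict_mono jj" unfolding strict_mono_Suc_iff jj_def by simp
  have "\<forall>N. \<exists>uv. fst uv < snd uv \<and> {fst uv<..<snd uv} \<subseteq> {-\<eta> N<..<\<eta> N} \<and>
      (\<forall>\<mu>\<in>{fst uv<..<snd uv}. elliptic_and_saddle (2 * (jj N + n)) (2 * jj N) \<mu>)"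
  proof
    fix N
    obtain u v where "u < v" "{u<..<v} \<subseteq> {-\<eta> N<..<\<eta> N}"
      "\<forall>\<mu>\<in>{u<..<v}. elliptic_and_saddle (2 * (jj N + n)) (2 * jj N) \<mu>" using JJ[OF jj(1)] by blast
    then show "\<exists>uv. fst uv < snd uv \<and> {fst uv<..<snd uv} \<subseteq> {-\<eta> N<..<\<eta> N} \<and>
      (\<forall>\<mu>\<in>{fst uv<..<snd uv}. elliptic_and_saddle (2 * (jj N + n)) (2 * jj N) \<mu>)" by (intro exI[of _ "(u, v)"]) simp
  qed
  from choice[OF this] obtain W where W: "\<And>N. fst (W N) < snd (W N)"
    "\<And>N. {fst (W N)<..<snd (W N)} \<subseteq> {-\<eta> N<..<\<eta> N}"
    "\<And>N \<mu>. \<mu> \<in> {fst (W N)<..<snd (W N)} \<Longrightarrow> elliptic_and_saddle (2 * (jj N + n)) (2 * jj N) \<mu>" by blast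
  define S where "S = range (\<lambda>N. (2 * jj N, 2 * (jj N + n)))"
  define \<delta> where "\<delta> = (\<lambda>k m::nat. {fst (W (inv jj (k div 2)))<..<snd (W (inv jj (k div 2)))})"
  have \<delta>: "\<delta> (2 * jj N) m = {fst (W N)<..<snd (W N)}" for N m
    unfolding \<delta>_def using inv_f_f[OF strict_mono_imp_inj_on[OF mono]] by simp
  have all_S: "(\<forall>(k, m)\<in>S. Q k m) \<longleftrightarrow> (\<forall>N. Q (2 * jj N) (2 * (jj N + n)))" for Q
    unfolding S_def by auto
  show ?thesis
  proof (rule exI[of _ S], rule exI[of _ \<delta>], intro conjI allI impI)
    fix N
    have "(2 * jj N, 2 * (jj N + n)) \<in> S" "2 * jj N \<ge> N" "2 * (jj N + n) \<ge> N"
      unfolding S_def using jj(2)[of N] by auto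
    then show "\<exists>(k, m)\<in>S. N \<le> k \<and> N \<le> m" by blast
  next
    have "{-\<eta> N<..<\<eta> N} \<subseteq> {-\<mu>0..\<mu>0}" for N using \<eta>[of N] \<mu>1 by auto
    then show "\<forall>(k, m)\<in>S. (\<exists>u v. u < v \<and> \<delta> k m = {u<..<v}) \<and> \<delta> k m \<subseteq> {-\<mu>0..\<mu>0}"
      unfolding all_S \<delta> using W(1,2) by blast
  next
    fix \<epsilon> :: real assume "\<epsilon> > 0"
    then obtain N1 where N1: "\<mu>1 / \<epsilon> < real N1" using reals_Archimedean2 by blast
    have "\<delta> (2 * jj N) (2 * (jj N + n)) \<subseteq> {-\<epsilon><..<\<epsilon>}" if "2 * jj N \<ge> 2 * jj N1" for N
    proof -
      have "N \<ge> N1" using that strict_mono_less_eq[OF mono] by simp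
      then have "\<mu>1 / \<epsilon> < real (Suc N)" using N1 by linarith
      then have "\<eta> N < \<epsilon>" unfolding \<eta>_def using \<open>\<epsilon> > 0\<close> by (simp add: field_simps)
      then have "{-\<eta> N<..<\<eta> N} \<subseteq> {-\<epsilon><..<\<epsilon>}" by auto
      then show ?thesis unfolding \<delta> using W(2) by blast
    qed
    then have "\<forall>(k, m)\<in>S. k \<ge> 2 * jj N1 \<and> m \<ge> 2 * jj N1 \<longrightarrow> \<delta> k m \<subseteq> {-\<epsilon><..<\<epsilon>}" unfolding all_S by blast
    then show "\<exists>N. \<forall>(k, m)\<in>S. k \<ge> N \<and> m \<ge> N \<longrightarrow> \<delta> k m \<subseteq> {-\<epsilon><..<\<epsilon>}" by blast
  next
    show "\<forall>(k, m)\<in>S. \<forall>\<mu>\<in>\<delta> k m. elliptic_and_saddle m k \<mu>" unfolding all_S \<delta> using W(3) by blast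
  qed
qed

end

theorem theorem2:
  fixes A :: "'m::{t2_space, second_countable_topology} chart set"
    and R :: "'m \<Rightarrow> 'm" and f :: "real \<Rightarrow> 'm \<Rightarrow> 'm" and P :: "real \<Rightarrow> 'm"
    and \<psi> :: "real \<Rightarrow> 'm \<Rightarrow> real^2" and h :: "real \<Rightarrow> real \<Rightarrow> real \<Rightarrow> real"
    and l xp ym a b c d :: "real \<Rightarrow> real"
    and U0 \<Gamma>1 \<Gamma>2 N1m N1p :: "'m set" and Mm Mp :: 'm
    and r q :: nat and \<mu>s :: real
  defines "I \<equiv> {-\<mu>s<..<\<mu>s}"
  assumes "r \<ge> 4" and "\<mu>s > 0"
    and "Ck_atlas r A"
    and "Ck_involution r A R" and "has_dim r A (Fix R) 1"
    and "Ck_diffeo_family r A I f" and "\<And>\<mu>. \<mu> \<in> I \<Longrightarrow> reversible R (f \<mu>)"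
    and condition_A: "symmetric_saddle A R (f 0) (P 0) (l 0)"
    and condition_B: "symmetric_couple_of_tangencies r A R (f 0) (P 0) \<Gamma>1 \<Gamma>2"
    and "local_coordinates r A R I f U0 P l \<psi> h"
    and "homoclinic_neighbourhoods (f 0) U0 (P 0) \<Gamma>1 q Mm Mp N1m N1p"
    and "\<psi> 0 Mm = vector [0, ym 0]" and "\<psi> 0 Mp = vector [xp 0, 0]"
    and "splitting_form I f \<psi> q N1m N1p xp ym a b c d"
    and condition_C: "\<bar>jacobian_in U0 (\<psi> 0) (f 0 ^^ q) Mm\<bar> \<noteq> 1"
  shows "\<forall>\<mu>0. 0 < \<mu>0 \<and> \<mu>0 < \<mu>s \<longrightarrow>
    (\<exists>(S :: (nat \<times> nat) set) (\<delta> :: nat \<Rightarrow> nat \<Rightarrow> real set).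
       (\<forall>N. \<exists>(k, m)\<in>S. k \<ge> N \<and> m \<ge> N) \<and>
       infinite {\<delta> k m | k m. (k, m) \<in> S} \<and>
       (\<forall>(k, m)\<in>S. (\<exists>u v. u < v \<and> \<delta> k m = {u<..<v}) \<and> \<delta> k m \<subseteq> {-\<mu>0..\<mu>0}) \<and>
       (\<forall>\<epsilon>>0. \<exists>N. \<forall>(k, m)\<in>S. k \<ge> N \<and> m \<ge> N \<longrightarrow> \<delta> k m \<subseteq> {-\<epsilon><..<\<epsilon>}) \<and>
       (\<forall>(k, m)\<in>S. \<forall>\<mu>\<in>\<delta> k m.
          (\<exists>p. symmetric_fixed_point R (f \<mu>) U0 N1m N1p q m k p \<and>
               elliptic A (first_return (f \<mu>) q m k) p) \<and>
          (\<exists>p. symmetric_fixed_point R (f \<mu>) U0 N1m N1p q m k p \<and>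
               saddle A (first_return (f \<mu>) q m k) p)))"
proof (intro allI impI)
  fix \<mu>0 assume \<mu>0: "0 < \<mu>0 \<and> \<mu>0 < \<mu>s"
  interpret splitting_family A R f P \<psi> h l U0 r I N1m N1p Mm Mp q xp ym a b c d
  proof unfold_locales
    show "open I" "0 \<in> I" unfolding I_def using \<open>\<mu>s > 0\<close> by auto
    show "R \<circ> R = id" using \<open>Ck_involution r A R\<close> unfolding Ck_involution_def by blast
  qed (use assms in \<open>auto simp: homoclinic_neighbourhoods_def\<close>)
  have "0 < \<mu>0" using \<mu>0 by simp
  from elliptic_saddle_cascade[OF this, unfolded elliptic_and_saddle_def] obtain S :: "(nat \<times> nat) set" and \<delta> where *:
       "\<forall>N. \<exists>(k, m)\<in>S. k \<ge> N \<and> m \<ge> N"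
       "\<forall>(k, m)\<in>S. (\<exists>u v. u < v \<and> \<delta> k m = {u<..<v}) \<and> \<delta> k m \<subseteq> {-\<mu>0..\<mu>0}"
       "\<forall>\<epsilon>>0. \<exists>N. \<forall>(k, m)\<in>S. k \<ge> N \<and> m \<ge> N \<longrightarrow> \<delta> k m \<subseteq> {-\<epsilon><..<\<epsilon>}"
       "\<forall>(k, m)\<in>S. \<forall>\<mu>\<in>\<delta> k m.
          (\<exists>p. symmetric_fixed_point R (f \<mu>) U0 N1m N1p q m k p \<and>
               elliptic A (first_return (f \<mu>) q m k) p) \<and>
          (\<exists>p. symmetric_fixed_point R (f \<mu>) U0 N1m N1p q m k p \<and>
               saddle A (first_return (f \<mu>) q m k) p)"
    by (elim exE conjE)
  have "\<forall>(k, m)\<in>S. \<exists>u v. u < v \<and> \<delta> k m = {u<..<v}" using *(2) by fast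
  from infinite_accumulating_intervals[OF *(1) this *(3)]
  have inf: "infinite {\<delta> k m | k m. (k, m) \<in> S}" .
  show "\<exists>(S :: (nat \<times> nat) set) (\<delta> :: nat \<Rightarrow> nat \<Rightarrow> real set).
       (\<forall>N. \<exists>(k, m)\<in>S. k \<ge> N \<and> m \<ge> N) \<and>
       infinite {\<delta> k m | k m. (k, m) \<in> S} \<and>
       (\<forall>(k, m)\<in>S. (\<exists>u v. u < v \<and> \<delta> k m = {u<..<v}) \<and> \<delta> k m \<subseteq> {-\<mu>0..\<mu>0}) \<and>
       (\<forall>\<epsilon>>0. \<exists>N. \<forall>(k, m)\<in>S. k \<ge> N \<and> m \<ge> N \<longrightarrow> \<delta> k m \<subseteq> {-\<epsilon><..<\<epsilon>}) \<and>
       (\<forall>(k, m)\<in>S. \<forall>\<mu>\<in>\<delta> k m.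
          (\<exists>p. symmetric_fixed_point R (f \<mu>) U0 N1m N1p q m k p \<and>
               elliptic A (first_return (f \<mu>) q m k) p) \<and>
          (\<exists>p. symmetric_fixed_point R (f \<mu>) U0 N1m N1p q m k p \<and>
               saddle A (first_return (f \<mu>) q m k) p))"
    by (rule exI[of _ S], rule exI[of _ \<delta>]) (intro conjI * inf)
qed

end
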